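(* Let $q>1$ and let $\mathscr{H}$ be the affine Hecke algebra of type $\tilde A_2(q)$ with $L=P$. With the representations described in the context, for all $h\in\mathscr{H}$ we have $$\mathrm{Tr}(h)=\frac{1}{6q^3}\int_{\mathbb{T}^2}\frac{\chi_t(h)}{|c(t)|^2}\,dt+\frac{(q-1)^2}{q^2(q^2-1)}\int_{\mathbb{T}}\frac{\chi_s^{1}(h)}{|c_1(s)|^2}\,ds+\frac{(q-1)^3}{3(q^3-1)}\left(\chi^{2}(h)+\chi^{3}(h)+\chi^{4}(h)\right),$$ where $$c(t)=\frac{(1-q^{-1}t_1^{-2}t_2)(1-q^{-1}t_1t_2^{-2})(1-q^{-1}t_1^{-1}t_2^{-1})}{(1-t_1^{-2}t_2)(1-t_1t_2^{-2})(1-t_1^{-1}t_2^{-1})},\qquad c_1(s)=\frac{1-q^{-3/2}s^{-3}}{1-q^{1/2}s^{-3}}.$$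
   Context: $\mathbb{T}$ is the unit circle in $\mathbb{C}$; $dt=dt_1dt_2$ and $ds$ are normalised Haar measures on $\mathbb{T}^2$ and $\mathbb{T}$. $R$ is the root system of type $A_2$ with simple roots $\alpha_1,\alpha_2$, Weyl group $W_0=\langle s_1,s_2\rangle$, coweight lattice $P=\mathbb{Z}\omega_1+\mathbb{Z}\omega_2$ with $\omega_1=\frac23\alpha_1^\vee+\frac13\alpha_2^\vee$, $\omega_2=\frac13\alpha_1^\vee+\frac23\alpha_2^\vee$, and coroot lattice $Q$. $W_P=P\rtimes W_0$ is the extended affine Weyl group, with translations $t_\lambda$; $s_0=t_{\varphi^\vee}s_\varphi$ ($\varphi$ the highest root); $W_Q=Q\rtimes W_0$ is a Coxeter group on $s_0,s_1,s_2$, and $W_P=W_Q\rtimes\Omega$ with $\Omega\cong P/Q$ the subgroup of length $0$ elements; $\ell$ is the length function. $\mathscr{H}$ has basis $\{T_w\mid w\in W_P\}$ with $T_uT_v=T_{uv}$ if $\ell(uv)=\ell(u)+\ell(v)$ and $T_i^2=1+(q^{1/2}-q^{-1/2})T_i$ ($i=0,1,2$, $T_i=T_{s_i}$). $\mathrm{Tr}(\sum_wc_wT_w)=c_1$, the coefficient of the identity. For $\lambda=\mu-\nu$ with $\mu,\nu\in P$ dominant, $x^\lambda=T_{t_\mu}T_{t_\nu}^{-1}$. $\mathscr{H}$ is generated by $T_1,T_2$, $x_1=x^{\omega_1}$, $x_2=x^{\omega_2}$ (and their inverses), with relations: the quadratic relations, $T_1T_2T_1=T_2T_1T_2$, $x_1x_2=x_2x_1$,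 $T_1x_1=x_1^{-1}x_2T_1+(q^{1/2}-q^{-1/2})x_1$, $T_2x_2=x_1x_2^{-1}T_2+(q^{1/2}-q^{-1/2})x_2$, $T_1x_2=x_2T_1$, $T_2x_1=x_1T_2$. Representations. $\chi_t$, for $t=(t_1,t_2)\in(\mathbb{C}^\times)^2$, is the character of the 6-dimensional principal series representation $\mathrm{Ind}_{\mathbb{C}[P]}^{\mathscr{H}}(\mathbb{C}v_t)$, where $\mathbb{C}[P]$ is the span of the $x^\lambda$ and $x_1v_t=t_1v_t$, $x_2v_t=t_2v_t$. $\chi_s^1$, for $s\in\mathbb{C}^\times$, is the character of the 3-dimensional representation $\mathscr{H}\otimes_{\mathscr{H}_1}\mathbb{C}u_s$, where $\mathscr{H}_1$ is the subalgebra generated by $T_1,x_1^{\pm1},x_2^{\pm1}$ and $T_1u_s=-q^{-1/2}u_s$, $x_1u_s=q^{-1/2}su_s$, $x_2u_s=s^2u_s$. With $\omega=e^{2\pi i/3}$, $\chi^2,\chi^3,\chi^4$ are the characters of the 1-dimensional representations with $T_1,T_2\mapsto-q^{-1/2}$ and $(x_1,x_2)\mapsto(q^{-1},q^{-1})$, $(\omega q^{-1},\omega^{-1}q^{-1})$, $(\omega^{-1}q^{-1},\omega q^{-1})$ respectively. *)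

theory Defs
  imports "HOL-Analysis.Analysis"
begin

section \<open>The root system of type $A_2$ and the extended affine Weyl group\<close>

text \<open>
  The real span of the coroots is identified with \<^typ>\<open>real \<times> real\<close> by means of the basis
  $\omega_1,\omega_2$ of fundamental coweights. As $\langle \omega_i,\alpha_j\rangle=\delta_{ij}$,
  the simple roots are the coordinate functionals, and solving
  $\omega_1=\frac23\alpha_1^\vee+\frac13\alpha_2^\vee$,
  $\omega_2=\frac13\alpha_1^\vee+\frac23\alpha_2^\vee$ gives
  $\alpha_1^\vee=2\omega_1-\omega_2$ and $\alpha_2^\vee=-\omega_1+2\omega_2$.
\<close>

type_synonym plane = "real \<times> real"

definition omega1 :: plane where "omega1 = (1, 0)"
definition omega2 :: plane where "omega2 = (0, 1)"

definition alpha1 :: "plane \<Rightarrow> real" where "alpha1 v = fst v"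
definition alpha2 :: "plane \<Rightarrow> real" where "alpha2 v = snd v"
definition phi :: "plane \<Rightarrow> real" where "phi v = alpha1 v + alpha2 v"

definition coroot1 :: plane where "coroot1 = (2, -1)"
definition coroot2 :: plane where "coroot2 = (-1, 2)"
definition corootphi :: plane where "corootphi = coroot1 + coroot2"

definition pos_roots :: "(plane \<Rightarrow> real) set" where
  "pos_roots = {alpha1, alpha2, phi}"

definition coweight_lattice :: "plane set" where
  "coweight_lattice = {v. fst v \<in> \<int> \<and> snd v \<in> \<int>}"

definition dominant :: "plane \<Rightarrow> bool" where
  "dominant v \<longleftrightarrow> v \<in> coweight_lattice \<and> 0 \<le> alpha1 v \<and> 0 \<le> alpha2 v"

definition refl_along :: "(plane \<Rightarrow> real) \<Rightarrow> plane \<Rightarrow> plane \<Rightarrow> plane" where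
  "refl_along a av v = v - a v *\<^sub>R av"

definition transl :: "plane \<Rightarrow> plane \<Rightarrow> plane" where
  "transl l v = l + v"

definition s1 :: "plane \<Rightarrow> plane" where "s1 = refl_along alpha1 coroot1"
definition s2 :: "plane \<Rightarrow> plane" where "s2 = refl_along alpha2 coroot2"
definition s0 :: "plane \<Rightarrow> plane" where "s0 = transl corootphi \<circ> refl_along phi corootphi"

inductive_set W0 :: "(plane \<Rightarrow> plane) set" where
  W0_id: "id \<in> W0"
| W0_s1: "w \<in> W0 \<Longrightarrow> s1 \<circ> w \<in> W0"
| W0_s2: "w \<in> W0 \<Longrightarrow> s2 \<circ> w \<in> W0"

text \<open>
  $W_P=P\rtimes W_0$ acts faithfully on the plane, so it is realised as a set of affine maps, with
  composition as the group law.
\<close>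

definition WP :: "(plane \<Rightarrow> plane) set" where
  "WP = {transl l \<circ> w |l w. l \<in> coweight_lattice \<and> w \<in> W0}"

definition fund_alcove :: "plane set" where
  "fund_alcove = {v. 0 < alpha1 v \<and> 0 < alpha2 v \<and> phi v < 1}"

definition separates :: "(plane \<Rightarrow> real) \<Rightarrow> int \<Rightarrow> plane set \<Rightarrow> plane set \<Rightarrow> bool" where
  "separates a k A B \<longleftrightarrow>
     (\<forall>v\<in>A. a v < of_int k) \<and> (\<forall>v\<in>B. a v > of_int k) \<or>
     (\<forall>v\<in>A. a v > of_int k) \<and> (\<forall>v\<in>B. a v < of_int k)"

text \<open>
  The length of \<open>w\<close> is the number of hyperplanes $\{v \mid \langle v,\alpha\rangle=k\}$
  ($\alpha$ a positive root, $k\in\mathbb{Z}$) between the fundamental alcove and its image under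
  \<open>w\<close>. On $W_Q$ this is the Coxeter length with respect to $s_0,s_1,s_2$, and the elements of
  $W_P$ of length 0 are those stabilising the fundamental alcove.
\<close>

definition len :: "(plane \<Rightarrow> plane) \<Rightarrow> nat" where
  "len w = card {(a, k). a \<in> pos_roots \<and> separates a k fund_alcove (w ` fund_alcove)}"


section \<open>The affine Hecke algebra\<close>

text \<open>
  The algebra is determined up to isomorphism by a basis \<open>T w\<close>, indexed by \<open>w \<in> WP\<close>, and the
  multiplication rules. Only the values of \<open>T\<close> on \<^term>\<open>WP\<close> are relevant.
\<close>

locale affine_hecke_A2 = vector_space scale
  for scale :: "complex \<Rightarrow> 'h::ring_1 \<Rightarrow> 'h" +
  fixes q :: real and T :: "(plane \<Rightarrow> plane) \<Rightarrow> 'h"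
  assumes scale_mult_left: "scale c a * b = scale c (a * b)"
    and scale_mult_right: "a * scale c b = scale c (a * b)"
    and T_inj: "inj_on T WP"
    and T_independent: "independent (T ` WP)"
    and T_span: "span (T ` WP) = UNIV"
    and T_mult: "\<lbrakk>u \<in> WP; v \<in> WP; len (u \<circ> v) = len u + len v\<rbrakk> \<Longrightarrow> T u * T v = T (u \<circ> v)"
    and T_quadratic: "s \<in> {s0, s1, s2} \<Longrightarrow>
      T s * T s = 1 + scale (of_real (q powr (1/2) - q powr (-1/2))) (T s)"
begin

definition Tr :: "'h \<Rightarrow> complex" where
  "Tr h = representation (T ` WP) h (T id)"

definition unit_inv :: "'h \<Rightarrow> 'h" where
  "unit_inv a = (THE b. a * b = 1 \<and> b * a = 1)"

definition x :: "plane \<Rightarrow> 'h" where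
  "x l = (THE y. \<forall>m n. dominant m \<and> dominant n \<and> l = m - n \<longrightarrow>
            y = T (transl m) * unit_inv (T (transl n)))"

definition subalgebra :: "'h set \<Rightarrow> bool" where
  "subalgebra A \<longleftrightarrow> subspace A \<and> 1 \<in> A \<and> (\<forall>a\<in>A. \<forall>b\<in>A. a * b \<in> A)"

definition alg_hom_on :: "'h set \<Rightarrow> ('h \<Rightarrow> complex) \<Rightarrow> bool" where
  "alg_hom_on A \<theta> \<longleftrightarrow> \<theta> 1 = 1 \<and>
     (\<forall>a\<in>A. \<forall>b\<in>A. \<theta> (a + b) = \<theta> a + \<theta> b \<and> \<theta> (a * b) = \<theta> a * \<theta> b) \<and>
     (\<forall>a\<in>A. \<forall>c. \<theta> (scale c a) = c * \<theta> a)"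


subsection \<open>Characters of induced representations\<close>

text \<open>
  A one-dimensional module $\mathbb{C}u$ over a subalgebra \<open>A\<close> of $\mathscr{H}$ is a homomorphism
  \<open>\<theta>\<close> from \<open>A\<close> to $\mathbb{C}$. Writing $h\otimes u$ as \<open>h\<close>, the tensor product
  $\mathscr{H}\otimes_A\mathbb{C}u$ is the quotient of $\mathscr{H}\otimes_{\mathbb{C}}\mathbb{C}u$,
  that is of $\mathscr{H}$, by the subspace spanned by the $ha\otimes u-h\otimes au$, and
  $\mathscr{H}$ acts on it by left multiplication.
\<close>

definition tensor_relations :: "'h set \<Rightarrow> ('h \<Rightarrow> complex) \<Rightarrow> 'h set" where
  "tensor_relations A \<theta> = span {h * a - scale (\<theta> a) h |h a. a \<in> A}"

text \<open>
  Linear algebra in the quotient by a subspace \<open>N\<close>, carried out on representatives: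
  \<open>quot_basis N B\<close> says that \<open>B\<close> is finite and represents a basis of the quotient,
  \<open>quot_coords N B v\<close> are the coordinates of the class of \<open>v\<close>, and \<open>quot_trace N f\<close> is the trace
  of the endomorphism induced by \<open>f\<close>, which does not depend on the choice of \<open>B\<close>.
\<close>

definition is_quot_coords :: "'h set \<Rightarrow> 'h set \<Rightarrow> 'h \<Rightarrow> ('h \<Rightarrow> complex) \<Rightarrow> bool" where
  "is_quot_coords N B v c \<longleftrightarrow> (\<forall>b. b \<notin> B \<longrightarrow> c b = 0) \<and> v - (\<Sum>b\<in>B. scale (c b) b) \<in> N"

definition quot_basis :: "'h set \<Rightarrow> 'h set \<Rightarrow> bool" where
  "quot_basis N B \<longleftrightarrow> finite B \<and> (\<forall>v. \<exists>!c. is_quot_coords N B v c)"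

definition quot_coords :: "'h set \<Rightarrow> 'h set \<Rightarrow> 'h \<Rightarrow> 'h \<Rightarrow> complex" where
  "quot_coords N B v = (THE c. is_quot_coords N B v c)"

definition quot_trace :: "'h set \<Rightarrow> ('h \<Rightarrow> 'h) \<Rightarrow> complex" where
  "quot_trace N f = (let B = (SOME B. quot_basis N B) in \<Sum>b\<in>B. quot_coords N B (f b) b)"

definition induced_char :: "'h set \<Rightarrow> ('h \<Rightarrow> complex) \<Rightarrow> 'h \<Rightarrow> complex" where
  "induced_char A \<theta> h = quot_trace (tensor_relations A \<theta>) (\<lambda>v. h * v)"


subsection \<open>The representations in the Plancherel formula\<close>

definition CP :: "'h set" where
  "CP = span (x ` coweight_lattice)"

definition H1 :: "'h set" where
  "H1 = subalgebra hull {T s1, x omega1, x (- omega1), x omega2, x (- omega2)}"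

text \<open>
  The homomorphisms chosen below exist and are unique on \<^term>\<open>CP\<close> (for nonzero
  \<open>t\<close>), on \<^term>\<open>H1\<close> (for nonzero \<open>s\<close>), and on all of $\mathscr{H}$ (for the three
  pairs \<open>(z1, z2)\<close> that occur), respectively; their values elsewhere do not matter.
\<close>

definition chi :: "complex \<times> complex \<Rightarrow> 'h \<Rightarrow> complex" where
  "chi t = induced_char CP
     (SOME \<theta>. alg_hom_on CP \<theta> \<and> \<theta> (x omega1) = fst t \<and> \<theta> (x omega2) = snd t)"

definition chi1 :: "complex \<Rightarrow> 'h \<Rightarrow> complex" where
  "chi1 s = induced_char H1
     (SOME \<theta>. alg_hom_on H1 \<theta> \<and> \<theta> (T s1) = - of_real (q powr (-1/2)) \<and>
        \<theta> (x omega1) = of_real (q powr (-1/2)) * s \<and> \<theta> (x omega2) = s ^ 2)"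

definition one_dim_char :: "complex \<Rightarrow> complex \<Rightarrow> 'h \<Rightarrow> complex" where
  "one_dim_char z1 z2 = (THE f. alg_hom_on UNIV f \<and>
     f (T s1) = - of_real (q powr (-1/2)) \<and> f (T s2) = - of_real (q powr (-1/2)) \<and>
     f (x omega1) = z1 \<and> f (x omega2) = z2)"

definition chi2 :: "'h \<Rightarrow> complex" where
  "chi2 = one_dim_char (1 / of_real q) (1 / of_real q)"

definition chi3 :: "'h \<Rightarrow> complex" where
  "chi3 = one_dim_char (cis (2*pi/3) / of_real q) (inverse (cis (2*pi/3)) / of_real q)"

definition chi4 :: "'h \<Rightarrow> complex" where
  "chi4 = one_dim_char (inverse (cis (2*pi/3)) / of_real q) (cis (2*pi/3) / of_real q)"

end


section \<open>The Plancherel measure\<close>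

text \<open>
  On the torus the denominator of \<open>c_fun q t\<close> vanishes only on a null set; there \<open>c_fun q t = 0\<close>
  by the convention for division by 0, and \<open>1 / |c_fun q t|\<^sup>2 = 0\<close> still agrees with the
  continuous extension of $1/|c(t)|^2$.
\<close>

definition c_fun :: "real \<Rightarrow> complex \<times> complex \<Rightarrow> complex" where
  "c_fun q t = (let t1 = fst t; t2 = snd t; p = 1 / complex_of_real q in
     ((1 - p * t1 powi (-2) * t2) * (1 - p * t1 * t2 powi (-2)) * (1 - p * t1 powi (-1) * t2 powi (-1)))
     / ((1 - t1 powi (-2) * t2) * (1 - t1 * t2 powi (-2)) * (1 - t1 powi (-1) * t2 powi (-1))))"

definition c1_fun :: "real \<Rightarrow> complex \<Rightarrow> complex" where
  "c1_fun q s = (1 - of_real (q powr (-3/2)) * s powi (-3)) / (1 - of_real (q powr (1/2)) * s powi (-3))"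

text \<open>
  Normalised Haar measure of the unit circle, as a Borel measure on $\mathbb{C}$ concentrated on
  the circle.
\<close>

definition circle_haar :: "complex measure" where
  "circle_haar = distr (uniform_measure lborel {0..2*pi}) borel cis"

end

theory Submission
  imports Defs
begin

text \<open>
  Both sides of the formula are linear functionals on $\mathscr{H}$ that vanish on commutators, and
  such a functional is determined by its values on the elements $T_w x^\lambda$ with $w \in W_0$ other
  than the longest element and $\lambda$ dominant, where $T_w x^\lambda = T_{w t_\lambda}$ and the trace
  is known. The characters are computed there from bases of weight vectors produced by intertwiners:
  up to the Weyl denominator they are sums of monomials over $W_0$-orbits. The moments of
  $1/|c(t)|^2$ and $1/|c_1(s)|^2$ against monomials are geometric series, and the residues that
  separate the double integral from the trace are exactly the contributions of
  $\chi_s^1$ and of $\chi^2, \chi^3, \chi^4$.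
\<close>

section \<open>Lengths in the extended affine Weyl group\<close>

text \<open>The longest element is left out because its diagonal entries in a weight basis are not
  products of rank-one factors: along T_1 T_2 T_1 a weight can be left and reached again. For the
  other five elements each entry is a power of q^(1/2) - q^(-1/2) divided by distinct factors 1 -
  e^(-alpha), so the Weyl denominator clears it and everything reduces to moments of monomials.
  Dominance keeps these moments tractable. Clearing the denominator lowers a weight by at most 2
  alpha_1 + 2 alpha_2, so the exponents satisfy m + 2n >= -6 and 2m + n >= -6; the poles outside the
  unit circle then matter only in the extreme case m + 2n = -6. The combination of the three moments
  vanishes except at (m, n) = (-2, -2), where it is -1, and the lowest term of the Weyl denominator,
  with coefficient -1, carries the identity element to exactly that weight. This is the origin of
  Tr(1) = 1. The representations are obtained from linear functionals prescribed on the elements T_w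
  x^lambda, whose independence therefore has to be proved.\<close>

lemma s1_apply: "s1 v = (- fst v, fst v + snd v)"
  by (cases v) (simp add: s1_def refl_along_def alpha1_def coroot1_def)

lemma s2_apply: "s2 v = (fst v + snd v, - snd v)"
  by (cases v) (simp add: s2_def refl_along_def alpha2_def coroot2_def)

lemma s0_apply: "s0 v = (1 - snd v, 1 - fst v)"
  by (cases v) (simp add: s0_def refl_along_def phi_def alpha1_def alpha2_def transl_def
      corootphi_def coroot1_def coroot2_def)

lemma transl_apply: "transl l v = (fst l + fst v, snd l + snd v)"
  by (simp add: transl_def prod_eq_iff)

lemmas weyl_apply = s1_apply s2_apply s0_apply transl_apply

lemma s1_s1: "s1 (s1 v) = v" and s2_s2: "s2 (s2 v) = v" and s0_s0: "s0 (s0 v) = v"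
  by (simp_all add: weyl_apply)

text \<open>Indices increase with length, and right multiplication by \<open>s1\<close> exchanges 2i
  and 2i + 1, so the even indices are the minimal representatives of the cosets of {1,
  \<open>s1\<close>}. The six-entry lists below all follow this numbering.\<close>

fun w_elt :: "nat \<Rightarrow> plane \<Rightarrow> plane" where
  "w_elt 0 = id"
| "w_elt (Suc 0) = s1"
| "w_elt (Suc (Suc 0)) = s2"
| "w_elt (Suc (Suc (Suc 0))) = s2 \<circ> s1"
| "w_elt (Suc (Suc (Suc (Suc 0)))) = s1 \<circ> s2"
| "w_elt _ = s1 \<circ> (s2 \<circ> s1)"

lemma less6_cases: "(k::nat) < 6 \<longleftrightarrow> k = 0 \<or> k = 1 \<or> k = 2 \<or> k = 3 \<or> k = 4 \<or> k = 5"
  by auto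

lemma w_elt_numeral [simp]:
  "w_elt 1 = s1" "w_elt 2 = s2" "w_elt 3 = s2 \<circ> s1" "w_elt 4 = s1 \<circ> s2" "w_elt 5 = s1 \<circ> (s2 \<circ> s1)"
  by (simp_all add: eval_nat_numeral)

lemma W0_eq: "W0 = w_elt ` {..<6}"
proof
  have "w \<in> w_elt ` {..<6}" if "w \<in> W0" for w
    using that
  proof induction
    case W0_id
    show ?case by (rule image_eqI[of _ _ 0]) auto
  next
    case (W0_s1 w)
    then obtain k where k: "k < 6" "w = w_elt k" by auto
    \<comment> \<open>The list is the permutation of the indices induced by left multiplication by
      \<open>s1\<close>; the next case has the one for \<open>s2\<close>.\<close>
    have "\<exists>j<6. s1 \<circ> w_elt k = w_elt j"
      by (rule exI[of _ "[1,0,4,5,2,3] ! k"]) (use k(1) in \<open>auto simp: less6_cases fun_eq_iff s1_s1\<close>)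
    with k show ?case by (metis image_eqI lessThan_iff)
  next
    case (W0_s2 w)
    then obtain k where k: "k < 6" "w = w_elt k" by auto
    have "\<exists>j<6. s2 \<circ> w_elt k = w_elt j"
      by (rule exI[of _ "[2,3,0,1,5,4] ! k"]) (use k(1) in \<open>auto simp: less6_cases fun_eq_iff weyl_apply\<close>)
    with k show ?case by (metis image_eqI lessThan_iff)
  qed
  then show "W0 \<subseteq> w_elt ` {..<6}" by blast
  have "w_elt k \<in> W0" if "k < 6" for k
    using that W0_id W0_s1[OF W0_s2[OF W0_id]] W0_s2[OF W0_s1[OF W0_id]]
      W0_s1[OF W0_s2[OF W0_s1[OF W0_id]]] W0_s1[OF W0_id] W0_s2[OF W0_id]
    unfolding less6_cases by auto
  then show "w_elt ` {..<6} \<subseteq> W0" by auto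
qed

section \<open>Normal form of the elements of the extended affine Weyl group\<close>

abbreviation lat :: "int \<Rightarrow> int \<Rightarrow> plane" where
  "lat m n \<equiv> (of_int m, of_int n)"

lemma coweight_lattice_eq: "coweight_lattice = {lat m n |m n. True}"
  by (auto simp: coweight_lattice_def elim!: Ints_cases)

lemma lat_in [simp]: "lat m n \<in> coweight_lattice"
  by (simp add: coweight_lattice_def)

lemma WP_E:
  assumes "w \<in> WP"
  obtains m n k where "k < 6" "w = transl (lat m n) \<circ> w_elt k"
proof -
  from assms obtain l u where "w = transl l \<circ> u" "l \<in> coweight_lattice" "u \<in> W0"
    unfolding WP_def by blast
  then show thesis using that unfolding W0_eq coweight_lattice_eq by auto
qed

lemma W0_lat: "u \<in> W0 \<Longrightarrow> \<exists>m' n'. \<forall>v. u (transl (lat m n) v) = transl (lat m' n') (u v)"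
proof (induction rule: W0.induct)
  case W0_id
  show ?case by (intro exI[of _ m] exI[of _ n]) simp
next
  case (W0_s1 w)
  then obtain m' n' where "\<forall>v. w (transl (lat m n) v) = transl (lat m' n') (w v)" by blast
  then show ?case by (intro exI[of _ "-m'"] exI[of _ "m' + n'"]) (simp add: weyl_apply)
next
  case (W0_s2 w)
  then obtain m' n' where "\<forall>v. w (transl (lat m n) v) = transl (lat m' n') (w v)" by blast
  then show ?case by (intro exI[of _ "m' + n'"] exI[of _ "-n'"]) (simp add: weyl_apply)
qed

lemma W0_comp: "u \<in> W0 \<Longrightarrow> v \<in> W0 \<Longrightarrow> u \<circ> v \<in> W0"
  by (induction rule: W0.induct) (auto simp: comp_assoc intro: W0.intros)

lemma WP_I: "u \<in> W0 \<Longrightarrow> transl (lat m n) \<circ> u \<in> WP"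
  unfolding WP_def using lat_in by blast

lemma WP_comp:
  assumes "u \<in> WP" "v \<in> WP"
  shows "u \<circ> v \<in> WP"
proof -
  obtain m n k where u: "k < 6" "u = transl (lat m n) \<circ> w_elt k" using assms(1) by (rule WP_E)
  obtain m' n' k' where v: "k' < 6" "v = transl (lat m' n') \<circ> w_elt k'" using assms(2) by (rule WP_E)
  have w: "w_elt k \<in> W0" "w_elt k' \<in> W0" using u v by (auto simp: W0_eq)
  obtain i j where "\<And>x. w_elt k (transl (lat m' n') x) = transl (lat i j) (w_elt k x)"
    using W0_lat[OF w(1)] by blast
  then have "u \<circ> v = transl (lat (m + i) (n + j)) \<circ> (w_elt k \<circ> w_elt k')"
    by (simp add: u v fun_eq_iff transl_apply)
  then show ?thesis by (simp only: WP_I[OF W0_comp[OF w]])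
qed

lemma transl_0: "transl (lat 0 0) = id"
  by (simp add: fun_eq_iff transl_apply)

lemma W0_WP: "u \<in> W0 \<Longrightarrow> u \<in> WP"
  using WP_I[of u 0 0] unfolding transl_0 by simp

lemma transl_WP: "transl (lat m n) \<in> WP"
  using WP_I[OF W0_id] by simp

lemma s0_eq: "s0 = transl (lat 1 1) \<circ> w_elt 5"
  by (simp add: fun_eq_iff weyl_apply)

lemma simple_WP: "id \<in> WP" "s1 \<in> WP" "s2 \<in> WP" "s0 \<in> WP"
proof -
  show "id \<in> WP" using W0_WP W0_id by blast
  show "s1 \<in> WP" using W0_WP W0_s1[OF W0_id] by simp
  show "s2 \<in> WP" using W0_WP W0_s2[OF W0_id] by simp
  have "w_elt 5 \<in> W0" unfolding W0_eq by (rule imageI) simp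
  then show "s0 \<in> WP" unfolding s0_eq by (rule WP_I)
qed

section \<open>Lengths from the three root coordinates of an alcove\<close>

definition centre :: plane where "centre = (1/3, 1/3)"

text \<open>\<open>centre\<close> is the barycentre of the fundamental alcove. Its image lies inside
  the image alcove and takes no integer value on a root, so the three floors record the strips
  between consecutive hyperplanes that contain this alcove.\<close>

definition n1 :: "(plane \<Rightarrow> plane) \<Rightarrow> int" where "n1 w = \<lfloor>fst (w centre)\<rfloor>"
definition n2 :: "(plane \<Rightarrow> plane) \<Rightarrow> int" where "n2 w = \<lfloor>snd (w centre)\<rfloor>"
definition n3 :: "(plane \<Rightarrow> plane) \<Rightarrow> int" where "n3 w = \<lfloor>fst (w centre) + snd (w centre)\<rfloor>"

lemma floor_third [simp]:
  "\<lfloor>of_int m + 1/3 :: real\<rfloor> = m" "\<lfloor>of_int m + 2/3 :: real\<rfloor> = m"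
  "\<lfloor>of_int m - 1/3 :: real\<rfloor> = m - 1" "\<lfloor>of_int m - 2/3 :: real\<rfloor> = m - 1"
  by linarith+

text \<open>The lists give the strips of the six alcoves around the origin; the translation shifts
  them by m, n and m + n.\<close>

lemma WP_centre_cases:
  assumes "w \<in> WP"
  obtains m n k where "k < 6" "w = transl (lat m n) \<circ> w_elt k"
    "n1 w = m + [0,-1,0,0,-1,-1] ! k" "n2 w = n + [0,0,-1,-1,0,-1] ! k"
    "n3 w = m + n + [0,0,0,-1,-1,-1] ! k"
proof -
  obtain m n k where w: "k < 6" "w = transl (lat m n) \<circ> w_elt k" using assms by (rule WP_E)
  have "n1 w = m + [0,-1,0,0,-1,-1] ! k \<and> n2 w = n + [0,0,-1,-1,0,-1] ! k \<and>
    n3 w = m + n + [0,0,0,-1,-1,-1] ! k"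
    using w(1) unfolding less6_cases w(2)
    by (elim disjE; simp add: n1_def n2_def n3_def weyl_apply centre_def floor_eq_iff)
  with w that show thesis by blast
qed

lemma alcove_strip:
  assumes "w \<in> WP" "v \<in> fund_alcove"
  shows "of_int (n1 w) < alpha1 (w v) \<and> alpha1 (w v) < of_int (n1 w) + 1"
    "of_int (n2 w) < alpha2 (w v) \<and> alpha2 (w v) < of_int (n2 w) + 1"
    "of_int (n3 w) < phi (w v) \<and> phi (w v) < of_int (n3 w) + 1"
proof -
  obtain m n k where w: "k < 6" "w = transl (lat m n) \<circ> w_elt k"
    and n: "n1 w = m + [0,-1,0,0,-1,-1] ! k" "n2 w = n + [0,0,-1,-1,0,-1] ! k"
    "n3 w = m + n + [0,0,0,-1,-1,-1] ! k"
    using assms(1) by (rule WP_centre_cases)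
  have v: "0 < fst v" "0 < snd v" "fst v + snd v < 1"
    using assms(2) by (auto simp: fund_alcove_def alpha1_def alpha2_def phi_def)
  have *: "(of_int (n1 w) < alpha1 (w v) \<and> alpha1 (w v) < of_int (n1 w) + 1) \<and>
    (of_int (n2 w) < alpha2 (w v) \<and> alpha2 (w v) < of_int (n2 w) + 1) \<and>
    (of_int (n3 w) < phi (w v) \<and> phi (w v) < of_int (n3 w) + 1)"
    unfolding n using w(1) v unfolding less6_cases w(2)
    by (elim disjE; simp add: alpha1_def alpha2_def phi_def weyl_apply)
  show "of_int (n1 w) < alpha1 (w v) \<and> alpha1 (w v) < of_int (n1 w) + 1"
    "of_int (n2 w) < alpha2 (w v) \<and> alpha2 (w v) < of_int (n2 w) + 1"
    "of_int (n3 w) < phi (w v) \<and> phi (w v) < of_int (n3 w) + 1"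
    using * by auto
qed

text \<open>\<open>A\<close> lies in strip 0 and \<open>B\<close> in strip \<open>n\<close>, so the
  separating hyperplanes are those numbered 1 to \<open>n\<close>, or \<open>n\<close> + 1 to 0 when
  \<open>n\<close> is negative.\<close>

lemma card_separates:
  fixes a :: "plane \<Rightarrow> real" and n :: int and A B :: "plane set"
  assumes A: "A \<noteq> {}" "\<And>v. v \<in> A \<Longrightarrow> 0 < a v \<and> a v < 1"
    and B: "B \<noteq> {}" "\<And>v. v \<in> B \<Longrightarrow> of_int n < a v \<and> a v < of_int n + 1"
  shows "finite {k. separates a k A B}" "card {k. separates a k A B} = nat \<bar>n\<bar>"
proof -
  have lt: "(\<forall>v\<in>C. a v < of_int k) \<longleftrightarrow> j < k" and gt: "(\<forall>v\<in>C. a v > of_int k) \<longleftrightarrow> k \<le> j"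
    if ne: "C \<noteq> {}" and C: "\<And>v. v \<in> C \<Longrightarrow> of_int j < a v \<and> a v < of_int j + 1" for C and k j :: int
  proof -
    obtain v where v: "v \<in> C" using ne by blast
    show "(\<forall>v\<in>C. a v < of_int k) \<longleftrightarrow> j < k"
    proof
      assume "\<forall>v\<in>C. a v < of_int k"
      then have "a v < of_int k" "of_int j < a v" using v C by auto
      then show "j < k" by linarith
    next
      assume "j < k"
      then have "of_int j + 1 \<le> (of_int k :: real)" by linarith
      then show "\<forall>v\<in>C. a v < of_int k" using C by force
    qed
    show "(\<forall>v\<in>C. a v > of_int k) \<longleftrightarrow> k \<le> j"
    proof
      assume "\<forall>v\<in>C. a v > of_int k"
      then have "of_int k < a v" "a v < of_int j + 1" using v C by auto
      then show "k \<le> j" by linarith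
    next
      assume "k \<le> j"
      then have "of_int k \<le> (of_int j :: real)" by linarith
      then show "\<forall>v\<in>C. a v > of_int k" using C by force
    qed
  qed
  \<comment> \<open>At most one of the two intervals is nonempty, depending on the sign of
    \<open>n\<close>.\<close>
  have "{k. separates a k A B} = {1..n} \<union> {n+1..0}"
    unfolding separates_def using lt[of A 0] gt[of A 0] lt[OF B] gt[OF B] A by auto
  moreover have "card ({1..n} \<union> {n+1..0}) = nat \<bar>n\<bar>"
    by (cases "n \<ge> 0") auto
  ultimately show "finite {k. separates a k A B}" "card {k. separates a k A B} = nat \<bar>n\<bar>"
    by auto
qed

lemma roots_distinct: "alpha1 \<noteq> alpha2" "alpha1 \<noteq> phi" "alpha2 \<noteq> phi"
proof -
  have "alpha1 (1,2) \<noteq> alpha2 (1,2)" "alpha1 (1,2) \<noteq> phi (1,2)" "alpha2 (1,2) \<noteq> phi (1,2)"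
    by (simp_all add: alpha1_def alpha2_def phi_def)
  then show "alpha1 \<noteq> alpha2" "alpha1 \<noteq> phi" "alpha2 \<noteq> phi" by metis+
qed

lemma len_WP:
  assumes "w \<in> WP"
  shows "len w = nat \<bar>n1 w\<bar> + nat \<bar>n2 w\<bar> + nat \<bar>n3 w\<bar>"
proof -
  let ?K = "\<lambda>a. {k. separates a k fund_alcove (w ` fund_alcove)}"
  have c: "centre \<in> fund_alcove"
    by (simp add: fund_alcove_def centre_def alpha1_def alpha2_def phi_def)
  then have ne: "fund_alcove \<noteq> {}" "w ` fund_alcove \<noteq> {}" by auto
  have pos: "0 < a v \<and> a v < 1" if "v \<in> fund_alcove" "a \<in> pos_roots" for a v
    using that by (auto simp: fund_alcove_def pos_roots_def phi_def)
  have roots: "alpha1 \<in> pos_roots" "alpha2 \<in> pos_roots" "phi \<in> pos_roots"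
    by (auto simp: pos_roots_def)
  have K: "finite (?K a) \<and> card (?K a) = nat \<bar>j\<bar>"
    if "a \<in> pos_roots" and "\<And>v. v \<in> fund_alcove \<Longrightarrow> of_int j < a (w v) \<and> a (w v) < of_int j + 1"
    for a j
    by (intro conjI card_separates[OF ne(1) _ ne(2), where n = j]) (use pos that in auto)
  note K1 = K[OF roots(1) alcove_strip(1)[OF assms]]
  note K2 = K[OF roots(2) alcove_strip(2)[OF assms]]
  note K3 = K[OF roots(3) alcove_strip(3)[OF assms]]
  have fin: "finite (?K alpha1)" "finite (?K alpha2)" "finite (?K phi)"
    and cd: "card (?K alpha1) = nat \<bar>n1 w\<bar>" "card (?K alpha2) = nat \<bar>n2 w\<bar>" "card (?K phi) = nat \<bar>n3 w\<bar>"
    using K1 K2 K3 by auto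
  have "{(a, k). a \<in> pos_roots \<and> separates a k fund_alcove (w ` fund_alcove)} = Sigma pos_roots ?K"
    by auto
  also have "card \<dots> = (\<Sum>a\<in>pos_roots. card (?K a))"
    using fin by (intro card_SigmaI) (auto simp: pos_roots_def)
  also have "\<dots> = nat \<bar>n1 w\<bar> + nat \<bar>n2 w\<bar> + nat \<bar>n3 w\<bar>"
    using roots_distinct cd by (simp add: pos_roots_def)
  finally show ?thesis by (simp add: len_def)
qed

lemma n_transl:
  "n1 (transl (lat m n)) = m" "n2 (transl (lat m n)) = n" "n3 (transl (lat m n)) = m + n"
  by (simp_all add: n1_def n2_def n3_def weyl_apply centre_def floor_eq_iff)

text \<open>A reflection permutes the roots up to sign, and floor(-x) = -floor(x) - 1 for the
  non-integral values met here; for \<open>s0\<close> an integer shift is added.\<close>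

lemma n_simple_comp:
  assumes "w \<in> WP"
  shows "n1 (s1 \<circ> w) = - n1 w - 1" "n2 (s1 \<circ> w) = n3 w" "n3 (s1 \<circ> w) = n2 w"
    "n1 (s2 \<circ> w) = n3 w" "n2 (s2 \<circ> w) = - n2 w - 1" "n3 (s2 \<circ> w) = n1 w"
    "n1 (s0 \<circ> w) = - n2 w" "n2 (s0 \<circ> w) = - n1 w" "n3 (s0 \<circ> w) = 1 - n3 w"
proof -
  obtain m n k where w: "k < 6" "w = transl (lat m n) \<circ> w_elt k"
    and n: "n1 w = m + [0,-1,0,0,-1,-1] ! k" "n2 w = n + [0,0,-1,-1,0,-1] ! k"
    "n3 w = m + n + [0,0,0,-1,-1,-1] ! k"
    using assms by (rule WP_centre_cases)
  have "n1 (s1 \<circ> w) = - n1 w - 1 \<and> n2 (s1 \<circ> w) = n3 w \<and> n3 (s1 \<circ> w) = n2 w \<and>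
    n1 (s2 \<circ> w) = n3 w \<and> n2 (s2 \<circ> w) = - n2 w - 1 \<and> n3 (s2 \<circ> w) = n1 w \<and>
    n1 (s0 \<circ> w) = - n2 w \<and> n2 (s0 \<circ> w) = - n1 w \<and> n3 (s0 \<circ> w) = 1 - n3 w"
    unfolding n using w(1) unfolding less6_cases w(2)
    by (elim disjE; simp add: n1_def n2_def n3_def weyl_apply centre_def floor_eq_iff)
  then show "n1 (s1 \<circ> w) = - n1 w - 1" "n2 (s1 \<circ> w) = n3 w" "n3 (s1 \<circ> w) = n2 w"
    "n1 (s2 \<circ> w) = n3 w" "n2 (s2 \<circ> w) = - n2 w - 1" "n3 (s2 \<circ> w) = n1 w"
    "n1 (s0 \<circ> w) = - n2 w" "n2 (s0 \<circ> w) = - n1 w" "n3 (s0 \<circ> w) = 1 - n3 w"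
    by auto
qed

lemma transl_00 [simp]: "transl (0, 0) = id"
  by (simp add: fun_eq_iff transl_apply)

lemma n_id [simp]: "n1 id = 0" "n2 id = 0" "n3 id = 0"
  using n_transl[of 0 0] by simp_all

text \<open>The two nontrivial elements of length 0, which rotate the fundamental alcove.\<close>

definition om :: "plane \<Rightarrow> plane" where "om = transl (lat 1 0) \<circ> w_elt 4"
definition om' :: "plane \<Rightarrow> plane" where "om' = transl (lat 0 1) \<circ> w_elt 3"

lemma om_WP: "om \<in> WP" "om' \<in> WP"
  unfolding om_def om'_def by (rule WP_I; simp add: W0_eq del: w_elt_numeral)+

lemma om_apply: "om v = (1 - fst v - snd v, fst v)" "om' v = (snd v, 1 - fst v - snd v)"
  by (simp_all add: om_def om'_def weyl_apply)

lemma n_comp_om: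
  "n1 (w \<circ> om) = n1 w" "n2 (w \<circ> om) = n2 w" "n3 (w \<circ> om) = n3 w"
  "n1 (w \<circ> om') = n1 w" "n2 (w \<circ> om') = n2 w" "n3 (w \<circ> om') = n3 w"
proof -
  have "om centre = centre" "om' centre = centre" by (simp_all add: om_apply centre_def)
  then show "n1 (w \<circ> om) = n1 w" "n2 (w \<circ> om) = n2 w" "n3 (w \<circ> om) = n3 w"
    "n1 (w \<circ> om') = n1 w" "n2 (w \<circ> om') = n2 w" "n3 (w \<circ> om') = n3 w"
    by (simp_all add: n1_def n2_def n3_def)
qed

lemma n_om_comp:
  assumes "w \<in> WP"
  shows "n1 (om \<circ> w) = - n3 w" "n2 (om \<circ> w) = n1 w" "n3 (om \<circ> w) = - n2 w"
    "n1 (om' \<circ> w) = n2 w" "n2 (om' \<circ> w) = - n3 w" "n3 (om' \<circ> w) = - n1 w"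
proof -
  obtain m n k where w: "k < 6" "w = transl (lat m n) \<circ> w_elt k"
    and n: "n1 w = m + [0,-1,0,0,-1,-1] ! k" "n2 w = n + [0,0,-1,-1,0,-1] ! k"
    "n3 w = m + n + [0,0,0,-1,-1,-1] ! k"
    using assms by (rule WP_centre_cases)
  have "n1 (om \<circ> w) = - n3 w \<and> n2 (om \<circ> w) = n1 w \<and> n3 (om \<circ> w) = - n2 w \<and>
    n1 (om' \<circ> w) = n2 w \<and> n2 (om' \<circ> w) = - n3 w \<and> n3 (om' \<circ> w) = - n1 w"
    unfolding n using w(1) unfolding less6_cases w(2)
    by (elim disjE; simp add: n1_def n2_def n3_def weyl_apply om_apply centre_def floor_eq_iff)
  then show "n1 (om \<circ> w) = - n3 w" "n2 (om \<circ> w) = n1 w" "n3 (om \<circ> w) = - n2 w"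
    "n1 (om' \<circ> w) = n2 w" "n2 (om' \<circ> w) = - n3 w" "n3 (om' \<circ> w) = - n1 w"
    by auto
qed

text \<open>The alcoves of \<open>w\<close> and \<open>w \<circ> s\<close> share a wall, so exactly
  one strip changes, and only by one.\<close>

lemma n_comp_simple:
  assumes "w \<in> WP" "s \<in> {s0, s1, s2}"
  shows "(n1 (w \<circ> s), n2 (w \<circ> s), n3 (w \<circ> s)) \<in> {(n1 w + 1, n2 w, n3 w), (n1 w - 1, n2 w, n3 w),
    (n1 w, n2 w + 1, n3 w), (n1 w, n2 w - 1, n3 w), (n1 w, n2 w, n3 w + 1), (n1 w, n2 w, n3 w - 1)}"
proof -
  obtain m n k where w: "k < 6" "w = transl (lat m n) \<circ> w_elt k"
    and n: "n1 w = m + [0,-1,0,0,-1,-1] ! k" "n2 w = n + [0,0,-1,-1,0,-1] ! k"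
    "n3 w = m + n + [0,0,0,-1,-1,-1] ! k"
    using assms(1) by (rule WP_centre_cases)
  \<comment> \<open>\<open>s0\<close> sends \<open>centre\<close> to (2/3, 2/3), whose coordinate
    sum is 4/3.\<close>
  have f: "\<lfloor>of_int m + 4/3 :: real\<rfloor> = m + 1" "\<lfloor>of_int m - 4/3 :: real\<rfloor> = m - 2" for m
    by linarith+
  have "s = s0 \<or> s = s1 \<or> s = s2" using assms(2) by auto
  then show ?thesis
    unfolding n using w(1) unfolding less6_cases w(2)
    by (elim disjE; simp add: n1_def n2_def n3_def weyl_apply centre_def f floor_eq_iff)
qed

lemma len_comp_simple:
  assumes "w \<in> WP" "s \<in> {s0, s1, s2}"
  shows "len (w \<circ> s) = len w + 1 \<or> len w = len (w \<circ> s) + 1"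
proof -
  have WP: "w \<circ> s \<in> WP" using WP_comp[OF assms(1)] assms(2) simple_WP by auto
  show ?thesis using n_comp_simple[OF assms] unfolding len_WP[OF assms(1)] len_WP[OF WP] by auto
qed

text \<open>The sign conditions place the alcove of \<open>w\<close> on the same side of all three
  walls as the fundamental alcove, which is therefore stabilised.\<close>

lemma alcove_stabiliser:
  assumes "w \<in> WP" "n1 w \<ge> 0" "n2 w \<ge> 0" "n3 w \<le> 0"
  shows "w = id \<or> w = om \<or> w = om'"
proof -
  obtain m n k where w: "k < 6" "w = transl (lat m n) \<circ> w_elt k"
    and n: "n1 w = m + [0,-1,0,0,-1,-1] ! k" "n2 w = n + [0,0,-1,-1,0,-1] ! k"
    "n3 w = m + n + [0,0,0,-1,-1,-1] ! k"
    using assms(1) by (rule WP_centre_cases)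
  have "k = 0 \<and> m = 0 \<and> n = 0 \<or> k = 4 \<and> m = 1 \<and> n = 0 \<or> k = 3 \<and> m = 0 \<and> n = 1"
    using assms(2-4) w(1) unfolding n less6_cases by auto
  then show ?thesis using w(2) by (auto simp: om_def om'_def)
qed

lemma w_elt_transl_inj:
  assumes "k < 6" "k' < 6" "w_elt k \<circ> transl (lat m n) = w_elt k' \<circ> transl (lat m' n')"
  shows "k = k' \<and> m = m' \<and> n = n'"
proof -
  have e: "w_elt k (transl (lat m n) v) = w_elt k' (transl (lat m' n') v)" for v
    using fun_cong[OF assms(3), of v] by simp
  show ?thesis
    using assms(1,2) e[of "(0,0)"] e[of "(1,0)"] e[of "(0,1)"] unfolding less6_cases
    by (elim disjE; simp add: weyl_apply)
qed

section \<open>Integration over the torus\<close>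

lemma cis_eq_iff: "cis a = cis b \<longleftrightarrow> (\<exists>n::int. a = b + 2 * pi * n)"
  unfolding sin_cos_eq_iff[of a b, symmetric] complex_eq_iff by auto

lemma measurable_cis [measurable]: "cis \<in> borel \<rightarrow>\<^sub>M borel"
  by (intro borel_measurable_continuous_onI continuous_intros)

lemma sets_circle_haar [simp, measurable_cong]: "sets circle_haar = sets borel"
  and space_circle_haar [simp]: "space circle_haar = UNIV"
  by (simp_all add: circle_haar_def)

lemma emeasure_circle_haar:
  assumes "A \<in> sets borel"
  shows "emeasure circle_haar A = emeasure lborel ({0..2*pi} \<inter> cis -` A) / ennreal (2*pi)"
proof -
  have "cis -` A \<in> sets borel" using measurable_sets[OF measurable_cis assms] by simp
  then show ?thesis using assms by (simp add: circle_haar_def emeasure_distr)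
qed

lemma emeasure_circle_UNIV: "emeasure circle_haar UNIV = 1"
  by (subst emeasure_circle_haar) (auto simp: ennreal_divide_self)

interpretation H: finite_measure circle_haar
  by (rule finite_measureI) (simp add: emeasure_circle_UNIV)

lemma measure_circle_UNIV [simp]: "measure circle_haar UNIV = 1"
  by (simp add: measure_def emeasure_circle_UNIV)

lemma AE_circle: "AE z in circle_haar. norm z = 1"
proof -
  have "{z::complex. norm z = 1} \<in> sets borel" by measurable
  then show ?thesis unfolding circle_haar_def by (subst AE_distr_iff) auto
qed

lemma AE_circle_neq: "AE z in circle_haar. z \<noteq> c"
proof -
  have "countable (cis -` {c})"
  proof (cases "cis -` {c} = {}")
    case False
    then obtain b where "cis b = c" by auto
    then have "cis -` {c} \<subseteq> range (\<lambda>n::int. b + 2 * pi * n)" by (auto simp: cis_eq_iff)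
    then show ?thesis by (rule countable_subset) simp
  qed simp
  then have "emeasure lborel ({0..2*pi} \<inter> cis -` {c}) = 0"
    by (intro emeasure_lborel_countable) auto
  then have "emeasure circle_haar {c} = 0" by (simp add: emeasure_circle_haar)
  then have "{c} \<in> null_sets circle_haar" by auto
  from AE_not_in[OF this] show ?thesis by simp
qed

text \<open>Cut at 0: the part of the interval below 0 moves up by one period and fills the missing
  end from g to 2 pi.\<close>

lemma periodic_measure:
  fixes S :: "real set"
  assumes S: "S \<in> sets borel" and per: "\<And>x. x + 2*pi \<in> S \<longleftrightarrow> x \<in> S" and g: "0 \<le> g" "g \<le> 2*pi"
  shows "emeasure lborel ({g - 2*pi..g} \<inter> S) = emeasure lborel ({0..2*pi} \<inter> S)"
proof -
  have shift: "emeasure lborel ({g - 2*pi..<0} \<inter> S) = emeasure lborel ({g..<2*pi} \<inter> S)"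
  proof -
    have "emeasure lborel ({g..<2*pi} \<inter> S) = emeasure (distr lborel borel ((+) (2*pi))) ({g..<2*pi} \<inter> S)"
      by (simp add: lborel_distr_plus)
    also have "\<dots> = emeasure lborel ((+) (2*pi) -` ({g..<2*pi} \<inter> S))"
      using S by (subst emeasure_distr) auto
    also have "(+) (2*pi) -` ({g..<2*pi} \<inter> S) = {g - 2*pi..<0} \<inter> S"
      proof (rule set_eqI)
      fix x
      have "2*pi + x \<in> S \<longleftrightarrow> x \<in> S" using per[of x] by (simp only: add.commute)
      then show "x \<in> (+) (2*pi) -` ({g..<2*pi} \<inter> S) \<longleftrightarrow> x \<in> {g - 2*pi..<0} \<inter> S"
        by (auto simp del: add_uminus_conv_diff)
    qed
    finally show ?thesis ..
  qed
  have pt: "emeasure lborel ({b..c} \<inter> S) = emeasure lborel ({b..<c} \<inter> S)" for b c :: real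
  proof (rule emeasure_eq_AE)
    have "AE x in lborel. x \<noteq> c" by (rule AE_lborel_singleton)
    then show "AE x in lborel. x \<in> {b..c} \<inter> S \<longleftrightarrow> x \<in> {b..<c} \<inter> S" by eventually_elim auto
  qed (use S in auto)
  have split: "emeasure lborel ({a..<c} \<inter> S) = emeasure lborel ({a..<b} \<inter> S) + emeasure lborel ({b..<c} \<inter> S)"
    if "a \<le> b" "b \<le> c" for a b c :: real
  proof -
    have "{a..<c} \<inter> S = ({a..<b} \<inter> S) \<union> ({b..<c} \<inter> S)" "({a..<b} \<inter> S) \<inter> ({b..<c} \<inter> S) = {}"
      using that by auto
    with plus_emeasure[of "{a..<b} \<inter> S" lborel "{b..<c} \<inter> S"] S show ?thesis by simp
  qed
  have "emeasure lborel ({g - 2*pi..<g} \<inter> S) = emeasure lborel ({g - 2*pi..<0} \<inter> S) + emeasure lborel ({0..<g} \<inter> S)"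
    using g by (intro split) auto
  also have "\<dots> = emeasure lborel ({0..<g} \<inter> S) + emeasure lborel ({g..<2*pi} \<inter> S)"
    by (simp add: shift add.commute)
  also have "\<dots> = emeasure lborel ({0..<2*pi} \<inter> S)"
    using g by (intro split[symmetric]) auto
  finally show ?thesis by (simp add: pt)
qed

text \<open>Reflections z to c/z are chosen because rotations are composites of two of them and
  inversion is the case c = 1; the simple reflections act on each torus coordinate in this way
  too.\<close>

lemma circle_haar_reflect:
  assumes c: "norm c = 1"
  shows "distr circle_haar borel (\<lambda>z. c / z) = circle_haar"
proof (rule measure_eqI)
  fix A assume "A \<in> sets (distr circle_haar borel (\<lambda>z. c / z))"
  then have A: "A \<in> sets borel" by simp
  define g where "g = Arg2pi c"
  have g: "0 \<le> g" "g \<le> 2*pi" "c = cis g"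
    using Arg2pi[of c] c by (auto simp: g_def cis_conv_exp is_Arg_def mult.commute)
  let ?S = "cis -` A"
  have S: "?S \<in> sets borel" using measurable_sets[OF measurable_cis A] by simp
  have per: "x + 2*pi \<in> ?S \<longleftrightarrow> x \<in> ?S" for x by (simp add: cis_mult[symmetric])
  have m: "(\<lambda>z. c / z) \<in> borel \<rightarrow>\<^sub>M borel" by measurable
  have "emeasure (distr circle_haar borel (\<lambda>z. c / z)) A = emeasure circle_haar ((\<lambda>z. c / z) -` A)"
    using A m by (subst emeasure_distr) auto
  also have "\<dots> = emeasure lborel ({0..2*pi} \<inter> cis -` (\<lambda>z. c / z) -` A) / ennreal (2*pi)"
    using measurable_sets[OF m A] by (subst emeasure_circle_haar) auto
  \<comment> \<open>In angles the map is x to g - x, which carries [0, 2 pi] onto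
    [g - 2 pi, g].\<close>
  also have "{0..2*pi} \<inter> cis -` (\<lambda>z. c / z) -` A = (\<lambda>x. g + (- 1) * x) -` ({g - 2*pi..g} \<inter> ?S)"
    by (auto simp: g(3) cis_divide)
  also have "emeasure lborel \<dots> = emeasure (distr lborel borel (\<lambda>x. g + (- 1) * x)) ({g - 2*pi..g} \<inter> ?S)"
    using S by (subst emeasure_distr) auto
  also have "distr lborel borel (\<lambda>x. g + (- 1) * x) = lborel"
    using lborel_real_affine[of "- 1" g] by (simp add: density_1)
  also have "emeasure lborel ({g - 2*pi..g} \<inter> ?S) = emeasure lborel ({0..2*pi} \<inter> ?S)"
    by (rule periodic_measure[OF S per g(1,2)])
  also have "\<dots> / ennreal (2*pi) = emeasure circle_haar A" by (simp add: emeasure_circle_haar A)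
  finally show "emeasure (distr circle_haar borel (\<lambda>z. c / z)) A = emeasure circle_haar A" .
qed simp

lemma integral_circle_reflect:
  fixes f :: "complex \<Rightarrow> complex"
  assumes [measurable]: "f \<in> borel \<rightarrow>\<^sub>M borel" and c: "norm c = 1"
  shows "(LINT z|circle_haar. f (c / z)) = (LINT z|circle_haar. f z)"
proof -
  have m: "(\<lambda>z. c / z) \<in> circle_haar \<rightarrow>\<^sub>M borel" by measurable
  have "(LINT z|circle_haar. f z) = (LINT z|distr circle_haar borel (\<lambda>z. c / z). f z)"
    by (simp add: circle_haar_reflect[OF c])
  also have "\<dots> = (LINT z|circle_haar. f (c / z))"
    by (rule integral_distr[OF m assms(1)])
  finally show ?thesis ..
qed

lemma circle_integrable:
  fixes f :: "complex \<Rightarrow> complex"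
  assumes "f \<in> borel \<rightarrow>\<^sub>M borel" "\<And>z. norm z = 1 \<Longrightarrow> norm (f z) \<le> B"
  shows "integrable circle_haar f"
proof (rule H.integrable_const_bound)
  show "AE z in circle_haar. norm (f z) \<le> B" using AE_circle by eventually_elim (rule assms)
qed (use assms(1) in simp)

lemma measurable_powi [measurable]: "f \<in> borel_measurable M \<Longrightarrow> (\<lambda>x. f x powi k) \<in> borel_measurable M"
  for f :: "'a \<Rightarrow> complex"
  by (cases "k \<ge> 0") (simp_all add: power_int_def)

lemma integral_circle_powi: "(LINT z|circle_haar. z powi k) = (if k = 0 then 1 else 0)"
proof (cases "k = 0")
  case True
  then show ?thesis by simp
next
  case False
  \<comment> \<open>Rotation by \<open>c\<close> multiplies z^k by -1, while as a composite of two
    reflections it preserves the measure; the integral thus equals its own negative.\<close>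
  define c where "c = cis (pi / k)"
  have "c powi k = cis (k * (pi / k))" unfolding c_def by (rule cis_power_int)
  then have ck: "c powi k = - 1" using False by simp
  have "(LINT z|circle_haar. z powi k) = (LINT z|circle_haar. (1 / z) powi k)"
    by (rule integral_circle_reflect[symmetric]) auto
  also have "\<dots> = (LINT z|circle_haar. (1 / (c / z)) powi k)"
    by (rule integral_circle_reflect[symmetric, of "\<lambda>z. (1 / z) powi k"]) (auto simp: c_def)
  also have "\<dots> = (LINT z|circle_haar. inverse (c powi k) * z powi k)"
    by (simp add: power_int_mult_distrib divide_inverse mult.commute power_int_inverse)
  also have "\<dots> = - (LINT z|circle_haar. z powi k)" by (simp add: ck)
  finally show ?thesis using False by (simp add: equal_neg_zero)
qed

lemma one_minus_nonzero: "norm (a::complex) < 1 \<Longrightarrow> 1 - a \<noteq> 0"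
  by auto

lemma norm_one_minus_ge: "1 - norm (a::complex) \<le> norm (1 - a)"
  using norm_triangle_ineq2[of 1 a] by simp

lemma circle_integrable_geometric:
  fixes A :: complex
  assumes A: "norm A < 1"
  shows "integrable circle_haar (\<lambda>z. z powi k / (1 - A * z powi l))"
    "norm (LINT z|circle_haar. z powi k / (1 - A * z powi l)) \<le> 1 / (1 - norm A)"
proof -
  have b: "norm (z powi k / (1 - A * z powi l)) \<le> 1 / (1 - norm A)" if "norm z = 1" for z
    using norm_one_minus_ge[of "A * z powi l"] A that
    by (auto simp: norm_divide norm_power_int norm_mult intro!: divide_left_mono mult_pos_pos)
  show i: "integrable circle_haar (\<lambda>z. z powi k / (1 - A * z powi l))"
    by (rule circle_integrable[where B = "1 / (1 - norm A)"]) (measurable, rule b)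
  have "norm (LINT z|circle_haar. z powi k / (1 - A * z powi l))
      \<le> (LINT z|circle_haar. norm (z powi k / (1 - A * z powi l)))" by (rule integral_norm_bound)
  also have "\<dots> \<le> (LINT z|circle_haar. 1 / (1 - norm A))"
    using AE_circle by (intro integral_mono_AE integrable_norm i) (auto elim!: eventually_mono intro: b)
  finally show "norm (LINT z|circle_haar. z powi k / (1 - A * z powi l)) \<le> 1 / (1 - norm A)"
    by simp
qed

text \<open>No series is integrated term by term. The moment and its claimed value satisfy the same
  recursion f(k) - A f(k - d) = [k = 0], so their difference is A^n times the difference at k - n d;
  being bounded uniformly, it tends to 0 with n and is therefore 0.\<close>

lemma integral_geometric:
  fixes A :: complex
  assumes A: "norm A < 1" and d: "d > 0"
  shows "(LINT z|circle_haar. z powi k / (1 - A * z powi (- d))) = (if d dvd k \<and> k \<ge> 0 then A ^ nat (k div d) else 0)"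
proof -
  define m where "m k = (LINT z|circle_haar. z powi k / (1 - A * z powi (- d)))" for k
  define c where "c k = (if d dvd k \<and> k \<ge> 0 then A ^ nat (k div d) else 0)" for k
  have rec: "m k - A * m (k - d) = (if k = 0 then 1 else 0)" for k
  proof -
    have "m k - A * m (k - d) = (LINT z|circle_haar. z powi k / (1 - A * z powi (- d)) - A * (z powi (k - d) / (1 - A * z powi (- d))))"
      unfolding m_def integral_mult_right_zero[symmetric]
      by (intro Bochner_Integration.integral_diff[symmetric] integrable_mult_right circle_integrable_geometric(1)[OF A])
    also have "\<dots> = (LINT z|circle_haar. z powi k)"
    proof (rule integral_cong_AE)
      show "AE z in circle_haar. z powi k / (1 - A * z powi (- d)) - A * (z powi (k - d) / (1 - A * z powi (- d))) = z powi k"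
        using AE_circle
      proof eventually_elim
        case (elim z)
        then have z: "z \<noteq> 0" by auto
        have "1 - A * z powi (- d) \<noteq> 0" using elim A by (intro one_minus_nonzero) (simp add: norm_mult norm_power_int)
        moreover have "z powi (k - d) = z powi k * z powi (- d)" using z by (simp flip: power_int_add)
        then have "z powi k / (1 - A * z powi (- d)) - A * (z powi (k - d) / (1 - A * z powi (- d)))
            = z powi k * (1 - A * z powi (- d)) / (1 - A * z powi (- d))"
          by (simp add: diff_divide_distrib[symmetric] right_diff_distrib mult.left_commute)
        ultimately show ?case by simp
      qed
    qed measurable
    finally show ?thesis by (simp add: integral_circle_powi)
  qed
  have recc: "c k - A * c (k - d) = (if k = 0 then 1 else 0)" for k
  proof (cases "d dvd k")
    case True
    then obtain j where k: "k = d * j" by blast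
    have kd: "(k - d) div d = j - 1" "k div d = j" "d dvd k - d" using d by (simp_all add: k algebra_simps)
    consider "j < 0" | "j = 0" | "j > 0" by linarith
    then show ?thesis
    proof cases
      case 1
      then have "k < 0" using d by (simp add: k mult_pos_neg)
      then show ?thesis using d by (simp add: c_def)
    next
      case 2
      then show ?thesis using d by (simp add: c_def k)
    next
      case 3
      then have "k \<ge> d" using d by (simp add: k)
      moreover have "nat j = Suc (nat (j - 1))" using 3 by simp
      ultimately show ?thesis using d True kd by (simp add: c_def)
    qed
  next
    case False
    then have "\<not> d dvd k - d" "k \<noteq> 0" by (metis diff_add_cancel dvd_add dvd_refl, auto)
    then show ?thesis using False by (simp add: c_def)
  qed
  have e: "m k - c k = A ^ n * (m (k - int n * d) - c (k - int n * d))" for n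
  proof (induction n)
    case (Suc n)
    have "m l - c l = A * (m (l - d) - c (l - d))" for l
      using rec[of l] recc[of l] by (simp add: algebra_simps)
    moreover have "k - int n * d - d = k - int (Suc n) * d" by (simp add: algebra_simps)
    ultimately have "m (k - int n * d) - c (k - int n * d)
        = A * (m (k - int (Suc n) * d) - c (k - int (Suc n) * d))" by metis
    with Suc.IH show ?case by (simp only: power_Suc2 mult.assoc)
  qed simp
  have bd: "norm (m l - c l) \<le> 1 / (1 - norm A) + 1" for l
  proof -
    have "norm (c l) \<le> 1" using A by (simp add: c_def norm_power power_le_one)
    moreover have "norm (m l) \<le> 1 / (1 - norm A)"
      unfolding m_def by (rule circle_integrable_geometric(2)[OF A])
    ultimately show ?thesis using norm_triangle_ineq4[of "m l" "c l"] by linarith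
  qed
  have "norm (m k - c k) \<le> norm A ^ n * (1 / (1 - norm A) + 1)" for n
    unfolding e[of n] norm_mult norm_power using bd by (intro mult_left_mono) auto
  moreover have "(\<lambda>n. norm A ^ n * (1 / (1 - norm A) + 1)) \<longlonglongrightarrow> 0 * (1 / (1 - norm A) + 1)"
    using A by (intro tendsto_intros LIMSEQ_power_zero) simp
  ultimately have "norm (m k - c k) \<le> 0"
    by (intro LIMSEQ_le_const[of _ "0::real"]) auto
  then show ?thesis by (simp add: m_def c_def)
qed

lemma integral_geometric':
  fixes B :: complex
  assumes B: "norm B < 1" and d: "d > 0"
  shows "(LINT z|circle_haar. z powi k / (1 - B * z powi d)) = (if d dvd k \<and> k \<le> 0 then B ^ nat (- k div d) else 0)"
proof -
  have "(LINT z|circle_haar. z powi k / (1 - B * z powi d))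
      = (LINT z|circle_haar. (1 / z) powi k / (1 - B * (1 / z) powi d))"
    by (rule integral_circle_reflect[symmetric]) auto
  also have "\<dots> = (LINT z|circle_haar. z powi (- k) / (1 - B * z powi (- d)))"
    by (simp add: power_int_inverse power_int_minus divide_inverse)
  also have "\<dots> = (if d dvd k \<and> k \<le> 0 then B ^ nat (- k div d) else 0)"
    using integral_geometric[OF B d, of "- k"] by simp
  finally show ?thesis .
qed

text \<open>The k-th moment on the circle of 1 / ((1 - A/z) (1 - B z)), see
  \<open>integral_poisson1\<close>.\<close>

definition Lc :: "complex \<Rightarrow> complex \<Rightarrow> int \<Rightarrow> complex" where
  "Lc A B k = (if k \<ge> 0 then A ^ nat k else B ^ nat (- k)) / (1 - A * B)"

lemma integral_poisson:
  fixes A B :: complex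
  assumes A: "norm A < 1" and B: "norm B < 1" and d: "d > 0"
  shows "(LINT z|circle_haar. z powi k / ((1 - A * z powi (- d)) * (1 - B * z powi d)))
    = (if d dvd k then Lc A B (k div d) else 0)"
proof -
  have "norm (A * B) < 1" using A B mult_strict_mono[of "norm A" 1 "norm B" 1] by (simp add: norm_mult)
  then have AB: "1 - A * B \<noteq> 0" by (rule one_minus_nonzero)
  \<comment> \<open>The kernel is a combination of the two one-sided geometric series, which share
    their constant term; the third fraction, whose denominator is 1, removes the double
    count.\<close>
  have "(LINT z|circle_haar. z powi k / ((1 - A * z powi (- d)) * (1 - B * z powi d)))
      = (LINT z|circle_haar. (z powi k / (1 - A * z powi (- d)) + z powi k / (1 - B * z powi d) - z powi k / (1 - 0 * z powi d)) / (1 - A * B))"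
  proof (rule integral_cong_AE)
    show "AE z in circle_haar. z powi k / ((1 - A * z powi (- d)) * (1 - B * z powi d))
      = (z powi k / (1 - A * z powi (- d)) + z powi k / (1 - B * z powi d) - z powi k / (1 - 0 * z powi d)) / (1 - A * B)"
      using AE_circle
    proof eventually_elim
      case (elim z)
      define w where "w = z powi d"
      have w: "w \<noteq> 0" "z powi (- d) = 1 / w" "norm w = 1"
        using elim by (auto simp: w_def power_int_minus divide_inverse norm_power_int)
      have nz: "1 - A * (1 / w) \<noteq> 0" "1 - B * w \<noteq> 0"
        using w A B by (intro one_minus_nonzero; simp add: norm_mult norm_divide)+
      have "((1 - B * w) + (1 - A * (1 / w)) - (1 - A * (1 / w)) * (1 - B * w)) = 1 - A * B"
        using w by (simp add: field_simps)
      then have "1 / (1 - A * (1 / w)) + 1 / (1 - B * w) - 1 = (1 - A * B) / ((1 - A * (1 / w)) * (1 - B * w))"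
        using nz by (simp add: divide_simps)
      then have "z powi k * (1 / ((1 - A * (1 / w)) * (1 - B * w))) = z powi k * ((1 / (1 - A * (1 / w)) + 1 / (1 - B * w) - 1) / (1 - A * B))"
        using AB by simp
      then show ?case unfolding w(2) w_def[symmetric] by (simp add: algebra_simps)
    qed
  qed measurable
  also have "\<dots> = ((if d dvd k \<and> k \<ge> 0 then A ^ nat (k div d) else 0) + (if d dvd k \<and> k \<le> 0 then B ^ nat (- k div d) else 0)
      - (if k = 0 then 1 else 0)) / (1 - A * B)"
    by (simp add: circle_integrable_geometric[OF A] circle_integrable_geometric[OF B]
      circle_integrable_geometric[of 0, simplified] integral_geometric[OF A d] integral_geometric'[OF B d] integral_circle_powi)
  also have "\<dots> = (if d dvd k then Lc A B (k div d) else 0)"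
  proof -
    have "- (d * j) div d = - j" for j
      using d nonzero_mult_div_cancel_left[of d "- j"] by simp
    then show ?thesis using d by (auto simp: Lc_def mult_le_0_iff zero_le_mult_iff elim!: dvdE)
  qed
  finally show ?thesis .
qed

section \<open>Integrals over the two-dimensional torus\<close>

abbreviation torus :: "(complex \<times> complex) measure" where
  "torus \<equiv> circle_haar \<Otimes>\<^sub>M circle_haar"

interpretation HH: pair_sigma_finite circle_haar circle_haar ..

interpretation torus: finite_measure torus
  by (rule finite_measure_pair_measure) unfold_locales

lemma sets_torus [simp, measurable_cong]: "sets torus = sets borel"
proof -
  have "sets torus = sets ((borel :: complex measure) \<Otimes>\<^sub>M (borel :: complex measure))"
    by (rule sets_pair_measure_cong) simp_all
  then show ?thesis unfolding borel_prod .
qed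

lemma space_torus [simp]: "space torus = UNIV"
  by (simp add: space_pair_measure)

lemma AE_torusI:
  assumes P: "{t. P (fst t) (snd t)} \<in> sets borel" and ae: "\<And>x. norm x = 1 \<Longrightarrow> AE y in circle_haar. P x y"
  shows "AE t in torus. P (fst t) (snd t)"
proof (rule HH.AE_pair_measure)
  show "{t \<in> space torus. P (fst t) (snd t)} \<in> sets torus" using P unfolding sets_torus space_torus by simp
  show "AE x in circle_haar. AE y in circle_haar. P (fst (x, y)) (snd (x, y))"
    using AE_circle by eventually_elim (simp add: ae)
qed

text \<open>Measurability on pairs is established for the product sigma-algebra and then carried
  over to \<open>borel\<close> by \<open>borel_prod\<close>; the same detour recurs below.\<close>

lemma borel_pair_set: "Measurable.pred (borel \<Otimes>\<^sub>M borel) (\<lambda>t. P (fst t) (snd t)) \<Longrightarrow> {t. P (fst t) (snd t)} \<in> sets borel"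
  for P :: "complex \<Rightarrow> complex \<Rightarrow> bool"
  using measurable_sets[of "\<lambda>t. P (fst t) (snd t)" "borel \<Otimes>\<^sub>M borel" "count_space UNIV" "{True}"]
  by (simp add: borel_prod vimage_def space_pair_measure)

lemma AE_torus: "AE t in torus. norm (fst t) = 1 \<and> norm (snd t) = 1"
proof (rule AE_torusI)
  show "{t::complex \<times> complex. norm (fst t) = 1 \<and> norm (snd t) = 1} \<in> sets borel"
    by (rule borel_pair_set) measurable
qed (use AE_circle in simp)

lemma AE_torus_regular:
  "AE t in torus. snd t \<noteq> fst t ^ 2 \<and> fst t \<noteq> snd t ^ 2 \<and> fst t * snd t \<noteq> 1"
proof (rule AE_torusI)
  show "{t::complex \<times> complex. snd t \<noteq> fst t ^ 2 \<and> fst t \<noteq> snd t ^ 2 \<and> fst t * snd t \<noteq> 1} \<in> sets borel"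
    by (rule borel_pair_set) measurable
  fix x :: complex assume x: "norm x = 1"
  \<comment> \<open>For fixed \<open>x\<close> at most four values of \<open>y\<close> are excluded,
    the two square roots of \<open>x\<close> among them.\<close>
  show "AE y in circle_haar. y \<noteq> x ^ 2 \<and> x \<noteq> y ^ 2 \<and> x * y \<noteq> 1"
    using AE_circle_neq[of "x ^ 2"] AE_circle_neq[of "csqrt x"] AE_circle_neq[of "- csqrt x"] AE_circle_neq[of "inverse x"]
  proof eventually_elim
    case (elim y)
    have "x \<noteq> y ^ 2" using elim(2,3) power2_csqrt[of x] power2_eq_iff[of y "csqrt x"] by auto
    moreover have "x * y \<noteq> 1" using elim(4) inverse_unique[of x y] by auto
    ultimately show ?case using elim by simp
  qed
qed

lemma torus_integrable:
  fixes f :: "complex \<times> complex \<Rightarrow> complex"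
  assumes "f \<in> borel \<rightarrow>\<^sub>M borel" "\<And>t. norm (fst t) = 1 \<Longrightarrow> norm (snd t) = 1 \<Longrightarrow> norm (f t) \<le> B"
  shows "integrable torus f"
proof (rule torus.integrable_const_bound)
  show "AE t in torus. norm (f t) \<le> B" using AE_torus by eventually_elim (simp add: assms)
qed (use assms(1) in simp)

lemma measurable_torus_section:
  fixes f :: "complex \<times> complex \<Rightarrow> complex"
  assumes "f \<in> borel \<rightarrow>\<^sub>M borel" "g \<in> borel \<rightarrow>\<^sub>M borel" "h \<in> borel \<rightarrow>\<^sub>M borel"
  shows "(\<lambda>y. f (g y, h y)) \<in> borel \<rightarrow>\<^sub>M borel"
proof -
  have "(\<lambda>y. (g y, h y)) \<in> borel \<rightarrow>\<^sub>M borel" using measurable_Pair[OF assms(2,3)] by (simp add: borel_prod)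
  from measurable_compose[OF this assms(1)] show ?thesis .
qed

lemma torus_fubini:
  fixes f :: "complex \<times> complex \<Rightarrow> complex"
  assumes "integrable torus f"
  shows "(LINT t|torus. f t) = (LINT x|circle_haar. LINT y|circle_haar. f (x, y))"
    "(LINT t|torus. f t) = (LINT y|circle_haar. LINT x|circle_haar. f (x, y))"
  using HH.integral_fst'[OF assms] HH.integral_snd[of "\<lambda>x y. f (x, y)"] assms by simp_all

lemma measurable_torus_maps:
  "(\<lambda>t. (snd t, fst t)) \<in> borel \<rightarrow>\<^sub>M (borel :: (complex \<times> complex) measure)"
  "(\<lambda>t. (fst t, fst t ^ k / snd t)) \<in> borel \<rightarrow>\<^sub>M (borel :: (complex \<times> complex) measure)"
proof -
  have "(\<lambda>t. (snd t, fst t)) \<in> (borel \<Otimes>\<^sub>M borel) \<rightarrow>\<^sub>M ((borel :: complex measure) \<Otimes>\<^sub>M (borel :: complex measure))"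
    "(\<lambda>t. (fst t, fst t ^ k / snd t)) \<in> (borel \<Otimes>\<^sub>M borel) \<rightarrow>\<^sub>M ((borel :: complex measure) \<Otimes>\<^sub>M (borel :: complex measure))"
    by measurable
  then show "(\<lambda>t. (snd t, fst t)) \<in> borel \<rightarrow>\<^sub>M (borel :: (complex \<times> complex) measure)"
    "(\<lambda>t. (fst t, fst t ^ k / snd t)) \<in> borel \<rightarrow>\<^sub>M (borel :: (complex \<times> complex) measure)"
    unfolding borel_prod .
qed

text \<open>For k = 1 this is the action of s_2 on the torus, for k = 2 the substitution used in
  \<open>integral_monW\<close>. By Fubini it reduces to a reflection of the inner circle with c =
  t_1^k.\<close>

lemma torus_reflect_snd:
  fixes f :: "complex \<times> complex \<Rightarrow> complex"
  assumes f: "f \<in> borel \<rightarrow>\<^sub>M borel" "\<And>t. norm (fst t) = 1 \<Longrightarrow> norm (snd t) = 1 \<Longrightarrow> norm (f t) \<le> B"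
  shows "(LINT t|torus. f (fst t, fst t ^ k / snd t)) = (LINT t|torus. f t)"
proof -
  note m = measurable_torus_maps(2)[of k]
  have i: "integrable torus (\<lambda>t. f (fst t, fst t ^ k / snd t))"
    by (rule torus_integrable[OF measurable_compose[OF m f(1)], of B], rule f(2))
      (simp_all add: norm_divide norm_power)
  have "(LINT t|torus. f (fst t, fst t ^ k / snd t)) = (LINT x|circle_haar. LINT y|circle_haar. f (x, x ^ k / y))"
    using torus_fubini(1)[OF i] by simp
  also have "\<dots> = (LINT x|circle_haar. LINT y|circle_haar. f (x, y))"
  proof (rule integral_cong_AE)
    show "AE x in circle_haar. (LINT y|circle_haar. f (x, x ^ k / y)) = (LINT y|circle_haar. f (x, y))"
      using AE_circle
    proof eventually_elim
      case (elim x)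
      show ?case
        by (rule integral_circle_reflect[of "\<lambda>y. f (x, y)"])
          (rule measurable_torus_section[OF f(1)], simp_all add: elim norm_power)
    qed
    show "(\<lambda>x. LINT y|circle_haar. f (x, x ^ k / y)) \<in> borel_measurable circle_haar"
      using HH.integrable_fst'[OF i] by (intro borel_measurable_integrable) simp
    show "(\<lambda>x. LINT y|circle_haar. f (x, y)) \<in> borel_measurable circle_haar"
      using HH.integrable_fst'[OF torus_integrable[OF f]] by (intro borel_measurable_integrable) simp
  qed
  also have "\<dots> = (LINT t|torus. f t)" by (rule torus_fubini(1)[OF torus_integrable[OF f], symmetric])
  finally show ?thesis .
qed

lemma torus_swap:
  fixes f :: "complex \<times> complex \<Rightarrow> complex"
  assumes "f \<in> borel \<rightarrow>\<^sub>M borel"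
  shows "(LINT t|torus. f (snd t, fst t)) = (LINT t|torus. f t)"
  using HH.integral_product_swap[of f] assms by (simp add: split_def)

lemma torus_reflect_fst:
  fixes f :: "complex \<times> complex \<Rightarrow> complex"
  assumes f: "f \<in> borel \<rightarrow>\<^sub>M borel" "\<And>t. norm (fst t) = 1 \<Longrightarrow> norm (snd t) = 1 \<Longrightarrow> norm (f t) \<le> B"
  shows "(LINT t|torus. f (snd t ^ k / fst t, snd t)) = (LINT t|torus. f t)"
proof -
  define g where "g t = f (snd t, fst t)" for t
  note m = measurable_torus_maps(1) measurable_torus_maps(2)[of k]
  have g: "g \<in> borel \<rightarrow>\<^sub>M borel" unfolding g_def by (rule measurable_compose[OF m(1) f(1)])
  have "(LINT t|torus. f (snd t ^ k / fst t, snd t)) = (LINT t|torus. g (fst (snd t, fst t), fst (snd t, fst t) ^ k / snd (snd t, fst t)))"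
    by (simp add: g_def)
  also have "\<dots> = (LINT t|torus. g (fst t, fst t ^ k / snd t))"
    by (rule torus_swap[of "\<lambda>t. g (fst t, fst t ^ k / snd t)"]) (rule measurable_compose[OF m(2) g])
  also have "\<dots> = (LINT t|torus. g t)"
    by (rule torus_reflect_snd[OF g, of B]) (simp add: g_def f(2))
  also have "\<dots> = (LINT t|torus. f t)" unfolding g_def by (rule torus_swap[OF f(1)])
  finally show ?thesis .
qed

subsection \<open>The moments of the Plancherel density\<close>

text \<open>With u = e^(alpha_1), v = e^(alpha_2) and P = 1/q this is the density 1/|c|^2 divided by
  the Weyl denominator, see \<open>monW_density\<close>.\<close>

definition Wk :: "complex \<Rightarrow> complex \<Rightarrow> complex \<Rightarrow> complex" where
  "Wk P u v = ((1 - u) * (1 - v) * (1 - u * v)) /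
    (((1 - P * u) * (1 - P / u)) * ((1 - P * v) * (1 - P / v)) * ((1 - P * (u * v)) * (1 - P / (u * v))))"

definition monW :: "complex \<Rightarrow> int \<Rightarrow> int \<Rightarrow> complex \<times> complex \<Rightarrow> complex" where
  "monW P m n t = fst t powi m * snd t powi n * Wk P (fst t ^ 2 / snd t) (snd t ^ 2 / fst t)"

lemma measurable_monW: "monW P m n \<in> borel \<rightarrow>\<^sub>M borel"
proof -
  have "monW P m n \<in> (borel \<Otimes>\<^sub>M borel) \<rightarrow>\<^sub>M borel" unfolding monW_def[abs_def] Wk_def by measurable
  then show ?thesis unfolding borel_prod .
qed

lemma norm_Wk_le:
  assumes P: "norm P < 1" and u: "norm u = 1" "norm v = 1"
  shows "norm (Wk P u v) \<le> 8 / (1 - norm P) ^ 6"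
proof -
  let ?e = "1 - norm P"
  have f: "norm (1 - z) \<le> 2" if "norm z = 1" for z :: complex
    using norm_triangle_ineq4[of 1 z] that by simp
  have g: "?e \<le> norm (1 - P * z)" "?e \<le> norm (1 - P / z)" if "norm z = 1" for z
    using norm_one_minus_ge[of "P * z"] norm_one_minus_ge[of "P / z"] that by (simp_all add: norm_mult norm_divide)
  have uv: "norm (u * v) = 1" using u by (simp add: norm_mult)
  have e: "0 \<le> ?e" "0 < ?e" using P by auto
  have gg: "?e * ?e \<le> norm (1 - P * z) * norm (1 - P / z)" if "norm z = 1" for z
    using g[OF that] e by (intro mult_mono) auto
  have "norm ((1 - u) * (1 - v) * (1 - u * v)) \<le> 2 * 2 * 2"
    unfolding norm_mult[of "(1 - u) * (1 - v)"] norm_mult[of "1 - u"] using f[OF u(1)] f[OF u(2)] f[OF uv] by (intro mult_mono) auto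
  moreover have "?e * ?e * (?e * ?e) * (?e * ?e) \<le> norm (1 - P * u) * norm (1 - P / u) * (norm (1 - P * v) * norm (1 - P / v)) * (norm (1 - P * (u * v)) * norm (1 - P / (u * v)))"
    using gg[OF u(1)] gg[OF u(2)] gg[OF uv] e by (intro mult_mono[of "?e * ?e * (?e * ?e)"] mult_mono[of "?e * ?e"]) auto
  moreover have "0 < ?e * ?e * (?e * ?e) * (?e * ?e)" using e by simp
  ultimately have "norm (Wk P u v) \<le> 2 * 2 * 2 / (?e * ?e * (?e * ?e) * (?e * ?e))"
    unfolding Wk_def norm_divide by (intro frac_le) (simp_all add: norm_mult)
  also have "\<dots> = 8 / ?e ^ 6" by (simp add: eval_nat_numeral mult_ac)
  finally show ?thesis .
qed

lemma norm_monW_le: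
  assumes "norm P < 1" "norm (fst t) = 1" "norm (snd t) = 1"
  shows "norm (monW P m n t) \<le> 8 / (1 - norm P) ^ 6"
  using norm_Wk_le[OF assms(1), of "fst t ^ 2 / snd t" "snd t ^ 2 / fst t"] assms
  by (simp add: monW_def norm_mult norm_power_int norm_power norm_divide)

section \<open>The integral over one circle with the other variable u fixed\<close>

context
  fixes P u :: complex
  assumes P: "norm P < 1" "P \<noteq> 0" and u: "norm u = 1" "u \<noteq> 1"
begin

lemma kernel_nonzero: "1 + P \<noteq> 0" "1 - P * u \<noteq> 0" "1 - P / u \<noteq> 0" "u \<noteq> 0" "u - P \<noteq> 0" "1 - P ^ 2 * u \<noteq> 0" "u - P ^ 2 \<noteq> 0" "u - 1 \<noteq> 0"
proof -
  have P2: "norm (P ^ 2) < 1" using P by (simp add: norm_power power_less_one_iff)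
  show "1 + P \<noteq> 0" using one_minus_nonzero[of "- P"] P by simp
  show "1 - P * u \<noteq> 0" "1 - P / u \<noteq> 0" "1 - P ^ 2 * u \<noteq> 0"
    using P P2 u by (intro one_minus_nonzero; simp add: norm_mult norm_divide)+
  show "u \<noteq> 0" "u - 1 \<noteq> 0" using u by auto
  show "u - P \<noteq> 0" "u - P ^ 2 \<noteq> 0" using P P2 u by auto
qed

text \<open>Coefficients of the partial fraction expansion in v: the two \<open>\<alpha>\<close>
  belong to the poles P and P/u inside the unit circle, the two \<open>\<beta>\<close> to the poles
  1/P and 1/(P u) outside.\<close>

definition "\<alpha>1 = 1 / (P * (u - 1)) - 1 / (1 - P ^ 2 * u)"
definition "\<alpha>2 = - 1 / (P * (u - 1)) - 1 / (u - P ^ 2)"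
definition "\<beta>1 = 1 / (1 - u) - P / (u - P ^ 2)"
definition "\<beta>2 = - P * u / (1 - P ^ 2 * u) - u / (1 - u)"

text \<open>Each of (1 - v) / ((v - P) (1 - P v)) and its analogue in u v is a difference of two
  simple fractions over 1 + P. Their product consists of four products of two linear forms, each of
  which splits again; u different from 1 keeps the two inner poles apart, and likewise the two outer
  ones.\<close>

lemma kernel_partial_fractions:
  assumes v: "norm v = 1"
  shows "(1 - v) * (1 - u * v) / ((1 - P * v) * (1 - P / v) * ((1 - P * (u * v)) * (1 - P / (u * v))))
    = v ^ 2 * u / (1 + P) ^ 2 * (\<alpha>1 / (v - P) + \<alpha>2 * u / (u * v - P) + \<beta>1 / (1 - P * v) + \<beta>2 / (1 - P * (u * v)))"
proof -
  note nz = kernel_nonzero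
  define A B C D where "A = v - P" and "B = u * v - P" and "C = 1 - P * v" and "D = 1 - P * (u * v)"
  have v0: "v \<noteq> 0" using v by auto
  have z: "A \<noteq> 0" "B \<noteq> 0" "C \<noteq> 0" "D \<noteq> 0"
  proof -
    show "A \<noteq> 0" using v P by (auto simp: A_def)
    have "norm (u * v) = 1" using u v by (simp add: norm_mult)
    then show "B \<noteq> 0" "D \<noteq> 0"
      using P one_minus_nonzero[of "P * (u * v)"] by (auto simp: B_def D_def norm_mult)
    show "C \<noteq> 0" using v P one_minus_nonzero[of "P * v"] by (simp add: C_def norm_mult)
  qed
  have e: "1 - P / v = A / v" "1 - P / (u * v) = B / (u * v)"
    using v0 nz by (simp_all add: A_def B_def field_simps)
  have 1: "(1 - v) / (A * C) = (1 / A - 1 / C) / (1 + P)"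
  proof -
    have "1 / A - 1 / C = (C - A) / (A * C)" using z by (simp add: field_simps)
    also have "C - A = (1 + P) * (1 - v)" by (simp add: A_def C_def algebra_simps)
    finally show ?thesis using nz by simp
  qed
  have 2: "(1 - u * v) / (B * D) = (1 / B - 1 / D) / (1 + P)"
  proof -
    have "1 / B - 1 / D = (D - B) / (B * D)" using z by (simp add: field_simps)
    also have "D - B = (1 + P) * (1 - u * v)" by (simp add: B_def D_def algebra_simps)
    finally show ?thesis using nz by simp
  qed
  have AB: "1 / (A * B) = (1 / A - u / B) * (1 / (P * (u - 1)))"
  proof -
    have "1 / A - u / B = (B - u * A) / (A * B)" using z by (simp add: field_simps)
    also have "B - u * A = P * (u - 1)" by (simp add: A_def B_def algebra_simps)
    finally show ?thesis using nz P by simp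
  qed
  have AD: "1 / (A * D) = (1 / A + P * u / D) * (1 / (1 - P ^ 2 * u))"
  proof -
    have "1 / A + P * u / D = (D + P * u * A) / (A * D)" using z by (simp add: field_simps)
    also have "D + P * u * A = 1 - P ^ 2 * u" by (simp add: A_def D_def algebra_simps power2_eq_square)
    finally show ?thesis using nz by simp
  qed
  have CB: "1 / (C * B) = (u / B + P / C) * (1 / (u - P ^ 2))"
  proof -
    have "u / B + P / C = (u * C + P * B) / (C * B)" using z by (simp add: field_simps)
    also have "u * C + P * B = u - P ^ 2" by (simp add: C_def B_def algebra_simps power2_eq_square)
    finally show ?thesis using nz by simp
  qed
  have CD: "1 / (C * D) = (1 / C - u / D) * (1 / (1 - u))"
  proof -
    have "1 / C - u / D = (D - u * C) / (C * D)" using z by (simp add: field_simps)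
    also have "D - u * C = 1 - u" by (simp add: C_def D_def algebra_simps)
    finally show ?thesis using nz by simp
  qed
  have "(1 - v) * (1 - u * v) / (C * (A / v) * (D * (B / (u * v)))) = v ^ 2 * u * (((1 - v) / (A * C)) * ((1 - u * v) / (B * D)))"
    using z v0 nz by (simp add: field_simps power2_eq_square)
  also have "\<dots> = v ^ 2 * u / (1 + P) ^ 2 * ((1 / A - 1 / C) * (1 / B - 1 / D))"
    unfolding 1 2 by (simp add: power2_eq_square)
  also have "(1 / A - 1 / C) * (1 / B - 1 / D) = 1 / (A * B) - 1 / (A * D) - 1 / (C * B) + 1 / (C * D)"
    by (simp add: algebra_simps)
  also have "\<dots> = \<alpha>1 / A + \<alpha>2 * u / B + \<beta>1 / C + \<beta>2 / D"
  proof -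
    define x y z t where "x = 1 / (P * (u - 1))" and "y = 1 / (1 - P ^ 2 * u)" and "z = 1 / (u - P ^ 2)" and "t = 1 / (1 - u)"
    have "\<alpha>1 = x - y" "\<alpha>2 = - x - z" "\<beta>1 = t - P * z" "\<beta>2 = - (P * u * y) - u * t"
      by (simp_all add: \<alpha>1_def \<alpha>2_def \<beta>1_def \<beta>2_def x_def y_def z_def t_def)
    then show ?thesis
      unfolding AB AD CB CD x_def[symmetric] y_def[symmetric] z_def[symmetric] t_def[symmetric]
      by (simp add: divide_inverse distrib_left distrib_right left_diff_distrib right_diff_distrib mult_ac)
  qed
  finally show ?thesis unfolding e A_def[symmetric] B_def[symmetric] C_def[symmetric] D_def[symmetric] .
qed

text \<open>The factor \<open>w\<close> collects what \<open>Wk\<close> contains in u alone. Its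
  zero at u = 1 cancels the poles of the coefficients there, so the results are regular on the whole
  circle and are combinations of Poisson kernels in u.\<close>

lemma residue_coefficients:
  defines "w \<equiv> (1 - u) / ((1 - P * u) * (1 - P / u))"
  shows "w * \<alpha>1 = - (1 + P) / (P * ((1 - P / u) * (1 - P ^ 2 * u)))"
    "w * \<alpha>2 = (1 + P) / (P * ((1 - P ^ 2 / u) * (1 - P * u)))"
    "P ^ 2 * w * (\<beta>1 + \<beta>2) = (1 + P) * (- 1 / ((1 - P / u) * (1 - P ^ 2 * u)) + u / ((1 - P ^ 2 / u) * (1 - P * u)))
      + (1 + P) ^ 2 * (1 - u) / ((1 - P / u) * (1 - P * u))"
proof -
  note nz = kernel_nonzero
  define A B C D where "A = u - 1" and "B = 1 - P ^ 2 * u" and "C = u - P ^ 2" and "D = 1 - P * u"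
  define E where "E = u - P"
  have z: "A \<noteq> 0" "B \<noteq> 0" "C \<noteq> 0" "D \<noteq> 0" "E \<noteq> 0" "u \<noteq> 0" "P \<noteq> 0"
    using nz P by (auto simp: A_def B_def C_def D_def E_def)
  have e: "1 - P / u = E / u" "1 - P ^ 2 / u = C / u" "1 - u = - A"
    using z by (simp_all add: E_def C_def A_def field_simps)
  have w: "w = - A * u / (D * E)" unfolding w_def e D_def[symmetric] by simp
  have a1: "\<alpha>1 = (1 + P) * D / (P * A * B)"
  proof -
    have "\<alpha>1 = (B - P * A) / (P * A * B)" using z unfolding \<alpha>1_def A_def[symmetric] B_def[symmetric] by (simp add: field_simps)
    also have "B - P * A = (1 + P) * D" by (simp add: A_def B_def D_def algebra_simps power2_eq_square)
    finally show ?thesis .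
  qed
  have a2: "\<alpha>2 = - ((1 + P) * E) / (P * A * C)"
  proof -
    have "\<alpha>2 = - (C + P * A) / (P * A * C)" using z unfolding \<alpha>2_def A_def[symmetric] C_def[symmetric] by (simp add: field_simps)
    also have "C + P * A = (1 + P) * E" by (simp add: A_def C_def E_def algebra_simps power2_eq_square)
    finally show ?thesis .
  qed
  have b: "\<beta>1 + \<beta>2 = 1 - P / C - P * u / B"
  proof -
    have "1 / (1 - u) - u / (1 - u) = 1" using z by (simp add: A_def diff_divide_distrib[symmetric])
    then show ?thesis unfolding \<beta>1_def \<beta>2_def B_def[symmetric] C_def[symmetric] by (simp add: algebra_simps)
  qed
  show "w * \<alpha>1 = - (1 + P) / (P * ((1 - P / u) * (1 - P ^ 2 * u)))"
    unfolding e B_def[symmetric] w a1 using z by (simp add: field_simps)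
  show "w * \<alpha>2 = (1 + P) / (P * ((1 - P ^ 2 / u) * (1 - P * u)))"
    unfolding e D_def[symmetric] w a2 using z by (simp add: field_simps)
  \<comment> \<open>The numerator of \<open>\<beta>1\<close> + \<open>\<beta>2\<close> over the
    common denominator B C.\<close>
  define N where "N = B * C - P * B - P * u * C"
  have "- (P ^ 2) * A * N = (1 + P) * (u * B * E - C * D) - (1 + P) ^ 2 * A * B * C"
    unfolding A_def B_def C_def D_def E_def N_def by algebra
  moreover have "P ^ 2 * (- A * u / (D * E)) * (N / (B * C)) = (- (P ^ 2) * A * N) * u / (B * C * D * E)"
    by (simp add: mult_ac)
  ultimately have "P ^ 2 * (- A * u / (D * E)) * ((B * C - P * B - P * u * C) / (B * C))
      = ((1 + P) * (u * B * E - C * D) - (1 + P) ^ 2 * A * B * C) * u / (B * C * D * E)"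
    unfolding N_def by metis
  moreover have "1 - P / C - P * u / B = (B * C - P * B - P * u * C) / (B * C)" using z by (simp add: field_simps)
  moreover have "((1 + P) * (u * B * E - C * D) - (1 + P) ^ 2 * A * B * C) * u / (B * C * D * E)
      = (1 + P) * (- 1 / (E / u * B) + u / (C / u * D)) + (1 + P) ^ 2 * (- A) / (E / u * D)"
    using z by (simp add: field_simps)
  ultimately show "P ^ 2 * w * (\<beta>1 + \<beta>2) = (1 + P) * (- 1 / ((1 - P / u) * (1 - P ^ 2 * u)) + u / ((1 - P ^ 2 / u) * (1 - P * u)))
      + (1 + P) ^ 2 * (1 - u) / ((1 - P / u) * (1 - P * u))"
    unfolding w b e B_def[symmetric] D_def[symmetric] by simp
qed

text \<open>With v = z^3 / u^2 everything is a series in z^3, hence 0 unless 3 divides k. The outer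
  poles contribute only for k + 6 <= 0 and the inner ones only for k + 3 >= 0; given k >= -6 and 3
  dividing k, this leaves the outer poles for k = -6 and the inner poles otherwise.\<close>

lemma inner_integral:
  fixes k :: int
  assumes k: "k \<ge> - 6"
  shows "(LINT z|circle_haar. z powi k * Wk P u (z ^ 3 / u ^ 2)) =
    (if 3 dvd k then (1 - u) / ((1 - P * u) * (1 - P / u)) * u powi (- 3) / (1 + P) ^ 2 *
      (if k = - 6 then \<beta>1 + \<beta>2 else \<alpha>1 * (P powi (k div 3 + 1) * u powi (2 * (k div 3) + 4)) + \<alpha>2 * (P powi (k div 3 + 1) * u powi (k div 3 + 3)))
     else 0)"
proof -
  note nz = kernel_nonzero
  \<comment> \<open>The factor u^(-3) comes from v^2 u = z^6 u^(-3).\<close>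
  define w where "w = (1 - u) / ((1 - P * u) * (1 - P / u)) * u powi (- 3) / (1 + P) ^ 2"
  have nB: "norm (P / u ^ 2) < 1" "norm (P / u) < 1" "norm (P * u ^ 2) < 1" "norm (P * u) < 1"
    using P u by (simp_all add: norm_mult norm_divide norm_power)
  let ?f = "\<lambda>z. w * (\<alpha>1 * u ^ 2 * (z powi (k + 3) / (1 - P * u ^ 2 * z powi (- 3))) + \<alpha>2 * u ^ 2 * (z powi (k + 3) / (1 - P * u * z powi (- 3)))
    + \<beta>1 * (z powi (k + 6) / (1 - P / u ^ 2 * z powi 3)) + \<beta>2 * (z powi (k + 6) / (1 - P / u * z powi 3)))"
  have "(LINT z|circle_haar. z powi k * Wk P u (z ^ 3 / u ^ 2)) = (LINT z|circle_haar. ?f z)"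
  proof (rule integral_cong_AE)
    show "AE z in circle_haar. z powi k * Wk P u (z ^ 3 / u ^ 2) = ?f z"
      using AE_circle
    proof eventually_elim
      case (elim z)
      define v where "v = z ^ 3 / u ^ 2"
      have z0: "z \<noteq> 0" using elim by auto
      have v: "norm v = 1" using elim u by (simp add: v_def norm_divide norm_power)
      have v0: "v \<noteq> 0" using v by auto
      have z3: "z powi 3 = v * u ^ 2" using nz by (simp add: v_def)
      have z3': "z powi (- 3) = 1 / (v * u ^ 2)" by (simp only: power_int_minus z3 divide_inverse mult_1_left)
      have zk: "z powi (k + 3) = z powi k * (v * u ^ 2)" "z powi (k + 6) = z powi k * (v * u ^ 2) ^ 2"
      proof -
        show "z powi (k + 3) = z powi k * (v * u ^ 2)" using z0 by (simp only: power_int_add z3 simp_thms)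
        have "z powi (k + 6) = z powi k * (z powi 3 * z powi 3)"
          using power_int_add[OF disjI1[OF z0], of k 6] power_int_add[OF disjI1[OF z0], of 3 3] by simp
        then show "z powi (k + 6) = z powi k * (v * u ^ 2) ^ 2" by (simp only: z3 power2_eq_square)
      qed
      have d: "1 - P * u ^ 2 * (1 / (v * u ^ 2)) = (v - P) / v" "1 - P * u * (1 / (v * u ^ 2)) = (u * v - P) / (u * v)"
        "P / u ^ 2 * (v * u ^ 2) = P * v" "P / u * (v * u ^ 2) = P * (u * v)"
        using v0 nz by (simp_all add: field_simps power2_eq_square)
      have "?f z = z powi k * ((1 - u) / ((1 - P * u) * (1 - P / u)) * (v ^ 2 * u / (1 + P) ^ 2 *
          (\<alpha>1 / (v - P) + \<alpha>2 * u / (u * v - P) + \<beta>1 / (1 - P * v) + \<beta>2 / (1 - P * (u * v)))))"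
      proof -
        have u3: "u powi (- 3) * u ^ 4 = u" using nz by (simp add: power_int_minus field_simps eval_nat_numeral)
        define y where "y = z powi k"
        define a b c e where "a = 1 / (v - P)" and "b = 1 / (u * v - P)" and "c = 1 / (1 - P * v)" and "e = 1 / (1 - P * (u * v))"
        have q: "y * (v * u ^ 2) / ((v - P) / v) = y * v ^ 2 * u ^ 2 * a"
          "y * (v * u ^ 2) / ((u * v - P) / (u * v)) = y * v ^ 2 * u ^ 3 * b"
          "y * (v * u ^ 2) ^ 2 / (1 - P * v) = y * v ^ 2 * u ^ 4 * c"
          "y * (v * u ^ 2) ^ 2 / (1 - P * (u * v)) = y * v ^ 2 * u ^ 4 * e"
          by (simp_all add: a_def b_def c_def e_def power_mult_distrib eval_nat_numeral)
        have "?f z = w * (\<alpha>1 * u ^ 2 * (y * v ^ 2 * u ^ 2 * a) + \<alpha>2 * u ^ 2 * (y * v ^ 2 * u ^ 3 * b)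
            + \<beta>1 * (y * v ^ 2 * u ^ 4 * c) + \<beta>2 * (y * v ^ 2 * u ^ 4 * e))"
          unfolding z3 z3' zk d y_def[symmetric] q ..
        also have "\<dots> = w * u ^ 4 * (y * v ^ 2 * (\<alpha>1 * a + \<alpha>2 * u * b + \<beta>1 * c + \<beta>2 * e))"
          by (simp add: distrib_left distrib_right eval_nat_numeral mult_ac)
        finally have "?f z = w * u ^ 4 * (z powi k * v ^ 2 * (\<alpha>1 / (v - P) + \<alpha>2 * u / (u * v - P) + \<beta>1 / (1 - P * v) + \<beta>2 / (1 - P * (u * v))))"
          by (simp add: a_def b_def c_def e_def y_def)
        also have "w * u ^ 4 = (1 - u) / ((1 - P * u) * (1 - P / u)) * (u powi (- 3) * u ^ 4) / (1 + P) ^ 2"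
          by (simp add: w_def)
        finally show ?thesis unfolding u3 by (simp add: mult_ac)
      qed
      also have "\<dots> = z powi k * Wk P u v"
        unfolding kernel_partial_fractions[OF v, symmetric] Wk_def by (simp add: mult_ac)
      finally show ?case by (simp add: v_def)
    qed
    show "(\<lambda>z. z powi k * Wk P u (z ^ 3 / u ^ 2)) \<in> borel_measurable circle_haar" unfolding Wk_def by measurable
  qed measurable
  also have "\<dots> = w * (\<alpha>1 * u ^ 2 * (LINT z|circle_haar. z powi (k + 3) / (1 - P * u ^ 2 * z powi (- 3)))
     + \<alpha>2 * u ^ 2 * (LINT z|circle_haar. z powi (k + 3) / (1 - P * u * z powi (- 3)))
     + \<beta>1 * (LINT z|circle_haar. z powi (k + 6) / (1 - P / u ^ 2 * z powi 3))
     + \<beta>2 * (LINT z|circle_haar. z powi (k + 6) / (1 - P / u * z powi 3)))"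
    unfolding integral_mult_right_zero[symmetric]
    by (simp only: Bochner_Integration.integral_add[symmetric] integrable_mult_right Bochner_Integration.integrable_add
        circle_integrable_geometric(1)[OF nB(1)] circle_integrable_geometric(1)[OF nB(2)]
        circle_integrable_geometric(1)[OF nB(3)] circle_integrable_geometric(1)[OF nB(4)] simp_thms)
      (simp only: integral_mult_right_zero)
  also have "\<dots> = w * (if 3 dvd k then (if k = - 6 then \<beta>1 + \<beta>2 else \<alpha>1 * (P powi (k div 3 + 1) * u powi (2 * (k div 3) + 4)) + \<alpha>2 * (P powi (k div 3 + 1) * u powi (k div 3 + 3))) else 0)"
  proof (cases "3 dvd k")
    case True
    then obtain j where j: "k = 3 * j" by blast
    have j2: "j \<ge> - 2" using k j by simp
    have pos: "(0::int) < 3" by simp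
    have 3: "3 * j + 3 = 3 * (j + 1)" "3 * j + 6 = 3 * (j + 2)" by simp_all
    have D: "(3 * j + 3) div 3 = j + 1" "- (3 * j + 6) div 3 = - (j + 2)" by simp_all
    show ?thesis
    proof (cases "j = - 2")
      case True
      have "(LINT z|circle_haar. z powi (3 * j + 3) / (1 - P * u ^ 2 * z powi (- 3))) = 0"
        "(LINT z|circle_haar. z powi (3 * j + 3) / (1 - P * u * z powi (- 3))) = 0"
        "(LINT z|circle_haar. z powi (3 * j + 6) / (1 - P / u ^ 2 * z powi 3)) = 1"
        "(LINT z|circle_haar. z powi (3 * j + 6) / (1 - P / u * z powi 3)) = 1"
        unfolding integral_geometric[OF nB(3) pos] integral_geometric[OF nB(4) pos]
          integral_geometric'[OF nB(1) pos] integral_geometric'[OF nB(2) pos]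
        using True by simp_all
      then show ?thesis unfolding j using True by simp
    next
      case False
      then have j1: "j + 1 \<ge> 0" "\<not> 3 * j + 6 \<le> 0" "0 \<le> 3 * j + 3" using j2 by auto
      have pw: "(P * u ^ 2) ^ nat (j + 1) * u ^ 2 = P powi (j + 1) * u powi (2 * j + 4)" "(P * u) ^ nat (j + 1) * u ^ 2 = P powi (j + 1) * u powi (j + 3)"
      proof -
        have "(P * u ^ 2) ^ nat (j + 1) = P powi (j + 1) * (u ^ 2) powi (j + 1)" "(P * u) ^ nat (j + 1) = P powi (j + 1) * u powi (j + 1)"
          using j1 by (simp_all add: power_int_def power_mult_distrib)
        moreover have "(u ^ 2) powi (j + 1) * u ^ 2 = u powi (2 * j + 4)" "u powi (j + 1) * u ^ 2 = u powi (j + 3)"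
        proof -
          have "(u ^ 2) powi (j + 1) = u powi (2 * (j + 1))" using power_int_mult[of u 2 "j + 1"] by simp
          moreover have "u powi (2 * (j + 1) + 2) = u powi (2 * (j + 1)) * u ^ 2" "u powi ((j + 1) + 2) = u powi (j + 1) * u ^ 2"
            using power_int_add[of u "2 * (j + 1)" 2] power_int_add[of u "j + 1" 2] nz by simp_all
          moreover have "2 * (j + 1) + 2 = 2 * j + 4" "(j + 1) + 2 = j + 3" by simp_all
          ultimately show "(u ^ 2) powi (j + 1) * u ^ 2 = u powi (2 * j + 4)" "u powi (j + 1) * u ^ 2 = u powi (j + 3)"
            by metis+
        qed
        ultimately show "(P * u ^ 2) ^ nat (j + 1) * u ^ 2 = P powi (j + 1) * u powi (2 * j + 4)" "(P * u) ^ nat (j + 1) * u ^ 2 = P powi (j + 1) * u powi (j + 3)"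
          by (simp_all only: mult.assoc)
      qed
      have "(LINT z|circle_haar. z powi (3 * j + 3) / (1 - P * u ^ 2 * z powi (- 3))) = (P * u ^ 2) ^ nat (j + 1)"
        "(LINT z|circle_haar. z powi (3 * j + 3) / (1 - P * u * z powi (- 3))) = (P * u) ^ nat (j + 1)"
        "(LINT z|circle_haar. z powi (3 * j + 6) / (1 - P / u ^ 2 * z powi 3)) = 0"
        "(LINT z|circle_haar. z powi (3 * j + 6) / (1 - P / u * z powi 3)) = 0"
        unfolding integral_geometric[OF nB(3) pos] integral_geometric[OF nB(4) pos]
          integral_geometric'[OF nB(1) pos] integral_geometric'[OF nB(2) pos]
        using j1 by (simp_all add: D)
      then show ?thesis using False pw by (simp add: j algebra_simps)
    qed
  next
    case False
    then have "\<not> 3 dvd k + 3" "\<not> 3 dvd k + 6" by presburger+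
    moreover have pos: "(0::int) < 3" by simp
    ultimately show ?thesis using False
      unfolding integral_geometric[OF nB(3) pos] integral_geometric[OF nB(4) pos]
          integral_geometric'[OF nB(1) pos] integral_geometric'[OF nB(2) pos] by simp
  qed
  finally show ?thesis by (simp add: w_def)
qed

end

section \<open>The double integral of a monomial against the kernel\<close>

definition poisson :: "complex \<Rightarrow> complex \<Rightarrow> int \<Rightarrow> complex \<Rightarrow> complex" where
  "poisson A B k z = z powi k / ((1 - A * z powi (- 1)) * (1 - B * z powi 1))"

lemma integrable_poisson:
  fixes A B :: complex
  assumes A: "norm A < 1" and B: "norm B < 1"
  shows "integrable circle_haar (poisson A B k)"
proof (rule circle_integrable[where B = "1 / ((1 - norm A) * (1 - norm B))"])
  fix z :: complex assume z: "norm z = 1"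
  have "(1 - norm A) * (1 - norm B) \<le> norm (1 - A * z powi (- 1)) * norm (1 - B * z powi 1)"
    using norm_one_minus_ge[of "A * z powi (- 1)"] norm_one_minus_ge[of "B * z powi 1"] A B z
    by (intro mult_mono) (auto simp: norm_mult norm_power_int norm_inverse)
  then show "norm (poisson A B k z) \<le> 1 / ((1 - norm A) * (1 - norm B))"
    unfolding poisson_def norm_divide norm_mult[of "1 - A * z powi (- 1)"] using A B z
    by (intro frac_le) (auto simp: norm_power_int)
qed (unfold poisson_def, measurable)

lemma integral_poisson1:
  "norm A < 1 \<Longrightarrow> norm B < 1 \<Longrightarrow> (LINT z|circle_haar. poisson A B k z) = Lc A B k"
  using integral_poisson[of A B 1 k] by (simp add: poisson_def)

text \<open>The indices are coordinates in the simple coroots: m omega_1 + n omega_2 equals i times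
  the first plus j times the second. The last term is the additional kernel that appears at j = -2,
  where the outer poles of \<open>inner_integral\<close> take over.\<close>

definition Jker :: "complex \<Rightarrow> int \<Rightarrow> int \<Rightarrow> complex" where
  "Jker P i j = P powi j / (1 + P) * (Lc (P ^ 2) P (i - j) - Lc P (P ^ 2) (i + 1))
    + (if j = - 2 then (Lc P P (i + 1) - Lc P P (i + 2)) / P ^ 2 else 0)"

text \<open>The substitution \<open>t\<^sub>2 = t\<^sub>1\<^sup>2 / u\<close> turns \<open>e\<^bsup>\<alpha>\<^sub>1\<^esup>\<close> into \<open>u\<close> and \<open>e\<^bsup>\<alpha>\<^sub>2\<^esup>\<close> into \<open>t\<^sub>1\<^sup>3 / u\<^sup>2\<close>,
  so all poles in \<open>t\<^sub>1\<^sup>3\<close> are simple.\<close>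

lemma integral_monW:
  assumes P: "norm P < 1" "P \<noteq> 0" and k: "m + 2 * n \<ge> - 6"
  shows "(LINT t|torus. monW P m n t) =
    (if 3 dvd m + 2 * n then Jker P (2 * ((m + 2 * n) div 3) - n) ((m + 2 * n) div 3) else 0)"
proof -
  define k where "k = m + 2 * n"
  define j where "j = k div 3"
  define i where "i = 2 * j - n"
  have P2: "norm (P ^ 2) < 1" using P by (simp add: norm_power power_less_one_iff)
  \<comment> \<open>The inner integral as a function of u, with \<open>residue_coefficients\<close>
    already rewritten in Poisson kernels.\<close>
  define G where "G u = (if 3 dvd k then P powi j / (1 + P) * (poisson (P ^ 2) P (i - j) u - poisson P (P ^ 2) (i + 1) u)
    + (if j = - 2 then (poisson P P (i + 1) u - poisson P P (i + 2) u) / P ^ 2 else 0) else 0)" for u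
  let ?F = "\<lambda>t. monW P m n (fst t, fst t ^ 2 / snd t)"
  have i1: "integrable torus ?F"
    by (rule torus_integrable[OF measurable_compose[OF measurable_torus_maps(2)[of 2] measurable_monW[of P m n]], of "8 / (1 - norm P) ^ 6"])
      (rule norm_monW_le[OF P(1)]; simp add: norm_divide norm_power)
  have "(LINT t|torus. monW P m n t) = (LINT t|torus. ?F t)"
    by (rule torus_reflect_snd[symmetric, OF measurable_monW norm_monW_le[OF P(1)]])
  also have "\<dots> = (LINT u|circle_haar. LINT z|circle_haar. monW P m n (z, z ^ 2 / u))"
    using torus_fubini(2)[OF i1] by simp
  also have "\<dots> = (LINT u|circle_haar. G u)"
  proof (rule integral_cong_AE)
    show "(\<lambda>u. LINT z|circle_haar. monW P m n (z, z ^ 2 / u)) \<in> borel_measurable circle_haar"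
      using HH.integrable_snd[of "\<lambda>x y. ?F (x, y)"] i1 by (intro borel_measurable_integrable) (simp add: split_def)
    show "G \<in> borel_measurable circle_haar"
      unfolding G_def[abs_def] poisson_def[abs_def] by measurable
    show "AE u in circle_haar. (LINT z|circle_haar. monW P m n (z, z ^ 2 / u)) = G u"
      using AE_circle AE_circle_neq[of 1]
    proof eventually_elim
      case (elim u)
      note u = elim and nz = kernel_nonzero[OF P elim]
      define w where "w = (1 - u) / ((1 - P * u) * (1 - P / u))"
      note rc = residue_coefficients[OF P elim, folded w_def]
      have "(LINT z|circle_haar. monW P m n (z, z ^ 2 / u)) = (LINT z|circle_haar. u powi (- n) * (z powi k * Wk P u (z ^ 3 / u ^ 2)))"
      proof (rule integral_cong_AE)
        show "AE z in circle_haar. monW P m n (z, z ^ 2 / u) = u powi (- n) * (z powi k * Wk P u (z ^ 3 / u ^ 2))"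
          using AE_circle
        proof eventually_elim
          case (elim z)
          then have z: "z \<noteq> 0" by auto
          have "z powi m * (z ^ 2 / u) powi n = u powi (- n) * z powi k"
            using z power_int_mult[of z 2 n] power_int_add[of z m "2 * n"]
            by (simp add: k_def power_int_mult_distrib power_int_inverse power_int_minus divide_inverse mult_ac)
          moreover have "z ^ 2 / (z ^ 2 / u) = u" "(z ^ 2 / u) ^ 2 / z = z ^ 3 / u ^ 2"
            using z nz by (simp_all add: eval_nat_numeral)
          ultimately show ?case by (simp add: monW_def)
        qed
        show "(\<lambda>z. monW P m n (z, z ^ 2 / u)) \<in> borel_measurable circle_haar"
          unfolding monW_def Wk_def by measurable
        show "(\<lambda>z. u powi (- n) * (z powi k * Wk P u (z ^ 3 / u ^ 2))) \<in> borel_measurable circle_haar"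
          unfolding Wk_def by measurable
      qed
      also have "\<dots> = u powi (- n) * (LINT z|circle_haar. z powi k * Wk P u (z ^ 3 / u ^ 2))" by simp
      also have "\<dots> = G u"
      proof (cases "3 dvd k")
        case False
        then show ?thesis using inner_integral[OF P u, of k] assms(3) by (simp add: G_def k_def)
      next
        case True
        then have kj: "k = 3 * j" by (simp add: j_def)
        have k6: "k = - 6 \<longleftrightarrow> j = - 2" using kj by auto
        have up: "1 - P * u powi (- 1) = 1 - P / u" "1 - P ^ 2 * u powi (- 1) = 1 - P ^ 2 / u"
          by (simp_all add: power_int_minus divide_inverse)
        define a b c where "a = 1 / ((1 - P / u) * (1 - P ^ 2 * u))" and "b = 1 / ((1 - P ^ 2 / u) * (1 - P * u))"
          and "c = 1 / ((1 - P / u) * (1 - P * u))"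
        have K: "poisson (P ^ 2) P l u = u powi l * b" "poisson P (P ^ 2) l u = u powi l * a" "poisson P P l u = u powi l * c" for l
          unfolding poisson_def up by (simp_all add: a_def b_def c_def)
        have rc': "w * \<alpha>1 P u = - (1 + P) / P * a" "w * \<alpha>2 P u = (1 + P) / P * b"
          "P ^ 2 * w * (\<beta>1 P u + \<beta>2 P u) = (1 + P) * (u * b - a) + (1 + P) ^ 2 * (1 - u) * c"
          using rc by (simp_all add: a_def b_def c_def mult_ac)
        note inn = inner_integral[OF P u, of k, folded w_def]
        show ?thesis
        proof (cases "j = - 2")
          case j2: True
          have e: "u powi (- n) * u powi (- 3) = u powi (i + 1)" "u powi (i + 2) = u powi (i + 1) * u"
            using nz power_int_add[of u "- n" "- 3"] power_int_add[of u "i + 1" 1] j2 by (simp_all add: i_def add.commute)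
          have h: "w * (\<beta>1 P u + \<beta>2 P u) = ((1 + P) * (u * b - a) + (1 + P) ^ 2 * (1 - u) * c) / P ^ 2"
            using rc'(3) P by (simp add: field_simps)
          have "u powi (- n) * (w * u powi (- 3) / (1 + P) ^ 2 * (\<beta>1 P u + \<beta>2 P u))
              = (u powi (- n) * u powi (- 3)) * (w * (\<beta>1 P u + \<beta>2 P u)) / (1 + P) ^ 2"
            by (simp add: mult_ac)
          also have "\<dots> = u powi (i + 1) * (((1 + P) * (u * b - a) + (1 + P) ^ 2 * (1 - u) * c) / P ^ 2) / (1 + P) ^ 2"
            unfolding e(1) h ..
          also have "\<dots> = u powi (i + 1) * (((u * b - a) / (1 + P) + (1 - u) * c) / P ^ 2)"
          proof -
            have sxy: "(s * x + s ^ 2 * y) / s ^ 2 = x / s + y" if "s \<noteq> 0" for s x y :: complex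
              using that by (simp add: field_simps power2_eq_square)
            have "((1 + P) * (u * b - a) + (1 + P) ^ 2 * (1 - u) * c) / (1 + P) ^ 2 = (u * b - a) / (1 + P) + (1 - u) * c"
              using sxy[of "1 + P" "u * b - a" "(1 - u) * c"] nz by (simp only: mult.assoc simp_thms)
            from this[symmetric] show ?thesis by (simp only: times_divide_eq_right divide_divide_eq_left mult_ac)
          qed
          also have "\<dots> = P powi (- 2) / (1 + P) * (u powi (i + 1) * u * b - u powi (i + 1) * a) + (u powi (i + 1) * c - u powi (i + 1) * u * c) / P ^ 2"
            by (simp add: power_int_minus divide_inverse algebra_simps)
          also have "\<dots> = G u"
            using True j2 by (simp add: G_def K e(2))
          finally show ?thesis using inn True assms(3) k6 j2 by (simp add: k_def)
        next
          case j2: False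
          have kd: "k div 3 = j" by (simp add: j_def)
          have e: "u powi (- n) * u powi (- 3) * u powi (2 * j + 4) = u powi (i + 1)" "u powi (- n) * u powi (- 3) * u powi (j + 3) = u powi (i - j)"
            "P powi (j + 1) = P powi j * P"
            using nz P power_int_add[of u "- n" "- 3"] power_int_add[of u "- n - 3" "2 * j + 4"] power_int_add[of u "- n - 3" "j + 3"] power_int_add[of P j 1]
            by (simp_all add: i_def algebra_simps)
          have "u powi (- n) * (w * u powi (- 3) / (1 + P) ^ 2 *
              (\<alpha>1 P u * (P powi (j + 1) * u powi (2 * j + 4)) + \<alpha>2 P u * (P powi (j + 1) * u powi (j + 3))))
            = P powi (j + 1) / (1 + P) ^ 2 * ((w * \<alpha>1 P u) * (u powi (- n) * u powi (- 3) * u powi (2 * j + 4))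
              + (w * \<alpha>2 P u) * (u powi (- n) * u powi (- 3) * u powi (j + 3)))"
            by (simp add: distrib_left mult_ac)
          also have "\<dots> = P powi j * P / (1 + P) ^ 2 * ((1 + P) / P * (b * u powi (i - j) - a * u powi (i + 1)))"
          proof -
            have g: "(- s / P * a) * x + (s / P * b) * y = s / P * (b * y - a * x)" for s x y
              by (simp add: right_diff_distrib mult_ac)
            show ?thesis unfolding e rc' g ..
          qed
          also have "\<dots> = P powi j / (1 + P) * (b * u powi (i - j) - a * u powi (i + 1))"
            using nz P by (simp add: power2_eq_square)
          also have "\<dots> = G u" using True j2 by (simp add: G_def K mult.commute)
          finally show ?thesis using inn True assms(3) k6 j2 by (simp add: k_def[symmetric] kd)
        qed
      qed
      finally show ?case .
    qed
  qed
  also have "\<dots> = (if 3 dvd k then Jker P i j else 0)"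
    unfolding G_def Jker_def using P P2
    by (simp add: integrable_poisson integral_poisson1)
  finally show ?thesis by (simp add: k_def i_def j_def)
qed

section \<open>Comparison of the three moments\<close>

definition pnum :: "complex \<Rightarrow> complex \<Rightarrow> int \<Rightarrow> complex" where
  "pnum A B k = (if k \<ge> 0 then A ^ nat k else B ^ nat (- k))"

lemma Lc_pnum: "Lc A B k = pnum A B k / (1 - A * B)"
  by (simp add: Lc_def pnum_def)

text \<open>Here r stands for q^(-1/2). The character chi_s^1 enters through kernels in s^3, hence
  the restriction to multiples of 3.\<close>

definition K3 :: "complex \<Rightarrow> int \<Rightarrow> complex" where
  "K3 r l = (if 3 dvd l then Lc (r ^ 3) (r ^ 3) (l div 3) else 0)"

definition I2sum :: "complex \<Rightarrow> int \<Rightarrow> int \<Rightarrow> complex" where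
  "I2sum r m n = (if 3 dvd m + 2 * n then Jker (r ^ 2) (2 * ((m + 2 * n) div 3) - n) ((m + 2 * n) div 3) else 0)"

text \<open>One term for each of the three weights of the representation with character chi_s^1;
  they are obtained in \<open>S1_orbit\<close>.\<close>

definition I1sum :: "complex \<Rightarrow> int \<Rightarrow> int \<Rightarrow> complex" where
  "I1sum r m n = r ^ 2 / (1 - r ^ 2) * (r powi (m - 1) * K3 r (m + 2 * n + 3) - r powi (m + n) * K3 r (m - n)
    + r powi (n - 1) * K3 r (- 2 * m - n - 3))"

text \<open>The three one-dimensional characters together: summing over the cube roots of unity
  gives 3 or 0, and the denominator is the Weyl denominator, which has the same value at all three
  points.\<close>

definition I0sum :: "complex \<Rightarrow> int \<Rightarrow> int \<Rightarrow> complex" where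
  "I0sum r m n = (if 3 dvd m - n then 3 * (r ^ 2) powi (m + n) else 0) / ((1 - 1 / r ^ 2) ^ 2 * (1 - 1 / r ^ 4))"

lemma powi_sq: "(r ^ 2) powi k = r powi (2 * k)" for r :: complex
  using power_int_mult[of r 2 k] by simp

lemma powi_pow: "0 \<le> k \<Longrightarrow> (r ^ a) ^ nat k = r powi (int a * k)" for r :: complex
  using power_int_mult[of r "int a" k] by (simp add: power_int_def)

text \<open>The residues collected by moving the contour of the double integral cancel against the two
  lower-dimensional terms of the Plancherel formula.\<close>

lemma plancherel_moment:
  fixes r :: complex
  assumes r: "norm r < 1" "r \<noteq> 0" and mn: "m + 2 * n \<ge> - 6" "2 * m + n \<ge> - 6"
  shows "r ^ 6 * I2sum r m n + r ^ 4 * (1 - r ^ 2) / (1 + r ^ 2) * I1sum r m n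
    + (1 - r ^ 2) ^ 3 / (3 * (1 - r ^ 6)) * I0sum r m n = (if m = - 2 \<and> n = - 2 then - 1 else 0)"
proof (cases "3 dvd m + 2 * n")
  case False
  then have "\<not> 3 dvd m + 2 * n + 3" "\<not> 3 dvd m - n" "\<not> 3 dvd - 2 * m - n - 3" "\<not> (m = - 2 \<and> n = - 2)"
    by presburger+
  with False show ?thesis by (simp add: I2sum_def I1sum_def I0sum_def K3_def)
next
  case True
  define j where "j = (m + 2 * n) div 3"
  define i where "i = 2 * j - n"
  have j3: "m + 2 * n = 3 * j" using True by (simp add: j_def)
  have m: "m = 2 * i - j" and n: "n = 2 * j - i" using j3 by (simp_all add: i_def)
  have ij: "i \<ge> - 2" "j \<ge> - 2" using mn by (simp_all add: m n)
  define p where "p = r ^ 2"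
  define s d c where "s = 1 + p" and "d = 1 - p" and "c = 1 - p ^ 3"
  have np: "norm p < 1" "norm (p ^ 3) < 1" using r by (simp_all add: p_def norm_power power_less_one_iff)
  have nz: "p \<noteq> 0" "s \<noteq> 0" "d \<noteq> 0" "c \<noteq> 0"
  proof -
    show "p \<noteq> 0" using r by (simp add: p_def)
    show "s \<noteq> 0" using one_minus_nonzero[of "- p"] np by (simp add: s_def)
    show "d \<noteq> 0" "c \<noteq> 0" using one_minus_nonzero np by (simp_all add: d_def c_def)
  qed
  have rp: "r ^ 6 = p ^ 3" "r ^ 4 = p ^ 2" "1 - r ^ 3 * r ^ 3 = c" "1 - p * p ^ 2 = c" "1 - p ^ 2 * p = c" "1 - p * p = d * s"
    by (simp_all add: p_def c_def d_def s_def eval_nat_numeral algebra_simps)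
  let ?a = "p powi j * pnum (p ^ 2) p (i - j)" and ?b = "p powi j * pnum p (p ^ 2) (i + 1)"
  let ?t = "r powi (m - 1) * pnum (r ^ 3) (r ^ 3) (j + 1)"
  have padd: "r powi a * r powi b = r powi (a + b)" for a b using r by (simp add: power_int_add)
  \<comment> \<open>\<open>A\<close> and \<open>B\<close> identify two of the three terms of the
    one-dimensional moment with the two main terms of the double integral; they enter the total with
    opposite signs and cancel.\<close>
  have A: "r powi (m + n) * pnum (r ^ 3) (r ^ 3) (i - j) = ?a"
  proof (cases "i \<ge> j")
    case True
    have "p powi j * (p ^ 2) ^ nat (i - j) = r powi (2 * j + 4 * (i - j))"
      using True r powi_pow[of "i - j" r 4] by (simp add: p_def powi_sq power_mult[symmetric] padd)
    moreover have "r powi (m + n) * (r ^ 3) ^ nat (i - j) = r powi (m + n + 3 * (i - j))"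
      using True r powi_pow[of "i - j" r 3] by (simp add: padd)
    ultimately show ?thesis using True by (simp add: pnum_def m n algebra_simps)
  next
    case False
    have "p powi j * p ^ nat (j - i) = r powi (2 * j + 2 * (j - i))"
      using False r powi_pow[of "j - i" r 2] by (simp add: p_def powi_sq padd)
    moreover have "r powi (m + n) * (r ^ 3) ^ nat (j - i) = r powi (m + n + 3 * (j - i))"
      using False r powi_pow[of "j - i" r 3] by (simp add: padd)
    ultimately show ?thesis using False by (simp add: pnum_def m n algebra_simps)
  qed
  have B: "r powi (n - 1) * pnum (r ^ 3) (r ^ 3) (- (i + 1)) = ?b"
  proof (cases "i = - 2")
    case True
    have "r powi (n - 1) * r ^ 3 = r powi (2 * j + 4)" "p powi j * p ^ 2 = r powi (2 * j + 4)"
      using r True power_int_add[of r "n - 1" 3] power_int_add[of r "2 * j" 4]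
      by (simp_all add: n p_def powi_sq power_mult[symmetric] algebra_simps)
    then show ?thesis using True by (simp add: pnum_def)
  next
    case False
    then have i: "i + 1 \<ge> 0" using ij by simp
    have "p powi j * p ^ nat (i + 1) = r powi (2 * j + 2 * (i + 1))"
      using i r powi_pow[of "i + 1" r 2] by (simp add: p_def powi_sq padd)
    moreover have "r powi (n - 1) * (r ^ 3) ^ nat (i + 1) = r powi (n - 1 + 3 * (i + 1))"
      using i r powi_pow[of "i + 1" r 3] by (simp add: padd)
    moreover have "i = - 1 \<or> \<not> - (i + 1) \<ge> 0" using i by auto
    ultimately show ?thesis using i by (auto simp: pnum_def n algebra_simps)
  qed
  have d3: "(m + 2 * n + 3) div 3 = j + 1" "3 dvd m + 2 * n + 3" "(m - n) div 3 = i - j" "3 dvd m - n"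
    "(- 2 * m - n - 3) div 3 = - (i + 1)" "3 dvd - 2 * m - n - 3"
  proof -
    have "m + 2 * n + 3 = 3 * (j + 1)" "m - n = 3 * (i - j)" "- 2 * m - n - 3 = 3 * (- (i + 1))"
      by (simp_all add: m n)
    then show "(m + 2 * n + 3) div 3 = j + 1" "3 dvd m + 2 * n + 3" "(m - n) div 3 = i - j" "3 dvd m - n"
    "(- 2 * m - n - 3) div 3 = - (i + 1)" "3 dvd - 2 * m - n - 3"
      by (metis nonzero_mult_div_cancel_left zero_neq_numeral dvd_triv_left)+
  qed
  have I1: "I1sum r m n = p / d * ((?t - ?a + ?b) / c)"
  proof -
    have "r powi (m - 1) * K3 r (m + 2 * n + 3) = ?t / c" "r powi (m + n) * K3 r (m - n) = ?a / c"
      "r powi (n - 1) * K3 r (- 2 * m - n - 3) = ?b / c"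
      unfolding K3_def if_P[OF d3(2)] if_P[OF d3(4)] if_P[OF d3(6)] d3(1,3,5) Lc_pnum rp(3) times_divide_eq_right A B by (rule refl)+
    then show ?thesis unfolding I1sum_def p_def[symmetric] d_def[symmetric]
      by (simp only: diff_divide_distrib add_divide_distrib)
  qed
  define X where "X = (if j = - 2 then (pnum p p (i + 1) - pnum p p (i + 2)) / (d * s) / p ^ 2 else 0)"
  have I2: "I2sum r m n = (?a - ?b) / (s * c) + X"
    unfolding I2sum_def if_P[OF True] j_def[symmetric] i_def[symmetric] Jker_def p_def[symmetric] Lc_pnum rp(4-6) s_def[symmetric] X_def
    by (simp add: diff_divide_distrib right_diff_distrib mult.commute)
  have "1 - 1 / r ^ 2 = - d / p" "1 - 1 / r ^ 4 = - (d * s) / p ^ 2"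
    using nz unfolding rp(2) p_def[symmetric] by (simp_all add: d_def s_def field_simps power2_eq_square)
  then have I0: "I0sum r m n = 3 * p powi (i + j) / ((- d / p) ^ 2 * (- (d * s) / p ^ 2))"
    unfolding I0sum_def if_P[OF d3(4)] p_def[symmetric] by (simp add: m n add.commute)
  have t0: "(1 - r ^ 2) ^ 3 / (3 * (1 - r ^ 6)) * I0sum r m n = - (p ^ 3 / (s * c)) * (p * p powi (i + j))"
    unfolding I0 rp(1) p_def[symmetric] d_def[symmetric] c_def[symmetric] using nz by (simp add: field_simps eval_nat_numeral)
  have t1: "r ^ 4 * (1 - r ^ 2) / (1 + r ^ 2) * I1sum r m n = p ^ 3 / (s * c) * (?t - ?a + ?b)"
    unfolding I1 rp(2) p_def[symmetric] d_def[symmetric] s_def[symmetric]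
    using nz by (simp add: eval_nat_numeral)
  have t2: "r ^ 6 * I2sum r m n = p ^ 3 / (s * c) * (?a - ?b) + p ^ 3 * X"
    unfolding I2 rp(1) by (simp add: distrib_left)
  have "r ^ 6 * I2sum r m n + r ^ 4 * (1 - r ^ 2) / (1 + r ^ 2) * I1sum r m n
    + (1 - r ^ 2) ^ 3 / (3 * (1 - r ^ 6)) * I0sum r m n = p ^ 3 / (s * c) * (?t - p * p powi (i + j)) + p ^ 3 * X"
    unfolding t0 t1 t2 by (simp add: algebra_simps)
  \<comment> \<open>The remaining term \<open>?t\<close> of the one-dimensional moment is cancelled
    by the zero-dimensional one as long as j + 1 >= 0.\<close>
  also have "\<dots> = (if m = - 2 \<and> n = - 2 then - 1 else 0)"
  proof (cases "j = - 2")
    case False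
    then have j1: "j + 1 \<ge> 0" using ij by simp
    have "?t = r powi (m - 1 + 3 * (j + 1))"
      using j1 r powi_pow[of "j + 1" r 3] by (simp add: pnum_def padd)
    also have "\<dots> = p * p powi (i + j)"
      using r power_int_add[of r 2 "2 * (i + j)"] by (simp add: p_def powi_sq m algebra_simps)
    finally have "?t = p * p powi (i + j)" .
    moreover have "\<not> (m = - 2 \<and> n = - 2)" using False m n by presburger
    ultimately show ?thesis using False by (simp add: X_def)
  next
    \<comment> \<open>At j = -2 this cancellation leaves the remainder -p^(i+2) / s. The extra term
      \<open>X\<close> of the double integral compensates it, except at i = -2, where the two add up
      to -1.\<close>
    case j: True
    have "?t = r powi (m - 1) * r ^ 3" using j by (simp add: pnum_def)
    also have "\<dots> = p powi (i + 2)"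
      using r power_int_add[of r "m - 1" 3] by (simp add: p_def powi_sq m j algebra_simps)
    also have "\<dots> = p ^ 3 * p powi (i - 1)" using nz power_int_add[of p 3 "i - 1"] by (simp add: add.commute)
    finally have t: "?t = p ^ 3 * p powi (i - 1)" .
    have "p * p powi (i + j) = p powi (i - 1)" using nz power_int_add[of p 1 "i + j"] j by simp
    then have "?t - p * p powi (i + j) = - (c * p powi (i - 1))" unfolding t by (simp add: c_def algebra_simps)
    then have 1: "p ^ 3 / (s * c) * (?t - p * p powi (i + j)) = - (p powi (i + 2)) / s"
      using nz power_int_add[of p 3 "i - 1"] by (simp add: mult.commute add.commute)
    show ?thesis
    proof (cases "i = - 2")
      case i: True
      have "p ^ 3 * X = - p / s"
      proof -
        have "pnum p p (i + 1) - pnum p p (i + 2) = - d" by (simp add: i pnum_def d_def)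
        then show ?thesis using nz j by (simp add: X_def eval_nat_numeral)
      qed
      then have "p ^ 3 / (s * c) * (?t - p * p powi (i + j)) + p ^ 3 * X = - (p powi (i + 2)) / s + - p / s"
        by (simp only: 1)
      also have "\<dots> = - ((1 + p) / s)" using i by (simp add: add_divide_distrib)
      also have "\<dots> = - 1" using nz by (simp add: s_def[symmetric])
      finally show ?thesis using i j by (simp add: m n)
    next
      case i: False
      then have i1: "i + 1 \<ge> 0" using ij by simp
      have "pnum p p (i + 1) - pnum p p (i + 2) = d * p powi (i + 1)"
      proof -
        have "nat (i + 2) = Suc (nat (i + 1))" using i1 by simp
        then show ?thesis using i1 by (simp add: pnum_def d_def power_int_def algebra_simps)
      qed
      moreover have "p powi (i + 2) = p * p powi (i + 1)" using nz power_int_add[of p 1 "i + 1"] by (simp add: add.commute)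
      ultimately have "p ^ 3 * X = p powi (i + 2) / s" using nz j by (simp add: X_def eval_nat_numeral)
      then show ?thesis unfolding 1 using i j by (simp add: m n)
    qed
  qed
  finally show ?thesis .
qed

declare o_apply [simp del] id_apply [simp del]

section \<open>The Bernstein presentation and the Bernstein basis\<close>

locale hecke_A2 = affine_hecke_A2 scale q T
  for scale :: "complex \<Rightarrow> 'h::ring_1 \<Rightarrow> 'h" and q :: real and T :: "(plane \<Rightarrow> plane) \<Rightarrow> 'h" +
  assumes q_gt1: "q > 1"
begin

definition Q :: complex where "Q = of_real (q powr (1/2) - q powr (-1/2))"

abbreviation T1 :: 'h where "T1 \<equiv> T s1"
abbreviation T2 :: 'h where "T2 \<equiv> T s2"
text \<open>By the quadratic relation \<open>U1\<close> and \<open>U2\<close> are the inverses of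
  \<open>T1\<close> and \<open>T2\<close>.\<close>

abbreviation U1 :: 'h where "U1 \<equiv> T1 - scale Q 1"
abbreviation U2 :: 'h where "U2 \<equiv> T2 - scale Q 1"

lemmas scale_mult = scale_mult_left scale_mult_right

text \<open>\<open>T id\<close> is a left unit on the basis by additivity of lengths, and 1 lies in
  the span of the basis.\<close>

lemma T_id: "T id = 1"
proof -
  have "len id = 0"
    using len_WP[OF simple_WP(1)] by simp
  then have l: "T id * T w = T w" if "w \<in> WP" for w
    using T_mult[OF simple_WP(1) that] by simp
  have "1 \<in> span (T ` WP)" using T_span by simp
  then have "T id * 1 = 1"
    by (rule span_induct) (auto simp: subspace_def l scale_mult distrib_left)
  then show ?thesis by simp
qed

lemma T1_T1: "T1 * T1 = 1 + scale Q T1" and T2_T2: "T2 * T2 = 1 + scale Q T2"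
  by (simp_all add: T_quadratic Q_def)

lemma T1_U1: "T1 * U1 = 1" "U1 * T1 = 1" and T2_U2: "T2 * U2 = 1" "U2 * T2 = 1"
  by (simp_all add: algebra_simps T1_T1 T2_T2 scale_mult)

text \<open>The sign condition says that the alcove of \<open>w\<close> lies on the same side of the
  wall of the reflection as the fundamental alcove, so left multiplication adds one to the
  length.\<close>

lemma T1_mult_T: "w \<in> WP \<Longrightarrow> n1 w \<ge> 0 \<Longrightarrow> T1 * T w = T (s1 \<circ> w)"
  and T2_mult_T: "w \<in> WP \<Longrightarrow> n2 w \<ge> 0 \<Longrightarrow> T2 * T w = T (s2 \<circ> w)"
  and T0_mult_T: "w \<in> WP \<Longrightarrow> n3 w \<le> 0 \<Longrightarrow> T s0 * T w = T (s0 \<circ> w)"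
proof -
  have l: "len s1 = 1" "len s2 = 1" "len s0 = 1"
    using n_simple_comp[OF simple_WP(1)] simple_WP by (simp_all add: len_WP)
  show "T1 * T w = T (s1 \<circ> w)" if "w \<in> WP" "n1 w \<ge> 0"
    by (rule T_mult) (use that simple_WP in \<open>simp_all add: len_WP WP_comp n_simple_comp l[unfolded len_WP[OF simple_WP(2)]]\<close>)
  show "T2 * T w = T (s2 \<circ> w)" if "w \<in> WP" "n2 w \<ge> 0"
    by (rule T_mult) (use that simple_WP in \<open>simp_all add: len_WP WP_comp n_simple_comp l[unfolded len_WP[OF simple_WP(3)]]\<close>)
  show "T s0 * T w = T (s0 \<circ> w)" if "w \<in> WP" "n3 w \<le> 0"
    by (rule T_mult) (use that simple_WP in \<open>simp_all add: len_WP WP_comp n_simple_comp l[unfolded len_WP[OF simple_WP(4)]]\<close>)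
qed

text \<open>The basis of the finite Hecke algebra; \<open>wb k\<close> is \<open>T (w_elt k)\<close>.\<close>

definition wb :: "nat \<Rightarrow> 'h" where
  "wb k = [1, T1, T2, T2 * T1, T1 * T2, T1 * (T2 * T1)] ! k"

lemma wb_simps [simp]:
  "wb 0 = 1" "wb (Suc 0) = T1" "wb 1 = T1" "wb 2 = T2" "wb 3 = T2 * T1" "wb 4 = T1 * T2" "wb 5 = T1 * (T2 * T1)"
  by (simp_all add: wb_def)

text \<open>A dominant translation has nonnegative strips, and building up an element of W_0 in
  front of it letter by letter increases the length at every step.\<close>

lemma wb_mult_transl:
  assumes "k < 6" "0 \<le> m" "0 \<le> n"
  shows "wb k * T (transl (lat m n)) = T (w_elt k \<circ> transl (lat m n))"
proof -
  let ?t = "transl (lat m n)"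
  note W = transl_WP[of m n] simple_WP
  have 1: "T1 * T ?t = T (s1 \<circ> ?t)" "T2 * T ?t = T (s2 \<circ> ?t)"
    using assms by (simp_all add: T1_mult_T T2_mult_T W n_transl)
  have 2: "T2 * T (s1 \<circ> ?t) = T (s2 \<circ> (s1 \<circ> ?t))" "T1 * T (s2 \<circ> ?t) = T (s1 \<circ> (s2 \<circ> ?t))"
    using assms by (simp_all add: T1_mult_T T2_mult_T W n_transl WP_comp n_simple_comp)
  have 3: "T1 * T (s2 \<circ> (s1 \<circ> ?t)) = T (s1 \<circ> (s2 \<circ> (s1 \<circ> ?t)))"
    using assms by (simp add: T1_mult_T W n_transl WP_comp n_simple_comp)
  show ?thesis
    using assms(1) unfolding less6_cases
    by (elim disjE; simp add: 1 2 3 mult.assoc comp_assoc)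
qed

lemma wb_eq: "k < 6 \<Longrightarrow> wb k = T (w_elt k)"
  using wb_mult_transl[of k 0 0] by (simp add: T_id)

lemma braid: "T1 * (T2 * T1) = T2 * (T1 * T2)"
proof -
  have "T2 * (T1 * T2) = T (s2 \<circ> (s1 \<circ> s2))"
    using n_simple_comp[OF simple_WP(1)] simple_WP
    by (simp add: T1_mult_T T2_mult_T WP_comp n_simple_comp)
  also have "s2 \<circ> (s1 \<circ> s2) = s1 \<circ> (s2 \<circ> s1)"
    by (simp add: fun_eq_iff o_apply weyl_apply)
  finally show ?thesis using wb_eq[of 5] by simp
qed

lemma T_mult_om: "w \<in> WP \<Longrightarrow> T w * T om = T (w \<circ> om)" "w \<in> WP \<Longrightarrow> T w * T om' = T (w \<circ> om')"
  and om_T_mult: "w \<in> WP \<Longrightarrow> T om * T w = T (om \<circ> w)" "w \<in> WP \<Longrightarrow> T om' * T w = T (om' \<circ> w)"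
proof -
  have "len om = 0" "len om' = 0"
    using n_comp_om[of id] om_WP by (simp_all add: len_WP)
  then show "w \<in> WP \<Longrightarrow> T w * T om = T (w \<circ> om)" "w \<in> WP \<Longrightarrow> T w * T om' = T (w \<circ> om')"
    "w \<in> WP \<Longrightarrow> T om * T w = T (om \<circ> w)" "w \<in> WP \<Longrightarrow> T om' * T w = T (om' \<circ> w)"
    using om_WP by (auto intro!: T_mult simp: len_WP WP_comp n_comp_om n_om_comp)
qed

lemma T_om_inverse: "T om * T om' = 1" "T om' * T om = 1"
proof -
  have "om \<circ> om' = id" "om' \<circ> om = id" by (simp_all add: fun_eq_iff o_apply id_apply om_apply)
  then show "T om * T om' = 1" "T om' * T om = 1"
    using T_mult_om om_WP by (simp_all add: T_id)
qed

lemma T_s0: "T s0 = T om * T2 * T om'"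
proof -
  have "T om * T2 * T om' = T (om \<circ> s2 \<circ> om')"
    using simple_WP om_WP by (simp add: om_T_mult T_mult_om WP_comp)
  also have "om \<circ> s2 \<circ> om' = s0" by (simp add: fun_eq_iff o_apply weyl_apply om_apply)
  finally show ?thesis ..
qed

abbreviation X1 :: 'h where "X1 \<equiv> T (transl (lat 1 0))"
abbreviation X2 :: 'h where "X2 \<equiv> T (transl (lat 0 1))"

lemma w_elt_WP: "k < 6 \<Longrightarrow> w_elt k \<in> WP"
  by (rule W0_WP) (simp add: W0_eq)

text \<open>The reduced expressions of the two fundamental translations. All commutation rules
  between the T_i and the x_j are derived from them.\<close>

lemma transl_om: "X1 = T om * (T2 * T1)" "X2 = T om' * (T1 * T2)"
proof -
  have "om \<circ> w_elt 3 = transl (lat 1 0)" "om' \<circ> w_elt 4 = transl (lat 0 1)"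
    by (simp_all add: fun_eq_iff o_apply weyl_apply om_apply)
  then show "X1 = T om * (T2 * T1)" "X2 = T om' * (T1 * T2)"
    using om_T_mult[OF w_elt_WP] wb_eq[of 3] wb_eq[of 4] by (metis wb_simps(5) less6_cases, metis wb_simps(6) less6_cases)
qed

lemma transl_mult:
  assumes "0 \<le> m" "0 \<le> n" "0 \<le> m'" "0 \<le> n'"
  shows "T (transl (lat m n)) * T (transl (lat m' n')) = T (transl (lat (m + m') (n + n')))"
proof -
  have c: "transl (lat m n) \<circ> transl (lat m' n') = transl (lat (m + m') (n + n'))"
    by (simp add: fun_eq_iff o_apply transl_apply)
  show ?thesis
    using T_mult[OF transl_WP transl_WP, of m n m' n'] assms unfolding c
    by (simp add: len_WP[OF transl_WP] n_transl del: of_int_add)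
qed

lemma X1_X2: "X1 * X2 = X2 * X1"
  using transl_mult[of 1 0 0 1] transl_mult[of 0 1 1 0] by simp

lemma T1_X2: "T1 * X2 = X2 * T1"
proof -
  have "X2 * T1 = T om' * T (w_elt 5)"
    using wb_eq[of 5] unfolding transl_om by (simp add: mult.assoc)
  also have "\<dots> = T (om' \<circ> w_elt 5)" by (simp add: om_T_mult w_elt_WP del: w_elt_numeral)
  also have "om' \<circ> w_elt 5 = w_elt 1 \<circ> transl (lat 0 1)"
    by (simp add: fun_eq_iff o_apply weyl_apply om_apply)
  finally show ?thesis using wb_mult_transl[of 1 0 1] by simp
qed

lemma T2_X1: "T2 * X1 = X1 * T2"
proof -
  have "X1 * T2 = T om * T (w_elt 5)"
    using wb_eq[of 5] unfolding transl_om by (simp add: mult.assoc braid)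
  also have "\<dots> = T (om \<circ> w_elt 5)" by (simp add: om_T_mult w_elt_WP del: w_elt_numeral)
  also have "om \<circ> w_elt 5 = w_elt 2 \<circ> transl (lat 1 0)"
    by (simp add: fun_eq_iff o_apply weyl_apply om_apply)
  finally show ?thesis using wb_mult_transl[of 2 1 0] by simp
qed

text \<open>Cancelling the last letter of t_(omega_1) = \<open>om\<close> s_2 s_1 turns x_1 T_1^(-1)
  into T_\<open>om\<close> T_2, and \<open>om\<close> s_2 t_(omega_1) = s_1 t_(omega_2). This is the
  Bernstein relation before x_1 is inverted.\<close>

lemma X1_U1_X1: "X1 * U1 * X1 = T1 * X2"
proof -
  have "X1 * U1 = T om * T2" by (simp only: transl_om mult.assoc T1_U1 mult_1_right)
  then have "X1 * U1 * X1 = T om * T (w_elt 2 \<circ> transl (lat 1 0))"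
    using wb_mult_transl[of 2 1 0] by (simp add: mult.assoc)
  also have "\<dots> = T (om \<circ> (w_elt 2 \<circ> transl (lat 1 0)))"
    by (rule om_T_mult) (intro WP_comp w_elt_WP transl_WP; simp)
  also have "om \<circ> (w_elt 2 \<circ> transl (lat 1 0)) = w_elt 1 \<circ> transl (lat 0 1)"
    by (simp add: fun_eq_iff o_apply weyl_apply om_apply)
  finally show ?thesis using wb_mult_transl[of 1 0 1] by simp
qed

lemma X2_U2_X2: "X2 * U2 * X2 = T2 * X1"
proof -
  have "X2 * U2 = T om' * T1" by (simp only: transl_om mult.assoc T2_U2 mult_1_right)
  then have "X2 * U2 * X2 = T om' * T (w_elt 1 \<circ> transl (lat 0 1))"
    using wb_mult_transl[of 1 0 1] by (simp add: mult.assoc)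
  also have "\<dots> = T (om' \<circ> (w_elt 1 \<circ> transl (lat 0 1)))"
    by (rule om_T_mult) (intro WP_comp w_elt_WP transl_WP; simp)
  also have "om' \<circ> (w_elt 1 \<circ> transl (lat 0 1)) = w_elt 2 \<circ> transl (lat 1 0)"
    by (simp add: fun_eq_iff o_apply weyl_apply om_apply)
  finally show ?thesis using wb_mult_transl[of 2 1 0] by simp
qed

section \<open>The lattice elements \<open>X m n\<close> and the Bernstein relations\<close>

definition Y1 :: 'h where "Y1 = U1 * U2 * T om'"
definition Y2 :: 'h where "Y2 = U2 * U1 * T om"

lemma X1_Y1: "X1 * Y1 = 1" "Y1 * X1 = 1" and X2_Y2: "X2 * Y2 = 1" "Y2 * X2 = 1"
proof -
  have c: "a * (b * c) = d * c" if "a * b = d" for a b c d :: 'h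
    using that by (simp add: mult.assoc[symmetric])
  note r = c[OF T1_U1(1)] c[OF T1_U1(2)] c[OF T2_U2(1)] c[OF T2_U2(2)]
    c[OF T_om_inverse(1)] c[OF T_om_inverse(2)] T1_U1 T2_U2 T_om_inverse
  show "X1 * Y1 = 1" "Y1 * X1 = 1" "X2 * Y2 = 1" "Y2 * X2 = 1"
    by (simp_all only: Y1_def Y2_def transl_om mult.assoc r mult_1_left)
qed

text \<open>Integer powers of a unit \<open>a\<close> whose inverse \<open>b\<close> is passed
  along, as the ring has no inverse operation.\<close>

definition upow :: "'h \<Rightarrow> 'h \<Rightarrow> int \<Rightarrow> 'h" where
  "upow a b k = (if k \<ge> 0 then a ^ nat k else b ^ nat (- k))"

lemma upow_add:
  assumes "a * b = 1" "b * a = 1"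
  shows "upow a b (j + k) = upow a b j * upow a b k"
proof -
  have suc: "upow a b (k + 1) = upow a b k * a" for k
  proof (cases "k \<ge> 0")
    case True
    then show ?thesis by (simp add: upow_def nat_add_distrib power_commutes)
  next
    case False
    then have "nat (- k) = Suc (nat (- (k + 1)))" by simp
    then have "upow a b k * a = b ^ nat (- (k + 1)) * (b * a)"
      using False by (simp add: upow_def power_Suc2 mult.assoc del: power_Suc nat_minus_as_int)
    with False assms show ?thesis by (auto simp: upow_def)
  qed
  have pred: "upow a b (k - 1) = upow a b k * b" for k
    using suc[of "k - 1"] assms by (simp add: mult.assoc)
  show ?thesis
  proof (induction k rule: int_induct[where k = 0])
    case base
    show ?case by (simp add: upow_def)
  next
    case (step1 i)
    then show ?case using suc[of "j + i"] suc[of i] by (simp add: add.assoc mult.assoc)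
  next
    case (step2 i)
    then show ?case using pred[of "j + i"] pred[of i] by (simp add: add_diff_eq mult.assoc)
  qed
qed

lemma commute_inverse:
  assumes "a * b = 1" "b * a = (1::'h)" "a * c = c * a"
  shows "b * c = c * b"
proof -
  have "b * c = b * ((c * a) * b)" using assms(1) by (simp add: mult.assoc)
  also have "\<dots> = (b * a) * c * b" unfolding assms(3)[symmetric] by (simp only: mult.assoc)
  finally show ?thesis using assms(2) by simp
qed

lemma commute_upow:
  assumes "a * b = 1" "b * a = (1::'h)" "a * c = c * a"
  shows "upow a b k * c = c * upow a b k"
proof -
  have p: "a ^ j * c = c * a ^ j" if "a * c = c * a" for j and a :: 'h
  proof (induction j)
    case (Suc j)
    have "a ^ Suc j * c = a * (a ^ j * c)" by (simp add: mult.assoc)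
    also have "\<dots> = (a * c) * a ^ j" by (simp add: Suc.IH mult.assoc)
    also have "\<dots> = c * a ^ Suc j" unfolding that by (simp add: mult.assoc)
    finally show ?case .
  qed simp
  show ?thesis
    using p[OF assms(3)] p[OF commute_inverse[OF assms]] by (simp add: upow_def)
qed

definition X :: "int \<Rightarrow> int \<Rightarrow> 'h" where "X m n = upow X1 Y1 m * upow X2 Y2 n"

lemma X_mult: "X m n * X m' n' = X (m + m') (n + n')"
proof -
  have c: "upow X2 Y2 n * upow X1 Y1 m' = upow X1 Y1 m' * upow X2 Y2 n"
    by (intro commute_upow commute_upow[symmetric] X1_Y1 X2_Y2 X1_X2[symmetric] X1_X2)
  have "X m n * X m' n' = upow X1 Y1 m * (upow X2 Y2 n * upow X1 Y1 m') * upow X2 Y2 n'"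
    by (simp only: X_def mult.assoc)
  also have "\<dots> = upow X1 Y1 m * upow X1 Y1 m' * (upow X2 Y2 n * upow X2 Y2 n')"
    by (simp only: c mult.assoc)
  finally show ?thesis by (simp only: X_def upow_add[OF X1_Y1] upow_add[OF X2_Y2])
qed

lemma X_0 [simp]: "X 0 0 = 1" by (simp add: X_def upow_def)

lemma X_dominant: "0 \<le> m \<Longrightarrow> 0 \<le> n \<Longrightarrow> X m n = T (transl (lat m n))"
proof -
  have "X1 ^ i = T (transl (lat (int i) 0))" "X2 ^ i = T (transl (lat 0 (int i)))" for i
  proof (induction i)
    case (Suc i)
    show "X1 ^ Suc i = T (transl (lat (int (Suc i)) 0))"
      using transl_mult[of 1 0 "int i" 0] unfolding power_Suc Suc by simp
    show "X2 ^ Suc i = T (transl (lat 0 (int (Suc i))))"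
      using transl_mult[of 0 1 0 "int i"] unfolding power_Suc Suc by simp
  qed (simp_all add: T_id)
  then show "0 \<le> m \<Longrightarrow> 0 \<le> n \<Longrightarrow> X m n = T (transl (lat m n))"
    using transl_mult[of m 0 0 n] by (simp add: X_def upow_def)
qed

lemma unit_inv_X: "unit_inv (X m n) = X (- m) (- n)"
  unfolding unit_inv_def
proof (rule the_equality)
  fix b assume b: "X m n * b = 1 \<and> b * X m n = 1"
  have "b = X (- m) (- n) * (X m n * b)" by (simp add: mult.assoc[symmetric] X_mult)
  with b show "b = X (- m) (- n)" by simp
qed (simp add: X_mult)

lemma x_lat: "x (lat m n) = X m n"
  unfolding x_def
proof (rule the_equality)
  have D: "\<exists>i j. v = lat i j \<and> 0 \<le> i \<and> 0 \<le> j" if "dominant v" for v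
    using that by (auto simp: dominant_def coweight_lattice_eq alpha1_def alpha2_def)
  show "\<forall>a b. dominant a \<and> dominant b \<and> lat m n = a - b \<longrightarrow>
      X m n = T (transl a) * unit_inv (T (transl b))"
  proof (intro allI impI)
    fix a b assume ab: "dominant a \<and> dominant b \<and> lat m n = a - b"
    with D obtain i j i' j' where *: "a = lat i j" "b = lat i' j'" "0 \<le> i" "0 \<le> j" "0 \<le> i'" "0 \<le> j'"
      by metis
    then have "m = i - i'" "n = j - j'" using ab by (simp_all flip: of_int_diff)
    with * show "X m n = T (transl a) * unit_inv (T (transl b))"
      by (simp add: X_dominant[symmetric] unit_inv_X X_mult)
  qed
  fix y assume y: "\<forall>a b. dominant a \<and> dominant b \<and> lat m n = a - b \<longrightarrow>
      y = T (transl a) * unit_inv (T (transl b))"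
  \<comment> \<open>The positive and negative parts of the weight give one dominant decomposition,
    which determines \<open>y\<close>.\<close>
  define a where "a = lat (max m 0) (max n 0)"
  define b where "b = lat (max m 0 - m) (max n 0 - n)"
  have "dominant a" "dominant b" "lat m n = a - b"
    by (auto simp: dominant_def a_def b_def alpha1_def alpha2_def coweight_lattice_def)
  then have "y = T (transl a) * unit_inv (T (transl b))" using y by blast
  also have "\<dots> = X m n"
    unfolding a_def b_def by (subst (1 2) X_dominant[symmetric]) (simp_all add: unit_inv_X X_mult)
  finally show "y = X m n" .
qed

lemma x_omega: "x omega1 = X 1 0" "x (- omega1) = X (- 1) 0" "x omega2 = X 0 1" "x (- omega2) = X 0 (- 1)"
  using x_lat[of 1 0] x_lat[of "-1" 0] x_lat[of 0 1] x_lat[of 0 "-1"]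
  by (simp_all add: omega1_def omega2_def)

lemma CP_eq: "CP = span (range (\<lambda>(m, n). X m n))"
proof -
  have "x ` coweight_lattice = range (\<lambda>(m, n). X m n)"
  proof -
    have c: "coweight_lattice = range (\<lambda>(m, n). lat m n)" by (auto simp: coweight_lattice_eq)
    show ?thesis unfolding c image_image by (intro image_cong) (auto simp: x_lat)
  qed
  then show ?thesis by (simp add: CP_def)
qed

lemma X_10: "X 1 0 = X1" "X 0 1 = X2"
  by (simp_all add: X_def upow_def)

text \<open>Multiplying \<open>X1_U1_X1\<close> by x_1^(-1) gives x_1 T_1^(-1) = T_1 x_1^(-1) x_2.
  Multiplication by T_1^(-1) on the left and T_1 on the right yields the second form.\<close>

lemma bernstein1: "X 1 0 * T1 = T1 * X (-1) 1 + scale Q (X 1 0)"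
  "T1 * X 1 0 = X (-1) 1 * T1 + scale Q (X 1 0)"
  "X 0 n * T1 = T1 * X 0 n"
proof -
  have "X1 * U1 * X1 * X (-1) 0 = T1 * X2 * X (-1) 0" by (simp only: X1_U1_X1)
  then have *: "X1 * U1 = T1 * X (-1) 1"
    unfolding X_10[symmetric] by (simp add: mult.assoc X_mult)
  then show "X 1 0 * T1 = T1 * X (-1) 1 + scale Q (X 1 0)"
    by (simp add: algebra_simps X_10 scale_mult)
  have "U1 * X1 = (U1 * (X1 * U1)) * T1" by (simp only: mult.assoc T1_U1 mult_1_right)
  also have "\<dots> = X (-1) 1 * T1" unfolding * by (simp only: mult.assoc[symmetric] T1_U1 mult_1_left)
  finally show "T1 * X 1 0 = X (-1) 1 * T1 + scale Q (X 1 0)"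
    by (simp add: algebra_simps X_10 scale_mult)
  show "X 0 n * T1 = T1 * X 0 n"
    using commute_upow[OF X2_Y2 T1_X2[symmetric]] by (simp add: X_def upow_def)
qed

lemma bernstein2: "X 0 1 * T2 = T2 * X 1 (-1) + scale Q (X 0 1)"
  "T2 * X 0 1 = X 1 (-1) * T2 + scale Q (X 0 1)"
  "X m 0 * T2 = T2 * X m 0"
proof -
  have "X2 * U2 * X2 * X 0 (-1) = T2 * X1 * X 0 (-1)" by (simp only: X2_U2_X2)
  then have *: "X2 * U2 = T2 * X 1 (-1)"
    unfolding X_10[symmetric] by (simp add: mult.assoc X_mult)
  then show "X 0 1 * T2 = T2 * X 1 (-1) + scale Q (X 0 1)"
    by (simp add: algebra_simps X_10 scale_mult)
  have "U2 * X2 = (U2 * (X2 * U2)) * T2" by (simp only: mult.assoc T2_U2 mult_1_right)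
  also have "\<dots> = X 1 (-1) * T2" unfolding * by (simp only: mult.assoc[symmetric] T2_U2 mult_1_left)
  finally show "T2 * X 0 1 = X 1 (-1) * T2 + scale Q (X 0 1)"
    by (simp add: algebra_simps X_10 scale_mult)
  show "X m 0 * T2 = T2 * X m 0"
    using commute_upow[OF X1_Y1 T2_X1[symmetric]] by (simp add: X_def upow_def)
qed

text \<open>The sum runs over the root string from the weight towards its reflection, without the
  last point. The family \<open>Y\<close> is abstract so that \<open>X\<close> with
  \<open>T1\<close> and \<open>X\<close> with exchanged indices and \<open>T2\<close> are both
  instances.\<close>

lemma bernstein_right_aux:
  fixes t :: 'h and Y :: "int \<Rightarrow> int \<Rightarrow> 'h"
  assumes Y: "\<And>a b c d. Y a b * Y c d = Y (a + c) (b + d)"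
    and t0: "\<And>l. Y 0 l * t = t * Y 0 l"
    and t1: "Y 1 0 * t = t * Y (-1) 1 + scale Q (Y 1 0)"
  shows "Y (int k) l * t = t * Y (- int k) (int k + l)
      + scale Q (\<Sum>j<k. Y (int k - 2 * int j) (l + int j))"
proof (induction k)
  case 0
  show ?case by (simp add: t0)
next
  case (Suc k)
  have "Y (int (Suc k)) l * t = Y (int k) l * (Y 1 0 * t)"
    by (simp add: mult.assoc[symmetric] Y add.commute)
  also have "\<dots> = (Y (int k) l * t) * Y (-1) 1 + scale Q (Y (int (Suc k)) l)"
    by (simp add: t1 distrib_left mult.assoc[symmetric] scale_mult Y add.commute)
  also have "(Y (int k) l * t) * Y (-1) 1 = t * Y (- int (Suc k)) (int (Suc k) + l)
      + scale Q (\<Sum>j<k. Y (int k - 2 * int j - 1) (l + int j + 1))"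
    unfolding Suc.IH
    by (simp add: distrib_right mult.assoc scale_mult Y sum_distrib_right algebra_simps)
  also have "(\<Sum>j<k. Y (int k - 2 * int j - 1) (l + int j + 1))
      = (\<Sum>j<k. Y (int (Suc k) - 2 * int (Suc j)) (l + int (Suc j)))"
    by (simp add: algebra_simps)
  finally show ?case
    unfolding sum.lessThan_Suc_shift by (simp add: scale_right_distrib ac_simps)
qed

lemma bernstein_left_aux:
  fixes t :: 'h and Y :: "int \<Rightarrow> int \<Rightarrow> 'h"
  assumes Y: "\<And>a b c d. Y a b * Y c d = Y (a + c) (b + d)"
    and t0: "\<And>l. Y 0 l * t = t * Y 0 l"
    and t1: "t * Y 1 0 = Y (-1) 1 * t + scale Q (Y 1 0)"
  shows "t * Y (int k) l = Y (- int k) (int k + l) * t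
      + scale Q (\<Sum>j<k. Y (int k - 2 * int j) (l + int j))"
proof (induction k)
  case 0
  show ?case by (simp add: t0)
next
  case (Suc k)
  have "t * Y (int (Suc k)) l = (t * Y 1 0) * Y (int k) l"
    by (simp add: mult.assoc Y)
  also have "\<dots> = Y (-1) 1 * (t * Y (int k) l) + scale Q (Y (int (Suc k)) l)"
    by (simp add: t1 distrib_right mult.assoc scale_mult Y)
  also have "Y (-1) 1 * (t * Y (int k) l) = Y (- int (Suc k)) (int (Suc k) + l) * t
      + scale Q (\<Sum>j<k. Y (int k - 2 * int j - 1) (l + int j + 1))"
    unfolding Suc.IH
    by (simp add: distrib_left mult.assoc[symmetric] scale_mult Y sum_distrib_left algebra_simps)
  also have "(\<Sum>j<k. Y (int k - 2 * int j - 1) (l + int j + 1))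
      = (\<Sum>j<k. Y (int (Suc k) - 2 * int (Suc j)) (l + int (Suc j)))"
    by (simp add: algebra_simps)
  finally show ?case
    unfolding sum.lessThan_Suc_shift by (simp add: scale_right_distrib ac_simps)
qed

lemmas bernstein_right1 = bernstein_right_aux[of X, OF X_mult bernstein1(3) bernstein1(1)]
lemmas bernstein_left1 = bernstein_left_aux[of X, OF X_mult bernstein1(3) bernstein1(2)]
lemmas bernstein_right2 = bernstein_right_aux[of "\<lambda>m n. X n m", OF X_mult bernstein2(3) bernstein2(1)]
lemmas bernstein_left2 = bernstein_left_aux[of "\<lambda>m n. X n m", OF X_mult bernstein2(3) bernstein2(2)]

lemma span_map:
  assumes "\<And>a b. f (a + b) = f a + f b" "\<And>c a. f (scale c a) = scale c (f a)"
    and "subspace V" "\<And>b. b \<in> B \<Longrightarrow> f b \<in> V" "h \<in> span B"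
  shows "f h \<in> V"
proof -
  have "f 0 = 0" using assms(2)[of 0 0] by simp
  with assms(1-4) show ?thesis
    by (intro span_induct[OF assms(5), where P = "\<lambda>h. f h \<in> V"])
      (auto simp: subspace_def)
qed

lemma T1_wb:
  "T1 * wb 0 = wb 1" "T1 * wb 1 = wb 0 + scale Q (wb 1)" "T1 * wb 2 = wb 4"
  "T1 * wb 3 = wb 5" "T1 * wb 4 = wb 2 + scale Q (wb 4)" "T1 * wb 5 = wb 3 + scale Q (wb 5)"
  by (simp_all add: T1_T1 mult.assoc[symmetric]) (simp_all add: distrib_right scale_mult mult.assoc)

lemma wb_5': "wb 5 = T2 * (T1 * T2)" by (simp add: braid)

lemma T2_wb:
  "T2 * wb 0 = wb 2" "T2 * wb 1 = wb 3" "T2 * wb 2 = wb 0 + scale Q (wb 2)"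
  "T2 * wb 3 = wb 1 + scale Q (wb 3)" "T2 * wb 4 = wb 5" "T2 * wb 5 = wb 4 + scale Q (wb 5)"
proof -
  have *: "T2 * (T2 * a) = a + scale Q (T2 * a)" for a
    using T2_T2 by (simp add: mult.assoc[symmetric] distrib_right scale_mult)
  show "T2 * wb 0 = wb 2" "T2 * wb 1 = wb 3" "T2 * wb 2 = wb 0 + scale Q (wb 2)"
    "T2 * wb 3 = wb 1 + scale Q (wb 3)" "T2 * wb 4 = wb 5" by (simp_all add: T2_T2 * braid)
  show "T2 * wb 5 = wb 4 + scale Q (wb 5)" unfolding wb_5' * by simp
qed

lemma wb_T1:
  "wb 0 * T1 = wb 1" "wb 1 * T1 = wb 0 + scale Q (wb 1)" "wb 2 * T1 = wb 3"
  "wb 3 * T1 = wb 2 + scale Q (wb 3)" "wb 4 * T1 = wb 5" "wb 5 * T1 = wb 4 + scale Q (wb 5)"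
  by (simp_all add: T1_T1 mult.assoc distrib_left scale_mult)

lemma wb_T2:
  "wb 0 * T2 = wb 2" "wb 1 * T2 = wb 4" "wb 2 * T2 = wb 0 + scale Q (wb 2)"
  "wb 3 * T2 = wb 5" "wb 4 * T2 = wb 1 + scale Q (wb 4)" "wb 5 * T2 = wb 3 + scale Q (wb 5)"
proof -
  show "wb 0 * T2 = wb 2" "wb 1 * T2 = wb 4" "wb 2 * T2 = wb 0 + scale Q (wb 2)"
    "wb 3 * T2 = wb 5" "wb 4 * T2 = wb 1 + scale Q (wb 4)"
    by (simp_all add: T2_T2 mult.assoc distrib_left scale_mult braid)
  show "wb 5 * T2 = wb 3 + scale Q (wb 5)"
    unfolding wb_5' by (simp add: T2_T2 mult.assoc distrib_left scale_mult)
qed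

section \<open>The elements T_w x^lambda span the algebra\<close>

definition BB :: "'h set" where "BB = {wb k * X m n |k m n. k < 6}"

lemma subspace_span_BB: "subspace (span BB)" by simp

lemma wbX_in: "k < 6 \<Longrightarrow> wb k * X m n \<in> span BB"
  by (rule span_base) (auto simp: BB_def)

lemma span_BB_left_finite:
  assumes "h \<in> span BB"
  shows "T1 * h \<in> span BB" "T2 * h \<in> span BB"
proof -
  have "T1 * (wb k * X m n) \<in> span BB \<and> T2 * (wb k * X m n) \<in> span BB" if "k < 6" for k m n
    using that unfolding less6_cases
    by (elim disjE; simp only: mult.assoc[symmetric] T1_wb T2_wb distrib_right scale_mult;
        intro conjI span_add span_scale wbX_in; simp)
  then show "T1 * h \<in> span BB" "T2 * h \<in> span BB"
    using span_map[where f = "\<lambda>h. T1 * h", OF _ _ subspace_span_BB _ assms]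
      span_map[where f = "\<lambda>h. T2 * h", OF _ _ subspace_span_BB _ assms]
    by (auto simp: distrib_left scale_mult BB_def)
qed

lemma CP_base: "X m n \<in> CP"
  unfolding CP_eq by (rule span_base) auto

lemma subspace_CP: "subspace CP"
  by (simp add: CP_eq)

lemma CP_T1: "y \<in> CP \<Longrightarrow> \<exists>y'\<in>CP. \<exists>y''\<in>CP. y * T1 = T1 * y' + y''"
  and CP_T2: "y \<in> CP \<Longrightarrow> \<exists>y'\<in>CP. \<exists>y''\<in>CP. y * T2 = T2 * y' + y''"
proof -
  have gen: "\<exists>y'\<in>CP. \<exists>y''\<in>CP. y * t = t * y' + y''"
    if y: "y \<in> CP" and t: "\<And>m n. \<exists>y'\<in>CP. \<exists>y''\<in>CP. X m n * t = t * y' + y''" for y t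
  proof -
    have "y \<in> span (range (\<lambda>(m, n). X m n))" using y by (simp add: CP_eq)
    then show ?thesis
    proof (rule span_induct)
      show "subspace {y. \<exists>y'\<in>CP. \<exists>y''\<in>CP. y * t = t * y' + y''}"
        unfolding subspace_def
      proof (safe, goal_cases)
        case 1
        show ?case by (intro bexI[of _ 0]) (auto simp: subspace_0[OF subspace_CP])
      next
        case (2 x y a' b' a'' b'')
        then show ?case
          by (intro bexI[of _ "a' + a''"] bexI[of _ "b' + b''"])
            (auto simp: distrib_left distrib_right subspace_add[OF subspace_CP] ac_simps)
      next
        case (3 c x a' a'')
        then show ?case
          by (intro bexI[of _ "scale c a'"] bexI[of _ "scale c a''"])
            (auto simp: scale_mult scale_right_distrib subspace_scale[OF subspace_CP])
      qed
    qed (use t in auto)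
  qed
  have r: "\<exists>y'\<in>CP. \<exists>y''\<in>CP. Y k l * t = t * y' + y''"
    if Y: "\<And>a b. Y a b \<in> CP"
      and 1: "\<And>k l. Y (int k) l * t = t * Y (- int k) (int k + l)
        + scale Q (\<Sum>j<k. Y (int k - 2 * int j) (l + int j))"
      and 2: "\<And>k l. t * Y (int k) l = Y (- int k) (int k + l) * t
        + scale Q (\<Sum>j<k. Y (int k - 2 * int j) (l + int j))" for Y t k l
  proof -
    have s: "scale Q (\<Sum>j<i. Y (int i - 2 * int j) (l + int j)) \<in> CP" for i l
      by (intro subspace_scale[OF subspace_CP] subspace_sum[OF subspace_CP] Y)
    show ?thesis
    proof (cases "k \<ge> 0")
      case True
      then obtain i where "k = int i" by (rule nonneg_int_cases)
      then show ?thesis using 1[of i l] by (intro bexI[OF _ Y] bexI[OF _ s]) auto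
    next
      case False
      then obtain i where i: "k = - int i" by (metis int_cases2 of_nat_0_le_iff)
      \<comment> \<open>A negative exponent is covered by the left relation for the reflected
        weight, in which \<open>Y k l * t\<close> is the leading term.\<close>
      have "Y k l * t = t * Y (int i) (l - int i)
          + - scale Q (\<Sum>j<i. Y (int i - 2 * int j) ((l - int i) + int j))"
        using 2[of i "l - int i"] by (simp add: i)
      then show ?thesis by (intro bexI[OF _ Y] bexI[OF _ subspace_neg[OF subspace_CP s]])
    qed
  qed
  show "y \<in> CP \<Longrightarrow> \<exists>y'\<in>CP. \<exists>y''\<in>CP. y * T1 = T1 * y' + y''"
    by (rule gen, assumption, rule r[of X, OF CP_base bernstein_right1 bernstein_left1])
  show "y \<in> CP \<Longrightarrow> \<exists>y'\<in>CP. \<exists>y''\<in>CP. y * T2 = T2 * y' + y''"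
    by (rule gen, assumption, rule r[of "\<lambda>m n. X n m", OF CP_base bernstein_right2 bernstein_left2])
qed

lemma span_BB_right_X:
  assumes "h \<in> span BB"
  shows "h * X m n \<in> span BB"
proof -
  have "b * X m n \<in> span BB" if b: "b \<in> BB" for b
  proof -
    obtain k i j where "b = wb k * X i j" "k < 6" using b unfolding BB_def by blast
    then show ?thesis by (simp only: mult.assoc X_mult wbX_in)
  qed
  from span_map[where f = "\<lambda>h. h * X m n", OF _ _ subspace_span_BB this assms]
  show ?thesis by (simp add: distrib_right scale_mult)
qed

text \<open>The finite part is peeled off one letter at a time: \<open>CP_T1\<close> and
  \<open>CP_T2\<close> move the lattice part past each T_i, leaving lattice elements in front of a
  shorter word.\<close>

lemma span_BB_left_CP:
  assumes "y \<in> CP" "h \<in> span BB"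
  shows "y * h \<in> span BB"
proof -
  have 0: "y * 1 \<in> span BB" if "y \<in> CP" for y
  proof -
    have "CP \<subseteq> span BB" unfolding CP_eq
      by (rule span_minimal) (use wbX_in[of 0] in auto)
    with that show ?thesis by auto
  qed
  have 1: "y * (T1 * w) \<in> span BB" if "\<And>y. y \<in> CP \<Longrightarrow> y * w \<in> span BB" "y \<in> CP" for w y
  proof -
    obtain y' y'' where "y' \<in> CP" "y'' \<in> CP" "y * T1 = T1 * y' + y''" using CP_T1[OF \<open>y \<in> CP\<close>] by blast
    then show ?thesis
      using span_add[OF span_BB_left_finite(1)[OF that(1)] that(1), of y' y'']
      by (simp add: mult.assoc[symmetric] distrib_right)
  qed
  have 2: "y * (T2 * w) \<in> span BB" if "\<And>y. y \<in> CP \<Longrightarrow> y * w \<in> span BB" "y \<in> CP" for w y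
  proof -
    obtain y' y'' where "y' \<in> CP" "y'' \<in> CP" "y * T2 = T2 * y' + y''" using CP_T2[OF \<open>y \<in> CP\<close>] by blast
    then show ?thesis
      using span_add[OF span_BB_left_finite(2)[OF that(1)] that(1), of y' y'']
      by (simp add: mult.assoc[symmetric] distrib_right)
  qed
  have w: "y * wb k \<in> span BB" if "k < 6" "y \<in> CP" for k y
  proof -
    have w1: "y * (T1 * 1) \<in> span BB" "y * (T2 * 1) \<in> span BB" if "y \<in> CP" for y
      by (rule 1[OF 0 that] 2[OF 0 that], assumption)+
    have w2: "y * (T2 * (T1 * 1)) \<in> span BB" "y * (T1 * (T2 * 1)) \<in> span BB" if "y \<in> CP" for y
      by (rule 2[OF w1(1) that] 1[OF w1(2) that], assumption)+
    have w3: "y * (T1 * (T2 * (T1 * 1))) \<in> span BB" if "y \<in> CP" for y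
      by (rule 1[OF w2(1) that], assumption)
    show ?thesis
      using that(1) 0[OF that(2)] w1[OF that(2)] w2[OF that(2)] w3[OF that(2)]
      unfolding less6_cases by (elim disjE) (simp_all only: wb_simps mult_1_right)
  qed
  have "y * b \<in> span BB" if "b \<in> BB" for b
  proof -
    from that obtain k m n where b: "b = wb k * X m n" "k < 6" unfolding BB_def by blast
    then have "y * b = (y * wb k) * X m n" by (simp only: mult.assoc)
    also have "\<dots> \<in> span BB" by (rule span_BB_right_X[OF w[OF b(2) assms(1)]])
    finally show ?thesis .
  qed
  from span_map[where f = "\<lambda>h. y * h", OF _ _ subspace_span_BB this assms(2)]
  show ?thesis by (simp add: distrib_left scale_mult)
qed

text \<open>A negative \<open>n1\<close>, a negative \<open>n2\<close> or a positive
  \<open>n3\<close> signals that s_1, s_2 or s_0 shortens \<open>w\<close> from the left. Without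
  such a reflection only the length 0 elements remain.\<close>

lemma T_induct:
  assumes "w \<in> WP" and one: "V 1" and om: "V (T om)" "V (T om')"
    and step: "\<And>s w. s \<in> {s0, s1, s2} \<Longrightarrow> w \<in> WP \<Longrightarrow> V (T w) \<Longrightarrow> V (T s * T w)"
  shows "V (T w)"
  using assms(1)
proof (induction "len w" arbitrary: w rule: less_induct)
  case less
  consider "n1 w < 0" | "n2 w < 0" | "n3 w > 0" | "n1 w \<ge> 0" "n2 w \<ge> 0" "n3 w \<le> 0" by linarith
  then show ?case
  proof cases
    case 1
    have WP: "s1 \<circ> w \<in> WP" using less.prems simple_WP WP_comp by blast
    have "V (T (s1 \<circ> w))"
      using 1 less.prems WP by (intro less.hyps) (simp_all add: len_WP n_simple_comp)
    moreover have "s1 \<circ> (s1 \<circ> w) = w" by (simp add: fun_eq_iff o_apply s1_s1)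
    then have "T w = T1 * T (s1 \<circ> w)"
      using T1_mult_T[OF WP] 1 by (simp add: n_simple_comp less.prems)
    ultimately show ?thesis using step[OF _ WP] by simp
  next
    case 2
    have WP: "s2 \<circ> w \<in> WP" using less.prems simple_WP WP_comp by blast
    have "V (T (s2 \<circ> w))"
      using 2 less.prems WP by (intro less.hyps) (simp_all add: len_WP n_simple_comp)
    moreover have "s2 \<circ> (s2 \<circ> w) = w" by (simp add: fun_eq_iff o_apply s2_s2)
    then have "T w = T2 * T (s2 \<circ> w)"
      using T2_mult_T[OF WP] 2 by (simp add: n_simple_comp less.prems)
    ultimately show ?thesis using step[OF _ WP] by simp
  next
    case 3
    have WP: "s0 \<circ> w \<in> WP" using less.prems simple_WP WP_comp by blast
    have "V (T (s0 \<circ> w))"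
      using 3 less.prems WP by (intro less.hyps) (simp_all add: len_WP n_simple_comp)
    moreover have "s0 \<circ> (s0 \<circ> w) = w" by (simp add: fun_eq_iff o_apply s0_s0)
    then have "T w = T s0 * T (s0 \<circ> w)"
      using T0_mult_T[OF WP] 3 by (simp add: n_simple_comp less.prems)
    ultimately show ?thesis using step[OF _ WP] by simp
  next
    case 4
    from alcove_stabiliser[OF less.prems this] show ?thesis
      using one om by (auto simp: T_id)
  qed
qed

text \<open>The span contains 1 and is stable under left multiplication by all generators. For the
  length 0 elements this rests on T_\<open>om\<close> = x_1 T_1^(-1) T_2^(-1), read off from
  \<open>transl_om\<close>, and its mirror image.\<close>

lemma span_BB: "span BB = UNIV"
proof -
  have om: "T om * h \<in> span BB" "T om' * h \<in> span BB" if "h \<in> span BB" for h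
  proof -
    have U: "U1 * h \<in> span BB" "U2 * h \<in> span BB" if "h \<in> span BB" for h
      using span_BB_left_finite[OF that] span_scale[OF that]
      by (auto simp: left_diff_distrib scale_mult intro!: span_diff)
    have "T om = X 1 0 * (U1 * U2)"
      unfolding X_10 transl_om mult.assoc
      by (simp only: mult.assoc[of T1 U1, symmetric] T1_U1 T2_U2 mult_1_left mult_1_right)
    moreover have "T om' = X 0 1 * (U2 * U1)"
      unfolding X_10 transl_om mult.assoc
      by (simp only: mult.assoc[of T2 U2, symmetric] T1_U1 T2_U2 mult_1_left mult_1_right)
    ultimately show "T om * h \<in> span BB" "T om' * h \<in> span BB"
      using span_BB_left_CP[OF CP_base U(1)[OF U(2)[OF that]], of 1 0]
        span_BB_left_CP[OF CP_base U(2)[OF U(1)[OF that]], of 0 1]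
      by (simp_all only: mult.assoc)
  qed
  have s0: "T s0 * h \<in> span BB" if "h \<in> span BB" for h
    using om(1)[OF span_BB_left_finite(2)[OF om(2)[OF that]]] by (simp add: T_s0 mult.assoc)
  have one: "1 \<in> span BB" using wbX_in[of 0 0 0] by simp
  have "T w \<in> span BB" if "w \<in> WP" for w
    using that one
  proof (rule T_induct)
    show "T om \<in> span BB" "T om' \<in> span BB" using om[OF one] by simp_all
  qed (use s0 span_BB_left_finite in auto)
  then have "span (T ` WP) \<subseteq> span BB" by (intro span_minimal) auto
  then show ?thesis by (simp add: T_span top.extremum_unique)
qed

section \<open>The trace is a trace\<close>

lemma rep_T:
  "representation (T ` WP) (a + b) = (\<lambda>v. representation (T ` WP) a v + representation (T ` WP) b v)"
  "representation (T ` WP) (scale c a) = (\<lambda>v. c * representation (T ` WP) a v)"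
  "w \<in> WP \<Longrightarrow> u \<in> WP \<Longrightarrow> representation (T ` WP) (T w) (T u) = (if w = u then 1 else 0)"
proof -
  show "representation (T ` WP) (a + b) = (\<lambda>v. representation (T ` WP) a v + representation (T ` WP) b v)"
    "representation (T ` WP) (scale c a) = (\<lambda>v. c * representation (T ` WP) a v)"
    using T_span T_independent by (simp_all add: representation_add representation_scale)
  show "w \<in> WP \<Longrightarrow> u \<in> WP \<Longrightarrow> representation (T ` WP) (T w) (T u) = (if w = u then 1 else 0)"
    using representation_basis[OF T_independent, of "T w"] T_inj by (auto simp: inj_on_eq_iff)
qed

lemma Tr_add: "Tr (a + b) = Tr a + Tr b" and Tr_scale: "Tr (scale c a) = c * Tr a"
  and Tr_T: "w \<in> WP \<Longrightarrow> Tr (T w) = (if w = id then 1 else 0)"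
  using simple_WP by (simp_all add: Tr_def rep_T)

lemma simple_square: "s \<in> {s0, s1, s2} \<Longrightarrow> s \<circ> s = id"
proof -
  have "s0 \<circ> s0 = id" "s1 \<circ> s1 = id" "s2 \<circ> s2 = id"
    by (simp_all add: fun_eq_iff o_apply id_apply s1_s1 s2_s2 s0_s0)
  then show "s \<in> {s0, s1, s2} \<Longrightarrow> s \<circ> s = id" by auto
qed

text \<open>The clause \<open>w \<noteq> id\<close> records that the correction term, a multiple of
  \<open>T w\<close>, has trace 0; \<open>Tr_commute\<close> relies on this.\<close>

lemma T_simple_mult:
  assumes s: "s \<in> {s0, s1, s2}" and w: "w \<in> WP"
  shows "T s * T w = T (s \<circ> w) \<or> T s * T w = T (s \<circ> w) + scale Q (T w) \<and> w \<noteq> id"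
    "T w * T s = T (w \<circ> s) \<or> T w * T s = T (w \<circ> s) + scale Q (T w) \<and> w \<noteq> id"
proof -
  have sq: "T s * T s = 1 + scale Q (T s)" using T_quadratic[OF s] by (simp add: Q_def)
  have ss: "s \<circ> s = id" by (rule simple_square[OF s])
  have sWP: "s \<in> WP" using s simple_WP by auto
  have len_s: "len s = 1"
    using s simple_WP n_simple_comp[OF simple_WP(1)] by (auto simp: len_WP)
  have l: "T s * T (s \<circ> w) = T w" "w \<noteq> id" if "T s * T w \<noteq> T (s \<circ> w)"
  proof -
    have c: "s \<circ> (s \<circ> w) = w" by (simp add: ss comp_assoc[symmetric])
    have WP: "s1 \<circ> w \<in> WP" "s2 \<circ> w \<in> WP" "s0 \<circ> w \<in> WP" using WP_comp simple_WP w by auto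
    show "T s * T (s \<circ> w) = T w"
      using s that T1_mult_T[OF w] T2_mult_T[OF w] T0_mult_T[OF w]
        T1_mult_T[OF WP(1)] T2_mult_T[OF WP(2)] T0_mult_T[OF WP(3)] c
      by (fastforce simp: n_simple_comp[OF w])
    show "w \<noteq> id" using that s by (auto simp: T_id)
  qed
  show "T s * T w = T (s \<circ> w) \<or> T s * T w = T (s \<circ> w) + scale Q (T w) \<and> w \<noteq> id"
  proof (cases "T s * T w = T (s \<circ> w)")
    case False
    have "T s * T w = (T s * T s) * T (s \<circ> w)" using l[OF False] by (simp add: mult.assoc)
    also have "\<dots> = T (s \<circ> w) + scale Q (T s * T (s \<circ> w))" by (simp add: sq distrib_right scale_mult)
    finally show ?thesis using l[OF False] by simp
  qed simp
  have WP: "w \<circ> s \<in> WP" by (rule WP_comp[OF w sWP])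
  from len_comp_simple[OF w s] show "T w * T s = T (w \<circ> s) \<or> T w * T s = T (w \<circ> s) + scale Q (T w) \<and> w \<noteq> id"
  proof
    assume "len (w \<circ> s) = len w + 1"
    then show ?thesis using T_mult[OF w sWP] len_s by simp
  next
    assume *: "len w = len (w \<circ> s) + 1"
    have c: "(w \<circ> s) \<circ> s = w" by (simp add: ss comp_assoc)
    have "T (w \<circ> s) * T s = T w" using T_mult[OF WP sWP] * len_s by (simp add: c)
    then have "T w * T s = T (w \<circ> s) * (T s * T s)" by (simp add: mult.assoc[symmetric])
    also have "\<dots> = T (w \<circ> s) + scale Q (T (w \<circ> s) * T s)" by (simp add: sq distrib_left scale_mult)
    finally have "T w * T s = T (w \<circ> s) + scale Q (T w)" using \<open>T (w \<circ> s) * T s = T w\<close> by simp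
    moreover have "w \<noteq> id" using * len_WP[OF simple_WP(1)] by auto
    ultimately show ?thesis by simp
  qed
qed

text \<open>The elements that commute with everything under the trace are closed under products, so
  the generators suffice. For these both traces are 1 exactly when \<open>w\<close> is the inverse
  of the generator's index, and 0 otherwise.\<close>

lemma Tr_commute: "Tr (a * b) = Tr (b * a)"
proof -
  define V where "V a \<longleftrightarrow> (\<forall>b. Tr (a * b) = Tr (b * a))" for a
  have VI: "V a" if "\<And>w. w \<in> WP \<Longrightarrow> Tr (a * T w) = Tr (T w * a)" for a
    unfolding V_def
  proof
    fix b
    have "b \<in> span (T ` WP)" by (simp add: T_span)
    then show "Tr (a * b) = Tr (b * a)"
    proof (rule span_induct)
      have "Tr 0 = 0" using Tr_scale[of 0 0] by simp
      then show "subspace {b. Tr (a * b) = Tr (b * a)}"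
        by (auto simp: subspace_def distrib_left distrib_right Tr_add scale_mult Tr_scale)
    qed (use that in auto)
  qed
  have Vm: "V (a * b)" if "V a" "V b" for a b
    using that unfolding V_def by (metis mult.assoc)
  have Vs: "V (T s)" if s: "s \<in> {s0, s1, s2}" for s
  proof (rule VI)
    fix w assume w: "w \<in> WP"
    have sWP: "s \<in> WP" using s simple_WP by auto
    have ss: "s \<circ> s = id" by (rule simple_square[OF s])
    have "s \<circ> w = id \<longleftrightarrow> w \<circ> s = id" using ss by (metis comp_assoc comp_id id_comp)
    then show "Tr (T s * T w) = Tr (T w * T s)"
      using T_simple_mult[OF s w] WP_comp[OF sWP w] WP_comp[OF w sWP] w
      by (auto simp: Tr_T Tr_add Tr_scale)
  qed
  have Vom: "V (T om)" "V (T om')"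
  proof (rule VI, goal_cases)
    have i: "om \<circ> om' = id" "om' \<circ> om = id" by (simp_all add: fun_eq_iff o_apply id_apply om_apply)
    case (1 w)
    have "om \<circ> w = id \<longleftrightarrow> w \<circ> om = id" using i by (metis comp_assoc comp_id id_comp)
    then show ?case using 1 WP_comp om_WP by (simp add: T_mult_om om_T_mult Tr_T)
  next
    have i: "om \<circ> om' = id" "om' \<circ> om = id" by (simp_all add: fun_eq_iff o_apply id_apply om_apply)
    show "V (T om')"
    proof (rule VI)
      fix w assume w: "w \<in> WP"
      have "om' \<circ> w = id \<longleftrightarrow> w \<circ> om' = id" using i by (metis comp_assoc comp_id id_comp)
      then show "Tr (T om' * T w) = Tr (T w * T om')" using w WP_comp om_WP by (simp add: T_mult_om om_T_mult Tr_T)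
    qed
  qed
  have "V (T w)" if "w \<in> WP" for w
    by (rule T_induct[OF that, of V]) (use Vs Vom Vm in \<open>auto simp: V_def\<close>)
  then have "V b" if "b \<in> T ` WP" for b using that by blast
  then show ?thesis using VI[of b] by (auto simp: V_def)
qed

lemma Tr_wbX:
  assumes "k < 6" "0 \<le> m" "0 \<le> n"
  shows "Tr (wb k * X m n) = (if k = 0 \<and> m = 0 \<and> n = 0 then 1 else 0)"
proof -
  have "w_elt k \<circ> transl (lat m n) = id \<longleftrightarrow> k = 0 \<and> m = 0 \<and> n = 0"
    using w_elt_transl_inj[OF assms(1), of 0 m n 0 0] by auto
  then show ?thesis using assms WP_comp[OF w_elt_WP transl_WP]
    by (simp add: X_dominant wb_mult_transl Tr_T)
qed

section \<open>Independence of the elements T_w x^lambda, and functionals with prescribed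
  values\<close>

definition linf :: "('h \<Rightarrow> complex) \<Rightarrow> bool" where
  "linf f \<longleftrightarrow> (\<forall>a b. f (a + b) = f a + f b) \<and> (\<forall>c a. f (scale c a) = c * f a)"

lemma linfD: "linf f \<Longrightarrow> f (a + b) = f a + f b" "linf f \<Longrightarrow> f (scale c a) = c * f a"
  "linf f \<Longrightarrow> f 0 = 0" "linf f \<Longrightarrow> f (- a) = - f a" "linf f \<Longrightarrow> f (a - b) = f a - f b"
  "linf f \<Longrightarrow> f (sum g A) = (\<Sum>x\<in>A. f (g x))"
proof -
  assume f: "linf f"
  show a: "f (a + b) = f a + f b" and s: "f (scale c a) = c * f a" for a b c
    using f by (auto simp: linf_def)
  show z: "f 0 = 0" using s[of 0 0] by simp
  show n: "f (- a) = - f a" for a using a[of a "- a"] z by (simp add: eq_neg_iff_add_eq_0 add.commute)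
  show "f (a - b) = f a - f b" using a[of a "- b"] n by simp
  show "f (sum g A) = (\<Sum>x\<in>A. f (g x))"
    by (induction A rule: infinite_finite_induct) (simp_all add: a z)
qed

text \<open>Right multiplication by a sufficiently dominant x^lambda moves all weights of the
  relation into the dominant cone, where the T_w x^mu are distinct members of the basis
  \<open>T\<close> indexed by \<open>WP\<close>.\<close>

lemma wbX_indep:
  assumes "finite F" "\<And>k m n. (k, m, n) \<in> F \<Longrightarrow> k < 6"
    and sum0: "(\<Sum>(k, m, n)\<in>F. scale (c (k, m, n)) (wb k * X m n)) = 0"
    and "(k0, m0, n0) \<in> F"
  shows "c (k0, m0, n0) = 0"
proof -
  define K where "K = Max ((\<lambda>(k, m, n). max \<bar>m\<bar> \<bar>n\<bar>) ` F)"
  have K: "0 \<le> m + K" "0 \<le> n + K" if "(k, m, n) \<in> F" for k m n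
  proof -
    have "max \<bar>m\<bar> \<bar>n\<bar> \<le> K" unfolding K_def using assms(1) that by (intro Max_ge) force+
    then show "0 \<le> m + K" "0 \<le> n + K" by auto
  qed
  let ?t = "\<lambda>k m n. w_elt k \<circ> transl (lat (m + K) (n + K))"
  have WP: "?t k m n \<in> WP" if "k < 6" for k m n using that WP_comp w_elt_WP transl_WP by blast
  have "0 = representation (T ` WP)
      ((\<Sum>(k, m, n)\<in>F. scale (c (k, m, n)) (wb k * X m n)) * X K K) (T (?t k0 m0 n0))"
    unfolding sum0 by (simp add: representation_zero)
  also have "(\<Sum>(k, m, n)\<in>F. scale (c (k, m, n)) (wb k * X m n)) * X K K
      = (\<Sum>(k, m, n)\<in>F. scale (c (k, m, n)) (T (?t k m n)))"
    unfolding sum_distrib_right using assms(2) K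
    by (intro sum.cong)
      (auto simp: scale_mult mult.assoc X_mult X_dominant wb_mult_transl simp del: of_int_add)
  also have "representation (T ` WP) \<dots> (T (?t k0 m0 n0))
      = (\<Sum>(k, m, n)\<in>F. representation (T ` WP) (scale (c (k, m, n)) (T (?t k m n))) (T (?t k0 m0 n0)))"
    using T_span T_independent by (subst representation_sum) (auto simp: split_def)
  also have "\<dots> = (\<Sum>x\<in>F. if x = (k0, m0, n0) then c x else 0)"
  proof (intro sum.cong refl, safe)
    fix k m n assume "(k, m, n) \<in> F"
    then have "?t k m n = ?t k0 m0 n0 \<longleftrightarrow> (k, m, n) = (k0, m0, n0)"
      using w_elt_transl_inj[of k k0 "m + K" "n + K" "m0 + K" "n0 + K"] assms(2,4) by auto
    then show "representation (T ` WP) (scale (c (k, m, n)) (T (?t k m n))) (T (?t k0 m0 n0))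
        = (if (k, m, n) = (k0, m0, n0) then c (k, m, n) else 0)"
      using assms(2)[OF \<open>(k, m, n) \<in> F\<close>] assms(2)[OF assms(4)] WP by (simp add: rep_T del: of_int_add)
  qed
  also have "\<dots> = c (k0, m0, n0)" using assms(1,4) by simp
  finally show ?thesis ..
qed

text \<open>The matrix coefficients of all representations below are produced by this lemma.\<close>

lemma functional_exists: "\<exists>\<phi>. linf \<phi> \<and> (\<forall>k<6. \<forall>m n. \<phi> (wb k * X m n) = f k m n)"
proof -
  interpret vs: vector_space_pair scale "(*) :: complex \<Rightarrow> complex \<Rightarrow> complex"
    by unfold_locales (simp_all add: algebra_simps)
  define I :: "(nat \<times> int \<times> int) set" where "I = {(k, m, n) |k m n. k < 6}"
  define b where "b = (\<lambda>(k, m, n). wb k * X m n)"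
  have indep: "c x = 0" if "finite F" "F \<subseteq> I" "(\<Sum>x\<in>F. scale (c x) (b x)) = 0" "x \<in> F" for F c x
  proof -
    obtain k m n where x: "x = (k, m, n)" by (cases x)
    show ?thesis
      unfolding x by (rule wbX_indep[of F c]) (use that in \<open>auto simp: I_def b_def split_def x\<close>)
  qed
  have inj: "inj_on b I"
  proof (rule inj_onI, rule ccontr)
    fix x y assume xy: "x \<in> I" "y \<in> I" "b x = b y" "x \<noteq> y"
    then show False
      using indep[of "{x, y}" "\<lambda>z. if z = x then 1 else - 1" x] by (simp split: if_splits)
  qed
  have "independent (b ` I)"
  proof
    assume "dependent (b ` I)"
    then obtain S u where S: "finite S" "S \<subseteq> b ` I" "(\<Sum>v\<in>S. scale (u v) v) = 0" "\<exists>v\<in>S. u v \<noteq> 0"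
      unfolding dependent_explicit by blast
    then obtain F where F: "F \<subseteq> I" "S = b ` F" "inj_on b F"
      by (metis inj subset_image_inj inj_on_subset)
    with S have "finite F" by (simp add: finite_image_iff)
    moreover have "(\<Sum>x\<in>F. scale (u (b x)) (b x)) = 0"
      using S(3) F by (simp add: sum.reindex o_def)
    ultimately have "\<forall>x\<in>F. u (b x) = 0" using indep[of F "u \<circ> b"] F(1) by (simp add: o_apply)
    with S(4) F(2) show False by auto
  qed
  from vs.linear_independent_extend[OF this, of "\<lambda>x. case inv_into I b x of (k, m, n) \<Rightarrow> f k m n"]
  obtain \<phi> where \<phi>: "Vector_Spaces.linear scale (*) \<phi>"
      "\<forall>x\<in>b ` I. \<phi> x = (case inv_into I b x of (k, m, n) \<Rightarrow> f k m n)"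
    by blast
  have "linf \<phi>"
    using \<phi>(1) by (simp add: linf_def Vector_Spaces.linear_iff_module_hom module_hom_iff)
  moreover have "\<phi> (wb k * X m n) = f k m n" if "k < 6" for k m n
  proof -
    have "(k, m, n) \<in> I" using that by (simp add: I_def)
    then show ?thesis using \<phi>(2) inj by (auto simp: b_def dest: inv_into_f_f)
  qed
  ultimately show ?thesis by blast
qed

lemma functional_unique:
  assumes "linf f" "linf g" "\<And>k m n. k < 6 \<Longrightarrow> f (wb k * X m n) = g (wb k * X m n)"
  shows "f h = g h"
proof -
  have "h \<in> span BB" by (simp add: span_BB)
  then show ?thesis
    by (rule span_induct[where P = "\<lambda>h. f h = g h"])
      (use assms in \<open>auto simp: subspace_def linfD BB_def\<close>)
qed

section \<open>Characters of induced representations\<close>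

subsection \<open>Traces on quotients\<close>

text \<open>The family \<open>b\<close> represents a basis of the quotient by \<open>N\<close>, and
  the \<open>\<pi>\<close> are its coordinate functionals, given on the whole algebra and vanishing
  on \<open>N\<close>.\<close>

definition dual_data :: "'h set \<Rightarrow> 'i set \<Rightarrow> ('i \<Rightarrow> 'h) \<Rightarrow> ('i \<Rightarrow> 'h \<Rightarrow> complex) \<Rightarrow> bool" where
  "dual_data N I b \<pi> \<longleftrightarrow> subspace N \<and> finite I \<and> (\<forall>i\<in>I. linf (\<pi> i)) \<and> (\<forall>i\<in>I. \<forall>v\<in>N. \<pi> i v = 0)
    \<and> (\<forall>i\<in>I. \<forall>j\<in>I. \<pi> i (b j) = (if i = j then 1 else 0))
    \<and> (\<forall>v. v - (\<Sum>i\<in>I. scale (\<pi> i v) (b i)) \<in> N)"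

lemma dual_dataD:
  assumes "dual_data N I b \<pi>"
  shows "subspace N" "finite I" "i \<in> I \<Longrightarrow> linf (\<pi> i)" "i \<in> I \<Longrightarrow> v \<in> N \<Longrightarrow> \<pi> i v = 0"
    "i \<in> I \<Longrightarrow> j \<in> I \<Longrightarrow> \<pi> i (b j) = (if i = j then 1 else 0)"
    "v - (\<Sum>i\<in>I. scale (\<pi> i v) (b i)) \<in> N"
  using assms unfolding dual_data_def by blast+

lemma dual_expand:
  assumes "dual_data N I b \<pi>" "linf g" "\<And>v. v \<in> N \<Longrightarrow> g v = 0"
  shows "g v = (\<Sum>i\<in>I. \<pi> i v * g (b i))"
proof -
  have "g (v - (\<Sum>i\<in>I. scale (\<pi> i v) (b i))) = 0" using assms dual_dataD(6) by blast
  then show ?thesis using assms(2) by (simp add: linfD)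
qed

definition endo :: "'h set \<Rightarrow> ('h \<Rightarrow> 'h) \<Rightarrow> bool" where
  "endo N f \<longleftrightarrow> (\<forall>a b. f (a + b) = f a + f b) \<and> (\<forall>c a. f (scale c a) = scale c (f a)) \<and> (\<forall>v\<in>N. f v \<in> N)"

lemma linf_endo: "linf g \<Longrightarrow> endo N f \<Longrightarrow> linf (\<lambda>v. g (f v))"
  by (simp add: linf_def endo_def)

lemma dual_trace_unique:
  assumes d: "dual_data N I b \<pi>" and e: "dual_data N J c \<rho>" and f: "endo N f"
  shows "(\<Sum>j\<in>J. \<rho> j (f (c j))) = (\<Sum>i\<in>I. \<pi> i (f (b i)))"
proof -
  have "(\<Sum>j\<in>J. \<rho> j (f (c j))) = (\<Sum>j\<in>J. \<Sum>i\<in>I. \<pi> i (c j) * \<rho> j (f (b i)))"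
  proof (intro sum.cong refl)
    fix j assume j: "j \<in> J"
    show "\<rho> j (f (c j)) = (\<Sum>i\<in>I. \<pi> i (c j) * \<rho> j (f (b i)))"
      by (rule dual_expand[OF d linf_endo[OF dual_dataD(3)[OF e j] f]])
        (use dual_dataD(4)[OF e j] f in \<open>auto simp: endo_def\<close>)
  qed
  also have "\<dots> = (\<Sum>i\<in>I. \<Sum>j\<in>J. \<rho> j (f (b i)) * \<pi> i (c j))"
    by (subst sum.swap) (simp add: mult.commute)
  also have "\<dots> = (\<Sum>i\<in>I. \<pi> i (f (b i)))"
    by (intro sum.cong refl dual_expand[OF e, symmetric] dual_dataD(3,4)[OF d])
  finally show ?thesis .
qed

lemma dual_trace_commute:
  assumes d: "dual_data N I b \<pi>" and f: "endo N f" and g: "endo N g"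
  shows "(\<Sum>i\<in>I. \<pi> i (f (g (b i)))) = (\<Sum>i\<in>I. \<pi> i (g (f (b i))))"
proof -
  have e: "\<pi> i (f v) = (\<Sum>j\<in>I. \<pi> j v * \<pi> i (f (b j)))" if "i \<in> I" "endo N f" for i v f
    by (rule dual_expand[OF d linf_endo[OF dual_dataD(3)[OF d that(1)] that(2)]])
      (use dual_dataD(4)[OF d that(1)] that(2) in \<open>auto simp: endo_def\<close>)
  have "(\<Sum>i\<in>I. \<pi> i (f (g (b i)))) = (\<Sum>i\<in>I. \<Sum>j\<in>I. \<pi> j (g (b i)) * \<pi> i (f (b j)))"
    using f by (intro sum.cong refl e)
  also have "\<dots> = (\<Sum>j\<in>I. \<Sum>i\<in>I. \<pi> i (f (b j)) * \<pi> j (g (b i)))"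
    by (subst sum.swap) (simp add: mult.commute)
  also have "\<dots> = (\<Sum>j\<in>I. \<pi> j (g (f (b j))))"
    using g by (intro sum.cong refl e[symmetric])
  finally show ?thesis .
qed

lemma dual_data_exists:
  assumes N: "subspace N" and I: "finite I"
    and ex: "\<And>v. \<exists>c. v - (\<Sum>i\<in>I. scale (c i) (b i)) \<in> N"
    and uni: "\<And>c i. (\<Sum>i\<in>I. scale (c i) (b i)) \<in> N \<Longrightarrow> i \<in> I \<Longrightarrow> c i = 0"
  shows "\<exists>\<pi>. dual_data N I b \<pi>"
proof -
  obtain c where c: "\<And>v. v - (\<Sum>i\<in>I. scale (c v i) (b i)) \<in> N" using ex by metis
  have u: "c v i = d i" if "v - (\<Sum>i\<in>I. scale (d i) (b i)) \<in> N" "i \<in> I" for v d i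
  proof -
    have "(v - (\<Sum>i\<in>I. scale (d i) (b i))) - (v - (\<Sum>i\<in>I. scale (c v i) (b i))) \<in> N"
      using subspace_diff[OF N that(1) c] .
    then have "(\<Sum>i\<in>I. scale (c v i - d i) (b i)) \<in> N"
      by (simp add: scale_left_diff_distrib sum_subtractf)
    from uni[OF this that(2)] show ?thesis by simp
  qed
  have "dual_data N I b (\<lambda>i v. c v i)"
    unfolding dual_data_def
  proof (intro conjI ballI allI)
    fix i assume i: "i \<in> I"
    show "linf (\<lambda>v. c v i)"
      unfolding linf_def
    proof (intro conjI allI)
      fix a a' s
      show "c (a + a') i = c a i + c a' i"
        using subspace_add[OF N c[of a] c[of a']] i
        by (intro u) (simp_all add: scale_left_distrib sum.distrib algebra_simps)
      show "c (scale s a) i = s * c a i"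
        using subspace_scale[OF N c[of a], of s] i
        by (intro u) (simp_all add: scale_right_diff_distrib scale_sum_right)
    qed
    show "c v i = 0" if "v \<in> N" for v
      using that i by (intro u) simp_all
    show "c (b j) i = (if i = j then 1 else 0)" if "j \<in> I" for j
      using that i I subspace_0[OF N]
      by (intro u) (simp_all add: if_distrib[of "\<lambda>s. scale s _"] cong: if_cong)
  qed (use N I c in auto)
  then show ?thesis by blast
qed

lemma quot_basis_dual:
  assumes d: "dual_data N I b \<pi>"
  shows "quot_basis N (b ` I)"
proof -
  have inj: "inj_on b I"
    by (rule inj_onI) (metis dual_dataD(5)[OF d] zero_neq_one)
  show ?thesis
    unfolding quot_basis_def
  proof (intro conjI allI ex1I)
    show "finite (b ` I)" using dual_dataD(2)[OF d] by simp
    fix v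
    let ?c = "\<lambda>x. if x \<in> b ` I then \<pi> (inv_into I b x) v else 0"
    have "(\<Sum>x\<in>b ` I. scale (?c x) x) = (\<Sum>i\<in>I. scale (\<pi> i v) (b i))"
      using inj by (simp add: sum.reindex o_def inv_into_f_f cong: sum.cong)
    then show "is_quot_coords N (b ` I) v ?c"
      using dual_dataD(6)[OF d] by (simp add: is_quot_coords_def)
    fix c assume c: "is_quot_coords N (b ` I) v c"
    have *: "c (b i) = \<pi> i v" if i: "i \<in> I" for i
    proof -
      have "\<pi> i (v - (\<Sum>x\<in>b ` I. scale (c x) x)) = 0"
        using c dual_dataD(4)[OF d i] by (simp add: is_quot_coords_def)
      then have "\<pi> i v = (\<Sum>j\<in>I. c (b j) * \<pi> i (b j))"
        using dual_dataD(3)[OF d i] inj by (simp add: linfD sum.reindex o_def)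
      also have "\<dots> = (\<Sum>j\<in>I. if i = j then c (b j) else 0)"
        using dual_dataD(5)[OF d i] by (intro sum.cong) auto
      also have "\<dots> = c (b i)" using dual_dataD(2)[OF d] i by simp
      finally show ?thesis ..
    qed
    show "c = ?c"
    proof
      fix x show "c x = ?c x"
        using * c inj by (auto simp: is_quot_coords_def)
    qed
  qed
qed

text \<open>The basis inside \<open>quot_trace\<close> is an arbitrary choice. It has coordinate
  functionals as well, and two such systems give the same trace.\<close>

lemma quot_trace_dual:
  assumes d: "dual_data N I b \<pi>" and f: "endo N f"
  shows "quot_trace N f = (\<Sum>i\<in>I. \<pi> i (f (b i)))"
proof -
  define B where "B = (SOME B. quot_basis N B)"
  have B: "quot_basis N B" unfolding B_def by (rule someI, rule quot_basis_dual[OF d])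
  then have fin: "finite B" and ex1: "\<And>v. \<exists>!c. is_quot_coords N B v c"
    by (auto simp: quot_basis_def)
  have N: "subspace N" by (rule dual_dataD(1)[OF d])
  have "\<exists>\<rho>. dual_data N B (\<lambda>x. x) \<rho>"
  proof (rule dual_data_exists[OF N fin])
    fix v
    show "\<exists>c. v - (\<Sum>i\<in>B. scale (c i) i) \<in> N"
      using ex1[of v] by (auto simp: is_quot_coords_def)
  next
    fix c i assume c: "(\<Sum>i\<in>B. scale (c i) i) \<in> N" "i \<in> B"
    have "is_quot_coords N B 0 (\<lambda>i. if i \<in> B then c i else 0)"
      using subspace_neg[OF N c(1)] by (simp add: is_quot_coords_def)
    moreover have "is_quot_coords N B 0 (\<lambda>i. 0)"
      using subspace_0[OF N] by (simp add: is_quot_coords_def)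
    ultimately have "(\<lambda>i. if i \<in> B then c i else 0) = (\<lambda>i. 0)" using ex1[of 0] by blast
    then show "c i = 0" using c(2) by (metis (full_types))
  qed
  then obtain \<rho> where \<rho>: "dual_data N B (\<lambda>x. x) \<rho>" by blast
  have coords: "quot_coords N B v = (\<lambda>i. if i \<in> B then \<rho> i v else 0)" for v
  proof -
    have "is_quot_coords N B v (\<lambda>i. if i \<in> B then \<rho> i v else 0)"
      using dual_dataD(6)[OF \<rho>, of v] by (simp add: is_quot_coords_def)
    then show ?thesis unfolding quot_coords_def using ex1[of v] by (metis (mono_tags) the1_equality)
  qed
  have "quot_trace N f = (\<Sum>x\<in>B. \<rho> x (f x))"
    unfolding quot_trace_def B_def[symmetric] Let_def by (simp add: coords)
  also have "\<dots> = (\<Sum>i\<in>I. \<pi> i (f (b i)))"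
    by (rule dual_trace_unique[OF d \<rho> f])
  finally show ?thesis .
qed

text \<open>A family that spans the quotient and has as many members as a basis is itself a
  basis.\<close>

lemma dual_data_spanning:
  assumes d: "dual_data N I b \<pi>"
    and ex: "\<And>j. j \<in> I \<Longrightarrow> \<exists>c. b j - (\<Sum>i\<in>I. scale (c i) (b' i)) \<in> N"
  shows "\<exists>\<pi>'. dual_data N I b' \<pi>'"
proof (rule dual_data_exists)
  show N: "subspace N" and I: "finite I" by (rule dual_dataD[OF d])+
  obtain C where C: "\<And>j. j \<in> I \<Longrightarrow> b j - (\<Sum>i\<in>I. scale (C j i) (b' i)) \<in> N" using ex by metis
  show "\<exists>c. v - (\<Sum>i\<in>I. scale (c i) (b' i)) \<in> N" for v
  proof (rule exI)
    have "(v - (\<Sum>j\<in>I. scale (\<pi> j v) (b j)))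
        + (\<Sum>j\<in>I. scale (\<pi> j v) (b j - (\<Sum>i\<in>I. scale (C j i) (b' i)))) \<in> N"
      by (intro subspace_add[OF N] subspace_sum[OF N] subspace_scale[OF N] C dual_dataD(6)[OF d])
    also have "(v - (\<Sum>j\<in>I. scale (\<pi> j v) (b j)))
        + (\<Sum>j\<in>I. scale (\<pi> j v) (b j - (\<Sum>i\<in>I. scale (C j i) (b' i))))
        = v - (\<Sum>j\<in>I. \<Sum>i\<in>I. scale (\<pi> j v * C j i) (b' i))"
      by (simp add: scale_right_diff_distrib sum_subtractf scale_sum_right)
    also have "(\<Sum>j\<in>I. \<Sum>i\<in>I. scale (\<pi> j v * C j i) (b' i))
        = (\<Sum>i\<in>I. scale (\<Sum>j\<in>I. \<pi> j v * C j i) (b' i))"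
      by (subst sum.swap) (simp add: scale_sum_left)
    finally show "v - (\<Sum>i\<in>I. scale (\<Sum>j\<in>I. \<pi> j v * C j i) (b' i)) \<in> N" .
  qed
  show "c k = 0" if c: "(\<Sum>i\<in>I. scale (c i) (b' i)) \<in> N" and k: "k \<in> I" for c k
  proof (rule ccontr)
    assume ck: "c k \<noteq> 0"
    \<comment> \<open>\<open>pr\<close> is the projection along \<open>N\<close> onto the span of
      \<open>b\<close>. It turns relations modulo \<open>N\<close> into genuine ones, so that the
      dimension bound for spans applies.\<close>
    define pr where "pr v = (\<Sum>i\<in>I. scale (\<pi> i v) (b i))" for v
    have pr_add: "pr (u + v) = pr u + pr v" and pr_scale: "pr (scale s v) = scale s (pr v)" for u v s
      unfolding pr_def using dual_dataD(3)[OF d]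
      by (simp_all add: linfD scale_left_distrib sum.distrib scale_sum_right)
    have pr_0: "pr 0 = 0" using pr_scale[of 0 0] by simp
    have pr_sum: "pr (\<Sum>i\<in>J. scale (e i) (b' i)) = (\<Sum>i\<in>J. scale (e i) (pr (b' i)))" for e J
      by (induction J rule: infinite_finite_induct) (simp_all add: pr_0 pr_add pr_scale)
    have pr_N: "pr v = 0" if "v \<in> N" for v
      unfolding pr_def using dual_dataD(4)[OF d _ that] by simp
    have pr_b: "pr (b j) = b j" if "j \<in> I" for j
      unfolding pr_def using dual_dataD(5)[OF d _ that] I that
      by (simp add: if_distrib[of "\<lambda>s. scale s _"] cong: if_cong)
    let ?S = "span ((\<lambda>i. pr (b' i)) ` (I - {k}))"
    have "0 = (\<Sum>i\<in>I. scale (c i) (pr (b' i)))" using pr_N[OF c] by (simp add: pr_sum)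
    also have "\<dots> = scale (c k) (pr (b' k)) + (\<Sum>i\<in>I - {k}. scale (c i) (pr (b' i)))"
      using I k by (simp add: sum.remove)
    finally have "scale (c k) (pr (b' k)) = - (\<Sum>i\<in>I - {k}. scale (c i) (pr (b' i)))"
      by (simp add: eq_neg_iff_add_eq_0)
    also have "\<dots> \<in> ?S" by (intro span_neg span_sum span_scale span_base) auto
    finally have "scale (1 / c k) (scale (c k) (pr (b' k))) \<in> ?S" by (rule span_scale)
    then have k': "pr (b' k) \<in> ?S" using ck by simp
    have S: "pr (b' i) \<in> ?S" if "i \<in> I" for i
      using k' that by (cases "i = k") (auto intro: span_base)
    have "b ` I \<subseteq> ?S"
    proof (rule image_subsetI)
      fix j assume j: "j \<in> I"
      have "pr (b j) = pr ((b j - (\<Sum>i\<in>I. scale (C j i) (b' i))) + (\<Sum>i\<in>I. scale (C j i) (b' i)))"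
        by simp
      also have "\<dots> = (\<Sum>i\<in>I. scale (C j i) (pr (b' i)))"
        unfolding pr_add pr_N[OF C[OF j]] pr_sum by simp
      also have "\<dots> \<in> ?S" by (intro span_sum span_scale S)
      finally show "b j \<in> ?S" by (simp add: pr_b j)
    qed
    moreover have inj: "inj_on b I"
      by (rule inj_onI) (metis dual_dataD(5)[OF d] zero_neq_one)
    moreover have "independent (b ` I)"
      unfolding independent_explicit_finite_subsets
    proof (intro allI impI ballI)
      fix S u v assume S: "S \<subseteq> b ` I" "finite S" "(\<Sum>v\<in>S. scale (u v) v) = 0" "v \<in> S"
      then obtain J where J: "J \<subseteq> I" "S = b ` J" "inj_on b J"
        by (metis inj subset_image_inj inj_on_subset)
      then obtain i where i: "i \<in> J" "v = b i" using S by blast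
      have "0 = \<pi> i (\<Sum>v\<in>S. scale (u v) v)"
        using dual_dataD(3)[OF d, of i] S(3) i J by (simp add: linfD subset_iff)
      also have "\<dots> = (\<Sum>j\<in>J. u (b j) * \<pi> i (b j))"
        using dual_dataD(3)[OF d, of i] i J by (simp add: linfD subset_iff sum.reindex o_def)
      also have "\<dots> = (\<Sum>j\<in>J. if i = j then u (b j) else 0)"
        using dual_dataD(5)[OF d subsetD[OF J(1) i(1)]] J(1) by (intro sum.cong) auto
      also have "\<dots> = u v" using i J I by (simp add: finite_subset)
      finally show "u v = 0" ..
    qed
    ultimately have "card (b ` I) \<le> card ((\<lambda>i. pr (b' i)) ` (I - {k}))"
      using I by (intro independent_span_bound[THEN conjunct2]) auto
    also have "\<dots> \<le> card (I - {k})" using I by (intro card_image_le) auto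
    also have "\<dots> < card I" using I k by (intro psubset_card_mono) auto
    finally show False using inj by (simp add: card_image)
  qed
qed

subsection \<open>Characters induced from subalgebras\<close>

lemma subspace_tensor_relations: "subspace (tensor_relations A \<theta>)"
  by (simp add: tensor_relations_def)

lemma endo_mult: "endo (tensor_relations A \<theta>) (\<lambda>v. h * v)"
  unfolding endo_def
proof (intro conjI allI ballI)
  fix v assume v: "v \<in> tensor_relations A \<theta>"
  have "h * b \<in> tensor_relations A \<theta>" if b: "b \<in> {h * a - scale (\<theta> a) h |h a. a \<in> A}" for b
  proof -
    obtain g a where "b = g * a - scale (\<theta> a) g" "a \<in> A" using b by blast
    then have "h * b = (h * g) * a - scale (\<theta> a) (h * g)" "a \<in> A"
      by (simp_all add: right_diff_distrib scale_mult mult.assoc)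
    then show ?thesis unfolding tensor_relations_def by (intro span_base) blast
  qed
  from span_map[where f = "\<lambda>v. h * v" and B = "{h * a - scale (\<theta> a) h |h a. a \<in> A}" and h = v,
      OF _ _ subspace_tensor_relations this] v
  show "h * v \<in> tensor_relations A \<theta>"
    by (simp add: tensor_relations_def distrib_left scale_mult)
qed (simp_all add: distrib_left scale_mult)

lemma induced_char_dual:
  "dual_data (tensor_relations A \<theta>) I b \<pi> \<Longrightarrow> induced_char A \<theta> h = (\<Sum>i\<in>I. \<pi> i (h * b i))"
  unfolding induced_char_def by (rule quot_trace_dual[OF _ endo_mult])

lemma induced_char_tracial:
  assumes "dual_data (tensor_relations A \<theta>) I b \<pi>"
  shows "induced_char A \<theta> (g * h) = induced_char A \<theta> (h * g)"
  using dual_trace_commute[OF assms endo_mult endo_mult, of g h]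
  by (simp add: induced_char_dual[OF assms] mult.assoc)

lemma induced_char_linf:
  assumes d: "dual_data (tensor_relations A \<theta>) I b \<pi>"
  shows "linf (induced_char A \<theta>)"
  using dual_dataD(3)[OF d]
  by (simp add: linf_def induced_char_dual[OF d] distrib_right scale_mult sum.distrib sum_distrib_left)

text \<open>Functionals that transform by \<open>\<theta>\<close> under right multiplication by
  \<open>A\<close> kill the tensor relations. The last hypothesis says that the \<open>b\<close>
  span, since a product b_j a is congruent to a multiple of b_j.\<close>

lemma induced_dual_data:
  assumes I: "finite I" and lin: "\<And>i. i \<in> I \<Longrightarrow> linf (\<pi> i)"
    and A: "\<And>i h a. i \<in> I \<Longrightarrow> a \<in> A \<Longrightarrow> \<pi> i (h * a) = \<pi> i h * \<theta> a"
    and b: "\<And>i j. i \<in> I \<Longrightarrow> j \<in> I \<Longrightarrow> \<pi> i (b j) = (if i = j then 1 else 0)"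
    and wbX: "\<And>k m n. k < 6 \<Longrightarrow> \<exists>j\<in>I. \<exists>a\<in>A. wb k * X m n = b j * a"
  shows "dual_data (tensor_relations A \<theta>) I b \<pi>"
  unfolding dual_data_def
proof (intro conjI ballI allI)
  show "subspace (tensor_relations A \<theta>)" by (rule subspace_tensor_relations)
  fix i v assume i: "i \<in> I" and v: "v \<in> tensor_relations A \<theta>"
  show "\<pi> i v = 0"
    by (rule span_induct[OF v[unfolded tensor_relations_def], where P = "\<lambda>v. \<pi> i v = 0"])
      (use lin[OF i] A[OF i] in \<open>auto simp: subspace_def linfD\<close>)
next
  fix v
  let ?f = "\<lambda>v. v - (\<Sum>i\<in>I. scale (\<pi> i v) (b i))"
  have v: "v \<in> span BB" by (simp add: span_BB)
  show "?f v \<in> tensor_relations A \<theta>"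
  proof (rule span_map[where f = ?f, OF _ _ subspace_tensor_relations _ v])
    fix x y and c
    show "?f (x + y) = ?f x + ?f y" "?f (scale c x) = scale c (?f x)"
      using lin by (simp_all add: linfD scale_left_distrib sum.distrib scale_right_diff_distrib scale_sum_right algebra_simps)
    assume "x \<in> BB"
    then obtain k m n where x: "x = wb k * X m n" "k < 6" unfolding BB_def by blast
    then obtain j a where ja: "j \<in> I" "a \<in> A" "x = b j * a" using wbX by metis
    have "(\<Sum>i\<in>I. scale (\<pi> i x) (b i)) = (\<Sum>i\<in>I. if i = j then scale (\<theta> a) (b i) else 0)"
      using ja by (intro sum.cong) (auto simp: A b)
    also have "\<dots> = scale (\<theta> a) (b j)" using I ja by simp
    finally have "?f x = b j * a - scale (\<theta> a) (b j)" using ja by simp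
    also have "\<dots> \<in> tensor_relations A \<theta>"
      unfolding tensor_relations_def using ja(2) by (intro span_base) blast
    finally show "?f x \<in> tensor_relations A \<theta>" .
  qed
qed (use assms in auto)

text \<open>The elements through which all \<open>\<rho> i\<close> factor by the character \<open>\<theta>\<close> form a subalgebra, on
  which \<open>\<theta>\<close> is multiplicative; this gives all the homomorphisms that are needed.\<close>

definition factor_alg :: "'i set \<Rightarrow> ('i \<Rightarrow> 'h \<Rightarrow> complex) \<Rightarrow> ('h \<Rightarrow> complex) \<Rightarrow> 'h set" where
  "factor_alg I \<rho> \<theta> = {a. \<forall>h. \<forall>i\<in>I. \<rho> i (h * a) = \<rho> i h * \<theta> a}"

lemma factor_alg_subalgebra:
  assumes lin: "\<And>i. i \<in> I \<Longrightarrow> linf (\<rho> i)" and i0: "i0 \<in> I" "\<rho> i0 = \<theta>" "\<theta> 1 = 1"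
  shows "subalgebra (factor_alg I \<rho> \<theta>)" "alg_hom_on (factor_alg I \<rho> \<theta>) \<theta>"
proof -
  have \<theta>: "linf \<theta>" using lin[OF i0(1)] i0(2) by simp
  have m: "\<theta> (a * b) = \<theta> a * \<theta> b" if "b \<in> factor_alg I \<rho> \<theta>" for a b
    using that i0 by (auto simp: factor_alg_def)
  show "alg_hom_on (factor_alg I \<rho> \<theta>) \<theta>"
    using \<theta> m i0(3) by (simp add: alg_hom_on_def linfD)
  have z: "\<rho> i 0 = 0" if "i \<in> I" for i using lin[OF that] by (simp add: linfD)
  have "\<rho> i (h * (a * b)) = \<rho> i h * \<theta> (a * b)"
    if "a \<in> factor_alg I \<rho> \<theta>" "b \<in> factor_alg I \<rho> \<theta>" "i \<in> I" for a b h i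
  proof -
    have "\<rho> i (h * (a * b)) = \<rho> i ((h * a) * b)" by (simp add: mult.assoc)
    also have "\<dots> = \<rho> i (h * a) * \<theta> b" using that unfolding factor_alg_def by blast
    also have "\<rho> i (h * a) = \<rho> i h * \<theta> a" using that unfolding factor_alg_def by blast
    finally show ?thesis by (simp add: m[OF that(2)])
  qed
  then show "subalgebra (factor_alg I \<rho> \<theta>)"
    using lin \<theta> i0(3) z
    by (auto simp: subalgebra_def subspace_def factor_alg_def linfD distrib_left scale_mult algebra_simps)
qed

lemma alg_hom_X:
  assumes hom: "alg_hom_on A \<theta>" and A: "\<And>m n. X m n \<in> A"
  shows "\<theta> (X m n) = \<theta> (X 1 0) powi m * \<theta> (X 0 1) powi n" "\<theta> (X 1 0) \<noteq> 0" "\<theta> (X 0 1) \<noteq> 0"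
proof -
  have mult: "\<theta> (X m n) * \<theta> (X m' n') = \<theta> (X (m + m') (n + n'))" for m n m' n'
    using hom A by (simp add: alg_hom_on_def X_mult[symmetric])
  have one: "\<theta> (X 0 0) = 1" using hom by (simp add: alg_hom_on_def)
  show nz: "\<theta> (X 1 0) \<noteq> 0" "\<theta> (X 0 1) \<noteq> 0"
    using mult[of 1 0 "-1" 0] mult[of 0 1 0 "-1"] one by auto
  have pw: "f m = f 1 powi m" if f: "\<And>m n. f m * f n = f (m + n)" "f 0 = 1" for f :: "int \<Rightarrow> complex" and m
  proof (induction m rule: int_induct[where k = 0])
    case base
    show ?case by (simp add: f(2))
  next
    case (step1 i)
    have "f 1 \<noteq> 0" using f(1)[of 1 "-1"] f(2) by auto
    then show ?case using f(1)[of i 1] step1 by (simp add: power_int_add)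
  next
    case (step2 i)
    have nz: "f 1 \<noteq> 0" using f(1)[of 1 "-1"] f(2) by auto
    have "f (i - 1) * f 1 = f i" using f(1)[of "i - 1" 1] by simp
    with nz step2 show ?case by (simp add: power_int_diff field_simps)
  qed
  have "\<theta> (X m n) = \<theta> (X m 0) * \<theta> (X 0 n)" by (simp add: mult)
  also have "\<theta> (X m 0) = \<theta> (X 1 0) powi m" using one by (intro pw[of "\<lambda>m. \<theta> (X m 0)"]) (simp_all add: mult)
  also have "\<theta> (X 0 n) = \<theta> (X 0 1) powi n" using one by (intro pw[of "\<lambda>m. \<theta> (X 0 m)"]) (simp_all add: mult)
  finally show "\<theta> (X m n) = \<theta> (X 1 0) powi m * \<theta> (X 0 1) powi n" .
qed

lemma linf_mult_right: "linf f \<Longrightarrow> linf (\<lambda>h. f (h * a))"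
  and linf_mult_const: "linf f \<Longrightarrow> linf (\<lambda>h. f h * c)"
  by (simp_all add: linf_def distrib_right scale_mult)

lemma functional_X:
  assumes "linf f" "t1 \<noteq> 0" "t2 \<noteq> 0"
    "\<And>k m n. k < 6 \<Longrightarrow> f (wb k * X m n) = c k * t1 powi m * t2 powi n"
  shows "f (h * X m n) = f h * (t1 powi m * t2 powi n)"
proof (rule functional_unique[of "\<lambda>h. f (h * X m n)" "\<lambda>h. f h * (t1 powi m * t2 powi n)"])
  fix k i j assume "k < (6::nat)"
  then show "f (wb k * X i j * X m n) = f (wb k * X i j) * (t1 powi m * t2 powi n)"
    using assms(2,3) by (simp add: mult.assoc X_mult assms(4) power_int_add mult.left_commute)
qed (rule linf_mult_right linf_mult_const assms)+

definition \<tau> :: complex where "\<tau> = - of_real (q powr (-1/2))"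

text \<open>The first identity is the consistency condition behind \<open>functional_T_aux\<close>;
  the second makes \<open>\<tau>\<close> a root of the quadratic relation.\<close>

lemma \<tau>_Q: "\<tau> * of_real q + Q = \<tau>" "\<tau> * \<tau> = 1 + Q * \<tau>" "\<tau> \<noteq> 0"
proof -
  have "q powr (-1/2) * q = q powr (1/2)" "q powr (-1/2) * q powr (1/2) = 1"
    using q_gt1 powr_add[of q "-1/2" 1] powr_add[of q "-1/2" "1/2"] by simp_all
  then have "of_real (q powr (-1/2)) * of_real q = (of_real (q powr (1/2)) :: complex)"
    "of_real (q powr (-1/2)) * of_real (q powr (1/2)) = (1 :: complex)"
    unfolding of_real_mult[symmetric] by simp_all
  then show "\<tau> * of_real q + Q = \<tau>" "\<tau> * \<tau> = 1 + Q * \<tau>"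
    by (simp_all add: \<tau>_def Q_def algebra_simps)
  show "\<tau> \<noteq> 0" using q_gt1 by (simp add: \<tau>_def)
qed

text \<open>Because z2 = q z1^2, commuting \<open>t\<close> past \<open>Y 1 0\<close> turns the
  eigenvalue equation at one weight into a nonzero multiple of the equation at the neighbouring one.
  It therefore propagates from \<open>h\<close> along the whole lattice in both directions.\<close>

lemma functional_T_aux:
  fixes Y :: "int \<Rightarrow> int \<Rightarrow> 'h"
  assumes f: "linf f" and s: "z1 \<noteq> 0" "z2 = of_real q * z1 ^ 2"
    and Y: "\<And>a b c d. Y a b * Y c d = Y (a + c) (b + d)" "Y 0 0 = 1"
    and fY: "\<And>h m n. f (h * Y m n) = f h * (z1 powi m * z2 powi n)"
    and t0: "\<And>l. Y 0 l * t = t * Y 0 l"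
    and t1: "Y 1 0 * t = t * Y (-1) 1 + scale Q (Y 1 0)"
    and h: "f (h * t) = f h * \<tau>"
  shows "f (h * Y m n * t) = f (h * Y m n) * \<tau>"
proof -
  have q0: "of_real q \<noteq> (0::complex)" using q_gt1 by simp
  have step: "f (g * Y 1 0 * t) = f (g * Y 1 0) * \<tau> \<longleftrightarrow> f (g * t) = f g * \<tau>" for g
  proof -
    have "f (g * Y 1 0 * t) = f ((g * t) * Y (-1) 1) + Q * f (g * Y 1 0)"
      using f by (simp add: mult.assoc t1 distrib_left scale_mult linfD)
    also have "\<dots> = z1 * (of_real q * f (g * t) + Q * f g)"
      unfolding fY using s by (simp add: power_int_minus power2_eq_square field_simps)
    finally have "f (g * Y 1 0 * t) = f (g * Y 1 0) * \<tau> \<longleftrightarrow> of_real q * f (g * t) + Q * f g = f g * \<tau>"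
      using s by (simp add: fY mult_ac)
    also have "f g * \<tau> = f g * (\<tau> * of_real q + Q)" by (simp add: \<tau>_Q)
    also have "of_real q * f (g * t) + Q * f g = f g * (\<tau> * of_real q + Q) \<longleftrightarrow> of_real q * (f (g * t) - f g * \<tau>) = 0"
      by (simp add: algebra_simps)
    finally show ?thesis using q0 by simp
  qed
  have "f (h * Y m 0 * t) = f (h * Y m 0) * \<tau>"
  proof (induction m rule: int_induct[where k = 0])
    case base
    show ?case by (simp add: Y h)
  next
    case (step1 i)
    then show ?case using step[of "h * Y i 0"] by (simp add: mult.assoc Y(1) add.commute)
  next
    case (step2 i)
    then show ?case using step[of "h * Y (i - 1) 0"] by (simp add: mult.assoc Y(1))
  qed
  then have "f ((h * Y m 0 * t) * Y 0 n) = f ((h * Y m 0) * Y 0 n) * \<tau>"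
    unfolding fY[of "h * Y m 0 * t"] fY[of "h * Y m 0" 0] by simp
  moreover have "h * Y m n * t = (h * Y m 0 * t) * Y 0 n"
    using Y(1)[of m 0 0 n] by (simp add: mult.assoc t0[symmetric]) (simp add: mult.assoc[symmetric])
  ultimately show ?thesis using Y(1)[of m 0 0 n] by (simp add: mult.assoc)
qed

lemma functional_T1:
  assumes "linf f" "t1 \<noteq> 0" "t2 = of_real q * t1 ^ 2"
    "\<And>k m n. k < 6 \<Longrightarrow> f (wb k * X m n) = c k * t1 powi m * t2 powi n"
    "\<And>k. k < 6 \<Longrightarrow> f (wb k * T1) = f (wb k) * \<tau>"
  shows "f (h * T1) = f h * \<tau>"
proof (rule functional_unique[of "\<lambda>h. f (h * T1)" "\<lambda>h. f h * \<tau>"])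
  have "t2 \<noteq> 0" using assms(2,3) q_gt1 by simp
  note fX = functional_X[OF assms(1,2) this assms(4)]
  fix k m n assume "k < (6::nat)"
  then show "f (wb k * X m n * T1) = f (wb k * X m n) * \<tau>"
    by (intro functional_T_aux[OF assms(1-3) X_mult X_0 fX bernstein1(3,1) assms(5)])
qed (rule linf_mult_right linf_mult_const assms(1))+

lemma functional_T2:
  assumes "linf f" "t2 \<noteq> 0" "t1 = of_real q * t2 ^ 2"
    "\<And>k m n. k < 6 \<Longrightarrow> f (wb k * X m n) = c k * t1 powi m * t2 powi n"
    "\<And>k. k < 6 \<Longrightarrow> f (wb k * T2) = f (wb k) * \<tau>"
  shows "f (h * T2) = f h * \<tau>"
proof (rule functional_unique[of "\<lambda>h. f (h * T2)" "\<lambda>h. f h * \<tau>"])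
  have "t1 \<noteq> 0" using assms(2,3) q_gt1 by simp
  have fX: "f (h * X n m) = f h * (t2 powi m * t1 powi n)" for h m n
    using functional_X[OF assms(1) \<open>t1 \<noteq> 0\<close> assms(2,4)] by (simp add: mult_ac)
  fix k m n assume "k < (6::nat)"
  then show "f (wb k * X m n * T2) = f (wb k * X m n) * \<tau>"
    by (intro functional_T_aux[of f t2 t1 "\<lambda>m n. X n m", OF assms(1-3) X_mult X_0 fX bernstein2(3,1) assms(5)])
qed (rule linf_mult_right linf_mult_const assms(1))+

subsection \<open>The representations of the Plancherel formula\<close>

definition wfun :: "(nat \<Rightarrow> complex) \<Rightarrow> complex \<Rightarrow> complex \<Rightarrow> 'h \<Rightarrow> complex" where
  "wfun c t1 t2 = (SOME \<phi>. linf \<phi> \<and> (\<forall>k<6. \<forall>m n. \<phi> (wb k * X m n) = c k * t1 powi m * t2 powi n))"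

lemma wfun: "linf (wfun c t1 t2)" "k < 6 \<Longrightarrow> wfun c t1 t2 (wb k * X m n) = c k * t1 powi m * t2 powi n"
proof -
  have "linf (wfun c t1 t2) \<and> (\<forall>k<6. \<forall>m n. wfun c t1 t2 (wb k * X m n) = c k * t1 powi m * t2 powi n)"
    unfolding wfun_def by (rule someI_ex[OF functional_exists])
  then show "linf (wfun c t1 t2)" "k < 6 \<Longrightarrow> wfun c t1 t2 (wb k * X m n) = c k * t1 powi m * t2 powi n"
    by blast+
qed

lemma wfun_wb: "k < 6 \<Longrightarrow> wfun c t1 t2 (wb k) = c k"
  using wfun(2)[of k c t1 t2 0 0] by simp

lemma wfun_X: "t1 \<noteq> 0 \<Longrightarrow> t2 \<noteq> 0 \<Longrightarrow> wfun c t1 t2 (h * X m n) = wfun c t1 t2 h * (t1 powi m * t2 powi n)"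
  by (rule functional_X[OF wfun(1) _ _ wfun(2)])

lemma alg_hom_on_subset: "alg_hom_on B \<theta> \<Longrightarrow> A \<subseteq> B \<Longrightarrow> alg_hom_on A \<theta>"
  unfolding alg_hom_on_def by blast

lemma subalgebra_hull: "subalgebra (subalgebra hull S)"
  by (rule hull_in) (auto simp: subalgebra_def intro!: subspace_Inter)

lemma subalgebra_agree:
  assumes "subalgebra A" "alg_hom_on A \<theta>" "alg_hom_on A \<theta>'"
  shows "subalgebra {a \<in> A. \<theta> a = \<theta>' a}"
proof -
  have "\<theta> 0 = 0" "\<theta>' 0 = 0"
    using assms unfolding alg_hom_on_def subalgebra_def by (metis mult_zero_left scale_zero_left)+
  then show ?thesis using assms by (auto simp: subalgebra_def alg_hom_on_def subspace_def)
qed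

lemma subalgebra_CP: "subalgebra CP"
proof -
  have 1: "X m n * y \<in> CP" if y: "y \<in> CP" for m n y
  proof -
    have "X m n * b \<in> CP" if "b \<in> range (\<lambda>(m, n). X m n)" for b
      using that by (auto simp: X_mult CP_base)
    from span_map[where f = "\<lambda>y. X m n * y", OF _ _ subspace_CP this y[unfolded CP_eq]]
    show ?thesis by (simp add: distrib_left scale_mult)
  qed
  have "z * y \<in> CP" if z: "z \<in> CP" and y: "y \<in> CP" for y z
  proof -
    have "b * y \<in> CP" if "b \<in> range (\<lambda>(m, n). X m n)" for b
      using that 1[OF y] by auto
    from span_map[where f = "\<lambda>z. z * y", OF _ _ subspace_CP this z[unfolded CP_eq]]
    show ?thesis by (simp add: distrib_right scale_mult)
  qed
  then show ?thesis using subspace_CP CP_base[of 0 0] by (auto simp: subalgebra_def)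
qed

definition \<theta>P :: "complex \<times> complex \<Rightarrow> 'h \<Rightarrow> complex" where
  "\<theta>P t = (SOME \<theta>. alg_hom_on CP \<theta> \<and> \<theta> (x omega1) = fst t \<and> \<theta> (x omega2) = snd t)"

abbreviation \<pi>P :: "complex \<times> complex \<Rightarrow> nat \<Rightarrow> 'h \<Rightarrow> complex" where
  "\<pi>P t i \<equiv> wfun (\<lambda>k. if k = i then 1 else 0) (fst t) (snd t)"

lemma chi_eq: "chi t = induced_char CP (\<theta>P t)"
  by (simp add: chi_def \<theta>P_def)

text \<open>Functional number 0 restricts to a homomorphism on \<open>CP\<close> with the required
  values, so the choice in \<open>\<theta>P\<close> is possible; agreement on the
  \<open>X m n\<close> shows that it is unique on \<open>CP\<close>.\<close>

lemma principal_dual: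
  assumes t: "fst t \<noteq> 0" "snd t \<noteq> 0"
  shows "dual_data (tensor_relations CP (\<theta>P t)) {..<6} wb (\<pi>P t)"
    "a \<in> CP \<Longrightarrow> \<theta>P t a = \<pi>P t 0 a"
proof -
  let ?G = "factor_alg {..<6} (\<pi>P t) (\<pi>P t 0)"
  have X1: "\<pi>P t 0 (X m n) = fst t powi m * snd t powi n" for m n
    using wfun(2)[of 0 _ _ _ m n] by simp
  have G: "subalgebra ?G" "alg_hom_on ?G (\<pi>P t 0)"
    using X1[of 0 0] by (intro factor_alg_subalgebra[where ?i0.0 = 0]; simp add: wfun)+
  have XG: "X m n \<in> ?G" for m n
    using t by (simp add: factor_alg_def wfun_X X1)
  have sub: "CP \<subseteq> ?G" unfolding CP_eq
    using XG G(1) by (intro span_minimal) (auto simp: subalgebra_def)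
  have hom: "alg_hom_on CP (\<pi>P t 0)" by (rule alg_hom_on_subset[OF G(2) sub])
  have \<theta>: "alg_hom_on CP (\<theta>P t) \<and> \<theta>P t (x omega1) = fst t \<and> \<theta>P t (x omega2) = snd t"
    unfolding \<theta>P_def by (rule someI[of _ "\<pi>P t 0"]) (simp add: hom x_omega X1)
  have agree: "\<theta>P t a = \<pi>P t 0 a" if "a \<in> CP" for a
  proof -
    have "subspace {a \<in> CP. \<theta>P t a = \<pi>P t 0 a}"
      using subalgebra_agree[OF subalgebra_CP _ hom] \<theta> by (auto simp: subalgebra_def)
    moreover have "X m n \<in> {a \<in> CP. \<theta>P t a = \<pi>P t 0 a}" for m n
      using alg_hom_X(1)[OF conjunct1[OF \<theta>] CP_base, of m n] \<theta> by (simp add: CP_base X1 x_omega)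
    ultimately have "CP \<subseteq> {a \<in> CP. \<theta>P t a = \<pi>P t 0 a}"
      unfolding CP_eq by (intro span_minimal) auto
    then show ?thesis using that by blast
  qed
  then show "a \<in> CP \<Longrightarrow> \<theta>P t a = \<pi>P t 0 a" .
  show "dual_data (tensor_relations CP (\<theta>P t)) {..<6} wb (\<pi>P t)"
  proof (rule induced_dual_data)
    fix i h a assume "i \<in> {..<6::nat}" "a \<in> CP"
    then show "\<pi>P t i (h * a) = \<pi>P t i h * \<theta>P t a"
      using sub agree by (auto simp: factor_alg_def)
  next
    fix k m n assume "k < (6::nat)"
    then show "\<exists>j\<in>{..<6}. \<exists>a\<in>CP. wb k * X m n = wb j * a"
      using CP_base by blast
  qed (auto simp: wfun wfun_wb)
qed

definition cb :: "nat \<Rightarrow> 'h" where "cb i = [1, T2, T1 * T2] ! i"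

lemma cb_simps [simp]: "cb 0 = 1" "cb (Suc 0) = T2" "cb 1 = T2" "cb 2 = T1 * T2"
  by (simp_all add: cb_def)

lemma less3_cases: "(i::nat) < 3 \<longleftrightarrow> i = 0 \<or> i = 1 \<or> i = 2"
  by auto

definition \<theta>S :: "complex \<Rightarrow> 'h \<Rightarrow> complex" where
  "\<theta>S s = (SOME \<theta>. alg_hom_on H1 \<theta> \<and> \<theta> (T s1) = - of_real (q powr (-1/2)) \<and>
        \<theta> (x omega1) = of_real (q powr (-1/2)) * s \<and> \<theta> (x omega2) = s ^ 2)"

text \<open>As \<open>wb (2 * i + 1)\<close> is \<open>cb i * T1\<close>, its coordinate at
  \<open>cb i\<close> is \<open>\<tau>\<close>, which accounts for \<open>k div 2\<close> and
  \<open>k mod 2\<close>.\<close>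

abbreviation \<pi>S :: "complex \<Rightarrow> nat \<Rightarrow> 'h \<Rightarrow> complex" where
  "\<pi>S s i \<equiv> wfun (\<lambda>k. if k div 2 = i then \<tau> ^ (k mod 2) else 0) (of_real (q powr (-1/2)) * s) (s ^ 2)"

lemma chi1_eq: "chi1 s = induced_char H1 (\<theta>S s)"
  by (simp add: chi1_def \<theta>S_def)

lemma H1_props: "subalgebra H1" "T1 \<in> H1" "X m n \<in> H1"
proof -
  show H: "subalgebra H1" unfolding H1_def by (rule subalgebra_hull)
  have gens: "{T1, X 1 0, X (-1) 0, X 0 1, X 0 (-1)} \<subseteq> H1"
    unfolding H1_def x_omega by (rule hull_subset)
  then show "T1 \<in> H1" by simp
  have mult: "a * b \<in> H1" if "a \<in> H1" "b \<in> H1" for a b using H that by (simp add: subalgebra_def)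
  have one: "1 \<in> H1" using H by (simp add: subalgebra_def)
  have "X m 0 \<in> H1" for m
  proof (induction m rule: int_induct[where k = 0])
    case (step1 i)
    then show ?case using mult[of "X i 0" "X 1 0"] gens by (simp add: X_mult)
  next
    case (step2 i)
    then show ?case using mult[of "X i 0" "X (-1) 0"] gens by (simp add: X_mult)
  qed (simp add: one)
  moreover have "X 0 m \<in> H1" for m
  proof (induction m rule: int_induct[where k = 0])
    case (step1 i)
    then show ?case using mult[of "X 0 i" "X 0 1"] gens by (simp add: X_mult)
  next
    case (step2 i)
    then show ?case using mult[of "X 0 i" "X 0 (-1)"] gens by (simp add: X_mult)
  qed (simp add: one)
  ultimately show "X m n \<in> H1" using mult[of "X m 0" "X 0 n"] by (simp add: X_mult)
qed

lemma rt_q: "of_real q * of_real (q powr (-1/2)) ^ 2 = (1::complex)"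
proof -
  have "q * (q powr (-1/2)) ^ 2 = q * (q powr (-1/2 + -1/2))"
    unfolding powr_add power2_eq_square by simp
  also have "\<dots> = 1" using q_gt1 by (simp add: powr_minus)
  finally have "of_real (q * (q powr (-1/2)) ^ 2) = (1::complex)" by simp
  then show ?thesis by simp
qed

lemma steinberg1_dual:
  assumes s: "s \<noteq> 0"
  shows "dual_data (tensor_relations H1 (\<theta>S s)) {..<3} cb (\<pi>S s)"
    "a \<in> H1 \<Longrightarrow> \<theta>S s a = \<pi>S s 0 a"
proof -
  define t1 t2 where t1: "t1 = of_real (q powr (-1/2)) * s" and t2: "t2 = s ^ 2"
  define p where p: "p = \<pi>S s"
  \<comment> \<open>The relation t2 = q t1^2 is the compatibility required by
    \<open>functional_T1\<close> for \<open>T1\<close> to act by \<open>\<tau>\<close>.\<close>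
  have t: "t1 \<noteq> 0" "t2 \<noteq> 0" "t2 = of_real q * t1 ^ 2"
    using s q_gt1 rt_q by (auto simp: t1 t2 power_mult_distrib)
  have lin: "linf (p i)" for i by (simp add: p wfun)
  have val: "p i (wb k * X m n) = (if k div 2 = i then \<tau> ^ (k mod 2) else 0) * t1 powi m * t2 powi n"
    if "k < 6" for i k m n
    unfolding p t1 t2 by (rule wfun(2)[OF that])
  have valw: "p i (wb k) = (if k div 2 = i then \<tau> ^ (k mod 2) else 0)" if "k < 6" for i k
    using val[OF that, of i 0 0] by simp
  let ?G = "factor_alg {..<3} p (p 0)"
  have X1: "p 0 (X m n) = t1 powi m * t2 powi n" for m n
    using val[of 0 0 m n] by simp
  have T1v: "p 0 T1 = \<tau>"
    using valw[of 1 0] by simp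
  have G: "subalgebra ?G" "alg_hom_on ?G (p 0)"
    using X1[of 0 0] by (intro factor_alg_subalgebra[where ?i0.0 = 0]; simp add: lin)+
  have XG: "X m n \<in> ?G" for m n
    by (simp add: factor_alg_def functional_X[OF lin t(1,2) val] X1)
  have "p i (h * T1) = p i h * \<tau>" for i h
  proof (rule functional_T1[OF lin t(1,3) val])
    fix k assume "k < (6::nat)"
    then show "p i (wb k * T1) = p i (wb k) * \<tau>"
      unfolding less6_cases
      by (elim disjE; simp only: wb_T1 linfD[OF lin]; cases "i = 0"; cases "i = 1"; cases "i = 2"; simp add: valw \<tau>_Q(2) algebra_simps del: wb_simps)
  qed
  then have TG: "T1 \<in> ?G" by (simp add: factor_alg_def T1v)
  have sub: "H1 \<subseteq> ?G" unfolding H1_def x_omega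
    using XG G(1) TG by (intro hull_minimal) auto
  have hom: "alg_hom_on H1 (p 0)" by (rule alg_hom_on_subset[OF G(2) sub])
  have \<theta>: "alg_hom_on H1 (\<theta>S s) \<and> \<theta>S s T1 = - of_real (q powr (-1/2)) \<and>
      \<theta>S s (x omega1) = t1 \<and> \<theta>S s (x omega2) = t2"
    unfolding \<theta>S_def t1[symmetric] t2[symmetric]
    by (rule someI[of _ "p 0"]) (simp add: hom x_omega X1 T1v \<tau>_def)
  have agree: "\<theta>S s a = p 0 a" if "a \<in> H1" for a
  proof -
    have A: "subalgebra {a \<in> H1. \<theta>S s a = p 0 a}"
      using subalgebra_agree[OF H1_props(1) _ hom] \<theta> by blast
    have "X m n \<in> {a \<in> H1. \<theta>S s a = p 0 a}" for m n
      using alg_hom_X(1)[OF conjunct1[OF \<theta>] H1_props(3), of m n] \<theta> by (simp add: H1_props X1 x_omega)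
    moreover have "T1 \<in> {a \<in> H1. \<theta>S s a = p 0 a}"
      using \<theta> by (simp add: H1_props T1v \<tau>_def)
    ultimately have "H1 \<subseteq> {a \<in> H1. \<theta>S s a = p 0 a}"
      by (subst (1) H1_def, unfold x_omega, intro hull_minimal A) auto
    then show ?thesis using that by blast
  qed
  then show "a \<in> H1 \<Longrightarrow> \<theta>S s a = \<pi>S s 0 a" by (simp add: p)
  show "dual_data (tensor_relations H1 (\<theta>S s)) {..<3} cb (\<pi>S s)"
    unfolding p[symmetric]
  proof (rule induced_dual_data)
    fix i h a assume "i \<in> {..<3::nat}" "a \<in> H1"
    then show "p i (h * a) = p i h * \<theta>S s a"
      using sub agree by (auto simp: factor_alg_def)
  next
    fix i j assume "i \<in> {..<3::nat}" "j \<in> {..<3::nat}"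
    then have "cb j = wb (2 * j)" "2 * j < 6" by (auto simp: less3_cases)
    then show "p i (cb j) = (if i = j then 1 else 0)" by (auto simp: valw less3_cases)
  next
    fix k m n assume "k < (6::nat)"
    moreover have "T1 * X m n \<in> H1" using H1_props by (simp add: subalgebra_def)
    ultimately show "\<exists>j\<in>{..<3}. \<exists>a\<in>H1. wb k * X m n = cb j * a"
      by (intro bexI[of _ "k div 2"] bexI[of _ "if odd k then T1 * X m n else X m n"])
        (auto simp: less6_cases mult.assoc H1_props)
  qed (auto simp: lin)
qed

text \<open>The two equations are the compatibility conditions for T_1 and T_2. They force (q z1)^3
  = 1 and so have exactly the three pairs of the theorem as nonzero solutions. The list contains the
  lengths of the elements of W_0.\<close>

lemma one_dim_char:
  assumes z: "z1 \<noteq> 0" "z2 = of_real q * z1 ^ 2" "z1 = of_real q * z2 ^ 2"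
  shows "alg_hom_on UNIV (one_dim_char z1 z2)"
    "k < 6 \<Longrightarrow> one_dim_char z1 z2 (wb k * X m n) = \<tau> ^ ([0,1,1,2,2,3] ! k) * z1 powi m * z2 powi n"
proof -
  have z2: "z2 \<noteq> 0" using z(1) q_gt1 by (simp add: z(2))
  define \<pi> where "\<pi> = wfun (\<lambda>k. \<tau> ^ ([0,1,1,2,2,3] ! k)) z1 z2"
  let ?G = "factor_alg {0::nat} (\<lambda>_. \<pi>) \<pi>"
  have lin: "linf \<pi>" by (simp add: \<pi>_def wfun)
  have val: "\<pi> (wb k * X m n) = \<tau> ^ ([0,1,1,2,2,3] ! k) * z1 powi m * z2 powi n" if "k < 6" for k m n
    using that by (simp add: \<pi>_def wfun)
  have valw: "\<pi> (wb k) = \<tau> ^ ([0,1,1,2,2,3] ! k)" if "k < 6" for k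
    using val[OF that, of 0 0] by simp
  have X1: "\<pi> (X m n) = z1 powi m * z2 powi n" for m n
    using val[of 0 m n] by simp
  have G: "subalgebra ?G" "alg_hom_on ?G \<pi>"
    using X1[of 0 0] by (intro factor_alg_subalgebra[where ?i0.0 = 0]; simp add: lin)+
  have XG: "X m n \<in> ?G" for m n
    by (simp add: factor_alg_def X1 functional_X[OF lin z(1) z2 val])
  have v: "\<pi> (wb 0) = 1" "\<pi> (wb 1) = \<tau>" "\<pi> (wb 2) = \<tau>" "\<pi> (wb 3) = \<tau> * \<tau>"
    "\<pi> (wb 4) = \<tau> * \<tau>" "\<pi> (wb 5) = \<tau> * \<tau> * \<tau>"
    by (simp_all add: valw power2_eq_square power3_eq_cube del: wb_simps)
  have sq1: "1 + Q * \<tau> = \<tau> * \<tau>" by (rule \<tau>_Q(2)[symmetric])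
  have sq2: "\<tau> + Q * (\<tau> * \<tau>) = \<tau> * \<tau> * \<tau>"
    unfolding sq1[symmetric] distrib_right by (simp only: mult_1_left mult.assoc sq1)
  have sq3: "\<tau> * \<tau> + Q * (\<tau> * \<tau> * \<tau>) = \<tau> * \<tau> * \<tau> * \<tau>"
    unfolding sq2[symmetric] distrib_right by (simp only: mult.assoc sq2)
  note sq = sq1 sq2 sq3
  have T: "\<pi> (wb k * T1) = \<pi> (wb k) * \<tau>" if "k < 6" for k
    using that unfolding less6_cases
    by (elim disjE; simp only: wb_T1 linfD[OF lin] v mult_1_left sq)
  have T': "\<pi> (wb k * T2) = \<pi> (wb k) * \<tau>" if "k < 6" for k
    using that unfolding less6_cases
    by (elim disjE; simp only: wb_T2 linfD[OF lin] v mult_1_left sq)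
  have T1v: "\<pi> T1 = \<tau>" and T2v: "\<pi> T2 = \<tau>" using valw[of 1] valw[of 2] by simp_all
  have "T1 \<in> ?G" "T2 \<in> ?G"
    using functional_T1[OF lin z(1,2) val T] functional_T2[OF lin z2 z(3) val T']
    by (simp_all add: factor_alg_def T1v T2v)
  moreover have one: "1 \<in> ?G" and mult: "a * b \<in> ?G" if "a \<in> ?G" "b \<in> ?G" for a b
    using G(1) that unfolding subalgebra_def by blast+
  ultimately have "wb k * X m n \<in> ?G" if "k < 6" for k m n
    using that unfolding less6_cases
    by (elim disjE) (simp_all add: mult XG one)
  then have "span BB \<subseteq> ?G" using G(1) by (intro span_minimal) (auto simp: BB_def subalgebra_def)
  then have "?G = UNIV" by (simp add: span_BB top.extremum_unique)
  then have hom: "alg_hom_on UNIV \<pi>" using G(2) by simp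
  have "one_dim_char z1 z2 = \<pi>"
    unfolding one_dim_char_def
  proof (rule the_equality)
    show "alg_hom_on UNIV \<pi> \<and> \<pi> T1 = - of_real (q powr (-1/2)) \<and> \<pi> T2 = - of_real (q powr (-1/2)) \<and>
        \<pi> (x omega1) = z1 \<and> \<pi> (x omega2) = z2"
      using hom by (simp add: T1v T2v \<tau>_def x_omega X1)
    fix f assume f: "alg_hom_on UNIV f \<and> f T1 = - of_real (q powr (-1/2)) \<and> f T2 = - of_real (q powr (-1/2)) \<and>
        f (x omega1) = z1 \<and> f (x omega2) = z2"
    then have fX: "f (X m n) = z1 powi m * z2 powi n" for m n
      using alg_hom_X(1)[of UNIV f m n] by (simp add: x_omega)
    have fm: "f (a * b) = f a * f b" "f 1 = 1" for a b using f by (simp_all add: alg_hom_on_def)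
    have fT: "f T1 = \<tau>" "f T2 = \<tau>" using f by (simp_all add: \<tau>_def)
    show "f = \<pi>"
    proof
      fix h show "f h = \<pi> h"
      proof (rule functional_unique[OF _ lin])
        show "linf f" using f by (simp add: linf_def alg_hom_on_def)
        fix k m n assume "k < (6::nat)"
        then show "f (wb k * X m n) = \<pi> (wb k * X m n)"
          unfolding less6_cases
          by (elim disjE; simp only: val; simp add: fm fX fT power2_eq_square power3_eq_cube)
      qed
    qed
  qed
  with hom val show "alg_hom_on UNIV (one_dim_char z1 z2)"
    "k < 6 \<Longrightarrow> one_dim_char z1 z2 (wb k * X m n) = \<tau> ^ ([0,1,1,2,2,3] ! k) * z1 powi m * z2 powi n"
    by simp_all
qed

subsection \<open>Traces on weight spaces\<close>

definition lmod :: "'h set \<Rightarrow> bool" where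
  "lmod N \<longleftrightarrow> subspace N \<and> (\<forall>h. \<forall>v\<in>N. h * v \<in> N)"

lemma lmod_tensor_relations: "lmod (tensor_relations A \<theta>)"
  using endo_mult subspace_tensor_relations by (auto simp: lmod_def endo_def)

definition wvec :: "'h set \<Rightarrow> 'h \<Rightarrow> complex \<Rightarrow> complex \<Rightarrow> bool" where
  "wvec N v t1 t2 \<longleftrightarrow> X 1 0 * v - scale t1 v \<in> N \<and> X 0 1 * v - scale t2 v \<in> N"

lemma wvec_X:
  assumes N: "lmod N" and v: "wvec N v t1 t2" and t: "t1 \<noteq> 0" "t2 \<noteq> 0"
  shows "X m n * v - scale (t1 powi m * t2 powi n) v \<in> N"
proof -
  have sub: "subspace N" and L: "\<And>h v. v \<in> N \<Longrightarrow> h * v \<in> N" using N by (auto simp: lmod_def)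
  have trans: "g * h * v - scale (c * d) v \<in> N" if "h * v - scale d v \<in> N" "g * v - scale c v \<in> N" for g h c d
    using subspace_add[OF sub L[OF that(1), of g] subspace_scale[OF sub that(2), of d]]
    by (simp add: algebra_simps scale_mult mult.commute)
  have inv: "g * v - scale (inverse c) v \<in> N" if "h * v - scale c v \<in> N" "g * h = 1" "c \<noteq> 0" for g h c
  proof -
    have "scale (inverse c) (g * (h * v - scale c v)) \<in> N" by (rule subspace_scale[OF sub L[OF that(1)]])
    also have "scale (inverse c) (g * (h * v - scale c v)) = - (g * v - scale (inverse c) v)"
      using that(2,3) by (simp add: right_diff_distrib scale_mult mult.assoc[symmetric] scale_right_diff_distrib)
    finally show ?thesis using subspace_neg[OF sub, of "- (g * v - scale (inverse c) v)"] by (simp only: minus_minus)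
  qed
  have zero: "v - scale 1 v \<in> N" using subspace_0[OF sub] by simp
  have v1: "X 1 0 * v - scale t1 v \<in> N" "X 0 1 * v - scale t2 v \<in> N" using v by (auto simp: wvec_def)
  have v2: "X (-1) 0 * v - scale (inverse t1) v \<in> N" "X 0 (-1) * v - scale (inverse t2) v \<in> N"
    using inv[OF v1(1) _ t(1)] inv[OF v1(2) _ t(2)] by (simp_all add: X_mult)
  have a: "X m 0 * v - scale (t1 powi m) v \<in> N"
  proof (induction m rule: int_induct[where k = 0])
    case (step1 i)
    then show ?case using trans[OF step1(2) v1(1)] t by (simp add: X_mult power_int_add mult.commute add.commute)
  next
    case (step2 i)
    then show ?case using trans[OF step2(2) v2(1)] t by (simp add: X_mult power_int_diff divide_inverse mult.commute)
  qed (use zero in simp)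
  have b: "X 0 n * v - scale (t2 powi n) v \<in> N"
  proof (induction n rule: int_induct[where k = 0])
    case (step1 i)
    then show ?case using trans[OF step1(2) v1(2)] t by (simp add: X_mult power_int_add mult.commute add.commute)
  next
    case (step2 i)
    then show ?case using trans[OF step2(2) v2(2)] t by (simp add: X_mult power_int_diff divide_inverse mult.commute)
  qed (use zero in simp)
  show ?thesis using trans[OF b a] by (simp add: X_mult)
qed

text \<open>The unnormalised intertwiners: \<open>x\<^sup>\<lambda> I\<^sub>i = I\<^sub>i x\<^bsup>s\<^sub>i\<lambda>\<^esup>\<close>, so they map weight vectors to
  weight vectors.\<close>

definition I1 :: 'h where "I1 = T1 * (1 - X (-2) 1) - scale Q 1"
definition I2 :: 'h where "I2 = T2 * (1 - X 1 (-2)) - scale Q 1"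

lemma X_T: "X m 1 * T2 = T2 * X (m + 1) (-1) + scale Q (X m 1)" "X 1 n * T1 = T1 * X (-1) (n + 1) + scale Q (X 1 n)"
  using bernstein_right2[where k = 1 and l = m] bernstein_right1[where k = 1 and l = n] by (simp_all add: add.commute)

lemma X_I: "X 1 0 * I1 = I1 * X (-1) 1" "X 0 1 * I1 = I1 * X 0 1"
  "X 0 1 * I2 = I2 * X 1 (-1)" "X 1 0 * I2 = I2 * X 1 0"
proof -
  have a: "X 1 0 * (T1 * g) = T1 * (X (-1) 1 * g) + scale Q (X 1 0 * g)"
    "X 0 1 * (T1 * g) = T1 * (X 0 1 * g)"
    "X 0 1 * (T2 * g) = T2 * (X 1 (-1) * g) + scale Q (X 0 1 * g)"
    "X 1 0 * (T2 * g) = T2 * (X 1 0 * g)" for g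
    by (simp_all add: mult.assoc[symmetric] bernstein1 bernstein2 distrib_right scale_mult)
  show "X 1 0 * I1 = I1 * X (-1) 1" "X 0 1 * I1 = I1 * X 0 1"
    "X 0 1 * I2 = I2 * X 1 (-1)" "X 1 0 * I2 = I2 * X 1 0"
    by (simp_all add: I1_def I2_def right_diff_distrib left_diff_distrib a bernstein1(1,3) bernstein2(1,3) mult.assoc X_mult scale_mult
        scale_right_diff_distrib)
qed

lemma wvec_I:
  assumes N: "lmod N" and v: "wvec N v t1 t2" and t: "t1 \<noteq> 0" "t2 \<noteq> 0"
  shows "wvec N (I1 * v) (t2 / t1) t2" "wvec N (I2 * v) t1 (t1 / t2)"
proof -
  have L: "\<And>h v. v \<in> N \<Longrightarrow> h * v \<in> N" using N by (auto simp: lmod_def)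
  have *: "X i j * (I * v) - scale (t1 powi m * t2 powi n) (I * v) \<in> N" if "X i j * I = I * X m n" for I i j m n
  proof -
    have "X i j * (I * v) = I * (X m n * v)"
      using that by (simp add: mult.assoc[symmetric])
    then show ?thesis using L[OF wvec_X[OF N v t], of I m n] by (simp add: right_diff_distrib scale_mult)
  qed
  show "wvec N (I1 * v) (t2 / t1) t2" "wvec N (I2 * v) t1 (t1 / t2)"
    unfolding wvec_def using *[OF X_I(1)] *[OF X_I(2)] *[OF X_I(3)] *[OF X_I(4)]
    by (simp_all add: power_int_minus divide_inverse mult.commute)
qed

text \<open>The values at (t1, t2) of e^(-alpha_1) and, in \<open>rb\<close>, of
  e^(-alpha_2).\<close>

abbreviation ra :: "complex \<Rightarrow> complex \<Rightarrow> complex" where "ra t1 t2 \<equiv> t2 / t1 ^ 2"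
abbreviation rb :: "complex \<Rightarrow> complex \<Rightarrow> complex" where "rb t1 t2 \<equiv> t1 / t2 ^ 2"

text \<open>On a weight vector the lattice factor inside the intertwiner is a scalar, so T_i can be
  expressed by I_i whenever the root value differs from 1. The left factor \<open>g\<close> allows
  this inside longer words.\<close>

lemma T_wvec:
  assumes N: "lmod N" and v: "wvec N v t1 t2" and t: "t1 \<noteq> 0" "t2 \<noteq> 0"
  shows "scale (1 - ra t1 t2) (g * (T1 * v)) - (g * (I1 * v) + scale Q (g * v)) \<in> N"
    "scale (1 - rb t1 t2) (g * (T2 * v)) - (g * (I2 * v) + scale Q (g * v)) \<in> N"
proof -
  have L: "\<And>h v. v \<in> N \<Longrightarrow> h * v \<in> N" using N by (auto simp: lmod_def)
  have "g * (T1 * (X (-2) 1 * v - scale (t1 powi (-2) * t2 powi 1) v)) \<in> N"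
    "g * (T2 * (X 1 (-2) * v - scale (t1 powi 1 * t2 powi (-2)) v)) \<in> N"
    by (intro L wvec_X[OF N v t])+
  moreover have "t1 powi (-2) * t2 powi 1 = ra t1 t2" "t1 powi 1 * t2 powi (-2) = rb t1 t2"
    by (simp_all add: power_int_minus divide_inverse mult.commute)
  ultimately show "scale (1 - ra t1 t2) (g * (T1 * v)) - (g * (I1 * v) + scale Q (g * v)) \<in> N"
    "scale (1 - rb t1 t2) (g * (T2 * v)) - (g * (I2 * v) + scale Q (g * v)) \<in> N"
    by (simp_all add: I1_def I2_def algebra_simps scale_mult)
qed

definition regular :: "complex \<Rightarrow> complex \<Rightarrow> bool" where
  "regular t1 t2 \<longleftrightarrow> t1 \<noteq> 0 \<and> t2 \<noteq> 0 \<and> ra t1 t2 \<noteq> 1 \<and> rb t1 t2 \<noteq> 1 \<and> t1 * t2 \<noteq> 1"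

text \<open>The diagonal entry of \<open>wb k\<close> at a weight vector of weight (t1, t2): each
  simple letter contributes a factor Q / (1 - e^(-alpha)). The element of length 3 has no
  entry.\<close>

definition dcoef :: "nat \<Rightarrow> complex \<Rightarrow> complex \<Rightarrow> complex" where
  "dcoef k t1 t2 = [1, Q / (1 - ra t1 t2), Q / (1 - rb t1 t2),
    Q ^ 2 / ((1 - ra t1 t2) * (1 - rb t1 t2)), Q ^ 2 / ((1 - ra t1 t2) * (1 - rb t1 t2))] ! k"

text \<open>By \<open>T_wvec\<close> each letter either contributes its rank-one factor or applies
  an intertwiner. In words of length at most 2 the letters differ, so after an intertwiner the
  weight does not return to (t1, t2), by regularity.\<close>

lemma diagonal_coefficient:
  assumes N: "lmod N" and v: "wvec N v t1 t2" and t: "regular t1 t2"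
    and g: "linf g" "\<And>v. v \<in> N \<Longrightarrow> g v = 0"
    and gX: "\<And>v. g (X 1 0 * v) = t1 * g v" "\<And>v. g (X 0 1 * v) = t2 * g v"
    and k: "k < 5"
  shows "g (wb k * v) = dcoef k t1 t2 * g v"
proof -
  have t0: "t1 \<noteq> 0" "t2 \<noteq> 0" and r: "1 - ra t1 t2 \<noteq> 0" "1 - rb t1 t2 \<noteq> 0" "t1 * t2 \<noteq> 1"
    using t by (auto simp: regular_def)
  \<comment> \<open>\<open>g\<close> is an eigenfunctional of weight (t1, t2) and so vanishes on
    vectors of any other weight.\<close>
  have z: "g u = 0" if "wvec N u s1 s2" "s1 \<noteq> t1 \<or> s2 \<noteq> t2" for u s1 s2
    using g(2)[of "X 1 0 * u - scale s1 u"] g(2)[of "X 0 1 * u - scale s2 u"] that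
    by (auto simp: wvec_def linfD[OF g(1)] gX)
  have gT: "(1 - ra s1 s2) * g (h * (T1 * u)) = g (h * (I1 * u)) + Q * g (h * u)"
    "(1 - rb s1 s2) * g (h * (T2 * u)) = g (h * (I2 * u)) + Q * g (h * u)"
    if "wvec N u s1 s2" "s1 \<noteq> 0" "s2 \<noteq> 0" for u s1 s2 h
    using g(2)[OF T_wvec(1)[OF N that]] g(2)[OF T_wvec(2)[OF N that]] by (simp_all add: linfD[OF g(1)])
  note w1 = wvec_I(1)[OF N v t0] and w2 = wvec_I(2)[OF N v t0]
  have nz: "t2 / t1 \<noteq> 0" "t1 / t2 \<noteq> 0" using t0 by auto
  have w12: "wvec N (I1 * (I2 * v)) (t1 / t2 / t1) (t1 / t2)" by (rule wvec_I(1)[OF N w2 t0(1) nz(2)])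
  have w21: "wvec N (I2 * (I1 * v)) (t2 / t1) (t2 / t1 / t2)" by (rule wvec_I(2)[OF N w1 nz(1) t0(2)])
  have z1: "g (I1 * v) = 0" using r(1) t0 by (intro z[OF w1]) (auto simp: field_simps power2_eq_square)
  have z2: "g (I2 * v) = 0" using r(2) t0 by (intro z[OF w2]) (auto simp: field_simps power2_eq_square)
  have z12: "g (I1 * (I2 * v)) = 0" using r(3) t0 by (intro z[OF w12]) (auto simp: field_simps)
  have z21: "g (I2 * (I1 * v)) = 0" using r(3) t0 by (intro z[OF w21]) (auto simp: field_simps)
  \<comment> \<open>Both root values are 1 / (t1 t2), so the third regularity condition
    applies.\<close>
  have n12: "1 - ra t1 (t1 / t2) \<noteq> 0" "1 - rb (t2 / t1) t2 \<noteq> 0"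
    using r(3) t0 by (auto simp: field_simps power2_eq_square)
  have "(1 - ra t1 (t1 / t2)) * g (T1 * (I2 * v)) = 0" "(1 - rb (t2 / t1) t2) * g (T2 * (I1 * v)) = 0"
    using gT(1)[OF w2 t0(1) nz(2), of 1] gT(2)[OF w1 nz(1) t0(2), of 1] by (simp_all add: z1 z2 z12 z21)
  then have TI: "g (T1 * (I2 * v)) = 0" "g (T2 * (I1 * v)) = 0" using n12 by (simp_all only: mult_eq_0_iff simp_thms)
  have T1: "(1 - ra t1 t2) * g (T1 * v) = Q * g v" "(1 - rb t1 t2) * g (T2 * v) = Q * g v"
    using gT[OF v t0, of 1] by (simp_all add: z1 z2)
  have "(1 - rb t1 t2) * g (T1 * (T2 * v)) = Q * g (T1 * v)" "(1 - ra t1 t2) * g (T2 * (T1 * v)) = Q * g (T2 * v)"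
    using gT(2)[OF v t0, of T1] gT(1)[OF v t0, of T2] by (simp_all add: TI)
  moreover have k': "k = 0 \<or> k = 1 \<or> k = 2 \<or> k = 3 \<or> k = 4" using k by auto
  define A B where "A = 1 - ra t1 t2" and "B = 1 - rb t1 t2"
  ultimately have *: "A * g (T1 * v) = Q * g v" "B * g (T2 * v) = Q * g v"
    "B * g (T1 * (T2 * v)) = Q * g (T1 * v)" "A * g (T2 * (T1 * v)) = Q * g (T2 * v)" "A \<noteq> 0" "B \<noteq> 0"
    using T1 r by simp_all
  then have **: "g (T1 * v) = Q / A * g v" "g (T2 * v) = Q / B * g v" by (simp_all add: field_simps)
  have "g (T1 * (T2 * v)) = Q ^ 2 / (A * B) * g v" "g (T2 * (T1 * v)) = Q ^ 2 / (A * B) * g v"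
    using * by (simp_all add: ** field_simps power2_eq_square)
  with ** k' show ?thesis
    by (elim disjE) (simp_all add: dcoef_def A_def B_def mult.assoc)
qed

text \<open>In a basis of weight vectors the coordinate functional of a basis vector is an
  eigenfunctional of the same weight, so each diagonal entry is given by
  \<open>diagonal_coefficient\<close>.\<close>

lemma weight_trace:
  assumes d: "dual_data (tensor_relations A \<theta>) I b \<pi>"
    and w: "\<And>i. i \<in> I \<Longrightarrow> wvec (tensor_relations A \<theta>) (b i) (m1 i) (m2 i)"
    and r: "\<And>i. i \<in> I \<Longrightarrow> regular (m1 i) (m2 i)" and k: "k < 5"
  shows "induced_char A \<theta> (wb k * X m n) = (\<Sum>i\<in>I. dcoef k (m1 i) (m2 i) * (m1 i powi m * m2 i powi n))"
  unfolding induced_char_dual[OF d]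
proof (intro sum.cong refl)
  fix i assume i: "i \<in> I"
  let ?N = "tensor_relations A \<theta>"
  note N = lmod_tensor_relations[of A \<theta>]
  have L: "\<And>h v. v \<in> ?N \<Longrightarrow> h * v \<in> ?N" using N by (auto simp: lmod_def)
  note lin = dual_dataD(3)[OF d i] and van = dual_dataD(4)[OF d i]
  have gX: "\<pi> i (X a c * v) = e i * \<pi> i v"
    if "\<And>j. j \<in> I \<Longrightarrow> X a c * b j - scale (e j) (b j) \<in> ?N" for a c e v
  proof -
    have "\<pi> i (X a c * v) = (\<Sum>j\<in>I. \<pi> j v * \<pi> i (X a c * b j))"
      using lin van L by (intro dual_expand[OF d]) (auto simp: linf_def distrib_left scale_mult)
    also have "\<dots> = (\<Sum>j\<in>I. if j = i then e i * \<pi> i v else 0)"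
    proof (intro sum.cong refl)
      fix j assume j: "j \<in> I"
      have "\<pi> i (X a c * b j) = e j * \<pi> i (b j)"
        using van[OF that[OF j]] by (simp add: linfD[OF lin])
      then show "\<pi> j v * \<pi> i (X a c * b j) = (if j = i then e i * \<pi> i v else 0)"
        using dual_dataD(5)[OF d i j] by auto
    qed
    also have "\<dots> = e i * \<pi> i v" using dual_dataD(2)[OF d] i by simp
    finally show ?thesis .
  qed
  have gX1: "\<pi> i (X 1 0 * v) = m1 i * \<pi> i v" "\<pi> i (X 0 1 * v) = m2 i * \<pi> i v" for v
    using w by (auto intro!: gX simp: wvec_def)
  have rr: "m1 i \<noteq> 0" "m2 i \<noteq> 0" using r[OF i] by (auto simp: regular_def)
  have "\<pi> i (wb k * (X m n * b i - scale (m1 i powi m * m2 i powi n) (b i))) = 0"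
    by (intro van L wvec_X[OF N w[OF i] rr])
  then have "\<pi> i (wb k * X m n * b i) = (m1 i powi m * m2 i powi n) * \<pi> i (wb k * b i)"
    by (simp add: right_diff_distrib scale_mult linfD[OF lin] mult.assoc)
  also have "\<pi> i (wb k * b i) = dcoef k (m1 i) (m2 i) * \<pi> i (b i)"
    by (rule diagonal_coefficient[OF N w[OF i] r[OF i] lin van gX1 k])
  also have "\<pi> i (b i) = 1" using dual_dataD(5)[OF d i i] by simp
  finally show "\<pi> i (wb k * X m n * b i) = dcoef k (m1 i) (m2 i) * (m1 i powi m * m2 i powi n)"
    by simp
qed

text \<open>The weight vectors obtained from a generator by intertwiners span the same space as its
  translates under the finite Hecke algebra; \<open>S\<close> is the span of these weight vectors modulo \<open>N\<close>.\<close>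

lemma intertwiner_span:
  assumes N: "lmod N" and v: "wvec N 1 t1 t2" and t: "regular t1 t2"
    and S: "subspace S" "N \<subseteq> S"
  shows "1 \<in> S \<Longrightarrow> I2 \<in> S \<Longrightarrow> T2 \<in> S"
    "1 \<in> S \<Longrightarrow> I2 \<in> S \<Longrightarrow> I1 * I2 \<in> S \<Longrightarrow> T1 \<in> S \<Longrightarrow> T1 * T2 \<in> S"
    "1 \<in> S \<Longrightarrow> I1 \<in> S \<Longrightarrow> T1 \<in> S"
    "1 \<in> S \<Longrightarrow> I1 \<in> S \<Longrightarrow> I2 * I1 \<in> S \<Longrightarrow> T2 \<in> S \<Longrightarrow> T2 * T1 \<in> S"
    "1 \<in> S \<Longrightarrow> I1 \<in> S \<Longrightarrow> I2 * I1 \<in> S \<Longrightarrow> I1 * (I2 * I1) \<in> S \<Longrightarrow> T1 \<in> S \<Longrightarrow> T1 * T2 \<in> S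
      \<Longrightarrow> T1 * (T2 * T1) \<in> S"
proof -
  have L: "\<And>h v. v \<in> N \<Longrightarrow> h * v \<in> N" using N by (auto simp: lmod_def)
  have t0: "t1 \<noteq> 0" "t2 \<noteq> 0" and r: "ra t1 t2 \<noteq> 1" "rb t1 t2 \<noteq> 1" "t1 * t2 \<noteq> 1"
    using t by (auto simp: regular_def)
  have div: "u \<in> S" if "scale c u - (a + scale Q e) \<in> N" "c \<noteq> 0" "a \<in> S" "e \<in> S" for c u a e
  proof -
    have "(scale c u - (a + scale Q e)) + (a + scale Q e) \<in> S"
      using that S by (intro subspace_add[OF S(1)] subspace_scale[OF S(1)]) auto
    then have "scale c u \<in> S" by (simp only: diff_add_cancel)
    from subspace_scale[OF S(1) this, of "inverse c"] show ?thesis using that(2) by simp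
  qed
  have st: "g * (T1 * u) \<in> S" if "wvec N u s1 s2" "s1 \<noteq> 0" "s2 \<noteq> 0" "ra s1 s2 \<noteq> 1" "g * (I1 * u) \<in> S" "g * u \<in> S" for g u s1 s2
    using div[OF T_wvec(1)[OF N that(1-3)]] that(4-6) by simp
  have st': "g * (T2 * u) \<in> S" if "wvec N u s1 s2" "s1 \<noteq> 0" "s2 \<noteq> 0" "rb s1 s2 \<noteq> 1" "g * (I2 * u) \<in> S" "g * u \<in> S" for g u s1 s2
    using div[OF T_wvec(2)[OF N that(1-3)]] that(4-6) by simp
  have w1: "wvec N I1 (t2 / t1) t2" and w2: "wvec N I2 t1 (t1 / t2)" using wvec_I[OF N v t0] by simp_all
  have nz: "t2 / t1 \<noteq> 0" "t1 / t2 \<noteq> 0" using t0 by auto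
  have w21: "wvec N (I2 * I1) (t2 / t1) (t2 / t1 / t2)" using wvec_I(2)[OF N w1 nz(1) t0(2)] .
  have n12: "ra t1 (t1 / t2) \<noteq> 1" "rb (t2 / t1) t2 \<noteq> 1" "ra (t2 / t1) (t2 / t1 / t2) \<noteq> 1"
    using r t0 by (auto simp: field_simps power2_eq_square)
  show T2: "T2 \<in> S" if "1 \<in> S" "I2 \<in> S" using st'[OF v t0 r(2), of 1] that by simp
  show T1: "T1 \<in> S" if "1 \<in> S" "I1 \<in> S" using st[OF v t0 r(1), of 1] that by simp
  show "T1 * T2 \<in> S" if "1 \<in> S" "I2 \<in> S" "I1 * I2 \<in> S" "T1 \<in> S"
  proof -
    have "T1 * I2 \<in> S" using st[OF w2 t0(1) nz(2) n12(1), of 1] that by simp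
    then show ?thesis using st'[OF v t0 r(2), of T1] that by simp
  qed
  have T2I1: "T2 * I1 \<in> S" if "I1 \<in> S" "I2 * I1 \<in> S"
    using st'[OF w1 nz(1) t0(2) n12(2), of 1] that by simp
  show "T2 * T1 \<in> S" if "1 \<in> S" "I1 \<in> S" "I2 * I1 \<in> S" "T2 \<in> S"
    using st[OF v t0 r(1), of T2] that T2I1 by simp
  show "T1 * (T2 * T1) \<in> S" if h: "1 \<in> S" "I1 \<in> S" "I2 * I1 \<in> S" "I1 * (I2 * I1) \<in> S" "T1 \<in> S" "T1 * T2 \<in> S"
  proof -
    have nz': "t2 / t1 / t2 \<noteq> 0" using t0 by simp
    have 1: "T1 * (I2 * I1) \<in> S" using st[OF w21 nz(1) nz' n12(3), of 1] h by simp
    \<comment> \<open>Expanding through \<open>T_wvec\<close> would involve I1 * I1, which is not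
      among the given vectors. The quadratic relation leaves 1 and \<open>T1\<close> instead, once
      the lattice element is replaced by its eigenvalue on the generator.\<close>
    have "T1 * I1 = (1 + scale Q T1) * (1 - X (-2) 1) - scale Q T1"
      by (simp add: I1_def right_diff_distrib scale_mult mult.assoc[symmetric] T1_T1)
    also have "\<dots> = (1 + scale Q T1) * (scale (ra t1 t2) 1 - X (-2) 1)
        + scale (1 - ra t1 t2) (1 + scale Q T1) - scale Q T1"
      by (simp add: algebra_simps scale_mult)
    also have "\<dots> \<in> S"
    proof (intro subspace_diff[OF S(1)] subspace_add[OF S(1)] subspace_scale[OF S(1)] h)
      have "X (-2) 1 * 1 - scale (ra t1 t2) 1 \<in> N"
        using wvec_X[OF N v t0, of "-2" 1] by (simp add: power_int_minus divide_inverse mult.commute)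
      then have "- ((1 + scale Q T1) * (X (-2) 1 * 1 - scale (ra t1 t2) 1)) \<in> S"
        using L S by (intro subspace_neg[OF S(1)]) blast
      then show "(1 + scale Q T1) * (scale (ra t1 t2) 1 - X (-2) 1) \<in> S"
        by (simp add: algebra_simps scale_mult)
    qed
    finally have 2: "T1 * I1 \<in> S" .
    have "T1 * (T2 * I1) \<in> S" using st'[OF w1 nz(1) t0(2) n12(2), of T1] 1 2 by simp
    then show ?thesis using st[OF v t0 r(1), of "T1 * T2"] h by (simp add: mult.assoc)
  qed
qed

definition mod_span :: "'h set \<Rightarrow> nat \<Rightarrow> (nat \<Rightarrow> 'h) \<Rightarrow> 'h set" where
  "mod_span N d b = {v. \<exists>c. v - (\<Sum>i<d. scale (c i) (b i)) \<in> N}"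

lemma mod_span:
  assumes N: "subspace N"
  shows "subspace (mod_span N d b)" "N \<subseteq> mod_span N d b" "i < d \<Longrightarrow> b i \<in> mod_span N d b"
  unfolding mod_span_def
proof -
  let ?S = "{v. \<exists>c. v - (\<Sum>i<d. scale (c i) (b i)) \<in> N}"
  show "subspace ?S"
    unfolding subspace_def
  proof (safe, goal_cases)
    case 1
    show ?case by (intro exI[of _ "\<lambda>_. 0"]) (simp add: subspace_0[OF N])
  next
    case (2 x y c e)
    then show ?case using subspace_add[OF N, of "x - (\<Sum>i<d. scale (c i) (b i))"]
      by (intro exI[of _ "\<lambda>i. c i + e i"]) (force simp: scale_left_distrib sum.distrib algebra_simps)
  next
    case (3 s x c)
    then show ?case using subspace_scale[OF N, of "x - (\<Sum>i<d. scale (c i) (b i))" s]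
      by (intro exI[of _ "\<lambda>i. s * c i"]) (simp add: scale_right_diff_distrib scale_sum_right)
  qed
  show "N \<subseteq> ?S" by (auto intro!: exI[of _ "\<lambda>_. 0"])
  show "b i \<in> ?S" if "i < d"
    using that subspace_0[OF N]
    by (auto intro!: exI[of _ "\<lambda>j. if j = i then 1 else 0"] simp: if_distrib[of "\<lambda>s. scale s _"] cong: if_cong)
qed

text \<open>Entry i is the weight of the intertwiner word that corresponds to
  \<open>w_elt i\<close>.\<close>

definition orbit :: "complex \<Rightarrow> complex \<Rightarrow> nat \<Rightarrow> complex \<times> complex" where
  "orbit t1 t2 i = [(t1, t2), (t2 / t1, t2), (t1, t1 / t2), (t2 / t1, 1 / t1), (1 / t2, t1 / t2), (1 / t2, 1 / t1)] ! i"

lemma regular_orbit: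
  assumes "regular t1 t2" "i < 6"
  shows "regular (fst (orbit t1 t2 i)) (snd (orbit t1 t2 i))"
  using assms unfolding regular_def less6_cases
  by (elim disjE conjE) (auto simp: orbit_def field_simps power2_eq_square)

text \<open>For regular t the six intertwiner words applied to the generator form a weight basis,
  since they span a space of dimension six.\<close>

theorem chi_wbX:
  assumes t: "regular (fst t) (snd t)" and k: "k < 5"
  shows "chi t (wb k * X m n) = (\<Sum>i<6. dcoef k (fst (orbit (fst t) (snd t) i)) (snd (orbit (fst t) (snd t) i))
      * (fst (orbit (fst t) (snd t) i) powi m * snd (orbit (fst t) (snd t) i) powi n))"
proof -
  define t1 t2 where t12: "t1 = fst t" "t2 = snd t"
  have t': "regular t1 t2" using t by (simp add: t12)
  then have t0: "t1 \<noteq> 0" "t2 \<noteq> 0" by (auto simp: regular_def)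
  let ?N = "tensor_relations CP (\<theta>P t)"
  note N = lmod_tensor_relations[of CP "\<theta>P t"]
  note d = principal_dual[OF t0[unfolded t12]]
  define b where "b i = [1, I1, I2, I2 * I1, I1 * I2, I1 * (I2 * I1)] ! i" for i
  have "1 * a - scale (\<theta>P t a) 1 \<in> ?N" if "a \<in> CP" for a
    unfolding tensor_relations_def using that by (intro span_base) blast
  from this[OF CP_base[of 1 0]] this[OF CP_base[of 0 1]]
  have v: "wvec ?N 1 t1 t2"
    using d(2)[OF CP_base] wfun(2)[of 0 _ _ _ 1 0] wfun(2)[of 0 _ _ _ 0 1] by (simp add: wvec_def t12)
  note w1 = wvec_I(1)[OF N v t0] and w2 = wvec_I(2)[OF N v t0]
  have nz: "t2 / t1 \<noteq> 0" "t1 / t2 \<noteq> 0" "t2 / t1 / t2 \<noteq> 0" using t0 by auto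
  note w12 = wvec_I(1)[OF N w2 t0(1) nz(2)] and w21 = wvec_I(2)[OF N w1 nz(1) t0(2)]
  note w121 = wvec_I(1)[OF N w21 nz(1) nz(3)]
  have w: "wvec ?N (b i) (fst (orbit t1 t2 i)) (snd (orbit t1 t2 i))" if "i < 6" for i
    using that v w1 w2 w12 w21 w121 t0 unfolding less6_cases
    by (elim disjE) (simp_all add: b_def orbit_def)
  let ?S = "mod_span ?N 6 b"
  note S = mod_span[OF subspace_tensor_relations, where d = 6 and b = b]
  have bS: "1 \<in> ?S" "I1 \<in> ?S" "I2 \<in> ?S" "I2 * I1 \<in> ?S" "I1 * I2 \<in> ?S" "I1 * (I2 * I1) \<in> ?S"
    using S(3)[of 0] S(3)[of 1] S(3)[of 2] S(3)[of 3] S(3)[of 4] S(3)[of 5] by (simp_all add: b_def)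
  note isp = intertwiner_span[OF N v t' S(1,2)]
  have T: "T1 \<in> ?S" "T2 \<in> ?S" by (intro isp bS)+
  then have "T1 * T2 \<in> ?S" "T2 * T1 \<in> ?S" by (intro isp bS; assumption)+
  moreover from this have "T1 * (T2 * T1) \<in> ?S" using T by (intro isp bS)
  ultimately have "wb j \<in> ?S" if "j < 6" for j
    using that T bS(1) unfolding less6_cases by (elim disjE) (simp_all only: wb_simps)
  then have "\<exists>\<pi>. dual_data ?N {..<6} b \<pi>"
    by (intro dual_data_spanning[OF d(1)]) (auto simp: mod_span_def)
  then obtain \<pi> where "dual_data ?N {..<6} b \<pi>" by blast
  from weight_trace[OF this, of "\<lambda>i. fst (orbit t1 t2 i)" "\<lambda>i. snd (orbit t1 t2 i)" k m n] w regular_orbit[OF t'] k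
  show ?thesis by (simp add: chi_eq t12)
qed

text \<open>The values e^(-alpha_1), e^(-alpha_2) and t1 t2 have absolute values q, q^(-1/2) and
  q^(-1/2), none of which is 1.\<close>

lemma regular_steinberg1:
  fixes s :: complex
  defines "t1 \<equiv> of_real (q powr (-1/2)) * s" and "t2 \<equiv> s ^ 2"
  assumes s: "norm s = 1"
  shows "regular t1 t2"
proof -
  define r where "r = q powr (-1/2)"
  have r: "0 < r" "r < 1" using q_gt1 by (auto simp: r_def intro: powr_less_one)
  have s0: "s \<noteq> 0" using s by auto
  have t0: "t1 \<noteq> 0" "t2 \<noteq> 0" using r(1) s0 unfolding t1_def t2_def r_def[symmetric] by simp_all
  have nt: "norm t1 = r" "norm t2 = 1" using s r(1) unfolding t1_def t2_def r_def[symmetric] by (simp_all add: norm_mult norm_power)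
  have "norm (ra t1 t2) = 1 / r ^ 2" "norm (rb t1 t2) = r" "norm (t1 * t2) = r"
    by (simp_all add: norm_divide norm_mult norm_power nt)
  moreover have "1 / r ^ 2 \<noteq> 1" using r power_strict_decreasing[of 0 2 r] by auto
  ultimately show ?thesis
    unfolding regular_def using t0 r by (metis norm_one less_irrefl)
qed

text \<open>\<open>T1\<close> acts on the generator by a scalar, so the intertwiner words 1, I2, I1
  I2 of the minimal coset representatives already span; their weights are the entries 0, 2, 4 of the
  orbit.\<close>

theorem chi1_wbX:
  fixes s :: complex
  defines "t1 \<equiv> of_real (q powr (-1/2)) * s" and "t2 \<equiv> s ^ 2"
  assumes s: "norm s = 1" and k: "k < 5"
  shows "chi1 s (wb k * X m n) = (\<Sum>i\<in>{0,2,4}. dcoef k (fst (orbit t1 t2 i)) (snd (orbit t1 t2 i))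
      * (fst (orbit t1 t2 i) powi m * snd (orbit t1 t2 i) powi n))"
proof -
  have s0: "s \<noteq> 0" using s by auto
  have t': "regular t1 t2" unfolding t1_def t2_def by (rule regular_steinberg1[OF s])
  then have t0: "t1 \<noteq> 0" "t2 \<noteq> 0" by (auto simp: regular_def)
  let ?N = "tensor_relations H1 (\<theta>S s)"
  note N = lmod_tensor_relations[of H1 "\<theta>S s"]
  note d = steinberg1_dual[OF s0]
  define b where "b i = [1, I2, I1 * I2] ! i" for i
  have "1 * a - scale (\<theta>S s a) 1 \<in> ?N" if "a \<in> H1" for a
    unfolding tensor_relations_def using that by (intro span_base) blast
  note X1 = this[OF H1_props(3)[of 1 0]] this[OF H1_props(3)[of 0 1]] this[OF H1_props(2)]
  have "\<theta>S s (X 1 0) = t1" "\<theta>S s (X 0 1) = t2" "\<theta>S s T1 = \<tau>"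
    using d(2)[OF H1_props(3)] d(2)[OF H1_props(2)]
      wfun(2)[of 0 _ _ _ 1 0] wfun(2)[of 0 _ _ _ 0 1] wfun_wb[of 1] by (simp_all add: t1_def t2_def)
  with X1 have v: "wvec ?N 1 t1 t2" and vT: "T1 - scale \<tau> 1 \<in> ?N"
    by (simp_all add: wvec_def)
  note w2 = wvec_I(2)[OF N v t0]
  have nz: "t1 / t2 \<noteq> 0" using t0 by auto
  note w12 = wvec_I(1)[OF N w2 t0(1) nz]
  have w: "wvec ?N (b i) (fst (orbit t1 t2 (2 * i))) (snd (orbit t1 t2 (2 * i)))" if "i < 3" for i
    using that v w2 w12 t0 unfolding less3_cases
    by (elim disjE) (simp_all add: b_def orbit_def)
  let ?S = "mod_span ?N 3 b"
  note S = mod_span[OF subspace_tensor_relations, where d = 3 and b = b]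
  have bS: "1 \<in> ?S" "I2 \<in> ?S" "I1 * I2 \<in> ?S"
    using S(3)[of 0] S(3)[of 1] S(3)[of 2] by (simp_all add: b_def)
  note isp = intertwiner_span[OF N v t' S(1,2)]
  have "T1 = (T1 - scale \<tau> 1) + scale \<tau> 1" by simp
  also have "\<dots> \<in> ?S"
    using vT S(2) by (intro subspace_add[OF S(1)] subspace_scale[OF S(1)] bS) blast
  finally have T1: "T1 \<in> ?S" .
  have T: "T2 \<in> ?S" "T1 * T2 \<in> ?S"
    by (rule isp(1)[OF bS(1,2)], rule isp(2)[OF bS T1])
  then have "cb j \<in> ?S" if "j < 3" for j
    using that bS(1) unfolding less3_cases by (elim disjE) (simp_all only: cb_simps)
  then have "\<exists>\<pi>. dual_data ?N {..<3} b \<pi>"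
    by (intro dual_data_spanning[OF d(1)]) (auto simp: mod_span_def)
  then obtain \<pi> where "dual_data ?N {..<3} b \<pi>" by blast
  from weight_trace[OF this, of "\<lambda>i. fst (orbit t1 t2 (2 * i))" "\<lambda>i. snd (orbit t1 t2 (2 * i))" k m n]
    w regular_orbit[OF t'] k
  have "chi1 s (wb k * X m n) = (\<Sum>i<3. dcoef k (fst (orbit t1 t2 (2 * i))) (snd (orbit t1 t2 (2 * i)))
      * (fst (orbit t1 t2 (2 * i)) powi m * snd (orbit t1 t2 (2 * i)) powi n))"
    by (simp add: chi1_eq)
  also have "\<dots> = (\<Sum>i\<in>(*) 2 ` {..<3}. dcoef k (fst (orbit t1 t2 i)) (snd (orbit t1 t2 i))
      * (fst (orbit t1 t2 i) powi m * snd (orbit t1 t2 i) powi n))"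
    by (subst sum.reindex) (auto simp: inj_on_def o_def)
  also have "(*) 2 ` {..<3::nat} = {0, 2, 4}" by (auto simp: image_iff)
  finally show ?thesis .
qed

text \<open>At these points both root values are q, and Q / (1 - q) = \<open>\<tau>\<close>. Hence
  \<open>dcoef\<close> reproduces the powers of \<open>\<tau>\<close>, and the one-dimensional
  characters obey the general formula with a single weight.\<close>

lemma one_dim_wbX:
  assumes z: "z1 \<noteq> 0" "z2 = of_real q * z1 ^ 2" "z1 = of_real q * z2 ^ 2" and k: "k < 5"
  shows "one_dim_char z1 z2 (wb k * X m n) = dcoef k z1 z2 * (z1 powi m * z2 powi n)"
proof -
  have z2: "z2 \<noteq> 0" using z(1) q_gt1 by (simp add: z(2))
  have "ra z1 z2 = of_real q" using z(1) by (subst z(2)) simp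
  moreover have "rb z1 z2 = of_real q" using z2 by (subst z(3)) simp
  moreover have "Q / (1 - of_real q) = \<tau>"
  proof -
    have "1 - of_real q \<noteq> (0::complex)" using q_gt1 by (metis eq_iff_diff_eq_0 less_irrefl of_real_1 of_real_eq_iff)
    then show ?thesis using \<tau>_Q(1) by (simp add: field_simps)
  qed
  moreover have "Q ^ 2 / ((1 - of_real q) * (1 - of_real q)) = (Q / (1 - of_real q)) ^ 2"
    by (simp add: power2_eq_square)
  moreover have "k = 0 \<or> k = 1 \<or> k = 2 \<or> k = 3 \<or> k = 4" using k by auto
  ultimately show ?thesis
    using k by (elim disjE; simp only: one_dim_char(2)[OF z]; simp add: dcoef_def)
qed

subsection \<open>Reduction to dominant weights\<close>

definition H0 :: "'h set" where "H0 = span (wb ` {..<6})"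

lemma H0_mult:
  assumes "w \<in> H0"
  shows "T1 * w \<in> H0" "T2 * w \<in> H0" "w * T1 \<in> H0" "w * T2 \<in> H0"
    "U1 * w \<in> H0" "U2 * w \<in> H0" "w * U1 \<in> H0" "w * U2 \<in> H0"
proof -
  have sub: "subspace H0" by (simp add: H0_def)
  have b: "wb k \<in> H0" if "k < 6" for k unfolding H0_def using that by (intro span_base) auto
  have c: "T1 * wb k \<in> H0 \<and> T2 * wb k \<in> H0 \<and> wb k * T1 \<in> H0 \<and> wb k * T2 \<in> H0" if "k < 6" for k
    using that unfolding less6_cases
    by (elim disjE; simp only: T1_wb T2_wb wb_T1 wb_T2;
      intro conjI subspace_add[OF sub] subspace_scale[OF sub] b; simp)
  have m: "f w \<in> H0" if "\<And>a b. f (a + b) = f a + f b" "\<And>c a. f (scale c a) = scale c (f a)"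
    "\<And>k. k < 6 \<Longrightarrow> f (wb k) \<in> H0" for f
    using that by (intro span_map[OF that(1,2) sub _ assms[unfolded H0_def]]) auto
  show 1: "T1 * w \<in> H0" "T2 * w \<in> H0" "w * T1 \<in> H0" "w * T2 \<in> H0"
    using m[of "\<lambda>w. T1 * w"] m[of "\<lambda>w. T2 * w"] m[of "\<lambda>w. w * T1"] m[of "\<lambda>w. w * T2"] c
    by (simp_all add: distrib_left distrib_right scale_mult)
  show "U1 * w \<in> H0" "U2 * w \<in> H0" "w * U1 \<in> H0" "w * U2 \<in> H0"
    using 1 assms by (auto simp: left_diff_distrib right_diff_distrib scale_mult
        intro!: subspace_diff[OF sub] subspace_scale[OF sub])
qed

text \<open>A W_0-invariant quadratic form on the weights, used as the outer induction measure of
  \<open>tracial_functional_zero\<close>: it is unchanged by reflections and strictly smaller inside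
  a root string.\<close>

definition qnorm :: "int \<Rightarrow> int \<Rightarrow> int" where "qnorm m n = m * m + m * n + n * n"

text \<open>The second bound keeps the inner induction measure 2 \<open>qnorm m n\<close> - (m + n)
  nonnegative.\<close>

lemma qnorm_ge: "qnorm m n \<ge> 0" "\<bar>m + n\<bar> \<le> 2 * qnorm m n"
proof -
  have 4: "4 * qnorm m n = 3 * ((m + n) * (m + n)) + (m - n) * (m - n)" by (simp add: qnorm_def algebra_simps)
  have "(m + n) * (m + n) \<ge> 0" "(m - n) * (m - n) \<ge> 0" by simp_all
  with 4 show "qnorm m n \<ge> 0" by linarith
  have "\<bar>m + n\<bar> \<le> \<bar>m + n\<bar> * \<bar>m + n\<bar>" using mult_right_mono[of 1 "\<bar>m + n\<bar>" "\<bar>m + n\<bar>"] by (cases "m + n = 0") auto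
  then have "\<bar>m + n\<bar> \<le> (m + n) * (m + n)" by (simp add: abs_mult_self_eq)
  with 4 \<open>(m - n) * (m - n) \<ge> 0\<close> \<open>(m + n) * (m + n) \<ge> 0\<close> show "\<bar>m + n\<bar> \<le> 2 * qnorm m n" by linarith
qed

text \<open>The two sides differ by 3 j (k - j).\<close>

lemma qnorm_string:
  assumes "1 \<le> j" "j < k"
  shows "qnorm (k - 2 * j) (l + j) < qnorm k l" "qnorm (l + j) (k - 2 * j) < qnorm k l"
proof -
  have "0 < j * (k - j)" using assms by simp
  then show "qnorm (k - 2 * j) (l + j) < qnorm k l" "qnorm (l + j) (k - 2 * j) < qnorm k l"
    by (simp_all add: qnorm_def algebra_simps)
qed

text \<open>The Bernstein relation solved for the reflected weight. The first point of the string is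
  absorbed by replacing \<open>t\<close> on the right with its inverse, so only interior points
  remain in the sum.\<close>

lemma X_reflect_aux:
  fixes Y :: "int \<Rightarrow> int \<Rightarrow> 'h"
  assumes r: "Y (int (Suc k)) l * t = t * Y (- int (Suc k)) (int (Suc k) + l)
      + scale Q (\<Sum>j<Suc k. Y (int (Suc k) - 2 * int j) (l + int j))"
    and u: "(t - scale Q 1) * t = 1"
  shows "Y (- int (Suc k)) (int (Suc k) + l) = (t - scale Q 1) * Y (int (Suc k)) l * (t - scale Q 1)
      - scale Q (\<Sum>j<k. (t - scale Q 1) * Y (int (Suc k) - 2 * int (Suc j)) (l + int (Suc j)))"
proof -
  let ?S = "\<Sum>j<k. Y (int (Suc k) - 2 * int (Suc j)) (l + int (Suc j))"
  have "t * Y (- int (Suc k)) (int (Suc k) + l) = Y (int (Suc k)) l * (t - scale Q 1) - scale Q ?S"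
    using r unfolding sum.lessThan_Suc_shift by (simp add: algebra_simps scale_mult)
  then have "(t - scale Q 1) * (t * Y (- int (Suc k)) (int (Suc k) + l))
      = (t - scale Q 1) * (Y (int (Suc k)) l * (t - scale Q 1) - scale Q ?S)" by simp
  then show ?thesis
    by (simp only: mult.assoc[symmetric] u mult_1_left right_diff_distrib scale_mult sum_distrib_left)
qed

lemmas X_reflect1 = X_reflect_aux[of X, OF bernstein_right1 T1_U1(2)]
lemmas X_reflect2 = X_reflect_aux[of "\<lambda>m n. X n m", OF bernstein_right2 T2_U2(2)]

text \<open>The longest element sends omega_1 to -omega_2, which gives the leading term; all other
  terms carry a shorter element of W_0.\<close>

lemma x1_w0: "X 1 0 * wb 5 = wb 5 * X 0 (-1) + scale Q (X 1 0) + scale Q (wb 3 * X (-1) 1) + scale (Q ^ 2) (wb 2 * X 1 0)"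
proof -
  have u: "X (-1) 1 * T1 = U1 * X 1 0"
    using bernstein1(2) by (simp add: left_diff_distrib scale_mult)
  have "X 1 0 * wb 5 = (X 1 0 * T1) * (T2 * T1)" by (simp add: mult.assoc)
  also have "\<dots> = T1 * (X (-1) 1 * T2) * T1 + scale Q ((X 1 0 * T2) * T1)"
    unfolding bernstein1(1) by (simp add: distrib_right scale_mult mult.assoc)
  also have "X (-1) 1 * T2 = T2 * X 0 (-1) + scale Q (X (-1) 1)" using X_T(1)[of "-1"] by simp
  also have "X 1 0 * T2 = T2 * X 1 0" by (rule bernstein2(3))
  also have "T1 * (T2 * X 0 (-1) + scale Q (X (-1) 1)) * T1
      = T1 * (T2 * (X 0 (-1) * T1)) + scale Q (T1 * (X (-1) 1 * T1))"
    by (simp add: distrib_left distrib_right scale_mult mult.assoc)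
  also have "X 0 (-1) * T1 = T1 * X 0 (-1)" by (rule bernstein1(3))
  also have "T1 * (X (-1) 1 * T1) = X 1 0" unfolding u by (simp only: mult.assoc[symmetric] T1_U1 mult_1_left)
  also have "T2 * X 1 0 * T1 = T2 * (T1 * X (-1) 1) + scale Q (T2 * X 1 0)"
    unfolding mult.assoc bernstein1(1) by (simp add: distrib_left scale_mult)
  finally show ?thesis
    by (simp add: mult.assoc scale_right_distrib power2_eq_square algebra_simps)
qed

text \<open>Outer induction on \<open>qnorm\<close>, inner induction towards larger m + n. A
  nondominant weight is reflected to one with larger m + n, at the cost of string terms of smaller
  norm. At a dominant weight only the longest element is left: on a wall of the cone the trace
  property shortens it, elsewhere \<open>x1_w0\<close> reduces it to known cases.\<close>

theorem tracial_functional_zero: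
  assumes F: "linf F" and tr: "\<And>a b. F (a * b) = F (b * a)"
    and dom: "\<And>k m n. k < 5 \<Longrightarrow> 0 \<le> m \<Longrightarrow> 0 \<le> n \<Longrightarrow> F (wb k * X m n) = 0"
  shows "F h = 0"
proof -
  define V where "V m n \<longleftrightarrow> (\<forall>w\<in>H0. F (w * X m n) = 0)" for m n
  have V_D: "F (w * X m n) = 0" if "V m n" "w \<in> H0" for w m n using that by (simp add: V_def)
  have wb_H0: "wb k \<in> H0" if "k < 6" for k unfolding H0_def using that by (intro span_base) auto
  have V_I: "V m n" if k: "\<And>k. k < 6 \<Longrightarrow> F (wb k * X m n) = 0" for m n
    unfolding V_def
  proof
    fix w assume "w \<in> H0"
    then show "F (w * X m n) = 0" unfolding H0_def
      by (rule span_induct[where P = "\<lambda>w. F (w * X m n) = 0"])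
        (use k in \<open>auto simp: subspace_def distrib_right scale_mult linfD[OF F]\<close>)
  qed
  \<comment> \<open>The trace property moves the right-hand \<open>U\<close> to the front, where the
    finite Hecke algebra absorbs it.\<close>
  have refl: "V i' j'"
    if "Xij = U * Xkl * U - scale Q (\<Sum>j<k. U * Y j)" "Xij = X i' j'" "Xkl = X i j"
      "V i j" "\<And>a. a < k \<Longrightarrow> \<exists>b c. Y a = X b c \<and> V b c"
      "\<And>w. w \<in> H0 \<Longrightarrow> U * w \<in> H0 \<and> w * U \<in> H0" for i j i' j' U Y k Xij Xkl
    unfolding V_def
  proof
    fix w assume w: "w \<in> H0"
    have "F (w * X i' j') = F ((w * U * X i j) * U) - Q * (\<Sum>a<k. F (w * U * Y a))"
      unfolding that(2)[symmetric] that(1) that(3)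
      by (simp add: right_diff_distrib scale_mult sum_distrib_left mult.assoc linfD[OF F])
    also have "F ((w * U * X i j) * U) = F (U * w * U * X i j)" by (subst tr) (simp add: mult.assoc)
    also have "\<dots> = 0" using that(4,6) w by (intro V_D) auto
    also have "(\<Sum>a<k. F (w * U * Y a)) = 0"
      using that(5,6) w by (intro sum.neutral) (metis V_D lessThan_iff)
    finally show "F (w * X i' j') = 0" by simp
  qed
  have main: "V m n" if "qnorm m n = int a" "2 * qnorm m n - (m + n) = int d" for a d m n
    using that
  proof (induction a arbitrary: m n d rule: less_induct)
    case (less a)
    have small: "V i j" if "qnorm i j < int a" for i j
      using less.IH[of "nat (qnorm i j)" i j "nat (2 * qnorm i j - (i + j))"] that qnorm_ge[of i j] by auto
    show ?case using less.prems
    proof (induction d arbitrary: m n rule: less_induct)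
      case (less d)
      have higher: "V i j" if "qnorm i j = qnorm m n" "i + j > m + n" for i j
        using less.IH[of "nat (2 * qnorm i j - (i + j))" i j] that qnorm_ge[of i j] less.prems by auto
      consider "m < 0" | "n < 0" | "0 \<le> m" "0 \<le> n" by linarith
      then show ?case
      proof cases
        case 1
        then obtain k where k: "m = - int (Suc k)" by (metis negD)
        define l where "l = m + n"
        have n: "n = int (Suc k) + l" by (simp add: l_def k)
        show ?thesis unfolding k n
        proof (rule refl[OF X_reflect1[of k l] HOL.refl HOL.refl])
          show "V (int (Suc k)) l" by (rule higher) (simp_all add: k n qnorm_def algebra_simps)
          fix j assume j: "j < k"
          have "qnorm (int (Suc k) - 2 * int (Suc j)) (l + int (Suc j)) < qnorm (int (Suc k)) l"
            using j by (intro qnorm_string) auto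
          also have "\<dots> = int a" using less.prems(1) by (simp add: k n qnorm_def algebra_simps)
          finally show "\<exists>b c. X (int (Suc k) - 2 * int (Suc j)) (l + int (Suc j)) = X b c \<and> V b c"
            using small by blast
        qed (use H0_mult in auto)
      next
        case 2
        then obtain k where k: "n = - int (Suc k)" by (metis negD)
        define l where "l = m + n"
        have n: "m = int (Suc k) + l" by (simp add: l_def k)
        show ?thesis unfolding k n
        proof (rule refl[OF X_reflect2[of k l] HOL.refl HOL.refl])
          show "V l (int (Suc k))" by (rule higher) (simp_all add: k n qnorm_def algebra_simps)
          fix j assume j: "j < k"
          have "qnorm (l + int (Suc j)) (int (Suc k) - 2 * int (Suc j)) < qnorm (int (Suc k)) l"
            using j by (intro qnorm_string) auto
          also have "\<dots> = int a" using less.prems(1) by (simp add: k n qnorm_def algebra_simps)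
          finally show "\<exists>b c. X (l + int (Suc j)) (int (Suc k) - 2 * int (Suc j)) = X b c \<and> V b c"
            using small by blast
        qed (use H0_mult in auto)
      next
        case 3
        have 5: "F (wb 5 * X m n) = 0"
        proof (cases "m = 0 \<or> n = 0")
          case True
          then show ?thesis
          proof
            \<comment> \<open>On this wall \<open>T1\<close> commutes with the lattice element and
              can be cycled to the front, where the quadratic relation shortens the word.\<close>
            assume m: "m = 0"
            have "F (wb 5 * X m n) = F ((T1 * T2 * X 0 n) * T1)"
              unfolding m by (simp add: mult.assoc bernstein1(3))
            also have "\<dots> = F ((T1 * (T1 * T2)) * X 0 n)" by (subst tr) (simp add: mult.assoc)
            also have "\<dots> = F (wb 2 * X m n) + Q * F (wb 4 * X m n)"
              using T1_wb(5) m by (simp add: distrib_right scale_mult linfD[OF F])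
            finally show ?thesis using dom[of 2 m n] dom[of 4 m n] 3 by simp
          next
            assume n: "n = 0"
            have "F (wb 5 * X m n) = F ((T2 * T1 * X m 0) * T2)"
              unfolding n wb_5' by (simp add: mult.assoc bernstein2(3))
            also have "\<dots> = F ((T2 * (T2 * T1)) * X m 0)" by (subst tr) (simp add: mult.assoc)
            also have "\<dots> = F (wb 1 * X m n) + Q * F (wb 3 * X m n)"
              using T2_wb(4) n by (simp add: distrib_right scale_mult linfD[OF F])
            finally show ?thesis using dom[of 1 m n] dom[of 3 m n] 3 by simp
          qed
        next
          case False
          then have mn: "m \<ge> 1" "n \<ge> 1" using 3 by auto
          have "F (wb 5 * X m n) = F ((wb 5 * X (m - 1) n) * X 1 0)" by (simp add: mult.assoc X_mult)
          also have "\<dots> = F ((X 1 0 * wb 5) * X (m - 1) n)" by (subst tr) (simp only: mult.assoc)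
          also have "\<dots> = F (wb 5 * X (m - 1) (n - 1)) + Q * F (wb 0 * X m n) + Q * F (wb 3 * X (m - 2) (n + 1))
              + Q ^ 2 * F (wb 2 * X m n)"
            unfolding x1_w0
            by (simp add: distrib_right scale_mult linfD[OF F] mult.assoc X_mult del: wb_simps)
              (simp add: add.commute)
          also have "F (wb 5 * X (m - 1) (n - 1)) = 0"
          proof (rule V_D[OF small wb_H0])
            show "qnorm (m - 1) (n - 1) < int a"
              using less.prems(1) mn by (simp add: qnorm_def algebra_simps)
          qed simp
          also have "F (wb 3 * X (m - 2) (n + 1)) = 0"
          proof (cases "m = 1")
            case True
            \<comment> \<open>(-1, n + 1) has the same norm as (1, n), so the induction hypothesis
              does not cover it. It is reflected directly; its string has no interior
              points.\<close>
            have "X (-1) (n + 1) = U1 * X 1 n * U1"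
              using X_reflect1[of 0 n] by (simp add: add.commute)
            then have "F (wb 3 * X (m - 2) (n + 1)) = F ((T2 * (T1 * U1) * X 1 n) * U1)"
              by (simp add: True mult.assoc)
            also have "\<dots> = F (U1 * (T2 * X 1 n))" unfolding T1_U1 by (subst tr) simp
            also have "\<dots> = F (wb 4 * X 1 n) - Q * F (wb 2 * X 1 n)"
              by (simp add: left_diff_distrib scale_mult linfD[OF F] mult.assoc)
            finally show ?thesis using dom[of 4 1 n] dom[of 2 1 n] 3 by simp
          next
            case False
            show ?thesis
            proof (rule V_D[OF small wb_H0])
              show "qnorm (m - 2) (n + 1) < int a"
                using less.prems(1) mn False by (simp add: qnorm_def algebra_simps)
            qed simp
          qed
          finally show ?thesis using dom[of 0 m n] dom[of 2 m n] 3 by simp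
        qed
        show ?thesis
        proof (rule V_I)
          fix k assume "k < (6::nat)"
          then have "k < 5 \<or> k = 5" by auto
          then show "F (wb k * X m n) = 0" using dom 3 5 by auto
        qed
      qed
    qed
  qed
  have all: "V m n" for m n
    using main[of m n "nat (qnorm m n)" "nat (2 * qnorm m n - (m + n))"] qnorm_ge[of m n] by auto
  show ?thesis
    by (rule functional_unique[OF F, of "\<lambda>_. 0"]) (use all wb_H0 V_D in \<open>auto simp: linf_def\<close>)
qed

section \<open>The Plancherel formula\<close>

definition rq :: complex where "rq = of_real (q powr (-1/2))"
definition pq :: complex where "pq = of_real (1 / q)"

lemma pq_props: "norm pq < 1" "pq \<noteq> 0" "of_real q = 1 / pq" "norm pq = 1 / q"
proof -
  have q: "q > 0" "1 / q < 1" using q_gt1 by simp_all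
  show n: "norm pq = 1 / q" unfolding pq_def norm_of_real using q by simp
  show "norm pq < 1" unfolding n by (rule q(2))
  show "pq \<noteq> 0" "of_real q = 1 / pq" unfolding pq_def using q by simp_all
qed

lemma rq_sq: "rq ^ 2 = pq"
proof -
  have "of_real q * rq ^ 2 = 1" unfolding rq_def by (rule rt_q)
  then show ?thesis unfolding pq_props(3) using pq_props(2) by simp
qed

lemma rq_props: "norm rq < 1" "rq \<noteq> 0"
proof -
  have "norm rq ^ 2 < 1" using pq_props(1) by (simp add: rq_sq[symmetric] norm_power)
  then show "norm rq < 1" using power_less_one_iff[of "norm rq" 2] by simp
  show "rq \<noteq> 0" using rq_sq pq_props(2) by auto
qed

text \<open>On the unit circle this is |1 - z|^2 / |1 - z/q|^2, the factor of one root in 1/|c|^2.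
  Written without conjugates it is a rational function, visibly invariant under z to 1/z.\<close>

definition hfun :: "complex \<Rightarrow> complex" where
  "hfun z = (1 - z) * (1 - 1 / z) / ((1 - pq * z) * (1 - pq / z))"

lemma hfun_inverse: "hfun (1 / z) = hfun z"
  by (simp add: hfun_def mult_ac)

lemma norm_hfun_le: "norm z = 1 \<Longrightarrow> norm (hfun z) \<le> 4 / (1 - norm pq) ^ 2"
proof -
  assume z: "norm z = 1"
  have f: "norm (1 - z) \<le> 2" "norm (1 - 1 / z) \<le> 2"
    using norm_triangle_ineq4[of 1 z] norm_triangle_ineq4[of 1 "1 / z"] z by (simp_all add: norm_divide)
  have g: "1 - norm pq \<le> norm (1 - pq * z)" "1 - norm pq \<le> norm (1 - pq / z)"
    using norm_one_minus_ge[of "pq * z"] norm_one_minus_ge[of "pq / z"] z by (simp_all add: norm_mult norm_divide)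
  have e: "0 < 1 - norm pq" using pq_props by simp
  have "norm (hfun z) \<le> 2 * 2 / ((1 - norm pq) * (1 - norm pq))"
  proof -
    have "norm (1 - z) * norm (1 - 1 / z) \<le> 2 * 2" using f by (intro mult_mono) simp_all
    moreover have "(1 - norm pq) * (1 - norm pq) \<le> norm (1 - pq * z) * norm (1 - pq / z)"
      using g e by (intro mult_mono) simp_all
    ultimately show ?thesis
      unfolding hfun_def norm_divide[of "(1 - z) * (1 - 1 / z)"] norm_mult[of "1 - z"] norm_mult[of "1 - pq * z"]
      using e by (intro frac_le) simp_all
  qed
  then show ?thesis by (simp add: power2_eq_square)
qed

text \<open>On the circle the conjugate of z is 1/z. At z = 1 both sides are 0 because division by
  zero gives 0, so \<open>density\<close> holds on the whole torus.\<close>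

lemma norm_sq_frac:
  assumes "norm z = 1"
  shows "of_real ((norm ((1 - pq * z) / (1 - z)))\<^sup>2) = 1 / hfun z"
proof -
  have "z * cnj z = 1" using complex_norm_square[of z] assms by simp
  moreover have "z \<noteq> 0" using assms by auto
  ultimately have z: "cnj z = 1 / z" by (simp add: eq_divide_eq mult.commute)
  have pq: "cnj pq = pq" unfolding pq_def by (rule complex_cnj_complex_of_real)
  show ?thesis
    unfolding complex_norm_square by (simp add: z pq hfun_def)
qed

lemma density:
  assumes "norm t1 = 1" "norm t2 = 1"
  shows "1 / complex_of_real ((cmod (c_fun q (t1, t2)))\<^sup>2) = hfun (ra t1 t2) * hfun (rb t1 t2) * hfun (1 / (t1 * t2))"
proof -
  have n: "norm (ra t1 t2) = 1" "norm (rb t1 t2) = 1" "norm (1 / (t1 * t2)) = 1"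
    using assms by (simp_all add: norm_divide norm_mult norm_power)
  have "c_fun q (t1, t2) = ((1 - pq * ra t1 t2) / (1 - ra t1 t2)) * ((1 - pq * rb t1 t2) / (1 - rb t1 t2))
      * ((1 - pq * (1 / (t1 * t2))) / (1 - 1 / (t1 * t2)))"
    by (simp add: c_fun_def Let_def pq_def power_int_minus divide_inverse mult_ac)
  then have "complex_of_real ((cmod (c_fun q (t1, t2)))\<^sup>2) = 1 / hfun (ra t1 t2) * (1 / hfun (rb t1 t2)) * (1 / hfun (1 / (t1 * t2)))"
    unfolding norm_sq_frac[OF n(1), symmetric] norm_sq_frac[OF n(2), symmetric] norm_sq_frac[OF n(3), symmetric]
    by (simp only: norm_mult power_mult_distrib of_real_mult)
  then show ?thesis by simp
qed

text \<open>W_0 permutes the roots, and \<open>hfun\<close> does not distinguish a root from its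
  negative.\<close>

lemma density_orbit:
  assumes "t1 \<noteq> 0" "t2 \<noteq> 0" "i < 6" "orbit t1 t2 i = (z1, z2)"
  shows "hfun (ra z1 z2) * hfun (rb z1 z2) * hfun (1 / (z1 * z2)) = hfun (ra t1 t2) * hfun (rb t1 t2) * hfun (1 / (t1 * t2))"
proof -
  define a b where "a = ra t1 t2" and "b = rb t1 t2"
  have ab: "1 / (t1 * t2) = a * b" using assms(1,2) by (simp add: a_def b_def power2_eq_square)
  have inv: "hfun (inverse z) = hfun z" for z using hfun_inverse[of z] by (simp add: divide_inverse)
  have o: "ra (t2 / t1) t2 = inverse a" "rb (t2 / t1) t2 = a * b" "1 / (t2 / t1 * t2) = b"
    "ra t1 (t1 / t2) = a * b" "rb t1 (t1 / t2) = inverse b" "1 / (t1 * (t1 / t2)) = a"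
    "ra (t2 / t1) (1 / t1) = b" "rb (t2 / t1) (1 / t1) = inverse (a * b)" "1 / (t2 / t1 * (1 / t1)) = inverse a"
    "ra (1 / t2) (t1 / t2) = inverse (a * b)" "rb (1 / t2) (t1 / t2) = a" "1 / (1 / t2 * (t1 / t2)) = inverse b"
    "ra (1 / t2) (1 / t1) = inverse b" "rb (1 / t2) (1 / t1) = inverse a" "1 / (1 / t2 * (1 / t1)) = inverse (a * b)"
    using assms(1,2) by (simp_all add: a_def b_def power2_eq_square)
  show ?thesis
    using assms(3) unfolding less6_cases
  proof (elim disjE)
    assume "i = 0"
    then have "z1 = t1" "z2 = t2" using assms(4) by (auto simp: orbit_def)
    then show ?thesis by (simp only: ab a_def[symmetric] b_def[symmetric])
  next
    assume "i = 1"
    then have "z1 = t2 / t1" "z2 = t2" using assms(4) by (auto simp: orbit_def)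
    then show ?thesis by (simp only: o inv ab a_def[symmetric] b_def[symmetric], simp only: mult_ac)
  next
    assume "i = 2"
    then have "z1 = t1" "z2 = t1 / t2" using assms(4) by (auto simp: orbit_def)
    then show ?thesis by (simp only: o inv ab a_def[symmetric] b_def[symmetric], simp only: mult_ac)
  next
    assume "i = 3"
    then have "z1 = t2 / t1" "z2 = 1 / t1" using assms(4) by (auto simp: orbit_def)
    then show ?thesis by (simp only: o inv ab a_def[symmetric] b_def[symmetric], simp only: mult_ac)
  next
    assume "i = 4"
    then have "z1 = 1 / t2" "z2 = t1 / t2" using assms(4) by (auto simp: orbit_def)
    then show ?thesis by (simp only: o inv ab a_def[symmetric] b_def[symmetric], simp only: mult_ac)
  next
    assume "i = 5"
    then have "z1 = 1 / t2" "z2 = 1 / t1" using assms(4) by (auto simp: orbit_def)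
    then show ?thesis by (simp only: o inv ab a_def[symmetric] b_def[symmetric], simp only: mult_ac)
  qed
qed

section \<open>Clearing the Weyl denominator\<close>

definition \<Delta> :: "complex \<Rightarrow> complex \<Rightarrow> complex" where
  "\<Delta> t1 t2 = (1 - ra t1 t2) * (1 - rb t1 t2) * (1 - 1 / (t1 * t2))"

text \<open>Multiplying by the Weyl denominator turns \<^term>\<open>dcoef k\<close> into a Laurent polynomial; \<open>dlist k\<close>
  lists its terms \<open>(c, e, f)\<close>, standing for \<open>c\<close> times the monomial with exponent
  \<open>- e \<alpha>\<^sub>1 - f \<alpha>\<^sub>2\<close>.\<close>

definition dlist :: "nat \<Rightarrow> (complex \<times> int \<times> int) list" where
  "dlist k = [[(1,0,0), (-1,1,0), (-1,0,1), (1,2,1), (1,1,2), (-1,2,2)],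
    [(Q,0,0), (-Q,0,1), (-Q,1,1), (Q,1,2)], [(Q,0,0), (-Q,1,0), (-Q,1,1), (Q,2,1)],
    [(Q^2,0,0), (-(Q^2),1,1)], [(Q^2,0,0), (-(Q^2),1,1)]] ! k"

text \<open>The Laurent polynomial of \<open>dlist k\<close> acts on an arbitrary function
  \<open>g\<close> of the exponents instead of on monomials, so that it commutes with sums over the
  orbit and with integrals.\<close>

definition dsum :: "nat \<Rightarrow> (int \<Rightarrow> int \<Rightarrow> complex) \<Rightarrow> int \<Rightarrow> int \<Rightarrow> complex" where
  "dsum k g m n = (\<Sum>(c, e, f)\<leftarrow>dlist k. c * g (m - 2 * e + f) (n + e - 2 * f))"

lemma dcoef_expand:
  assumes t: "regular t1 t2" and k: "k < 5"
  shows "dcoef k t1 t2 * (t1 powi m * t2 powi n) = dsum k (\<lambda>m n. t1 powi m * t2 powi n / \<Delta> t1 t2) m n"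
proof -
  define a b where "a = ra t1 t2" and "b = rb t1 t2"
  have t0: "t1 \<noteq> 0" "t2 \<noteq> 0" using t by (auto simp: regular_def)
  have ab: "1 / (t1 * t2) = a * b" using t0 by (simp add: a_def b_def eval_nat_numeral field_simps)
  have nz: "1 - a \<noteq> 0" "1 - b \<noteq> 0" "1 - a * b \<noteq> 0"
    using t unfolding ab[symmetric] by (auto simp: regular_def a_def b_def)
  define M where "M = t1 powi m * t2 powi n"
  have sh: "t1 powi (m - 2 * e + f) * t2 powi (n + e - 2 * f) = M * (a powi e * b powi f)" for e f
  proof -
    have "a powi e = t2 powi e * t1 powi (- 2 * e)" "b powi f = t1 powi f * t2 powi (- 2 * f)"
      using power_int_mult[of t1 2 "e"] power_int_mult[of t2 2 f]
      by (simp_all add: a_def b_def power_int_mult_distrib power_int_inverse power_int_minus divide_inverse)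
    moreover have "m - 2 * e + f = m + (- 2 * e) + f" "n + e - 2 * f = n + e + (- 2 * f)" by simp_all
    ultimately show ?thesis using t0 by (simp only: power_int_add simp_thms M_def mult_ac)
  qed
  have g: "x / y * (y * z) = x * z" if "y \<noteq> 0" for x y z :: complex using that by simp
  have k34: "Q ^ 2 / ((1 - a) * (1 - b)) * ((1 - a) * (1 - b) * (1 - a * b)) = Q ^ 2 - Q ^ 2 * (a * b)"
    using nz(1,2) by (subst g) (simp_all add: right_diff_distrib)
  have "k = 0 \<or> k = 1 \<or> k = 2 \<or> k = 3 \<or> k = 4" using k by auto
  then have "dcoef k t1 t2 * ((1 - a) * (1 - b) * (1 - a * b)) = (\<Sum>(c, e, f)\<leftarrow>dlist k. c * (a powi e * b powi f))"
    unfolding dcoef_def a_def[symmetric] b_def[symmetric] dlist_def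
    using nz k34 by (elim disjE) (simp_all, simp_all add: field_simps power2_eq_square)
  then have d: "dcoef k t1 t2 = (\<Sum>(c, e, f)\<leftarrow>dlist k. c * (a powi e * b powi f)) / ((1 - a) * (1 - b) * (1 - a * b))"
    using nz by (simp add: eq_divide_eq)
  have "dsum k (\<lambda>m n. t1 powi m * t2 powi n / \<Delta> t1 t2) m n
      = (\<Sum>(c, e, f)\<leftarrow>dlist k. (M / ((1 - a) * (1 - b) * (1 - a * b))) * (c * (a powi e * b powi f)))"
    unfolding dsum_def sh \<Delta>_def ab a_def[symmetric] b_def[symmetric]
    by (intro arg_cong[where f = sum_list] map_cong refl) (auto simp: mult_ac)
  also have "\<dots> = (M / ((1 - a) * (1 - b) * (1 - a * b))) * (\<Sum>(c, e, f)\<leftarrow>dlist k. c * (a powi e * b powi f))"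
    by (simp add: sum_list_const_mult[symmetric] split_def)
  finally show ?thesis unfolding d M_def[symmetric] by simp
qed

lemma dsum_sum: "finite I \<Longrightarrow> (\<Sum>i\<in>I. dsum k (g i) m n) = dsum k (\<lambda>m n. \<Sum>i\<in>I. g i m n) m n"
  by (induction I rule: finite_induct)
    (simp_all add: dsum_def sum_list_addf[symmetric] split_def distrib_left sum_list_0)

lemma dsum_mult: "dsum k g m n * c = dsum k (\<lambda>m n. g m n * c) m n"
  by (simp add: dsum_def sum_list_mult_const[symmetric] split_def mult.assoc)

lemma dsum_linear: "a * dsum k f m n + b * dsum k g m n + c * dsum k h m n
    = dsum k (\<lambda>m n. a * f m n + b * g m n + c * h m n) m n"
  by (simp add: dsum_def sum_list_const_mult[symmetric] sum_list_addf[symmetric] split_def algebra_simps)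

lemma integral_dsum:
  assumes "\<And>m n. integrable M (g m n)"
  shows "integrable M (\<lambda>x. dsum k (\<lambda>m n. g m n x) m n)"
    "(LINT x|M. dsum k (\<lambda>m n. g m n x) m n) = dsum k (\<lambda>m n. LINT x|M. g m n x) m n"
proof -
  have "integrable M (\<lambda>x. (\<Sum>(c, e, f)\<leftarrow>xs. c * g (m - 2 * e + f) (n + e - 2 * f) x)) \<and>
    (LINT x|M. (\<Sum>(c, e, f)\<leftarrow>xs. c * g (m - 2 * e + f) (n + e - 2 * f) x))
      = (\<Sum>(c, e, f)\<leftarrow>xs. c * integral\<^sup>L M (g (m - 2 * e + f) (n + e - 2 * f)))" for xs
    by (induction xs) (auto simp: assms)
  then show "integrable M (\<lambda>x. dsum k (\<lambda>m n. g m n x) m n)"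
    "(LINT x|M. dsum k (\<lambda>m n. g m n x) m n) = dsum k (\<lambda>m n. LINT x|M. g m n x) m n"
    by (simp_all add: dsum_def)
qed

text \<open>Dividing \<open>hfun\<close> by 1 - z leaves a single zero, written as 1 - 1/z; hence
  the single factors in the numerator of \<open>Wk\<close>.\<close>

lemma monW_density:
  assumes t: "regular t1 t2"
  shows "t1 powi m * t2 powi n / \<Delta> t1 t2 * (hfun (ra t1 t2) * hfun (rb t1 t2) * hfun (1 / (t1 * t2))) = monW pq m n (t1, t2)"
proof -
  define a b where "a = ra t1 t2" and "b = rb t1 t2"
  have t0: "t1 \<noteq> 0" "t2 \<noteq> 0" using t by (auto simp: regular_def)
  have ab: "1 / (t1 * t2) = a * b" using t0 by (simp add: a_def b_def eval_nat_numeral field_simps)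
  have nz: "1 - a \<noteq> 0" "1 - b \<noteq> 0" "1 - a * b \<noteq> 0"
    using t unfolding ab[symmetric] by (auto simp: regular_def a_def b_def)
  have uv: "t1 ^ 2 / t2 = 1 / a" "t2 ^ 2 / t1 = 1 / b" by (simp_all add: a_def b_def)
  have ab0: "a \<noteq> 0" "b \<noteq> 0" using t0 by (auto simp: a_def b_def)
  have h: "hfun z / (1 - z) = (1 - 1 / z) / ((1 - pq * (1 / z)) * (1 - pq / (1 / z)))" if "1 - z \<noteq> 0" for z
    using that by (simp add: hfun_def mult_ac)
  have "hfun a * hfun b * hfun (a * b) / ((1 - a) * (1 - b) * (1 - a * b)) = (hfun a / (1 - a)) * (hfun b / (1 - b)) * (hfun (a * b) / (1 - a * b))"
    by simp
  also have "\<dots> = Wk pq (1 / a) (1 / b)"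
    unfolding h[OF nz(1)] h[OF nz(2)] h[OF nz(3)] Wk_def by simp
  finally have e: "hfun a * hfun b * hfun (a * b) / ((1 - a) * (1 - b) * (1 - a * b)) = Wk pq (1 / a) (1 / b)" .
  have "x / y * z = x * (z / y)" for x y z :: complex by simp
  then show ?thesis
    unfolding monW_def \<Delta>_def fst_conv snd_conv uv ab a_def[symmetric] b_def[symmetric] e[symmetric] .
qed

lemma regular_torus: "norm t1 = 1 \<Longrightarrow> norm t2 = 1 \<Longrightarrow> t2 \<noteq> t1 ^ 2 \<and> t1 \<noteq> t2 ^ 2 \<and> t1 * t2 \<noteq> 1 \<Longrightarrow> regular t1 t2"
  by (auto simp: regular_def)

text \<open>As the density is constant on orbits, each weight can be paired with the density at that
  weight, which makes all six summands the same function evaluated along the orbit.\<close>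

lemma chi_density:
  assumes t: "norm (fst t) = 1" "norm (snd t) = 1" "regular (fst t) (snd t)" and k: "k < 5"
  shows "chi t (wb k * X m n) / complex_of_real ((cmod (c_fun q t))\<^sup>2)
    = (\<Sum>i<6. dsum k (\<lambda>m n. monW pq m n (orbit (fst t) (snd t) i)) m n)"
proof -
  define d where "d = hfun (ra (fst t) (snd t)) * hfun (rb (fst t) (snd t)) * hfun (1 / (fst t * snd t))"
  have nz: "fst t \<noteq> 0" "snd t \<noteq> 0" using t by auto
  have "1 / complex_of_real ((cmod (c_fun q t))\<^sup>2) = d"
    using density[OF t(1,2)] by (simp add: d_def)
  then have "chi t (wb k * X m n) / complex_of_real ((cmod (c_fun q t))\<^sup>2) = chi t (wb k * X m n) * d"
    by (metis divide_inverse mult_1_left)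
  also have "\<dots> = (\<Sum>i<6. dsum k (\<lambda>m n. monW pq m n (orbit (fst t) (snd t) i)) m n)"
    unfolding chi_wbX[OF t(3) k] sum_distrib_right
  proof (intro sum.cong refl)
    fix i assume "i \<in> {..<6::nat}"
    then have i: "i < 6" by simp
    obtain z1 z2 where z: "orbit (fst t) (snd t) i = (z1, z2)" by fastforce
    have r: "regular z1 z2" using regular_orbit[OF t(3) i] z by simp
    have "dcoef k z1 z2 * (z1 powi m * z2 powi n) * d = dsum k (\<lambda>m n. t1 powi m * t2 powi n / \<Delta> t1 t2 * d) m n"
      if "t1 = z1" "t2 = z2" for t1 t2
      unfolding dcoef_expand[OF r k] dsum_mult that ..
    also have "dsum k (\<lambda>m n. z1 powi m * z2 powi n / \<Delta> z1 z2 * d) m n = dsum k (\<lambda>m n. monW pq m n (z1, z2)) m n"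
      unfolding d_def density_orbit[OF nz i z, symmetric] monW_density[OF r] ..
    finally show "dcoef k (fst (orbit (fst t) (snd t) i)) (snd (orbit (fst t) (snd t) i)) *
        (fst (orbit (fst t) (snd t) i) powi m * snd (orbit (fst t) (snd t) i) powi n) * d
        = dsum k (\<lambda>m n. monW pq m n (orbit (fst t) (snd t) i)) m n"
      by (simp add: z)
  qed
  finally show ?thesis .
qed

lemma orbit_integral:
  fixes f :: "complex \<times> complex \<Rightarrow> complex"
  assumes f: "f \<in> borel \<rightarrow>\<^sub>M borel" "\<And>t. norm (fst t) = 1 \<Longrightarrow> norm (snd t) = 1 \<Longrightarrow> norm (f t) \<le> B" and i: "i < 6"
  shows "integrable torus (\<lambda>t. f (orbit (fst t) (snd t) i))"
    "(LINT t|torus. f (orbit (fst t) (snd t) i)) = (LINT t|torus. f t)"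
proof -
  \<comment> \<open>The bounded measurable functions with the same integral as \<open>f\<close>, a
    class closed under composition with the two simple reflections.\<close>
  define g :: "(complex \<times> complex \<Rightarrow> complex) \<Rightarrow> bool" where
    "g h \<longleftrightarrow> h \<in> borel \<rightarrow>\<^sub>M borel \<and> (\<forall>t. norm (fst t) = 1 \<longrightarrow> norm (snd t) = 1 \<longrightarrow> norm (h t) \<le> B)
      \<and> (LINT t|torus. h t) = (LINT t|torus. f t)" for h
  have m1: "(\<lambda>t. (snd t ^ 1 / fst t, snd t)) \<in> borel \<rightarrow>\<^sub>M (borel :: (complex \<times> complex) measure)"
    using measurable_compose[OF measurable_compose[OF measurable_torus_maps(1) measurable_torus_maps(2)[of 1]] measurable_torus_maps(1)]
    by simp
  have s1: "g (\<lambda>t. h (snd t / fst t, snd t))" if "g h" for h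
    using that torus_reflect_fst[of h B 1] measurable_compose[OF m1, of h borel] by (auto simp: g_def norm_divide)
  have s2: "g (\<lambda>t. h (fst t, fst t / snd t))" if "g h" for h
    using that torus_reflect_snd[of h B 1] measurable_compose[OF measurable_torus_maps(2)[of 1], of h borel] by (auto simp: g_def norm_divide)
  have 0: "g f" using f by (simp add: g_def)
  note 1 = s1[OF 0] and 2 = s2[OF 0]
  note 3 = s1[OF 2] and 4 = s2[OF 1]
  note 5 = s1[OF 4]
  have "\<exists>h. g h \<and> (\<forall>t. norm (fst t) = 1 \<longrightarrow> norm (snd t) = 1 \<longrightarrow> h t = f (orbit (fst t) (snd t) i))"
    using i unfolding less6_cases
    proof (elim disjE)
    assume "i = 0"
    then show ?thesis using 0 by (intro exI[of _ f]) (simp add: orbit_def)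
  next
    assume i: "i = 1"
    show ?thesis by (rule exI, rule conjI[OF 1]) (auto simp: orbit_def i)
  next
    assume i: "i = 2"
    show ?thesis by (rule exI, rule conjI[OF 2]) (auto simp: orbit_def i)
  next
    assume i: "i = 3"
    show ?thesis by (rule exI, rule conjI[OF 3]) (auto simp: orbit_def i)
  next
    assume i: "i = 4"
    show ?thesis by (rule exI, rule conjI[OF 4]) (auto simp: orbit_def i)
  next
    assume i: "i = 5"
    show ?thesis by (rule exI, rule conjI[OF 5]) (auto simp: orbit_def i)
  qed
  then obtain h where h: "g h" "\<And>t. norm (fst t) = 1 \<Longrightarrow> norm (snd t) = 1 \<Longrightarrow> h t = f (orbit (fst t) (snd t) i)"
    by blast
  have "(\<lambda>t. orbit (fst t) (snd t) i) \<in> (borel \<Otimes>\<^sub>M borel) \<rightarrow>\<^sub>M ((borel :: complex measure) \<Otimes>\<^sub>M (borel :: complex measure))"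
    using i unfolding less6_cases by (elim disjE; simp add: orbit_def; measurable)
  then have "(\<lambda>t. orbit (fst t) (snd t) i) \<in> borel \<rightarrow>\<^sub>M (borel :: (complex \<times> complex) measure)"
    unfolding borel_prod .
  from measurable_compose[OF this f(1)]
  have m: "(\<lambda>t. f (orbit (fst t) (snd t) i)) \<in> borel \<rightarrow>\<^sub>M borel" .
  show int: "integrable torus (\<lambda>t. f (orbit (fst t) (snd t) i))"
    using h by (intro torus_integrable[OF m, of B]) (metis g_def)
  have "(LINT t|torus. f (orbit (fst t) (snd t) i)) = (LINT t|torus. h t)"
  proof (rule integral_cong_AE)
    show "AE t in torus. f (orbit (fst t) (snd t) i) = h t" using AE_torus by eventually_elim (simp add: h(2))
  qed (use h(1) m in \<open>auto simp: g_def\<close>)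
  then show "(LINT t|torus. f (orbit (fst t) (snd t) i)) = (LINT t|torus. f t)"
    using h(1) by (simp add: g_def)
qed

text \<open>For fixed \<open>h\<close> the value is a Laurent polynomial in the two weights. Rather
  than exhibiting it, the proof checks that the elements \<open>h\<close> with both properties form
  a subspace containing \<open>BB\<close>.\<close>

lemma wfun_tame:
  assumes f: "f1 \<in> borel_measurable M" "f2 \<in> borel_measurable M"
    and S: "\<And>x. x \<in> S \<Longrightarrow> norm (f1 x) = \<rho>1 \<and> norm (f2 x) = \<rho>2"
  shows "(\<lambda>x. wfun c (f1 x) (f2 x) h) \<in> borel_measurable M"
    "\<exists>B. \<forall>x\<in>S. norm (wfun c (f1 x) (f2 x) h) \<le> B"
proof -
  define V where "V = {h. (\<lambda>x. wfun c (f1 x) (f2 x) h) \<in> borel_measurable M \<and>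
    (\<exists>B. \<forall>x\<in>S. norm (wfun c (f1 x) (f2 x) h) \<le> B)}"
  have "subspace V"
    unfolding subspace_def
  proof (intro conjI ballI allI)
    show "0 \<in> V" by (auto simp: V_def linfD[OF wfun(1)])
  next
    fix x y assume "x \<in> V" "y \<in> V"
    then obtain A B where *: "\<forall>z\<in>S. norm (wfun c (f1 z) (f2 z) x) \<le> A" "\<forall>z\<in>S. norm (wfun c (f1 z) (f2 z) y) \<le> B"
      and m: "(\<lambda>z. wfun c (f1 z) (f2 z) x) \<in> borel_measurable M" "(\<lambda>z. wfun c (f1 z) (f2 z) y) \<in> borel_measurable M"
      by (auto simp: V_def)
    have "\<forall>z\<in>S. norm (wfun c (f1 z) (f2 z) (x + y)) \<le> A + B"
      using * by (auto simp: linfD[OF wfun(1)] intro!: norm_triangle_le add_mono)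
    then show "x + y \<in> V" using m by (auto simp: V_def linfD[OF wfun(1)])
  next
    fix a x assume "x \<in> V"
    then obtain A where *: "\<forall>z\<in>S. norm (wfun c (f1 z) (f2 z) x) \<le> A"
      and m: "(\<lambda>z. wfun c (f1 z) (f2 z) x) \<in> borel_measurable M"
      by (auto simp: V_def)
    have "\<forall>z\<in>S. norm (wfun c (f1 z) (f2 z) (scale a x)) \<le> norm a * A"
      using * by (auto simp: linfD[OF wfun(1)] norm_mult intro!: mult_left_mono)
    then show "scale a x \<in> V" using m by (auto simp: V_def linfD[OF wfun(1)])
  qed
  moreover have "wb k * X m n \<in> V" if "k < 6" for k m n
  proof -
    have "(\<lambda>x. c k * f1 x powi m * f2 x powi n) \<in> borel_measurable M"
      using f by (intro borel_measurable_times measurable_powi) auto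
    moreover have "\<forall>x\<in>S. norm (c k * f1 x powi m * f2 x powi n) \<le> norm (c k) * \<rho>1 powi m * \<rho>2 powi n"
      using S by (auto simp: norm_mult norm_power_int)
    ultimately show ?thesis using that by (auto simp: V_def wfun)
  qed
  ultimately have "span BB \<subseteq> V" by (intro span_minimal) (auto simp: BB_def)
  then have "h \<in> V" by (auto simp: span_BB)
  then show "(\<lambda>x. wfun c (f1 x) (f2 x) h) \<in> borel_measurable M"
    "\<exists>B. \<forall>x\<in>S. norm (wfun c (f1 x) (f2 x) h) \<le> B" by (auto simp: V_def)
qed

lemma sum_bounded_ex:
  fixes f :: "'i \<Rightarrow> 'a \<Rightarrow> complex"
  assumes "finite I" "\<And>i. i \<in> I \<Longrightarrow> \<exists>B. \<forall>x\<in>S. norm (f i x) \<le> B"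
  shows "\<exists>B. \<forall>x\<in>S. norm (\<Sum>i\<in>I. f i x) \<le> B"
proof -
  obtain B where B: "\<And>i x. i \<in> I \<Longrightarrow> x \<in> S \<Longrightarrow> norm (f i x) \<le> B i" using assms(2) by metis
  then have "\<forall>x\<in>S. norm (\<Sum>i\<in>I. f i x) \<le> (\<Sum>i\<in>I. B i)" by (auto intro!: sum_norm_le)
  then show ?thesis ..
qed

lemma fst_snd_borel: "fst \<in> borel_measurable (borel :: (complex \<times> complex) measure)"
  "snd \<in> borel_measurable (borel :: (complex \<times> complex) measure)"
  by (intro borel_measurable_continuous_onI continuous_intros)+

text \<open>If a coordinate of \<open>t\<close> is 0, no homomorphism as in the definition of \<^term>\<open>chi t\<close> exists,
  so that \<^term>\<open>chi t\<close> is a junk value; it does not depend on \<open>t\<close>, whence \<open>chi\<close> is Borel measurable.\<close>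

lemma chi_tame:
  "(\<lambda>t. chi t h) \<in> borel \<rightarrow>\<^sub>M borel"
  "\<exists>B. \<forall>t. norm (fst t) = 1 \<longrightarrow> norm (snd t) = 1 \<longrightarrow> norm (chi t h) \<le> B"
proof -
  define J where "J = induced_char CP (SOME \<theta>. False) h"
  have e: "chi t h = (if fst t \<noteq> 0 \<and> snd t \<noteq> 0 then \<Sum>i<6. \<pi>P t i (h * wb i) else J)" for t
  proof (cases "fst t \<noteq> 0 \<and> snd t \<noteq> 0")
    case True
    then show ?thesis using induced_char_dual[OF principal_dual(1)] by (simp add: chi_eq)
  next
    case False
    have F: "(alg_hom_on CP \<theta> \<and> \<theta> (x omega1) = fst t \<and> \<theta> (x omega2) = snd t) = False" for \<theta>
      using alg_hom_X(2,3)[of CP \<theta>] CP_base False by (auto simp: x_omega)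
    have "chi t h = J" unfolding chi_def J_def F ..
    then show ?thesis by (simp only: False if_False)
  qed
  have S: "norm (fst t) = 1 \<and> norm (snd t) = 1" if "t \<in> {t::complex \<times> complex. norm (fst t) = 1 \<and> norm (snd t) = 1}" for t
    using that by simp
  note w = wfun_tame[OF fst_snd_borel S]
  have m: "(\<lambda>t. \<Sum>i<6. \<pi>P t i (h * wb i)) \<in> borel \<rightarrow>\<^sub>M borel"
    by (intro borel_measurable_sum w)
  have "{t::complex \<times> complex. fst t \<noteq> 0 \<and> snd t \<noteq> 0} \<in> sets borel"
    by (rule borel_pair_set) measurable
  then show "(\<lambda>t. chi t h) \<in> borel \<rightarrow>\<^sub>M borel"
    unfolding e using m by (intro measurable_If) auto
  have "\<exists>B. \<forall>t\<in>{t::complex \<times> complex. norm (fst t) = 1 \<and> norm (snd t) = 1}. norm (\<Sum>i<6. \<pi>P t i (h * wb i)) \<le> B"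
    by (intro sum_bounded_ex w(2)) simp
  then obtain B where "\<And>t. norm (fst t) = 1 \<Longrightarrow> norm (snd t) = 1 \<Longrightarrow> norm (\<Sum>i<6. \<pi>P t i (h * wb i)) \<le> B"
    by auto
  then have "norm (chi t h) \<le> B" if "norm (fst t) = 1" "norm (snd t) = 1" for t
    unfolding e using that by auto
  then show "\<exists>B. \<forall>t. norm (fst t) = 1 \<longrightarrow> norm (snd t) = 1 \<longrightarrow> norm (chi t h) \<le> B" by blast
qed

lemma chi1_tame:
  "(\<lambda>s. chi1 s h) \<in> borel \<rightarrow>\<^sub>M borel"
  "\<exists>B. \<forall>s. norm s = 1 \<longrightarrow> norm (chi1 s h) \<le> B"
proof -
  define J where "J = induced_char H1 (SOME \<theta>. False) h"
  have e: "chi1 s h = (if s \<noteq> 0 then \<Sum>i<3. \<pi>S s i (h * cb i) else J)" for s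
  proof (cases "s \<noteq> 0")
    case True
    then show ?thesis using induced_char_dual[OF steinberg1_dual(1)] by (simp add: chi1_eq)
  next
    case False
    have F: "(alg_hom_on H1 \<theta> \<and> \<theta> (T s1) = - of_real (q powr (-1/2)) \<and>
        \<theta> (x omega1) = of_real (q powr (-1/2)) * s \<and> \<theta> (x omega2) = s ^ 2) = False" for \<theta>
      using alg_hom_X(3)[of H1 \<theta>] H1_props(3) False by (auto simp: x_omega)
    have "chi1 s h = J" unfolding chi1_def J_def F ..
    then show ?thesis by (simp only: False if_False)
  qed
  have f: "(\<lambda>s. of_real (q powr (-1/2)) * s) \<in> borel_measurable (borel :: complex measure)" "(\<lambda>s. s ^ 2) \<in> borel_measurable (borel :: complex measure)"
    by measurable
  have S: "norm (of_real (q powr (-1/2)) * s) = norm (of_real (q powr (-1/2)) :: complex) \<and> norm (s ^ 2) = 1"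
    if "s \<in> {s::complex. norm s = 1}" for s
    using that by (simp only: norm_mult norm_power mem_Collect_eq mult_1_right power_one simp_thms)
  note w = wfun_tame[OF f S]
  have m: "(\<lambda>s. \<Sum>i<3. \<pi>S s i (h * cb i)) \<in> borel \<rightarrow>\<^sub>M borel"
    by (intro borel_measurable_sum w)
  then show "(\<lambda>s. chi1 s h) \<in> borel \<rightarrow>\<^sub>M borel"
    unfolding e by (intro measurable_If) auto
  have "\<exists>B. \<forall>s\<in>{s::complex. norm s = 1}. norm (\<Sum>i<3. \<pi>S s i (h * cb i)) \<le> B"
    by (intro sum_bounded_ex w(2)) simp
  then obtain B where "\<And>s. norm s = 1 \<Longrightarrow> norm (\<Sum>i<3. \<pi>S s i (h * cb i)) \<le> B"
    by auto
  then have "norm (chi1 s h) \<le> B" if "norm s = 1" for s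
    unfolding e using that by auto
  then show "\<exists>B. \<forall>s. norm s = 1 \<longrightarrow> norm (chi1 s h) \<le> B" by blast
qed

lemma measurable_c_fun: "(\<lambda>t. complex_of_real ((cmod (c_fun q t))\<^sup>2)) \<in> borel \<rightarrow>\<^sub>M borel"
proof -
  have "(\<lambda>t. complex_of_real ((cmod (c_fun q t))\<^sup>2)) \<in> (borel \<Otimes>\<^sub>M borel) \<rightarrow>\<^sub>M borel"
    unfolding c_fun_def Let_def by measurable
  then show ?thesis unfolding borel_prod .
qed

lemma measurable_c1_fun: "(\<lambda>s. complex_of_real ((cmod (c1_fun q s))\<^sup>2)) \<in> borel \<rightarrow>\<^sub>M borel"
  unfolding c1_fun_def by measurable

lemma chi_integrable: "integrable torus (\<lambda>t. chi t h / complex_of_real ((cmod (c_fun q t))\<^sup>2))"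
proof -
  obtain B where B: "\<And>t. norm (fst t) = 1 \<Longrightarrow> norm (snd t) = 1 \<Longrightarrow> norm (chi t h) \<le> B"
    using chi_tame(2) by blast
  let ?C = "4 / (1 - norm pq) ^ 2"
  have C: "0 \<le> ?C" by simp
  show ?thesis
  proof (rule torus_integrable)
    show "(\<lambda>t. chi t h / complex_of_real ((cmod (c_fun q t))\<^sup>2)) \<in> borel \<rightarrow>\<^sub>M borel"
      by (intro borel_measurable_divide chi_tame measurable_c_fun)
    fix t :: "complex \<times> complex" assume t: "norm (fst t) = 1" "norm (snd t) = 1"
    have "norm (hfun (ra (fst t) (snd t)) * hfun (rb (fst t) (snd t)) * hfun (1 / (fst t * snd t))) \<le> ?C * ?C * ?C"
      unfolding norm_mult using t C
      by (intro mult_mono norm_hfun_le mult_nonneg_nonneg) (simp_all add: norm_divide norm_mult norm_power)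
    then have "norm (1 / complex_of_real ((cmod (c_fun q t))\<^sup>2)) \<le> ?C * ?C * ?C"
      using density[OF t] by simp
    then have "norm (chi t h) * norm (1 / complex_of_real ((cmod (c_fun q t))\<^sup>2)) \<le> B * (?C * ?C * ?C)"
      using B[OF t] by (intro mult_mono) (auto intro: order_trans[OF norm_ge_zero])
    then show "norm (chi t h / complex_of_real ((cmod (c_fun q t))\<^sup>2)) \<le> B * (?C * ?C * ?C)"
      by (simp add: norm_divide)
  qed
qed

lemma powr_rq: "of_real (q powr (1/2)) = 1 / rq" "of_real (q powr (-3/2)) = rq ^ 3"
proof -
  have "q powr (1/2) * q powr (-1/2) = 1" using q_gt1 powr_add[of q "1/2" "-1/2"] by simp
  then have "of_real (q powr (1/2)) * rq = 1" unfolding rq_def of_real_mult[symmetric] by simp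
  then show "of_real (q powr (1/2)) = 1 / rq" using rq_props by (simp add: eq_divide_eq)
  have "(q powr (-1/2)) ^ 3 = q powr (-3/2)" using q_gt1 by (simp add: powr_power)
  then show "of_real (q powr (-3/2)) = rq ^ 3" unfolding rq_def of_real_power[symmetric] by simp
qed

lemma density1:
  assumes "norm s = 1"
  shows "1 / complex_of_real ((cmod (c1_fun q s))\<^sup>2) = (1 - 1 / (rq * s ^ 3)) * (1 - s ^ 3 / rq)
    / ((1 - rq ^ 3 * s powi (- 3)) * (1 - rq ^ 3 * s powi 3))"
proof -
  have "s * cnj s = 1" using complex_norm_square[of s] assms by simp
  moreover have s0: "s \<noteq> 0" using assms by auto
  ultimately have s: "cnj s = 1 / s" by (simp add: eq_divide_eq mult.commute)
  have r: "cnj rq = rq" unfolding rq_def by (rule complex_cnj_complex_of_real)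
  have c: "c1_fun q s = (1 - rq ^ 3 / s ^ 3) / (1 - 1 / (rq * s ^ 3))"
    unfolding c1_fun_def powr_rq by (simp add: power_int_minus divide_inverse)
  have cc: "cnj (c1_fun q s) = (1 - rq ^ 3 * s ^ 3) / (1 - s ^ 3 / rq)"
    unfolding c by (simp add: s r power_divide)
  show ?thesis
    unfolding complex_norm_square cc unfolding c by (simp add: power_int_minus divide_inverse)
qed

lemma chi1_integrable: "integrable circle_haar (\<lambda>s. chi1 s h / complex_of_real ((cmod (c1_fun q s))\<^sup>2))"
proof -
  obtain B where B: "\<And>s. norm s = 1 \<Longrightarrow> norm (chi1 s h) \<le> B"
    using chi1_tame(2) by blast
  have r: "norm (rq ^ 3) < 1" using rq_props by (simp add: norm_power power_less_one_iff)
  define C where "C = (1 + 1 / norm rq) * (1 + 1 / norm rq) / ((1 - norm (rq ^ 3)) * (1 - norm (rq ^ 3)))"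
  show ?thesis
  proof (rule circle_integrable)
    show "(\<lambda>s. chi1 s h / complex_of_real ((cmod (c1_fun q s))\<^sup>2)) \<in> borel \<rightarrow>\<^sub>M borel"
      by (intro borel_measurable_divide chi1_tame measurable_c1_fun)
    fix s :: complex assume s: "norm s = 1"
    have a: "norm (1 - 1 / (rq * s ^ 3)) \<le> 1 + 1 / norm rq" "norm (1 - s ^ 3 / rq) \<le> 1 + 1 / norm rq"
      using norm_triangle_ineq4[of 1 "1 / (rq * s ^ 3)"] norm_triangle_ineq4[of 1 "s ^ 3 / rq"] s
      by (simp_all add: norm_divide norm_mult norm_power)
    have b: "1 - norm (rq ^ 3) \<le> norm (1 - rq ^ 3 * s powi (- 3))" "1 - norm (rq ^ 3) \<le> norm (1 - rq ^ 3 * s powi 3)"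
      using norm_one_minus_ge[of "rq ^ 3 * s powi (- 3)"] norm_one_minus_ge[of "rq ^ 3 * s powi 3"] s
      by (simp_all only: norm_mult norm_power_int power_int_1_left mult_1_right)
    have ab: "norm (1 - 1 / (rq * s ^ 3)) * norm (1 - s ^ 3 / rq) \<le> (1 + 1 / norm rq) * (1 + 1 / norm rq)"
      using a by (intro mult_mono) simp_all
    have bb: "(1 - norm (rq ^ 3)) * (1 - norm (rq ^ 3)) \<le> norm (1 - rq ^ 3 * s powi (- 3)) * norm (1 - rq ^ 3 * s powi 3)"
      using b r by (intro mult_mono) linarith+
    have "norm (1 / complex_of_real ((cmod (c1_fun q s))\<^sup>2)) \<le> C"
      unfolding density1[OF s] C_def norm_divide norm_mult[of "1 - 1 / (rq * s ^ 3)"] norm_mult[of "1 - rq ^ 3 * s powi (- 3)"]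
      using ab bb r by (intro frac_le mult_pos_pos) simp_all
    then have "norm (chi1 s h) * norm (1 / complex_of_real ((cmod (c1_fun q s))\<^sup>2)) \<le> B * C"
      using B[OF s] by (intro mult_mono) (auto intro: order_trans[OF norm_ge_zero])
    then show "norm (chi1 s h / complex_of_real ((cmod (c1_fun q s))\<^sup>2)) \<le> B * C"
      by (simp add: norm_divide)
  qed
qed

section \<open>The three terms of the formula on the test elements\<close>

lemma dlist_range:
  assumes "k < 5" "(c, e, f) \<in> set (dlist k)"
  shows "e \<le> 2" "f \<le> 2"
proof -
  have "k = 0 \<or> k = 1 \<or> k = 2 \<or> k = 3 \<or> k = 4" using assms(1) by auto
  then have "e \<le> 2 \<and> f \<le> 2" using assms(2) by (elim disjE) (auto simp: dlist_def)
  then show "e \<le> 2" "f \<le> 2" by auto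
qed

text \<open>Dominance enters here: the shifts in \<open>dlist\<close> lower m + 2n and 2m + n by at
  most 6, which stays in the range of \<open>integral_monW\<close> and
  \<open>plancherel_moment\<close>.\<close>

lemma dsum_cong:
  assumes "k < 5" "0 \<le> m" "0 \<le> n" "\<And>m n. m + 2 * n \<ge> - 6 \<Longrightarrow> 2 * m + n \<ge> - 6 \<Longrightarrow> f m n = g m n"
  shows "dsum k f m n = dsum k g m n"
  unfolding dsum_def
proof (intro arg_cong[where f = sum_list] map_cong refl, clarify)
  fix c e h assume "(c, e, h) \<in> set (dlist k)"
  from dlist_range[OF assms(1) this]
  show "c * f (m - 2 * e + h) (n + e - 2 * h) = c * g (m - 2 * e + h) (n + e - 2 * h)"
    using assms(2,3) by (subst assms(4)) auto
qed

text \<open>From a dominant weight, (-2, -2) is reached only with e = f = 2 and m = n = 0. Only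
  \<open>dlist 0\<close> has such a term, and its coefficient -1 cancels the sign.\<close>

lemma dsum_delta:
  assumes "k < 5" "0 \<le> m" "0 \<le> n"
  shows "dsum k (\<lambda>m n. if m = - 2 \<and> n = - 2 then - 1 else 0) m n = (if k = 0 \<and> m = 0 \<and> n = 0 then 1 else 0)"
proof -
  have "k = 0 \<or> k = 1 \<or> k = 2 \<or> k = 3 \<or> k = 4" using assms(1) by auto
  then show ?thesis using assms(2,3) by (elim disjE) (auto simp: dsum_def dlist_def)
qed

text \<open>The six orbit points contribute equally by invariance of the measure; this factor 6 is
  compensated by the 1/6 of the formula.\<close>

lemma chi_integral:
  assumes k: "k < 5" "0 \<le> m" "0 \<le> n"
  shows "(LINT t|torus. chi t (wb k * X m n) / complex_of_real ((cmod (c_fun q t))\<^sup>2)) = 6 * dsum k (I2sum rq) m n"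
proof -
  note f = measurable_monW[of pq] norm_monW_le[OF pq_props(1)]
  have int1: "integrable torus (\<lambda>t. monW pq m n (orbit (fst t) (snd t) i))" if "i < 6" for i m n
    by (rule orbit_integral(1)[OF f that])
  have int2: "(LINT t|torus. monW pq m n (orbit (fst t) (snd t) i)) = (LINT t|torus. monW pq m n t)" if "i < 6" for i m n
    by (rule orbit_integral(2)[OF f that])
  have "(LINT t|torus. chi t (wb k * X m n) / complex_of_real ((cmod (c_fun q t))\<^sup>2))
      = (LINT t|torus. (\<Sum>i<6. dsum k (\<lambda>m n. monW pq m n (orbit (fst t) (snd t) i)) m n))"
  proof (rule integral_cong_AE)
    show "AE t in torus. chi t (wb k * X m n) / complex_of_real ((cmod (c_fun q t))\<^sup>2)
        = (\<Sum>i<6. dsum k (\<lambda>m n. monW pq m n (orbit (fst t) (snd t) i)) m n)"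
      using AE_torus AE_torus_regular
    proof eventually_elim
      case (elim t)
      then show ?case using regular_torus[of "fst t" "snd t"] by (intro chi_density k(1)) auto
    qed
    show "(\<lambda>t. chi t (wb k * X m n) / complex_of_real ((cmod (c_fun q t))\<^sup>2)) \<in> borel_measurable torus"
      by (rule borel_measurable_integrable[OF chi_integrable])
    show "(\<lambda>t. (\<Sum>i<6. dsum k (\<lambda>m n. monW pq m n (orbit (fst t) (snd t) i)) m n)) \<in> borel_measurable torus"
      by (intro borel_measurable_integrable Bochner_Integration.integrable_sum integral_dsum(1) int1) simp
  qed
  also have "\<dots> = (\<Sum>i<(6::nat). (LINT t|torus. dsum k (\<lambda>m n. monW pq m n (orbit (fst t) (snd t) i)) m n))"
    by (intro Bochner_Integration.integral_sum integral_dsum(1) int1) simp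
  also have "\<dots> = (\<Sum>i<(6::nat). dsum k (\<lambda>m n. (LINT t|torus. monW pq m n t)) m n)"
  proof (intro sum.cong refl)
    fix i assume "i \<in> {..<6::nat}"
    then have i: "i < 6" by simp
    show "(LINT t|torus. dsum k (\<lambda>m n. monW pq m n (orbit (fst t) (snd t) i)) m n) = dsum k (\<lambda>m n. (LINT t|torus. monW pq m n t)) m n"
      unfolding integral_dsum(2)[OF int1[OF i]] int2[OF i] ..
  qed
  also have "\<dots> = 6 * dsum k (\<lambda>m n. (LINT t|torus. monW pq m n t)) m n" by simp
  also have "dsum k (\<lambda>m n. (LINT t|torus. monW pq m n t)) m n = dsum k (I2sum rq) m n"
    by (rule dsum_cong[OF k]) (simp add: integral_monW[OF pq_props(1,2)] I2sum_def rq_sq)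
  finally show ?thesis .
qed

text \<open>The integrand of the one-dimensional term for one monomial, summed over the three
  weights and divided by the Weyl denominator, see \<open>S1_orbit\<close>.\<close>

definition S1 :: "int \<Rightarrow> int \<Rightarrow> complex \<Rightarrow> complex" where
  "S1 m n s = (let K = \<lambda>l. s powi l / ((1 - rq ^ 3 * s powi (- 3)) * (1 - rq ^ 3 * s powi 3)) in
    rq ^ 2 / (1 - rq ^ 2) * (rq powi (m - 1) * K (m + 2 * n + 3) - rq powi (m + n) * K (m - n)
    + rq powi (n - 1) * K (- 2 * m - n - 3)))"

lemma S1_integral: "integrable circle_haar (S1 m n)" "(LINT s|circle_haar. S1 m n s) = I1sum rq m n"
proof -
  have r: "norm (rq ^ 3) < 1" using rq_props by (simp add: norm_power power_less_one_iff)
  let ?K = "\<lambda>l s. s powi l / ((1 - rq ^ 3 * s powi (- 3)) * (1 - rq ^ 3 * s powi 3))"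
  have i: "integrable circle_haar (?K l)" for l
  proof (rule circle_integrable[where B = "1 / ((1 - norm (rq ^ 3)) * (1 - norm (rq ^ 3)))"])
    fix s :: complex assume s: "norm s = 1"
    have b: "1 - norm (rq ^ 3) \<le> norm (1 - rq ^ 3 * s powi (- 3))" "1 - norm (rq ^ 3) \<le> norm (1 - rq ^ 3 * s powi 3)"
      using norm_one_minus_ge[of "rq ^ 3 * s powi (- 3)"] norm_one_minus_ge[of "rq ^ 3 * s powi 3"] s
      by (simp_all only: norm_mult norm_power_int power_int_1_left mult_1_right)
    have "(1 - norm (rq ^ 3)) * (1 - norm (rq ^ 3)) \<le> norm (1 - rq ^ 3 * s powi (- 3)) * norm (1 - rq ^ 3 * s powi 3)"
      using b r by (intro mult_mono) linarith+
    then show "norm (?K l s) \<le> 1 / ((1 - norm (rq ^ 3)) * (1 - norm (rq ^ 3)))"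
      unfolding norm_divide norm_mult[of "1 - rq ^ 3 * s powi (- 3)"]
      using r s by (intro frac_le mult_pos_pos) (simp_all add: norm_power_int)
  qed measurable
  have v: "(LINT s|circle_haar. ?K l s) = K3 rq l" for l
    using integral_poisson[OF r r, of 3 l] by (simp add: K3_def)
  have e: "S1 m n = (\<lambda>s. rq ^ 2 / (1 - rq ^ 2) * (rq powi (m - 1) * ?K (m + 2 * n + 3) s - rq powi (m + n) * ?K (m - n) s
    + rq powi (n - 1) * ?K (- 2 * m - n - 3) s))"
    by (simp add: S1_def[abs_def] Let_def)
  show "integrable circle_haar (S1 m n)"
    unfolding e by (intro integrable_mult_right Bochner_Integration.integrable_add Bochner_Integration.integrable_diff i)
  show "(LINT s|circle_haar. S1 m n s) = I1sum rq m n"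
    unfolding e I1sum_def v[symmetric] integral_mult_right_zero
    by (subst Bochner_Integration.integral_add, intro integrable_mult_right Bochner_Integration.integrable_diff i,
        intro integrable_mult_right i, subst Bochner_Integration.integral_diff, intro integrable_mult_right i,
        intro integrable_mult_right i, simp only: integral_mult_right_zero)
qed

text \<open>At each of the three weights one factor of \<open>\<Delta>\<close> is the constant 1 - q
  or its analogue 1 - 1 / rq^2, and the other two cancel the numerator of the density up to a
  monomial in s^3. Only the kernel with denominator \<open>E\<close> survives.\<close>

lemma S1_orbit:
  assumes s: "norm s = 1"
  shows "(\<Sum>i\<in>{0,2,4}. fst (orbit (rq * s) (s ^ 2) i) powi m * snd (orbit (rq * s) (s ^ 2) i) powi n
      / \<Delta> (fst (orbit (rq * s) (s ^ 2) i)) (snd (orbit (rq * s) (s ^ 2) i))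
      * (1 / complex_of_real ((cmod (c1_fun q s))\<^sup>2))) = S1 m n s"
proof -
  have s0: "s \<noteq> 0" using s by auto
  note r0 = rq_props(2)
  define y where "y = s ^ 3"
  define E where "E = (1 - rq ^ 3 * s powi (- 3)) * (1 - rq ^ 3 * s powi 3)"
  have y: "y \<noteq> 0" "norm y = 1" using s s0 by (simp_all add: y_def norm_power)
  have nr: "norm rq \<noteq> 1" using rq_props by simp
  have nz: "1 - rq / y \<noteq> 0" "1 - 1 / (rq * y) \<noteq> 0" "1 - y / rq \<noteq> 0" "1 - rq * y \<noteq> 0"
  proof -
    have h: "1 - z \<noteq> 0" if "norm z \<noteq> 1" for z :: complex using that by auto
    show "1 - rq / y \<noteq> 0" "1 - 1 / (rq * y) \<noteq> 0" "1 - y / rq \<noteq> 0" "1 - rq * y \<noteq> 0"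
      by (intro h; use y(2) nr r0 in \<open>simp add: norm_divide norm_mult\<close>)+
  qed
  have n2: "1 - rq ^ 2 \<noteq> 0" using rq_props one_minus_nonzero[of "rq ^ 2"] by (simp add: norm_power power_less_one_iff)
  note c1 = divide_self[OF nz(3)] divide_self[OF nz(2)]
  define w where "w = rq ^ 2 / (1 - rq ^ 2)"
  have w: "1 / (1 - 1 / rq ^ 2) = - w"
  proof -
    have "1 - 1 / rq ^ 2 = - ((1 - rq ^ 2) / rq ^ 2)" using r0 by (simp add: diff_divide_distrib)
    then show ?thesis by (simp add: w_def)
  qed
  have d: "1 / complex_of_real ((cmod (c1_fun q s))\<^sup>2) = (1 - 1 / (rq * y)) * (1 - y / rq) / E"
    using density1[OF s] by (simp only: y_def E_def)
  have q1: "(1 - y / rq) / (1 - rq / y) = - (y / rq)" "(1 - 1 / (rq * y)) / (1 - rq * y) = - (1 / (rq * y))"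
  proof -
    have "1 - y / rq = - (y / rq) * (1 - rq / y)" "1 - 1 / (rq * y) = - (1 / (rq * y)) * (1 - rq * y)"
      using y(1) r0 by (simp_all add: right_diff_distrib)
    then show "(1 - y / rq) / (1 - rq / y) = - (y / rq)" "(1 - 1 / (rq * y)) / (1 - rq * y) = - (1 / (rq * y))"
      using nz by (simp_all only: nonzero_mult_div_cancel_right simp_thms)
  qed
  have "\<Delta> (rq * s) (s ^ 2) = (1 - 1 / rq ^ 2) * (1 - rq / y) * (1 - 1 / (rq * y))"
    unfolding \<Delta>_def using s0 r0 by (simp add: y_def eval_nat_numeral)
  then have t0: "1 / \<Delta> (rq * s) (s ^ 2) * ((1 - 1 / (rq * y)) * (1 - y / rq) / E) = w * (y / rq) / E"
  proof -
    assume D: "\<Delta> (rq * s) (s ^ 2) = (1 - 1 / rq ^ 2) * (1 - rq / y) * (1 - 1 / (rq * y))"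
    have "1 / \<Delta> (rq * s) (s ^ 2) * ((1 - 1 / (rq * y)) * (1 - y / rq) / E)
      = (1 / (1 - 1 / rq ^ 2)) * ((1 - y / rq) / (1 - rq / y)) * ((1 - 1 / (rq * y)) / (1 - 1 / (rq * y))) / E"
      unfolding D by (simp only: times_divide_eq_left times_divide_eq_right divide_divide_eq_left mult_1_left mult_1_right mult_ac)
    then show ?thesis unfolding w q1 c1 by simp
  qed
  have "\<Delta> (rq * s) (rq * s / s ^ 2) = (1 - 1 / (rq * y)) * (1 - y / rq) * (1 - 1 / rq ^ 2)"
    unfolding \<Delta>_def using s0 r0 by (simp add: y_def eval_nat_numeral)
  then have t2: "1 / \<Delta> (rq * s) (rq * s / s ^ 2) * ((1 - 1 / (rq * y)) * (1 - y / rq) / E) = - w / E"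
  proof -
    assume D: "\<Delta> (rq * s) (rq * s / s ^ 2) = (1 - 1 / (rq * y)) * (1 - y / rq) * (1 - 1 / rq ^ 2)"
    have "1 / \<Delta> (rq * s) (rq * s / s ^ 2) * ((1 - 1 / (rq * y)) * (1 - y / rq) / E)
      = (1 / (1 - 1 / rq ^ 2)) * ((1 - y / rq) / (1 - y / rq)) * ((1 - 1 / (rq * y)) / (1 - 1 / (rq * y))) / E"
      unfolding D by (simp only: times_divide_eq_left times_divide_eq_right divide_divide_eq_left mult_1_left mult_1_right mult_ac)
    then show ?thesis unfolding w c1 by simp
  qed
  have "\<Delta> (1 / s ^ 2) (rq * s / s ^ 2) = (1 - rq * y) * (1 - 1 / rq ^ 2) * (1 - y / rq)"
    unfolding \<Delta>_def using s0 r0 by (simp add: y_def eval_nat_numeral)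
  then have t4: "1 / \<Delta> (1 / s ^ 2) (rq * s / s ^ 2) * ((1 - 1 / (rq * y)) * (1 - y / rq) / E) = w * (1 / (rq * y)) / E"
  proof -
    assume D: "\<Delta> (1 / s ^ 2) (rq * s / s ^ 2) = (1 - rq * y) * (1 - 1 / rq ^ 2) * (1 - y / rq)"
    have "1 / \<Delta> (1 / s ^ 2) (rq * s / s ^ 2) * ((1 - 1 / (rq * y)) * (1 - y / rq) / E)
      = (1 / (1 - 1 / rq ^ 2)) * ((1 - y / rq) / (1 - y / rq)) * ((1 - 1 / (rq * y)) / (1 - rq * y)) / E"
      unfolding D by (simp only: times_divide_eq_left times_divide_eq_right divide_divide_eq_left mult_1_left mult_1_right mult_ac)
    then show ?thesis unfolding w q1 c1 by simp
  qed
  have m0: "(rq * s) powi m * (s ^ 2) powi n * (y / rq) = rq powi (m - 1) * s powi (m + 2 * n + 3)"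
    using s0 r0 power_int_mult[of s 2 n]
    by (simp add: y_def power_int_mult_distrib power_int_add power_int_diff mult_ac)
  have m2: "(rq * s) powi m * (rq * s / s ^ 2) powi n = rq powi (m + n) * s powi (m - n)"
    using s0 r0
    by (simp add: y_def power_int_mult_distrib power_int_add power_int_diff power_int_divide_distrib power2_eq_square mult_ac)
  have m4: "(1 / s ^ 2) powi m * (rq * s / s ^ 2) powi n * (1 / (rq * y)) = rq powi (n - 1) * s powi (- 2 * m - n - 3)"
  proof -
    have "- 2 * m - n - 3 = - (2 * m + n + 3)" by simp
    then have "s powi (- 2 * m - n - 3) = inverse ((s ^ 2) powi m * s powi n * y)"
      using s0 power_int_mult[of s 2 m] by (simp only: power_int_minus) (simp add: power_int_add y_def)
    moreover have e: "rq * s / s ^ 2 = rq / s" using s0 by (simp add: power2_eq_square)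
    ultimately show ?thesis
      unfolding e using s0 r0 by (simp add: power_int_diff power_int_mult_distrib divide_inverse power_int_inverse mult_ac)
  qed
  have "(\<Sum>i\<in>{0,2,4}. fst (orbit (rq * s) (s ^ 2) i) powi m * snd (orbit (rq * s) (s ^ 2) i) powi n
      / \<Delta> (fst (orbit (rq * s) (s ^ 2) i)) (snd (orbit (rq * s) (s ^ 2) i))
      * (1 / complex_of_real ((cmod (c1_fun q s))\<^sup>2)))
    = (rq * s) powi m * (s ^ 2) powi n * (1 / \<Delta> (rq * s) (s ^ 2) * ((1 - 1 / (rq * y)) * (1 - y / rq) / E))
    + (rq * s) powi m * (rq * s / s ^ 2) powi n * (1 / \<Delta> (rq * s) (rq * s / s ^ 2) * ((1 - 1 / (rq * y)) * (1 - y / rq) / E))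
    + (1 / s ^ 2) powi m * (rq * s / s ^ 2) powi n * (1 / \<Delta> (1 / s ^ 2) (rq * s / s ^ 2) * ((1 - 1 / (rq * y)) * (1 - y / rq) / E))"
    unfolding d by (simp add: orbit_def add.assoc)
  also have "\<dots> = w / E * ((rq * s) powi m * (s ^ 2) powi n * (y / rq) - (rq * s) powi m * (rq * s / s ^ 2) powi n
      + (1 / s ^ 2) powi m * (rq * s / s ^ 2) powi n * (1 / (rq * y)))"
    unfolding t0 t2 t4 by (simp add: right_diff_distrib distrib_left mult_ac)
  also have "\<dots> = S1 m n s"
    unfolding m0 m2 m4 S1_def Let_def E_def[symmetric] w_def by (simp add: right_diff_distrib distrib_left mult_ac)
  finally show ?thesis .
qed

lemma chi1_integral:
  assumes k: "k < 5"
  shows "(LINT s|circle_haar. chi1 s (wb k * X m n) / complex_of_real ((cmod (c1_fun q s))\<^sup>2)) = dsum k (I1sum rq) m n"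
proof -
  have "(LINT s|circle_haar. chi1 s (wb k * X m n) / complex_of_real ((cmod (c1_fun q s))\<^sup>2))
      = (LINT s|circle_haar. dsum k (\<lambda>m n. S1 m n s) m n)"
  proof (rule integral_cong_AE)
    show "AE s in circle_haar. chi1 s (wb k * X m n) / complex_of_real ((cmod (c1_fun q s))\<^sup>2) = dsum k (\<lambda>m n. S1 m n s) m n"
      using AE_circle
    proof eventually_elim
      case (elim s)
      define D where "D = 1 / complex_of_real ((cmod (c1_fun q s))\<^sup>2)"
      let ?z = "\<lambda>i. fst (orbit (rq * s) (s ^ 2) i)" and ?z' = "\<lambda>i. snd (orbit (rq * s) (s ^ 2) i)"
      have r: "regular (?z i) (?z' i)" if "i \<in> {0,2,4}" for i
        using that unfolding rq_def by (intro regular_orbit regular_steinberg1[OF elim]) auto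
      have "chi1 s (wb k * X m n) / complex_of_real ((cmod (c1_fun q s))\<^sup>2) = chi1 s (wb k * X m n) * D"
        by (simp add: D_def)
      also have "\<dots> = (\<Sum>i\<in>{0,2,4}. dcoef k (?z i) (?z' i) * (?z i powi m * ?z' i powi n) * D)"
        unfolding chi1_wbX[OF elim k, folded rq_def] sum_distrib_right ..
      also have "\<dots> = (\<Sum>i\<in>{0,2,4}. dsum k (\<lambda>m n. ?z i powi m * ?z' i powi n / \<Delta> (?z i) (?z' i) * D) m n)"
        by (intro sum.cong refl) (simp only: dcoef_expand[OF r k] dsum_mult)
      also have "\<dots> = dsum k (\<lambda>m n. \<Sum>i\<in>{0,2,4}. ?z i powi m * ?z' i powi n / \<Delta> (?z i) (?z' i) * D) m n"
        by (rule dsum_sum) simp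
      also have "\<dots> = dsum k (\<lambda>m n. S1 m n s) m n" unfolding D_def S1_orbit[OF elim] ..
      finally show ?case .
    qed
    show "(\<lambda>s. chi1 s (wb k * X m n) / complex_of_real ((cmod (c1_fun q s))\<^sup>2)) \<in> borel_measurable circle_haar"
      by (rule borel_measurable_integrable[OF chi1_integrable])
    show "(\<lambda>s. dsum k (\<lambda>m n. S1 m n s) m n) \<in> borel_measurable circle_haar"
      by (intro borel_measurable_integrable integral_dsum(1) S1_integral(1))
  qed
  also have "\<dots> = dsum k (I1sum rq) m n"
    unfolding integral_dsum(2)[OF S1_integral(1)] S1_integral(2) ..
  finally show ?thesis .
qed

lemma cube_root_sum:
  fixes w :: complex
  assumes w: "w ^ 3 = 1" "w \<noteq> 1"
  shows "1 + w powi k + inverse w powi k = (if 3 dvd k then 3 else 0)"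
proof -
  have w0: "w \<noteq> 0" using w by auto
  have "(w - 1) * (1 + w + w ^ 2) = w ^ 3 - 1" by (simp add: algebra_simps eval_nat_numeral)
  then have s: "1 + w + w ^ 2 = 0" using w by auto
  have i: "inverse w = w ^ 2" using w w0 by (simp add: eval_nat_numeral inverse_eq_divide divide_eq_eq mult.assoc)
  have red: "v powi k = v ^ nat (k mod 3)" if v: "v ^ 3 = 1" for v :: complex
  proof -
    have v0: "v \<noteq> 0" using v by auto
    have "v powi (3 * (k div 3)) = 1" using power_int_mult[of v 3 "k div 3"] v by simp
    moreover have "v powi (3 * (k div 3) + k mod 3) = v powi (3 * (k div 3)) * v powi (k mod 3)"
      by (rule power_int_add) (simp add: v0)
    moreover have "v powi (k mod 3) = v ^ nat (k mod 3)" by (simp add: power_int_def)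
    ultimately show ?thesis by simp
  qed
  have i3: "inverse w ^ 3 = 1" using w(1) by (simp add: power_inverse)
  have "k mod 3 = 0 \<or> k mod 3 = 1 \<or> k mod 3 = 2" by presburger
  then show ?thesis
  proof (elim disjE)
    assume k: "k mod 3 = 1"
    then have "\<not> 3 dvd k" by presburger
    then show ?thesis using s by (simp add: red[OF w(1)] red[OF i3, unfolded i] k i)
  next
    assume k: "k mod 3 = 2"
    then have d: "\<not> 3 dvd k" by presburger
    have "(w ^ 2) ^ 2 = w ^ 3 * w" by (simp add: eval_nat_numeral)
    then have "(w ^ 2) ^ 2 = w" using w(1) by simp
    then show ?thesis using s d by (simp add: red[OF w(1)] red[OF i3, unfolded i] k i add_ac)
  qed (use red[OF w(1)] red[OF i3] in \<open>auto simp: dvd_eq_mod_eq_0\<close>)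
qed

text \<open>The three characters belong to w = 1, omega and omega^(-1). At their points both root
  values are q, so \<open>\<Delta>\<close> is the same for all three and only w^(m - n)
  distinguishes them.\<close>

lemma one_dim_point:
  fixes w :: complex
  assumes w: "w ^ 3 = 1"
  defines "\<psi> \<equiv> one_dim_char (w / of_real q) (inverse w / of_real q)"
  shows "linf \<psi>" "\<psi> (a * b) = \<psi> (b * a)"
    "k < 5 \<Longrightarrow> \<psi> (wb k * X m n)
      = dsum k (\<lambda>m n. (rq ^ 2) powi (m + n) * w powi (m - n) / ((1 - 1 / rq ^ 2) ^ 2 * (1 - 1 / rq ^ 4))) m n"
proof -
  define z1 z2 where "z1 = w / of_real q" and "z2 = inverse w / of_real q"
  have w0: "w \<noteq> 0" using w by auto
  have i: "inverse w = w ^ 2" using w w0 by (simp add: eval_nat_numeral inverse_eq_divide divide_eq_eq mult.assoc)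
  have q0: "complex_of_real q \<noteq> 0" using q_gt1 by simp
  have z: "z1 = pq * w" "z2 = pq * inverse w" using q0 by (simp_all add: z1_def z2_def pq_props(3))
  have p0: "pq \<noteq> 0" by (rule pq_props)
  have "w ^ 4 = w ^ 3 * w" by (simp add: eval_nat_numeral)
  then have w4: "w ^ 4 = w" using w by simp
  have c: "z1 \<noteq> 0" "z2 = of_real q * z1 ^ 2" "z1 = of_real q * z2 ^ 2"
    using w0 p0 w4 unfolding z pq_props(3) i by (simp_all add: power_mult_distrib power2_eq_square[of pq] flip: power_mult)
  have hom: "alg_hom_on UNIV \<psi>" unfolding \<psi>_def z1_def[symmetric] z2_def[symmetric] by (rule one_dim_char(1)[OF c])
  show "linf \<psi>" "\<psi> (a * b) = \<psi> (b * a)" using hom by (simp_all add: alg_hom_on_def linf_def mult.commute)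
  assume k: "k < 5"
  have ra: "ra z1 z2 = 1 / pq" using c(1) by (subst c(2)) (simp add: pq_props(3))
  have z20: "z2 \<noteq> 0" using w0 p0 by (simp add: z)
  have rb: "rb z1 z2 = 1 / pq" using z20 by (subst c(3)) (simp add: pq_props(3))
  have zz: "z1 * z2 = pq ^ 2" using w0 by (simp add: z power2_eq_square)
  have np: "norm pq < 1" by (rule pq_props)
  then have n1: "pq \<noteq> 1" "pq ^ 2 \<noteq> 1"
    using one_minus_nonzero[of pq] one_minus_nonzero[of "pq ^ 2"] by (auto simp: norm_power power_less_one_iff)
  have r: "regular z1 z2" unfolding regular_def ra rb zz using c(1) z20 n1 p0 by auto
  have "rq ^ 4 = (rq ^ 2) ^ 2" by (simp flip: power_mult)
  then have D: "\<Delta> z1 z2 = (1 - 1 / rq ^ 2) ^ 2 * (1 - 1 / rq ^ 4)"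
    unfolding \<Delta>_def ra rb zz rq_sq by (simp only: rq_sq power2_eq_square)
  have "z1 powi m * z2 powi n = (rq ^ 2) powi (m + n) * w powi (m - n)" for m n
    using p0 w0 by (simp add: z rq_sq power_int_mult_distrib power_int_add power_int_diff power_int_inverse divide_inverse mult_ac)
  then show "\<psi> (wb k * X m n)
      = dsum k (\<lambda>m n. (rq ^ 2) powi (m + n) * w powi (m - n) / ((1 - 1 / rq ^ 2) ^ 2 * (1 - 1 / rq ^ 4))) m n"
    unfolding \<psi>_def z1_def[symmetric] z2_def[symmetric] one_dim_wbX[OF c k] dcoef_expand[OF r k] D by simp
qed

lemma cube_root: "cis (2 * pi / 3) ^ 3 = 1" "inverse (cis (2 * pi / 3)) ^ 3 = 1" "cis (2 * pi / 3) \<noteq> 1"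
proof -
  have "cis (2 * pi / 3) ^ 3 = cis (real 3 * (2 * pi / 3))" by (rule Complex.DeMoivre)
  also have "real 3 * (2 * pi / 3) = 2 * pi" by simp
  finally show c: "cis (2 * pi / 3) ^ 3 = 1" by simp
  then show "inverse (cis (2 * pi / 3)) ^ 3 = 1" by (simp only: power_inverse inverse_1)
  have "Re (cis (2 * pi / 3)) = - 1 / 2" by (simp add: cos_120)
  moreover have "Re 1 \<noteq> - 1 / 2" by simp
  ultimately show "cis (2 * pi / 3) \<noteq> 1" by metis
qed

lemma chi234_points:
  "chi2 = one_dim_char (1 / of_real q) (inverse 1 / of_real q)"
  "chi4 = one_dim_char (inverse (cis (2 * pi / 3)) / of_real q) (inverse (inverse (cis (2 * pi / 3))) / of_real q)"
  by (simp_all only: chi2_def chi4_def inverse_1 inverse_inverse_eq)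

lemma one_dim_total:
  assumes k: "k < 5"
  shows "chi2 (wb k * X m n) + chi3 (wb k * X m n) + chi4 (wb k * X m n) = dsum k (I0sum rq) m n"
proof -
  let ?D = "(1 - 1 / rq ^ 2) ^ 2 * (1 - 1 / rq ^ 4)"
  have "(rq ^ 2) powi (m + n) * 1 powi (m - n) / ?D + (rq ^ 2) powi (m + n) * cis (2 * pi / 3) powi (m - n) / ?D
      + (rq ^ 2) powi (m + n) * inverse (cis (2 * pi / 3)) powi (m - n) / ?D = I0sum rq m n" for m n
  proof -
    have "A * 1 powi l / d + A * w powi l / d + A * w' powi l / d = A * (1 + w powi l + w' powi l) / d"
      for A d w w' :: complex and l :: int
      by (simp add: distrib_left add_divide_distrib)
    note e = this
    show ?thesis unfolding I0sum_def e cube_root_sum[OF cube_root(1,3)] by (cases "3 dvd m - n") simp_all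
  qed
  then show ?thesis
    unfolding chi234_points chi3_def one_dim_point(3)[OF cube_root(1) k] one_dim_point(3)[OF cube_root(2) k]
      one_dim_point(3)[OF power_one k]
    using dsum_linear[of 1 k _ m n 1 _ 1] by simp
qed

lemma plancherel_constants:
  "complex_of_real (1 / (6 * q ^ 3)) = rq ^ 6 / 6"
  "complex_of_real ((q - 1) ^ 2 / (q ^ 2 * (q ^ 2 - 1))) = rq ^ 4 * (1 - rq ^ 2) / (1 + rq ^ 2)"
  "complex_of_real ((q - 1) ^ 3 / (3 * (q ^ 3 - 1))) = (1 - rq ^ 2) ^ 3 / (3 * (1 - rq ^ 6))"
proof -
  define p where "p = 1 / q"
  have q: "q > 1" "q \<noteq> 0" using q_gt1 by auto
  have "rq ^ 4 = (rq ^ 2) ^ 2" "rq ^ 6 = (rq ^ 2) ^ 3" by (simp_all flip: power_mult)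
  then have r: "rq ^ 2 = of_real p" "rq ^ 4 = of_real (p ^ 2)" "rq ^ 6 = of_real (p ^ 3)"
    by (simp_all add: rq_sq pq_def p_def)
  show "complex_of_real (1 / (6 * q ^ 3)) = rq ^ 6 / 6"
    unfolding r by (simp add: p_def power_divide)
  have "(q - 1) ^ 2 / (q ^ 2 * (q ^ 2 - 1)) = (q - 1) * (q - 1) / (q ^ 2 * (q + 1) * (q - 1))"
    by (simp add: power2_eq_square algebra_simps)
  also have "\<dots> = (q - 1) / (q ^ 2 * (q + 1))" using q by simp
  also have "\<dots> = p ^ 2 * ((q - 1) / q) / ((q + 1) / q)" using q by (simp add: p_def power_divide)
  also have "\<dots> = p ^ 2 * (1 - p) / (1 + p)" using q by (simp add: p_def diff_divide_distrib add_divide_distrib)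
  finally show "complex_of_real ((q - 1) ^ 2 / (q ^ 2 * (q ^ 2 - 1))) = rq ^ 4 * (1 - rq ^ 2) / (1 + rq ^ 2)"
    unfolding r by simp
  have "(q - 1) ^ 3 / (3 * (q ^ 3 - 1)) = ((q - 1) ^ 3 / q ^ 3) / (3 * ((q ^ 3 - 1) / q ^ 3))" using q by simp
  also have "\<dots> = ((q - 1) / q) ^ 3 / (3 * ((q ^ 3 - 1) / q ^ 3))" by (simp only: power_divide)
  also have "(q - 1) / q = 1 - p" using q by (simp add: p_def diff_divide_distrib)
  also have "(q ^ 3 - 1) / q ^ 3 = 1 - p ^ 3" using q by (simp add: p_def diff_divide_distrib power_divide)
  finally show "complex_of_real ((q - 1) ^ 3 / (3 * (q ^ 3 - 1))) = (1 - rq ^ 2) ^ 3 / (3 * (1 - rq ^ 6))"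
    unfolding r by simp
qed

text \<open>The pointwise properties are required only almost everywhere, because the characters are
  shown to be linear and tracial at nonzero parameters only.\<close>

lemma integral_functional:
  fixes f :: "'x \<Rightarrow> 'h \<Rightarrow> complex"
  assumes int: "\<And>h. integrable M (\<lambda>x. f x h / d x)"
    and f: "AE x in M. linf (f x) \<and> (\<forall>a b. f x (a * b) = f x (b * a))"
  shows "linf (\<lambda>h. LINT x|M. f x h / d x)" "(LINT x|M. f x (a * b) / d x) = (LINT x|M. f x (b * a) / d x)"
proof -
  note m = borel_measurable_integrable
  show "(LINT x|M. f x (a * b) / d x) = (LINT x|M. f x (b * a) / d x)"
    by (rule integral_cong_AE[OF m[OF int] m[OF int]]) (use f in eventually_elim, simp)
  have "(LINT x|M. f x (a + b) / d x) = (LINT x|M. f x a / d x + f x b / d x)" for a b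
    by (rule integral_cong_AE[OF m[OF int] m[OF Bochner_Integration.integrable_add[OF int int]]])
      (use f in eventually_elim, simp add: linfD add_divide_distrib)
  then have "(LINT x|M. f x (a + b) / d x) = (LINT x|M. f x a / d x) + (LINT x|M. f x b / d x)" for a b
    by (simp add: Bochner_Integration.integral_add[OF int int])
  moreover
  have "(LINT x|M. f x (scale c a) / d x) = (LINT x|M. c * (f x a / d x))" for c a
    by (rule integral_cong_AE[OF m[OF int] m[OF integrable_mult_right[OF int]]])
      (use f in eventually_elim, simp add: linfD)
  then have "(LINT x|M. f x (scale c a) / d x) = c * (LINT x|M. f x a / d x)" for c a
    by (simp only: integral_mult_right_zero)
  ultimately show "linf (\<lambda>h. LINT x|M. f x h / d x)" by (simp add: linf_def)
qed

proposition plancherel: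
  "Tr h = complex_of_real (1 / (6 * q ^ 3)) * (LINT t|torus. chi t h / complex_of_real ((cmod (c_fun q t))\<^sup>2))
    + complex_of_real ((q - 1) ^ 2 / (q ^ 2 * (q ^ 2 - 1)))
      * (LINT s|circle_haar. chi1 s h / complex_of_real ((cmod (c1_fun q s))\<^sup>2))
    + complex_of_real ((q - 1) ^ 3 / (3 * (q ^ 3 - 1))) * (chi2 h + chi3 h + chi4 h)"
proof -
  define I2 where "I2 h = (LINT t|torus. chi t h / complex_of_real ((cmod (c_fun q t))\<^sup>2))" for h
  define I1 where "I1 h = (LINT s|circle_haar. chi1 s h / complex_of_real ((cmod (c1_fun q s))\<^sup>2))" for h
  define C2 C1 C0 where "C2 = complex_of_real (1 / (6 * q ^ 3))"
    and "C1 = complex_of_real ((q - 1) ^ 2 / (q ^ 2 * (q ^ 2 - 1)))"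
    and "C0 = complex_of_real ((q - 1) ^ 3 / (3 * (q ^ 3 - 1)))"
  define F where "F h = Tr h - (C2 * I2 h + C1 * I1 h + C0 * (chi2 h + chi3 h + chi4 h))" for h
  have "AE t in torus. linf (chi t) \<and> (\<forall>a b. chi t (a * b) = chi t (b * a))"
    using AE_torus
  proof eventually_elim
    case (elim t)
    then have "fst t \<noteq> 0" "snd t \<noteq> 0" by auto
    note d = principal_dual(1)[OF this]
    show ?case unfolding chi_eq using induced_char_linf[OF d] induced_char_tracial[OF d] by auto
  qed
  note I2 = integral_functional[OF chi_integrable this, folded I2_def]
  have "AE s in circle_haar. linf (chi1 s) \<and> (\<forall>a b. chi1 s (a * b) = chi1 s (b * a))"
    using AE_circle
  proof eventually_elim
    case (elim s)
    then have "s \<noteq> 0" by auto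
    note d = steinberg1_dual(1)[OF this]
    show ?case unfolding chi1_eq using induced_char_linf[OF d] induced_char_tracial[OF d] by auto
  qed
  note I1 = integral_functional[OF chi1_integrable this, folded I1_def]
  note one = one_dim_point[OF power_one, folded chi234_points] one_dim_point[OF cube_root(1), folded chi3_def]
    one_dim_point[OF cube_root(2), folded chi234_points]
  have "F h = 0"
  proof (rule tracial_functional_zero)
    show "linf F"
      unfolding linf_def F_def
      by (simp add: Tr_add Tr_scale linfD[OF I2(1)] linfD[OF I1(1)] linfD[OF one(1)] linfD[OF one(4)] linfD[OF one(7)]
        algebra_simps)
    show "F (a * b) = F (b * a)" for a b
      unfolding F_def by (simp only: Tr_commute[of a] I2(2)[of a] I1(2)[of a] one(2)[of a] one(5)[of a] one(8)[of a])
    fix k :: nat and m n :: int assume k: "k < 5" "0 \<le> m" "0 \<le> n"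
    have "C2 * I2 (wb k * X m n) + C1 * I1 (wb k * X m n) + C0 * (chi2 (wb k * X m n) + chi3 (wb k * X m n) + chi4 (wb k * X m n))
      = rq ^ 6 * dsum k (I2sum rq) m n + rq ^ 4 * (1 - rq ^ 2) / (1 + rq ^ 2) * dsum k (I1sum rq) m n
        + (1 - rq ^ 2) ^ 3 / (3 * (1 - rq ^ 6)) * dsum k (I0sum rq) m n"
      unfolding I2_def I1_def chi_integral[OF k] chi1_integral[OF k(1)] one_dim_total[OF k(1)] C2_def C1_def C0_def plancherel_constants
      by simp
    also have "\<dots> = dsum k (\<lambda>m n. if m = - 2 \<and> n = - 2 then - 1 else 0) m n"
      unfolding dsum_linear by (rule dsum_cong[OF k plancherel_moment[OF rq_props]])
    also have "\<dots> = Tr (wb k * X m n)" using k Tr_wbX[of k m n] by (simp add: dsum_delta[OF k])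
    finally show "F (wb k * X m n) = 0" by (simp add: F_def)
  qed
  then show ?thesis by (simp only: F_def I2_def I1_def C2_def C1_def C0_def right_minus_eq)
qed

end

theorem theorem3p3:
  fixes q :: real
    and scale :: "complex \<Rightarrow> 'h::ring_1 \<Rightarrow> 'h"
    and T :: "(plane \<Rightarrow> plane) \<Rightarrow> 'h"
    and h :: 'h
  assumes "q > 1"
    and "affine_hecke_A2 scale q T"
  shows "affine_hecke_A2.Tr scale T h =
      complex_of_real (1 / (6 * q ^ 3)) *
        (LINT t|(circle_haar \<Otimes>\<^sub>M circle_haar).
           affine_hecke_A2.chi scale T t h / complex_of_real ((cmod (c_fun q t))\<^sup>2))
    + complex_of_real ((q - 1) ^ 2 / (q ^ 2 * (q ^ 2 - 1))) *
        (LINT s|circle_haar.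
           affine_hecke_A2.chi1 scale q T s h / complex_of_real ((cmod (c1_fun q s))\<^sup>2))
    + complex_of_real ((q - 1) ^ 3 / (3 * (q ^ 3 - 1))) *
        (affine_hecke_A2.chi2 scale q T h + affine_hecke_A2.chi3 scale q T h
          + affine_hecke_A2.chi4 scale q T h)"
proof -
  interpret hecke_A2 scale q T
    using assms by (simp add: hecke_A2_def hecke_A2_axioms_def)
  show ?thesis by (rule plancherel)
qed

end
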